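(* Let $L=\bigcup_i L_i\subset S^3$ be a link with components $L_i$. The dependence on $\omega$ of the spaces $R(L,\omega)$ and $R_B(L,\omega)$ is only through the parity of the number of endpoints of $\omega$ on each component of $L$. That is, if $\omega,\omega'$ are two choices of marking data for $L$ such that for every $i$ the numbers of endpoints of $\omega$ and of $\omega'$ on $L_i$ have the same parity, then $R(L,\omega)$ can be identified with $R(L,\omega')$, and $R_B(L,\omega)$ with $R_B(L,\omega')$.
   Context: Marking data $\omega$ for $L$: a one-dimensional submanifold of $S^3$ with boundary $\partial\omega=\omega\cap L$ on $L$. Regard $SU(2)$ as the unit quaternions, with standard imaginary units $I,J,K$. The binary dihedral group is $BD=S^1_A\cup S^1_B\subset SU(2)$, $S^1_A=\{e^{I\theta}\}$, $S^1_B=\{Je^{I\theta}\}$. $R(L,\omega)=\{\rho:\pi_1(S^3\setminus(L\cup\omega))\to BD \mid \rho(\mu_\omega)=-1\in S^1_A\}/\text{conjugation}$, $R_B(L,\omega)=\{\rho:\pi_1(S^3\setminus(L\cup\omega))\to BD \mid \rho(\mu_{L_i})\in S^1_B \text{ for all } i,\ \rho(\mu_\omega)=-1\in S^1_A\}/\text{conjugation}$, where $\mu_{L_i}$ denotes a meridian around $L_i$ and $\mu_\omega$ a meridian around $\omega$ (the conditions are imposed for all such meridians). *)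

theory Defs
  imports "HOL-Analysis.Analysis" "HOL-Algebra.Group"
begin

section \<open>The binary dihedral group\<close>

text \<open>
  A pair (a, b) of complex numbers encodes the quaternion a + J b, where complex numbers are
  read as quaternions in the span of 1 and I. The product comes from a J = J (cnj a) and
  J J = -1. In particular J exp(I t) is the pair (0, cis t).
\<close>

type_synonym quat = "complex \<times> complex"

definition qone :: quat where
  "qone = (1, 0)"

definition qmult :: "quat \<Rightarrow> quat \<Rightarrow> quat" where
  "qmult p q = (fst p * fst q - cnj (snd p) * snd q, cnj (fst p) * snd q + snd p * fst q)"

definition qI :: quat where "qI = (\<i>, 0)"
definition qJ :: quat where "qJ = (0, 1)"
definition qK :: quat where "qK = qmult qI qJ"

lemma quaternion_relations:
  "qmult qI qI = - qone" "qmult qJ qJ = - qone" "qmult qK qK = - qone"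
  "qmult qI qJ = qK" "qmult qJ qI = - qK"
  by (simp_all add: qmult_def qI_def qJ_def qK_def qone_def)

definition S1A :: "quat set" where
  "S1A = range (\<lambda>t::real. (cis t, 0))"

definition S1B :: "quat set" where
  "S1B = range (\<lambda>t::real. qmult qJ (cis t, 0))"

definition BD :: "quat monoid" where
  "BD = \<lparr>carrier = S1A \<union> S1B, mult = qmult, one = qone\<rparr>"

lemma S1A_iff: "q \<in> S1A \<longleftrightarrow> norm (fst q) = 1 \<and> snd q = 0"
proof
  assume "norm (fst q) = 1 \<and> snd q = 0"
  then have "q = (cis (Arg (fst q)), 0)"
    by (metis cis_Arg norm_zero prod.collapse sgn_div_norm scaleR_one inverse_1 zero_neq_one)
  then show "q \<in> S1A" by (auto simp: S1A_def)
qed (auto simp: S1A_def)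

lemma S1B_iff: "q \<in> S1B \<longleftrightarrow> fst q = 0 \<and> norm (snd q) = 1"
proof
  assume "fst q = 0 \<and> norm (snd q) = 1"
  then have "q = qmult qJ (cis (Arg (snd q)), 0)"
    by (simp add: qmult_def qJ_def)
       (metis cis_Arg norm_zero prod.collapse sgn_div_norm scaleR_one inverse_1 zero_neq_one)
  then show "q \<in> S1B" unfolding S1B_def by blast
qed (auto simp: S1B_def qmult_def qJ_def)

lemma group_BD: "group BD"
proof (rule groupI)
  fix x assume x: "x \<in> carrier BD"
  define y where "y = (cnj (fst x), - snd x)"
  have "y \<in> carrier BD"
    using x by (auto simp: BD_def S1A_iff S1B_iff y_def)
  moreover have "y \<otimes>\<^bsub>BD\<^esub> x = \<one>\<^bsub>BD\<^esub>"
    using x by (auto simp: BD_def S1A_iff S1B_iff y_def qmult_def qone_def mult.commute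
        complex_norm_square[symmetric])
  ultimately show "\<exists>y\<in>carrier BD. y \<otimes>\<^bsub>BD\<^esub> x = \<one>\<^bsub>BD\<^esub>" by blast
qed (auto simp: BD_def S1A_iff S1B_iff qmult_def qone_def norm_mult algebra_simps)


section \<open>Fundamental group\<close>

definition loops_at :: "'a::topological_space set \<Rightarrow> 'a \<Rightarrow> (real \<Rightarrow> 'a) set" where
  "loops_at X x = {p. path p \<and> path_image p \<subseteq> X \<and> pathstart p = x \<and> pathfinish p = x}"

definition path_class :: "'a::topological_space set \<Rightarrow> (real \<Rightarrow> 'a) \<Rightarrow> (real \<Rightarrow> 'a) set" where
  "path_class X p = {q. homotopic_paths X p q}"

definition fundamental_group ::
    "'a::real_normed_vector set \<Rightarrow> 'a \<Rightarrow> (real \<Rightarrow> 'a) set monoid" where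
  "fundamental_group X x =
     \<lparr>carrier = path_class X ` loops_at X x,
      mult = (\<lambda>a b. \<Union>p\<in>a. \<Union>q\<in>b. path_class X (p +++ q)),
      one = path_class X (linepath x x)\<rparr>"

lemma path_class_eqI:
  assumes "homotopic_paths X p q"
  shows "path_class X q = path_class X p"
  unfolding path_class_def
proof (intro Collect_cong iffI)
  fix r
  show "homotopic_paths X p r" if "homotopic_paths X q r"
    using assms that by (rule homotopic_paths_trans)
  show "homotopic_paths X q r" if "homotopic_paths X p r"
    using homotopic_paths_sym[OF assms] that by (rule homotopic_paths_trans)
qed

lemma path_class_eq_iff:
  assumes "p \<in> loops_at X x"
  shows "path_class X p = path_class X q \<longleftrightarrow> homotopic_paths X p q"
proof
  assume "path_class X p = path_class X q"
  moreover have "p \<in> path_class X p"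
    using assms by (auto simp: path_class_def loops_at_def)
  ultimately show "homotopic_paths X p q"
    by (auto simp: path_class_def intro: homotopic_paths_sym)
next
  assume "homotopic_paths X p q"
  then show "path_class X p = path_class X q"
    by (rule path_class_eqI[symmetric])
qed

lemma fundamental_group_mult:
  assumes "p \<in> loops_at X x" "q \<in> loops_at X x"
  shows "path_class X p \<otimes>\<^bsub>fundamental_group X x\<^esub> path_class X q = path_class X (p +++ q)"
proof -
  have refl: "p \<in> path_class X p" "q \<in> path_class X q"
    using assms by (auto simp: path_class_def loops_at_def)
  have "path_class X (p' +++ q') = path_class X (p +++ q)"
    if "p' \<in> path_class X p" "q' \<in> path_class X q" for p' q'
  proof -
    have "homotopic_paths X (p +++ q) (p' +++ q')"
      using that assms
      by (intro homotopic_paths_join) (auto simp: path_class_def loops_at_def)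
    then show ?thesis
      by (rule path_class_eqI)
  qed
  then have "(\<Union>p'\<in>path_class X p. \<Union>q'\<in>path_class X q. path_class X (p' +++ q')) =
      (\<Union>p'\<in>path_class X p. \<Union>q'\<in>path_class X q. path_class X (p +++ q))"
    by simp
  also have "\<dots> = path_class X (p +++ q)"
    using refl by blast
  finally show ?thesis by (simp add: fundamental_group_def)
qed

lemma group_fundamental_group:
  assumes "x \<in> X"
  shows "group (fundamental_group X x)"
proof (rule groupI)
  let ?G = "fundamental_group X x"
  have car: "carrier ?G = path_class X ` loops_at X x"
    and one: "\<one>\<^bsub>?G\<^esub> = path_class X (linepath x x)"
    by (simp_all add: fundamental_group_def)
  have join: "p +++ q \<in> loops_at X x" if "p \<in> loops_at X x" "q \<in> loops_at X x" for p q
    using that by (auto simp: loops_at_def path_image_join)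
  have const: "linepath x x \<in> loops_at X x"
    using assms by (auto simp: loops_at_def)
  show "\<one>\<^bsub>?G\<^esub> \<in> carrier ?G" using const by (simp add: car one)
  fix a assume "a \<in> carrier ?G"
  then obtain p where p: "p \<in> loops_at X x" "a = path_class X p" by (auto simp: car)
  have "homotopic_paths X (linepath x x +++ p) p"
    using p by (intro homotopic_paths_lid') (auto simp: loops_at_def)
  then show "\<one>\<^bsub>?G\<^esub> \<otimes>\<^bsub>?G\<^esub> a = a"
    using p const join by (simp add: one fundamental_group_mult path_class_eq_iff[of _ X x])
  have rev: "reversepath p \<in> loops_at X x" using p by (auto simp: loops_at_def)
  have "homotopic_paths X (reversepath p +++ p) (linepath x x)"
    using homotopic_paths_linv[of p X] p by (auto simp: loops_at_def)
  then have "path_class X (reversepath p) \<otimes>\<^bsub>?G\<^esub> a = \<one>\<^bsub>?G\<^esub>"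
    using p rev join by (simp add: one fundamental_group_mult path_class_eq_iff[of _ X x])
  then show "\<exists>b\<in>carrier ?G. b \<otimes>\<^bsub>?G\<^esub> a = \<one>\<^bsub>?G\<^esub>" using rev car by blast
  fix b assume "b \<in> carrier ?G"
  then obtain q where q: "q \<in> loops_at X x" "b = path_class X q" by (auto simp: car)
  show "a \<otimes>\<^bsub>?G\<^esub> b \<in> carrier ?G"
    using p q join by (auto simp: car fundamental_group_mult)
  fix c assume "c \<in> carrier ?G"
  then obtain r where r: "r \<in> loops_at X x" "c = path_class X r" by (auto simp: car)
  have "homotopic_paths X (p +++ (q +++ r)) ((p +++ q) +++ r)"
    using p q r by (intro homotopic_paths_assoc) (auto simp: loops_at_def)
  then show "a \<otimes>\<^bsub>?G\<^esub> b \<otimes>\<^bsub>?G\<^esub> c = a \<otimes>\<^bsub>?G\<^esub> (b \<otimes>\<^bsub>?G\<^esub> c)"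
    using p q r join
    by (simp add: fundamental_group_mult path_class_eq_iff[of _ X x] homotopic_paths_sym)
qed


section \<open>Links and marking data in the three-sphere\<close>

type_synonym R4 = "real ^ 4"

definition S3 :: "R4 set" where
  "S3 = sphere 0 1"

text \<open>Only used for open S, where the derivative D is unique on S.\<close>

primrec C_k_on :: "nat \<Rightarrow> 'a::euclidean_space set \<Rightarrow> ('a \<Rightarrow> 'b::real_normed_vector) \<Rightarrow> bool" where
  "C_k_on 0 S f \<longleftrightarrow> continuous_on S f"
| "C_k_on (Suc k) S f \<longleftrightarrow>
     (\<exists>D. (\<forall>x\<in>S. (f has_derivative D x) (at x)) \<and> (\<forall>v. C_k_on k S (\<lambda>x. D x v)))"

definition smooth_on :: "'a::euclidean_space set \<Rightarrow> ('a \<Rightarrow> 'b::real_normed_vector) \<Rightarrow> bool" where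
  "smooth_on S f \<longleftrightarrow> (\<forall>k. C_k_on k S f)"

text \<open>
  Submanifolds with boundary are given by local parametrizations: every point has a
  neighbourhood in M diffeomorphic to an open interval, or to a half-open interval with the
  point at the closed end. Smoothness on the half-open interval means existence of a smooth
  extension, here to (-1, 1); the extension need not map into M.
\<close>

definition manifold_interior_point :: "R4 set \<Rightarrow> R4 \<Rightarrow> bool" where
  "manifold_interior_point M p \<longleftrightarrow>
     (\<exists>U \<phi> \<psi>. open U \<and> smooth_on {-1<..<1::real} \<phi> \<and> \<phi> 0 = p \<and>
        homeomorphism {-1<..<1} (M \<inter> U) \<phi> \<psi> \<and>
        (\<forall>t\<in>{-1<..<1}. vector_derivative \<phi> (at t) \<noteq> 0))"

definition manifold_boundary_point :: "R4 set \<Rightarrow> R4 \<Rightarrow> bool" where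
  "manifold_boundary_point M p \<longleftrightarrow>
     (\<exists>U \<phi> \<psi>. open U \<and> smooth_on {-1<..<1::real} \<phi> \<and> \<phi> 0 = p \<and>
        homeomorphism {0..<1} (M \<inter> U) \<phi> \<psi> \<and>
        (\<forall>t\<in>{0..<1}. vector_derivative \<phi> (at t) \<noteq> 0))"

definition submanifold1 :: "R4 set \<Rightarrow> bool" where
  "submanifold1 M \<longleftrightarrow>
     M \<subseteq> S3 \<and> (\<forall>p\<in>M. manifold_interior_point M p \<or> manifold_boundary_point M p)"

definition manifold_boundary :: "R4 set \<Rightarrow> R4 set" where
  "manifold_boundary M = {p \<in> M. manifold_boundary_point M p}"

text \<open>The components of a link L are the members of \<^term>\<open>components L\<close>.\<close>

definition link :: "R4 set \<Rightarrow> bool" where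
  "link L \<longleftrightarrow> compact L \<and> submanifold1 L \<and> manifold_boundary L = {}"

definition marking_data :: "R4 set \<Rightarrow> R4 set \<Rightarrow> bool" where
  "marking_data L \<omega> \<longleftrightarrow> compact \<omega> \<and> submanifold1 \<omega> \<and> manifold_boundary \<omega> = \<omega> \<inter> L"


section \<open>Meridians\<close>

definition tangent_vectors :: "R4 set \<Rightarrow> R4 \<Rightarrow> R4 set" where
  "tangent_vectors M p =
     {v. \<exists>\<gamma> e. 0 < e \<and> smooth_on {-e<..<e::real} \<gamma> \<and> \<gamma> ` {-e<..<e} \<subseteq> M \<and> \<gamma> 0 = p \<and>
         (\<gamma> has_vector_derivative v) (at 0)}"

text \<open>
  A meridian disc of M avoiding N is a smoothly embedded closed disc in the three-sphere that
  misses N and meets M only at its centre, transversally: as the dimensions are 2 and 1,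
  transversality means that the tangent spaces meet only in 0.
\<close>

definition meridian_disc :: "R4 set \<Rightarrow> R4 set \<Rightarrow> (complex \<Rightarrow> R4) \<Rightarrow> bool" where
  "meridian_disc M N d \<longleftrightarrow>
     (\<exists>U D. open U \<and> cball 0 1 \<subseteq> U \<and> smooth_on U d \<and>
        (\<forall>z\<in>cball 0 1. (d has_derivative D z) (at z) \<and> inj (D z)) \<and>
        tangent_vectors M (d 0) \<inter> range (D 0) = {0}) \<and>
     inj_on d (cball 0 1) \<and> d ` cball 0 1 \<subseteq> S3 \<and>
     d ` cball 0 1 \<inter> M = {d 0} \<and> d ` cball 0 1 \<inter> N = {}"

text \<open>
  Based loops in the complement of M and N that are freely homotopic to the boundary of a
  meridian disc; both orientations occur, since the disc may be composed with conjugation.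
\<close>

definition meridian :: "R4 set \<Rightarrow> R4 set \<Rightarrow> R4 \<Rightarrow> (real \<Rightarrow> R4) \<Rightarrow> bool" where
  "meridian M N x p \<longleftrightarrow>
     p \<in> loops_at (S3 - (M \<union> N)) x \<and>
     (\<exists>d. meridian_disc M N d \<and>
        homotopic_loops (S3 - (M \<union> N)) p (\<lambda>t. d (cis (2 * pi * t))))"


section \<open>Representation spaces\<close>

definition link_group :: "R4 set \<Rightarrow> R4 set \<Rightarrow> R4 \<Rightarrow> (real \<Rightarrow> R4) set monoid" where
  "link_group L \<omega> x = fundamental_group (S3 - (L \<union> \<omega>)) x"

definition reps :: "R4 set \<Rightarrow> R4 set \<Rightarrow> R4 \<Rightarrow> ((real \<Rightarrow> R4) set \<Rightarrow> quat) set" where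
  "reps L \<omega> x =
     {\<rho> \<in> hom (link_group L \<omega> x) BD \<inter> extensional (carrier (link_group L \<omega> x)).
        \<forall>p. meridian \<omega> L x p \<longrightarrow> \<rho> (path_class (S3 - (L \<union> \<omega>)) p) = - qone}"

definition reps_B :: "R4 set \<Rightarrow> R4 set \<Rightarrow> R4 \<Rightarrow> ((real \<Rightarrow> R4) set \<Rightarrow> quat) set" where
  "reps_B L \<omega> x =
     {\<rho> \<in> reps L \<omega> x. \<forall>C\<in>components L. \<forall>p. meridian C ((L - C) \<union> \<omega>) x p \<longrightarrow>
        \<rho> (path_class (S3 - (L \<union> \<omega>)) p) \<in> S1B}"

definition conj_orbit ::
    "(real \<Rightarrow> R4) set monoid \<Rightarrow> ((real \<Rightarrow> R4) set \<Rightarrow> quat) \<Rightarrow> ((real \<Rightarrow> R4) set \<Rightarrow> quat) set" where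
  "conj_orbit G \<rho> =
     {restrict (\<lambda>a. g \<otimes>\<^bsub>BD\<^esub> \<rho> a \<otimes>\<^bsub>BD\<^esub> inv\<^bsub>BD\<^esub> g) (carrier G) | g. g \<in> carrier BD}"

definition quotient_topology :: "'a topology \<Rightarrow> ('a \<Rightarrow> 'b) \<Rightarrow> 'b topology" where
  "quotient_topology X f =
     topology (\<lambda>V. V \<subseteq> f ` topspace X \<and> openin X {x \<in> topspace X. f x \<in> V})"

lemma openin_quotient_topology:
  "openin (quotient_topology X f) V \<longleftrightarrow>
     V \<subseteq> f ` topspace X \<and> openin X {x \<in> topspace X. f x \<in> V}"
proof -
  have "istopology (\<lambda>V. V \<subseteq> f ` topspace X \<and> openin X {x \<in> topspace X. f x \<in> V})"
    unfolding istopology_def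
  proof (intro conjI allI impI; (elim conjE)?)
    fix S T
    assume "openin X {x \<in> topspace X. f x \<in> S}" "openin X {x \<in> topspace X. f x \<in> T}"
    moreover have "{x \<in> topspace X. f x \<in> S \<inter> T} =
        {x \<in> topspace X. f x \<in> S} \<inter> {x \<in> topspace X. f x \<in> T}" by auto
    ultimately show "openin X {x \<in> topspace X. f x \<in> S \<inter> T}" by auto
  next
    fix \<K> assume K: "\<forall>K\<in>\<K>. K \<subseteq> f ` topspace X \<and> openin X {x \<in> topspace X. f x \<in> K}"
    have "{x \<in> topspace X. f x \<in> \<Union>\<K>} = (\<Union>K\<in>\<K>. {x \<in> topspace X. f x \<in> K})" by auto
    then show "openin X {x \<in> topspace X. f x \<in> \<Union>\<K>}" using K by auto
  qed auto
  then show ?thesis by (simp add: quotient_topology_def topology_inverse')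
qed

lemma quotient_map_quotient_topology: "quotient_map X (quotient_topology X f) f"
proof -
  have "topspace (quotient_topology X f) = f ` topspace X"
  proof
    show "topspace (quotient_topology X f) \<subseteq> f ` topspace X"
      using openin_quotient_topology[of X f "topspace (quotient_topology X f)"] by simp
    have "{x \<in> topspace X. f x \<in> f ` topspace X} = topspace X" by auto
    then have "openin (quotient_topology X f) (f ` topspace X)"
      by (simp add: openin_quotient_topology)
    then show "f ` topspace X \<subseteq> topspace (quotient_topology X f)"
      by (rule openin_subset)
  qed
  then show ?thesis by (auto simp: quotient_map_def openin_quotient_topology)
qed

text \<open>Sets of homomorphisms carry the topology of pointwise convergence.\<close>

definition rep_quotient ::
    "(real \<Rightarrow> R4) set monoid \<Rightarrow> ((real \<Rightarrow> R4) set \<Rightarrow> quat) set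
      \<Rightarrow> ((real \<Rightarrow> R4) set \<Rightarrow> quat) set topology" where
  "rep_quotient G H =
     quotient_topology
       (subtopology (product_topology (\<lambda>_. top_of_set (carrier BD)) (carrier G)) H)
       (conj_orbit G)"

definition R_space ::
    "R4 set \<Rightarrow> R4 set \<Rightarrow> R4 \<Rightarrow> ((real \<Rightarrow> R4) set \<Rightarrow> quat) set topology" where
  "R_space L \<omega> x = rep_quotient (link_group L \<omega> x) (reps L \<omega> x)"

definition R_B_space ::
    "R4 set \<Rightarrow> R4 set \<Rightarrow> R4 \<Rightarrow> ((real \<Rightarrow> R4) set \<Rightarrow> quat) set topology" where
  "R_B_space L \<omega> x = rep_quotient (link_group L \<omega> x) (reps_B L \<omega> x)"

end

theory Submission
 imports Defs "HOL-Complex_Analysis.Complex_Analysis"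
begin

text \<open>
 Since the markings \<omega> and \<omega>' have the same parity on each component of L, their edges can
 be joined through L to closed paths: mod 2, the sum of \<omega>, \<omega>' and a part of L is a cycle
 (\<open>marking_closed_paths\<close>). Off the set K = L \<union> \<omega> \<union> \<omega>' the parity
 of the linking number with this cycle is a character of the fundamental group, with values 1 and -1
 (\<open>total_sign\<close>). On a small circle around a point off L of just one of the markings it is -1, and
 it is 1 where both markings run along the same arc (\<open>total_sign_flat\<close>).

 A representation for \<omega> is restricted to the complement of K and multiplied by this character,
 whose values are central in BD. Around a point of \<omega> off \<omega>' both factors are -1, so the
 product is trivial there and extends over \<omega> to the complement of L \<union> \<omega>'
 (\<open>transport_across\<close>). Around \<omega>' the product is -1, either by the sign or, along
 common arcs, by the given representation (\<open>discs_marking\<close>). Around L only a sign is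
 changed, and S1B is closed under signs (\<open>discs_link\<close>). Interchanging \<omega> and \<omega>'
 gives the inverse construction; both are compatible with conjugation and continuous in the values on
 loops, whence the homeomorphisms (\<open>transfer\<close>, \<open>rep_quotient_homeomorphic\<close>).

 The two markings may meet in a complicated closed set, so that the complement of K has no manageable
 structure near it. This is why everything is phrased in terms of transport along paths and of local
 conditions: transport in the complement of a thin set extends over it if it is locally trivial
 (\<open>extend_transport\<close>), and a condition on meridians may be checked at any nearby point of
 the same curve (\<open>move_circle\<close>), because small transverse discs all wind once around the
 curve (\<open>transverse_disc_loops\<close>). Linking numbers mod 2 of paths that are merely continuous
 are defined as winding numbers of cyclic products of inner products of spinors, which vanish only on the
 polygon concerned (\<open>link_sign\<close>); they are computed by counting crossings with a disc
 (\<open>link_sign_axis_circle\<close>). The cycle is found by Euler's argument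
 (\<open>even_ends_closed_paths\<close>), after a compact curve has been cut into finitely many arcs
 (\<open>curve_subdivision\<close>).
\<close>

abbreviation (input) "start \<equiv> pathstart"
abbreviation (input) "finish \<equiv> pathfinish"
abbreviation (input) "track \<equiv> path_image"

abbreviation turn :: "real => complex" where "turn t == cis (2 * pi * t)"

abbreviation rim :: "(complex => 'a) => real => 'a" where "rim d == %t. d (turn t)"

abbreviation BD_mult (infixl "\<cdot>" 70) where "a \<cdot> b == mult BD a b"

abbreviation BD_inv ("inv'_BD _" [81] 80) where "inv_BD a == m_inv BD a"

abbreviation one_BD where "one_BD == one BD"

section \<open>Transport along paths\<close>

lemma homotopic_paths_cancel_middle:
 fixes S :: "'a::real_normed_vector set"
 assumes "path p" "path q" "path r" "track p <= S" "track q <= S" "track r <= S"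
  "finish p = start q" "start q = start r"
 shows "homotopic_paths S ((p +++ q) +++ (reversepath q +++ r)) (p +++ r)"
proof -
 have 1: "homotopic_paths S (q +++ (reversepath q +++ r)) r"
 proof -
  have "homotopic_paths S (q +++ (reversepath q +++ r)) ((q +++ reversepath q) +++ r)"
   by (intro homotopic_paths_assoc) (auto simp: assms path_image_join)
  also have "homotopic_paths S ((q +++ reversepath q) +++ r) (linepath (start q) (start q) +++ r)"
   by (intro homotopic_paths_join homotopic_paths_rinv) (use assms in \<open>auto simp: path_image_join\<close>)
  also have "homotopic_paths S (linepath (start q) (start q) +++ r) r"
   by (intro homotopic_paths_lid') (use assms in \<open>auto simp: path_image_join\<close>)
  finally show ?thesis .
 qed
 have "homotopic_paths S ((p +++ q) +++ (reversepath q +++ r)) (p +++ (q +++ (reversepath q +++ r)))"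
  by (intro homotopic_paths_sym[OF homotopic_paths_assoc]) (use assms in \<open>auto simp: path_image_join\<close>)
 also have "homotopic_paths S (p +++ (q +++ (reversepath q +++ r))) (p +++ r)"
  by (intro homotopic_paths_join 1) (use assms in auto)
 finally show ?thesis .
qed

text \<open>
 A homomorphism out of the fundamental group sees only loops at one base point. It is easier to
 work with its extension to all paths, that is with a functor from the fundamental groupoid; the
 conditions on meridians are conditions on free loops, and are invariant under conjugation.
\<close>

locale path_functor = group G for G :: "('g, 'm) monoid_scheme" (structure) +
 fixes X :: "'a::real_normed_vector set" and T :: "(real => 'a) => 'g"
 assumes closed: "!!p. path p ==> track p <= X ==> T p : carrier G"
  and join: "!!p q. path p ==> path q ==> track p <= X ==> track q <= X ==>
   finish p = start q ==> T (p +++ q) = T p \<otimes> T q"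
  and homotopic: "!!p q. homotopic_paths X p q ==> T p = T q"
begin

lemma const: assumes "a : X" shows "T (linepath a a) = \<one>"
proof -
 let ?c = "linepath a a"
 have c: "path ?c" "track ?c <= X" using assms by auto
 have "homotopic_paths X (?c +++ ?c) ?c" using homotopic_paths_lid'[of ?c X a] c by simp
 then have "T ?c \<otimes> T ?c = T ?c" using homotopic join[of ?c ?c] c by simp
 then show ?thesis using closed[OF c] by (simp add: l_cancel_one)
qed

lemma rev: assumes "path p" "track p <= X" shows "T (reversepath p) = inv (T p)"
proof -
 have r: "path (reversepath p)" "track (reversepath p) <= X" using assms by auto
 have "homotopic_paths X (reversepath p +++ p) (linepath (finish p) (finish p))"
  using homotopic_paths_linv[OF assms] .
 then have "T (reversepath p) \<otimes> T p = T (linepath (finish p) (finish p))"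
  using homotopic join[of "reversepath p" p] r assms by simp
 also have "... = \<one>" using const assms by (metis pathfinish_in_path_image subsetD)
 finally show ?thesis using closed assms r by (metis inv_equality)
qed

lemma compose:
 assumes "continuous_on S f" "f ` S <= X"
 shows "path_functor G S (%p. T (f o p))"
proof unfold_locales
 fix p assume "path p" "track p <= S"
 then show "T (f o p) : carrier G" using assms
  by (intro closed path_continuous_image continuous_on_subset[OF assms(1)])
   (auto simp: path_image_compose)
next
 fix p q assume a: "path p" "path q" "track p <= S" "track q <= S" "finish p = start q"
 have "T ((f o p) +++ (f o q)) = T (f o p) \<otimes> T (f o q)" using a assms
  by (intro join path_continuous_image continuous_on_subset[OF assms(1)])
   (auto simp: path_image_compose pathfinish_compose pathstart_compose)
 then show "T (f o (p +++ q)) = T (f o p) \<otimes> T (f o q)" by (simp add: path_compose_join)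
next
 fix p q assume "homotopic_paths S p q"
 then have "homotopic_paths X (f o p) (f o q)"
  using assms by (intro homotopic_paths_continuous_image[where S=S]) auto
 then show "T (f o p) = T (f o q)" by (rule homotopic)
qed

lemma restrict_domain: assumes "S <= X" shows "path_functor G S T" using compose[of S id] assms by auto

lemma simply_connected_eq:
 assumes "simply_connected S" "S <= X" "path p" "track p <= S" "path q" "track q <= S"
  "start q = start p" "finish q = finish p"
 shows "T p = T q" using assms homotopic homotopic_paths_subset unfolding simply_connected_eq_homotopic_paths by metis

text \<open>
 The image of the boundary of the square under the homotopy: the bottom followed by the right
 side is homotopic to the left side followed by the top, since the square is convex.
\<close>

lemma homotopic_loops_conj:
 assumes "homotopic_loops X p q"
 shows "\<exists>g\<in>carrier G. T p = g \<otimes> T q \<otimes> inv g"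
proof -
 let ?A = "{0..1::real} \<times> {0..1::real}"
 obtain h where h: "continuous_on ?A h" "h ` ?A <= X" "!!x. x : {0..1} ==> h(0,x) = p x"
   "!!x. x : {0..1} ==> h(1,x) = q x"
   "!!t. t : {0..1} ==> finish (h o Pair t) = start (h o Pair t)"
  using assms by (force simp: homotopic_loops homotopic_with)
 interpret H: path_functor G ?A "%r. T (h o r)" by (rule compose[OF h(1,2)])
 define b where "b = linepath (0::real,0::real) (0,1)"
 define t where "t = linepath (1::real,0::real) (1,1)"
 define l where "l = linepath (0::real,0::real) (1,0)"
 define r where "r = linepath (0::real,1::real) (1,1)"
 note defs = b_def t_def l_def r_def
 have cA: "convex ?A" by (simp add: convex_Times)
 have img: "track b <= ?A" "track t <= ?A" "track l <= ?A" "track r <= ?A"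
  unfolding defs path_image_linepath by (intro closed_segment_subset cA; simp)+
 have ends [simp]: "path b" "path t" "path l" "path r" "start b = (0,0)" "finish b = (0,1)"
  "start t = (1,0)" "finish t = (1,1)" "start l = (0,0)" "finish l = (1,0)"
  "start r = (0,1)" "finish r = (1,1)" by (simp_all add: defs)
 have bl: "track (b +++ r) <= ?A" "track (l +++ t) <= ?A"
  using img by (simp_all add: path_image_join)
 have "T (h o (b +++ r)) = T (h o (l +++ t))"
  using bl by (intro H.simply_connected_eq[of ?A] convex_imp_simply_connected cA) auto
 then have eq: "T (h o b) \<otimes> T (h o r) = T (h o l) \<otimes> T (h o t)"
  using H.join[of b r] H.join[of l t] img by simp
 have cl: "T (h o b) : carrier G" "T (h o t) : carrier G" "T (h o l) : carrier G" "T (h o r) : carrier G"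
  using img by (auto intro!: H.closed)
 have pq: "path p" "path q" "track p <= X" "track q <= X"
  using assms homotopic_loops_imp_path homotopic_loops_imp_subset by blast+
 have "T (h o b) = T p" by (intro homotopic homotopic_paths_sym[OF homotopic_paths_eq])
   (use pq h in \<open>auto simp: b_def linepath_def\<close>)
 moreover have "T (h o t) = T q" by (intro homotopic homotopic_paths_sym[OF homotopic_paths_eq])
   (use pq h in \<open>auto simp: t_def linepath_def\<close>)
 moreover have "T (h o r) = T (h o l)"
 proof (intro homotopic homotopic_paths_eq)
  show "path (h o r)" "track (h o r) <= X"
   using img(4) h(2) by (auto intro!: path_continuous_image continuous_on_subset[OF h(1)] simp: path_image_compose)
  fix s :: real assume "s : {0..1}"
  then show "(h o r) s = (h o l) s"
   using h(5)[of s] by (auto simp: defs linepath_def pathfinish_def pathstart_def)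
 qed
 ultimately have "T p \<otimes> T (h o l) = T (h o l) \<otimes> T q" using eq by simp
 then have "T p = T (h o l) \<otimes> T q \<otimes> inv (T (h o l))"
  using cl closed pq by (metis inv_solve_right' m_closed)
 then show ?thesis using cl by blast
qed

lemma homotopic_loops_conj_iff:
 assumes "homotopic_loops X p q" and S: "!!g a. g : carrier G ==> a : S ==> a : carrier G ==> g \<otimes> a \<otimes> inv g : S"
 shows "T p : S \<longleftrightarrow> T q : S"
 using homotopic_loops_conj[OF assms(1)] homotopic_loops_conj[OF homotopic_loops_sym[OF assms(1)]] S
 by (metis assms(1) closed homotopic_loops_imp_path homotopic_loops_imp_subset)

end

text \<open>
 A functor need only be known on paths with end points in C, if every point can be reached from C.
\<close>

lemma path_functor_conjugate_by_paths:
 fixes X :: "'a::real_normed_vector set"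
 defines "P == %C. {p. path p & track p <= X & start p : C & finish p : C}"
 assumes "group G"
  and h: "!!p. p : P C ==> f p : carrier G"
   "!!p q. p : P C ==> q : P C ==> finish p = start q ==> f (p +++ q) = f p \<otimes>\<^bsub>G\<^esub> f q"
   "!!p q. p : P C ==> homotopic_paths X p q ==> f p = f q"
  and k: "!!y. y : X ==> path (k y)" "!!y. y : X ==> track (k y) <= X"
   "!!y. y : X ==> start (k y) : C" "!!y. y : X ==> finish (k y) = y"
 shows "path_functor G X (%p. f (k (start p) +++ (p +++ reversepath (k (finish p)))))"
proof -
 interpret group G by fact
 have st: "start p : X" "finish p : X" if "track p <= X" for p
  using that by (auto intro: subsetD)
 have L: "k (start p) +++ p +++ reversepath (k (finish p)) : P C"
  if "path p" "track p <= X" for p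
  using that st[of p] k[of "start p"] k[of "finish p"] by (auto simp: P_def path_image_join)
 show ?thesis
 proof unfold_locales
  fix p assume "path p" "track p <= X"
  then show "f (k (start p) +++ p +++ reversepath (k (finish p))) : carrier G" using L h by blast
 next
  fix p q assume a: "homotopic_paths X p q"
  then have b: "path p" "track p <= X" "start p = start q" "finish p = finish q"
   by (auto dest: homotopic_paths_imp_path homotopic_paths_imp_subset homotopic_paths_imp_pathstart homotopic_paths_imp_pathfinish)
  have "homotopic_paths X (k (start p) +++ p +++ reversepath (k (finish p)))
    (k (start q) +++ q +++ reversepath (k (finish q)))" using a b st[of p] k by (intro homotopic_paths_join) auto
  then show "f (k (start p) +++ p +++ reversepath (k (finish p))) =
    f (k (start q) +++ q +++ reversepath (k (finish q)))" using h(3) L b by blast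
 next
  fix p q assume a: "path p" "path q" "track p <= X" "track q <= X" "finish p = start q"
  define u v w where "u = k (start p)" and "v = k (finish p)" and "w = k (finish q)"
  note kk = k[OF st(1)[OF a(3)], folded u_def] k[OF st(2)[OF a(3)], folded v_def] k[OF st(2)[OF a(4)], folded w_def]
  note simps = a kk path_image_join
  have "homotopic_paths X ((u +++ (p +++ reversepath v)) +++ (v +++ (q +++ reversepath w)))
    (((u +++ p) +++ reversepath v) +++ (reversepath (reversepath v) +++ (q +++ reversepath w)))"
   unfolding reversepath_reversepath by (intro homotopic_paths_join homotopic_paths_assoc) (auto simp: simps)
  also have "homotopic_paths X (((u +++ p) +++ reversepath v) +++ (reversepath (reversepath v) +++ (q +++ reversepath w)))
    ((u +++ p) +++ (q +++ reversepath w))" by (intro homotopic_paths_cancel_middle) (auto simp: simps)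
  also have "homotopic_paths X ((u +++ p) +++ (q +++ reversepath w)) (u +++ (p +++ (q +++ reversepath w)))"
   by (intro homotopic_paths_sym[OF homotopic_paths_assoc]) (auto simp: simps)
  also have "homotopic_paths X (u +++ (p +++ (q +++ reversepath w))) (u +++ ((p +++ q) +++ reversepath w))"
   by (intro homotopic_paths_join homotopic_paths_assoc) (auto simp: simps)
  finally have "homotopic_paths X ((u +++ (p +++ reversepath v)) +++ (v +++ (q +++ reversepath w))) (u +++ ((p +++ q) +++ reversepath w))" .
  moreover have l: "u +++ (p +++ reversepath v) : P C" "v +++ (q +++ reversepath w) : P C"
   "(u +++ (p +++ reversepath v)) +++ (v +++ (q +++ reversepath w)) : P C" by (auto simp: P_def simps)
  ultimately have "f (u +++ ((p +++ q) +++ reversepath w)) = f (u +++ (p +++ reversepath v)) \<otimes>\<^bsub>G\<^esub> f (v +++ (q +++ reversepath w))"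
   using h(2)[OF l(1,2)] h(3)[OF l(3)] by (simp add: kk)
  then show "f (k (start (p +++ q)) +++ (p +++ q) +++ reversepath (k (finish (p +++ q)))) =
   f (k (start p) +++ p +++ reversepath (k (finish p))) \<otimes>\<^bsub>G\<^esub>
   f (k (start q) +++ q +++ reversepath (k (finish q)))" by (simp add: u_def v_def w_def a)
 qed
qed

section \<open>Extending transport over a thin closed set\<close>

text \<open>
 The elements of \<open>\<U>\<close> are small open sets and \<^term>\<open>t U p q\<close> is the transport from p to q
 inside U. Such data determine transport along arbitrary paths.
\<close>

locale local_system = group G for G :: "('g, 'm) monoid_scheme" (structure) +
 fixes Y :: "'a::metric_space set" and \<U> :: "'a set set" and t :: "'a set => 'a => 'a => 'g"
 assumes basis: "!!W y. openin (top_of_set Y) W ==> y : W ==> \<exists>U\<in>\<U>. y : U & U <= W"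
  and U_open: "!!U. U : \<U> ==> openin (top_of_set Y) U"
  and t_closed: "!!U p q. U : \<U> ==> p : U ==> q : U ==> t U p q : carrier G"
  and t_trans: "!!U p q r. U : \<U> ==> p : U ==> q : U ==> r : U ==> t U p q \<otimes> t U q r = t U p r"
  and t_mono: "!!U V p q. U : \<U> ==> V : \<U> ==> V <= U ==> p : V ==> q : V ==> t V p q = t U p q"
begin

definition flat_on :: "'a set => ('p::metric_space => 'a) => 'p set => ('p => 'g) => bool" where
 "flat_on U H N s \<longleftrightarrow> (\<forall>r\<in>N. s r : carrier G & H r : U) & (\<forall>r\<in>N. \<forall>r'\<in>N. s r' = s r \<otimes> t U (H r) (H r'))"

definition flat :: "('p::metric_space => 'a) => 'p set => ('p => 'g) => bool" where
 "flat H R s \<longleftrightarrow> (\<forall>r\<in>R. \<exists>U\<in>\<U>. \<exists>N. open N & r : N & flat_on U H (N Int R) s)"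

lemma flat_on_mono:
 assumes "flat_on U H N s" "M <= N" shows "flat_on U H M s" using assms unfolding flat_on_def by blast

lemma flat_on_shrink:
 assumes "flat_on U H N s" "U : \<U>" "V : \<U>" "V <= U" "M <= N" "H ` M <= V" shows "flat_on V H M s"
 using assms t_mono[of U V] unfolding flat_on_def by (auto simp: image_subset_iff subset_iff)

lemma flat_closed: "flat H R s ==> r : R ==> s r : carrier G"
 unfolding flat_def flat_on_def by blast

lemma flat_subset: assumes "flat H R s" "Q <= R" shows "flat H Q s" unfolding flat_def
proof
 fix r assume "r : Q"
 then obtain U N where "U : \<U>" "open N" "r : N" "flat_on U H (N Int R) s"
  using assms unfolding flat_def by blast
 then show "\<exists>U\<in>\<U>. \<exists>N. open N & r : N & flat_on U H (N Int Q) s"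
  using assms(2) flat_on_mono[of U H "N Int R" s "N Int Q"] by blast
qed

lemma preimage_nbhd:
 assumes H: "continuous_on UNIV H" "range H <= Y" and "V : \<U>" "H r : V"
 obtains M where "open M" "r : M" "H ` M <= V"
proof -
 obtain O' where O: "open O'" "V = Y Int O'" using U_open[OF \<open>V : \<U>\<close>] by (auto simp: openin_open)
 have "open (H -` O')" using O H by (intro open_vimage)
 then show ?thesis using O H assms by (intro that[of "H -` O'"]) auto
qed

lemma flat_common:
 assumes H: "continuous_on UNIV H" "range H <= Y"
  and "flat H R s" "flat H R' s'" "r : R" "r : R'"
 obtains V N where "V : \<U>" "open N" "r : N" "flat_on V H (N Int R) s" "flat_on V H (N Int R') s'"
proof -
 obtain U N where U: "U : \<U>" "open N" "r : N" "flat_on U H (N Int R) s"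
  using assms unfolding flat_def by blast
 obtain U' N' where U': "U' : \<U>" "open N'" "r : N'" "flat_on U' H (N' Int R') s'"
  using assms unfolding flat_def by blast
 have "H r : U" "H r : U'" using U U' assms unfolding flat_on_def by auto
 then obtain V where V: "V : \<U>" "H r : V" "V <= U" "V <= U'"
  using basis[of "U Int U'" "H r"] U_open[OF U(1)] U_open[OF U'(1)] by auto
 obtain M where M: "open M" "r : M" "H ` M <= V" by (rule preimage_nbhd[OF H V(1,2)])
 show ?thesis
 proof (rule that[of V "M Int N Int N'"])
  show "flat_on V H (M Int N Int N' Int R) s" by (rule flat_on_shrink[OF U(4) U(1) V(1,3)]) (use M in auto)
  show "flat_on V H (M Int N Int N' Int R') s'"
   by (rule flat_on_shrink[OF U'(4) U'(1) V(1,4)]) (use M in auto)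
 qed (use U U' V M in auto)
qed

lemma flat_local:
 assumes H: "continuous_on UNIV H" "range H <= Y"
 shows "\<exists>M s. open M & r : M & flat H M s"
proof -
 have "H r : Y" using H(2) by auto
 then obtain V where V: "V : \<U>" "H r : V" using basis[of Y "H r"] by auto
 obtain M where M: "open M" "r : M" "H ` M <= V" by (rule preimage_nbhd[OF H V])
 have "flat_on V H M (%q. t V (H r) (H q))"
  using M V t_closed t_trans unfolding flat_on_def by (auto simp: image_subset_iff)
 then show ?thesis using M V unfolding flat_def by (metis inf.idem)
qed

lemma flat_translate:
 assumes "flat H R s" "c : carrier G"
  and H: "continuous_on UNIV H" "range H <= Y"
 shows "flat H R (%r. c \<otimes> s r)" unfolding flat_def
proof
 fix r assume r: "r : R"
 obtain U N where U: "U : \<U>" "open N" "r : N" "flat_on U H (N Int R) s"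
  using assms r unfolding flat_def by blast
 then have "flat_on U H (N Int R) (%r. c \<otimes> s r)"
  unfolding flat_on_def using assms(2) t_closed[OF U(1)] by (metis m_assoc m_closed)
 then show "\<exists>U\<in>\<U>. \<exists>N. open N & r : N & flat_on U H (N Int R) (%r. c \<otimes> s r)" using U by blast
qed

text \<open>The quotient of two flat sections is locally constant, hence constant on connected sets.\<close>

lemma flat_unique:
 assumes H: "continuous_on UNIV H" "range H <= Y"
  and s: "flat H R s" "flat H R s'" and "connected R" "a : R" "b : R"
 shows "s' a \<otimes> inv (s a) = s' b \<otimes> inv (s b)"
proof (rule connected_local_const[OF \<open>connected R\<close> \<open>a : R\<close> \<open>b : R\<close>], intro ballI)
 fix r assume r: "r : R"
 obtain V N where V: "V : \<U>" "open N" "r : N" "flat_on V H (N Int R) s" "flat_on V H (N Int R) s'"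
  by (rule flat_common[OF H s r r])
 have "s' r \<otimes> inv (s r) = s' q \<otimes> inv (s q)" if q: "q : N Int R" for q
 proof -
  let ?t = "t V (H r) (H q)"
  have t: "?t : carrier G" and eq: "s q = s r \<otimes> ?t" "s' q = s' r \<otimes> ?t"
   using V q r t_closed unfolding flat_on_def by blast+
  have c: "s r : carrier G" "s' r : carrier G" using s r flat_closed by blast+
  show ?thesis unfolding eq using c t by (simp add: inv_mult_group m_assoc) (simp add: m_assoc[symmetric])
 qed
 then show "\<forall>\<^sub>F q in at r within R. s' r \<otimes> inv (s r) = s' q \<otimes> inv (s q)"
  using V(2,3) unfolding eventually_at_topological by blast
qed

text \<open>
 On the connected intersection the sections differ by a constant factor, which is absorbed into one of
 them.
\<close>

lemma flat_glue:
 assumes H: "continuous_on UNIV H" "range H <= Y"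
  and s: "flat H R s" "flat H R' s'" and R: "closed R" "closed R'" "connected (R Int R')" "R Int R' ~= {}"
 shows "\<exists>u. flat H (R Un R') u"
proof -
 obtain a where a: "a : R Int R'" using R by auto
 define c where "c = s a \<otimes> inv (s' a)"
 have sa: "s a : carrier G" "s' a : carrier G" using a s flat_closed by blast+
 then have c: "c : carrier G" by (simp add: c_def)
 define v where "v r = c \<otimes> s' r" for r
 have v: "flat H R' v" unfolding v_def by (rule flat_translate[OF s(2) c H])
 have va: "v a = s a" using sa by (simp add: v_def c_def m_assoc)
 have agree: "v r = s r" if "r : R Int R'" for r
 proof -
  have "v r \<otimes> inv (s r) = v a \<otimes> inv (s a)"
   using flat_unique[OF H flat_subset[OF s(1)] flat_subset[OF v] R(3) that a] by auto
  then have "v r \<otimes> inv (s r) = \<one>" using va sa by simp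
  then show ?thesis using that flat_closed[OF v] flat_closed[OF s(1)] by (metis IntD1 IntD2 inv_closed inv_equality inv_inv)
 qed
 define u where "u r = (if r : R then s r else v r)" for r
 have uR: "flat_on U H N u = flat_on U H N s" if "N <= R" for U N
  using that unfolding flat_on_def u_def by (simp add: subset_iff)
 have uR': "flat_on U H N u = flat_on U H N v" if "N <= R'" for U N
 proof -
  have "u r = v r" if "r : N" for r using that \<open>N <= R'\<close> agree by (auto simp: u_def)
  then show ?thesis unfolding flat_on_def by simp
 qed
 have "flat H (R Un R') u" unfolding flat_def
 proof
  fix r assume "r : R Un R'"
  then consider "r : R" "r : R'" | "r : R" "r ~: R'" | "r ~: R" "r : R'" by blast
  then show "\<exists>U\<in>\<U>. \<exists>N. open N & r : N & flat_on U H (N Int (R Un R')) u"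
  proof cases
   case 1
   obtain V N where V: "V : \<U>" "open N" "r : N" "flat_on V H (N Int R) s" "flat_on V H (N Int R') v"
    by (rule flat_common[OF H s(1) v 1])
   have sv: "v r = s r" using agree 1 by auto
   have m: "u q : carrier G & H q : V & u q = s r \<otimes> t V (H r) (H q)" if "q : N Int (R Un R')" for q
   proof (cases "q : R")
    case True
    have "s q = s r \<otimes> t V (H r) (H q)" "s q : carrier G" "H q : V"
     using V(3,4) that 1 True unfolding flat_on_def by blast+
    then show ?thesis using True by (simp add: u_def)
   next
    case False
    then have "v q = v r \<otimes> t V (H r) (H q)" "v q : carrier G" "H q : V"
     using V(3,5) that 1 unfolding flat_on_def by blast+
    then show ?thesis using False by (simp add: u_def sv)
   qed
   have m1: "u q : carrier G" and m2: "H q : V" if "q : N Int (R Un R')" for q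
    using m[OF that] by blast+
   have "flat_on V H (N Int (R Un R')) u" unfolding flat_on_def
   proof (intro conjI ballI)
    fix q q' assume q: "q : N Int (R Un R')" "q' : N Int (R Un R')"
    have Hr: "H r : V" using V 1 unfolding flat_on_def by blast
    have sr: "s r : carrier G" using s 1 flat_closed by blast
    have "t V (H r) (H q') = t V (H r) (H q) \<otimes> t V (H q) (H q')"
     using t_trans[OF V(1) Hr m2[OF q(1)] m2[OF q(2)]] by simp
    then show "u q' = u q \<otimes> t V (H q) (H q')"
     using m[OF q(1), THEN conjunct2, THEN conjunct2] m[OF q(2), THEN conjunct2, THEN conjunct2] t_closed[OF V(1) Hr m2[OF q(1)]] t_closed[OF V(1) m2[OF q(1)] m2[OF q(2)]] sr
     by (simp add: m_assoc)
   qed (fact m1, fact m2)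
   then show ?thesis using V by blast
  next
   case 2
   then obtain U N where U: "U : \<U>" "open N" "r : N" "flat_on U H (N Int R) s"
    using s unfolding flat_def by blast
   have e: "(N - R') Int (R Un R') <= N Int R" by auto
   have "flat_on U H ((N - R') Int (R Un R')) u" by (subst uR) (use e flat_on_mono[OF U(4) e] in auto)
   then show ?thesis using U 2 R(2) by (intro bexI[of _ U] exI[of _ "N - R'"]) (auto simp: open_Diff)
  next
   case 3
   then obtain U N where U: "U : \<U>" "open N" "r : N" "flat_on U H (N Int R') v"
    using v unfolding flat_def by blast
   have e: "(N - R) Int (R Un R') <= N Int R'" by auto
   have "flat_on U H ((N - R) Int (R Un R')) u" by (subst uR') (use e flat_on_mono[OF U(4) e] in auto)
   then show ?thesis using U 3 R(1) by (intro bexI[of _ U] exI[of _ "N - R"]) (auto simp: open_Diff)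
  qed
 qed
 then show ?thesis by blast
qed

text \<open>
 Flat sections over a thin strip are glued along vertical segments, and sections over strips are
 glued along horizontal segments; the segments are connected, so only a constant is to be adjusted.
\<close>

lemma flat_square:
 fixes H :: "real \<times> real => 'a"
 assumes H: "continuous_on UNIV H" "range H <= Y"
 shows "\<exists>s. flat H ({0..1} \<times> {0..1}) s"
proof -
 have strip: "\<exists>e>0. \<exists>s. flat H ({u-e..u+e} \<times> {0..1}) s" for u
 proof -
  define P where "P c d \<longleftrightarrow> c <= d --> (\<exists>e>0. \<exists>s. flat H ({u-e..u+e} \<times> {c..d}) s)" for c d
  have "(0::real) <= 1" by simp
  then have "P 0 1"
  proof (induction rule: Bolzano)
   case (trans a b c)
   then obtain e s e' s' where e: "e > 0" "flat H ({u-e..u+e} \<times> {a..b}) s" "e' > 0" "flat H ({u-e'..u+e'} \<times> {b..c}) s'"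
    unfolding P_def by auto
   define d where "d = min e e'"
   have d: "d > 0" "d <= e" "d <= e'" using e by (auto simp: d_def)
   have "\<exists>v. flat H (({u-d..u+d} \<times> {a..b}) Un ({u-d..u+d} \<times> {b..c})) v"
   proof (rule flat_glue[OF H])
    show "flat H ({u-d..u+d} \<times> {a..b}) s" by (rule flat_subset[OF e(2)]) (use d in auto)
    show "flat H ({u-d..u+d} \<times> {b..c}) s'" by (rule flat_subset[OF e(4)]) (use d in auto)
    have i: "({u-d..u+d} \<times> {a..b}) Int ({u-d..u+d} \<times> {b..c}) = {u-d..u+d} \<times> {b}" using trans by auto
    show "connected (({u-d..u+d} \<times> {a..b}) Int ({u-d..u+d} \<times> {b..c}))"
     unfolding i by (intro connected_Times) auto
    show "({u-d..u+d} \<times> {a..b}) Int ({u-d..u+d} \<times> {b..c}) ~= {}" unfolding i using d by auto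
   qed (auto intro: closed_Times)
   moreover have "({u-d..u+d} \<times> {a..b}) Un ({u-d..u+d} \<times> {b..c}) = {u-d..u+d} \<times> {a..c}" using trans by auto
   ultimately show ?case unfolding P_def using d by auto
  next
   case (local x)
   obtain M s where M: "open M" "(u,x) : M" "flat H M s" using flat_local[OF H, of "(u,x)"] by blast
   then obtain e where e: "e > 0" "ball (u,x) e <= M" by (meson open_contains_ball)
   have "P c d" if "c <= x" "x <= d" "d - c < e/2" for c d
   proof -
    have "{u-e/2..u+e/2} \<times> {c..d} <= ball (u,x) e"
    proof clarsimp
     fix y z assume y: "u - e/2 <= y" "y <= u + e/2" and z: "c <= z" "z <= d"
     have "dist (u,x) (y,z) <= \<bar>u-y\<bar> + \<bar>x-z\<bar>"
      unfolding dist_norm using norm_Pair_le[of "u-y" "x-z"] by simp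
     also have "... < e" using y z that by linarith
     finally show "dist (u,x) (y,z) < e" .
    qed
    then have "flat H ({u-e/2..u+e/2} \<times> {c..d}) s" using flat_subset[OF M(3)] e by blast
    then show ?thesis unfolding P_def using e by (intro impI exI[of _ "e/2"]) auto
   qed
   then show ?case using e by (intro exI[of _ "e/2"]) auto
  qed
  then show ?thesis by (simp add: P_def)
 qed
 define Q where "Q a b \<longleftrightarrow> a <= b --> (\<exists>s. flat H ({a..b} \<times> {0..1}) s)" for a b :: real
 have "(0::real) <= 1" by simp
 then have "Q 0 1"
 proof (induction rule: Bolzano)
  case (trans a b c)
  then obtain s s' where s: "flat H ({a..b} \<times> {0..1}) s" "flat H ({b..c} \<times> {0..1}) s'" unfolding Q_def by auto
  have i: "({a..b} \<times> {0..1::real}) Int ({b..c} \<times> {0..1}) = {b} \<times> {0..1}" using trans by auto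
  have "\<exists>v. flat H (({a..b} \<times> {0..1}) Un ({b..c} \<times> {0..1})) v"
  proof (rule flat_glue[OF H s])
   show "connected (({a..b} \<times> {0..1::real}) Int ({b..c} \<times> {0..1}))" unfolding i by (intro connected_Times) auto
   show "({a..b} \<times> {0..1::real}) Int ({b..c} \<times> {0..1}) ~= {}" unfolding i by auto
  qed (auto intro: closed_Times)
  moreover have "({a..b} \<times> {0..1}) Un ({b..c} \<times> {0..1}) = {a..c} \<times> {0..1::real}" using trans by auto
  ultimately show ?case unfolding Q_def by auto
 next
  case (local x)
  obtain e s where e: "e > 0" "flat H ({x-e..x+e} \<times> {0..1}) s" using strip by blast
  have "Q a b" if "a <= x" "x <= b" "b - a < e" for a b
   unfolding Q_def using flat_subset[OF e(2), of "{a..b} \<times> {0..1}"] that by (auto simp: subset_iff)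
  then show ?case using e by blast
 qed
 then show ?thesis by (simp add: Q_def)
qed

end

text \<open>
 Y is covered by small sets U in which the complement of X is so thin that U minus it is path
 connected, and P singles out those sets in which it does not obstruct the transport in question.
\<close>

definition thin_complement ::
  "('a::real_normed_vector set => bool) => 'a set => 'a set => bool" where
 "thin_complement P X Y \<longleftrightarrow> X <= Y &
   (\<forall>W y. openin (top_of_set Y) W --> y : W -->
    (\<exists>U. openin (top_of_set Y) U & y : U & U <= W & simply_connected U &
       path_connected (U Int X) & U Int X ~= {} & P U))"

lemma thin_complement_subset: "thin_complement P X Y ==> X <= Y" by (simp add: thin_complement_def)

lemma thin_complementE:
 assumes "thin_complement P X Y" "openin (top_of_set Y) W" "y : W"
 obtains U where "openin (top_of_set Y) U" "y : U" "U <= W" "simply_connected U"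
  "path_connected (U Int X)" "U Int X ~= {}" "P U"
proof -
 have "\<exists>U. openin (top_of_set Y) U & y : U & U <= W & simply_connected U &
       path_connected (U Int X) & U Int X ~= {} & P U"
  using assms unfolding thin_complement_def by simp
 then show ?thesis using that by blast
qed

text \<open>
 Any path of Y between points of X can be pushed into X: this is clear for short pieces, and
 pieces are joined at connectors, which are short paths from a point of the path into X.
\<close>

lemma thin_complement_push:
 fixes l :: "real => 'a::real_normed_vector"
 assumes thin: "thin_complement P X Y" and l: "path l" "track l <= Y"
  and ends: "start l : X" "finish l : X"
 shows "\<exists>al. path al & track al <= X & homotopic_paths Y l al"
proof -
 note XY = thin_complement_subset[OF thin]
 define conn where "conn p W h \<longleftrightarrow> path h & track h <= W & start h = p & finish h : X" for p W h
 define Q where "Q a b \<longleftrightarrow> 0 <= a & a <= b & b <= 1 -->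
  (\<exists>Wa Wb. openin (top_of_set Y) Wa & l a : Wa & openin (top_of_set Y) Wb & l b : Wb &
   (\<forall>h h'. conn (l a) Wa h --> conn (l b) Wb h' -->
     (\<exists>al. path al & track al <= X & homotopic_paths Y ((reversepath h +++ subpath a b l) +++ h') al)))" for a b
 have sub: "path (subpath a b l)" "track (subpath a b l) <= Y" if "0 <= a" "a <= b" "b <= 1" for a b
  using l that path_image_subpath_subset[of a b l] by (auto intro: path_subpath)
 have conn_in: "path h" "track h <= Y" "start h = p" "finish h : X"
  if "conn p W h" "openin (top_of_set Y) W" for p W h using that openin_imp_subset unfolding conn_def by blast+
 have "(0::real) <= 1" by simp
 then have "Q 0 1"
 proof (induction rule: Bolzano)
  case (trans a b c)
  show ?case unfolding Q_def
  proof (intro impI)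
   assume abc: "0 <= a & a <= c & c <= 1"
   obtain Wa Wb where 1: "openin (top_of_set Y) Wa" "l a : Wa" "openin (top_of_set Y) Wb" "l b : Wb"
    and k1: "!!h h'. conn (l a) Wa h ==> conn (l b) Wb h' ==>
     \<exists>al. path al & track al <= X & homotopic_paths Y ((reversepath h +++ subpath a b l) +++ h') al"
    using trans abc unfolding Q_def by (elim impE) auto
   obtain Vb Wc where 2: "openin (top_of_set Y) Vb" "l b : Vb" "openin (top_of_set Y) Wc" "l c : Wc"
    and k2: "!!h h'. conn (l b) Vb h ==> conn (l c) Wc h' ==>
     \<exists>al. path al & track al <= X & homotopic_paths Y ((reversepath h +++ subpath b c l) +++ h') al"
    using trans abc unfolding Q_def by (elim impE) auto
   have "openin (top_of_set Y) (Wb Int Vb)" "l b : Wb Int Vb" using 1 2 by auto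
   then obtain U where U: "l b : U" "U <= Wb Int Vb" "simply_connected U" "U Int X ~= {}"
    using thin_complementE[OF thin] by metis
   then obtain z where z: "z : U" "z : X" by auto
   obtain k where k: "path k" "track k <= U" "start k = l b" "finish k = z"
    using simply_connected_imp_path_connected[OF U(3)] U(1) z unfolding path_connected_def by metis
   have ck: "conn (l b) Wb k" "conn (l b) Vb k" using k U z unfolding conn_def by auto
   show "\<exists>Wa Wb. openin (top_of_set Y) Wa & l a : Wa & openin (top_of_set Y) Wb & l c : Wb &
    (\<forall>h h'. conn (l a) Wa h --> conn (l c) Wb h' -->
     (\<exists>al. path al & track al <= X & homotopic_paths Y ((reversepath h +++ subpath a c l) +++ h') al))"
   proof (rule exI[of _ Wa], rule exI[of _ Wc], intro conjI allI impI 1(1,2) 2(3,4))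
    fix h h' assume c: "conn (l a) Wa h" "conn (l c) Wc h'"
    note ci = conn_in[OF c(1) 1(1)] conn_in[OF c(2) 2(3)] conn_in[OF ck(1) 1(3)]
    obtain al where al: "path al" "track al <= X" "homotopic_paths Y ((reversepath h +++ subpath a b l) +++ k) al"
     using k1[OF c(1) ck(1)] by blast
    obtain be where be: "path be" "track be <= X" "homotopic_paths Y ((reversepath k +++ subpath b c l) +++ h') be"
     using k2[OF ck(2) c(2)] by blast
    have ab: "finish al = finish k" "start be = finish k"
     using homotopic_paths_imp_pathfinish[OF al(3)] homotopic_paths_imp_pathstart[OF be(3)] by auto
    have bnds: "0 <= a" "a <= b" "b <= c" "c <= 1" "b <= 1" "0 <= b" "a <= c" using trans abc by auto
    note simps = ci sub[OF bnds(1,2,5)] sub[OF bnds(6,3,4)] sub[OF bnds(1,7,4)] path_image_join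
    let ?s = "subpath a b l" and ?s' = "subpath b c l"
    have "homotopic_paths Y ((reversepath h +++ subpath a c l) +++ h') ((reversepath h +++ (?s +++ ?s')) +++ h')"
     by (intro homotopic_paths_join homotopic_paths_sym[OF homotopic_join_subpaths])
      (use l bnds in \<open>auto simp: simps\<close>)
    also have "homotopic_paths Y ((reversepath h +++ (?s +++ ?s')) +++ h') (((reversepath h +++ ?s) +++ ?s') +++ h')"
     by (intro homotopic_paths_join homotopic_paths_assoc) (use bnds in \<open>auto simp: simps\<close>)
    also have "homotopic_paths Y (((reversepath h +++ ?s) +++ ?s') +++ h') ((reversepath h +++ ?s) +++ (?s' +++ h'))"
     by (intro homotopic_paths_sym[OF homotopic_paths_assoc]) (use bnds in \<open>auto simp: simps\<close>)
    also have "homotopic_paths Y ((reversepath h +++ ?s) +++ (?s' +++ h'))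
      (((reversepath h +++ ?s) +++ k) +++ (reversepath k +++ (?s' +++ h')))"
     by (intro homotopic_paths_sym[OF homotopic_paths_cancel_middle]) (use bnds in \<open>auto simp: simps\<close>)
    also have "homotopic_paths Y (((reversepath h +++ ?s) +++ k) +++ (reversepath k +++ (?s' +++ h')))
      (((reversepath h +++ ?s) +++ k) +++ ((reversepath k +++ ?s') +++ h'))"
     by (intro homotopic_paths_join homotopic_paths_assoc) (use bnds in \<open>auto simp: simps\<close>)
    also have "homotopic_paths Y (((reversepath h +++ ?s) +++ k) +++ ((reversepath k +++ ?s') +++ h')) (al +++ be)"
     by (intro homotopic_paths_join al be) (use bnds in \<open>auto simp: simps\<close>)
    finally show "\<exists>al. path al & track al <= X & homotopic_paths Y ((reversepath h +++ subpath a c l) +++ h') al"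
     using al be ab by (intro exI[of _ "al +++ be"]) (auto simp: path_image_join)
   qed
  qed
 next
  case (local x)
  show ?case
  proof (cases "x : {0..1}")
   case False
   then show ?thesis using local by auto
  next
   case True
   then have "l x : Y" using l by (auto simp: path_image_def)
   then obtain U where U: "openin (top_of_set Y) U" "l x : U" "simply_connected U" "path_connected (U Int X)"
    using thin_complementE[OF thin openin_subtopology_self] by metis
   obtain O' where O: "open O'" "U = Y Int O'" using U(1) by (auto simp: openin_open)
   have "continuous_on {0..1} l" using l by (simp add: path_def)
   then obtain d where d: "d > 0" "!!y. y : {0..1} ==> dist y x < d ==> l y : O'"
    using O U True unfolding continuous_on_topological by (metis Int_iff eventually_at_topological open_dist)
   have "Q a b" if ab: "a <= x" "x <= b" "b - a < d" for a b unfolding Q_def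
   proof (intro impI exI[of _ U] conjI allI U(1))
    assume ab': "0 <= a & a <= b & b <= 1"
    have inU: "l y : U" if "y : {a..b}" for y
     using d(2)[of y] that ab ab' l(2) O by (auto simp: path_image_def dist_real_def image_subset_iff)
    show "l a : U" "l b : U" using inU ab' by auto
    have im: "track (subpath a b l) <= U" using inU ab' by (auto simp: path_image_subpath)
    fix h h' assume c: "conn (l a) U h" "conn (l b) U h'"
    then have cc: "path h" "track h <= U" "start h = l a" "finish h : X"
     "path h'" "track h' <= U" "start h' = l b" "finish h' : X" unfolding conn_def by auto
    then have "finish h : U Int X" "finish h' : U Int X" by auto
    then obtain al where al: "path al" "track al <= U Int X" "start al = finish h" "finish al = finish h'"
     using U(4) unfolding path_connected_def by metis
    have "homotopic_paths U ((reversepath h +++ subpath a b l) +++ h') al"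
     using U(3)[unfolded simply_connected_eq_homotopic_paths] al cc im ab' l by (auto simp: path_image_join path_subpath)
    then have "homotopic_paths Y ((reversepath h +++ subpath a b l) +++ h') al" using O homotopic_paths_subset by blast
    then show "\<exists>al. path al & track al <= X & homotopic_paths Y ((reversepath h +++ subpath a b l) +++ h') al"
     using al by blast
   qed
   then show ?thesis using d(1) by blast
  qed
 qed
 then obtain Wa Wb where W: "l 0 : Wa" "l 1 : Wb"
  and *: "!!h h'. conn (l 0) Wa h ==> conn (l 1) Wb h' ==>
     \<exists>al. path al & track al <= X & homotopic_paths Y ((reversepath h +++ subpath 0 1 l) +++ h') al"
  unfolding Q_def by auto
 let ?k = "linepath (l 0) (l 0)" and ?k' = "linepath (l 1) (l 1)"
 have e: "l 0 : X" "l 1 : X" using ends by (auto simp: pathstart_def pathfinish_def)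
 have "conn (l 0) Wa ?k" "conn (l 1) Wb ?k'" using W e by (auto simp: conn_def)
 then obtain al where al: "path al" "track al <= X" "homotopic_paths Y ((reversepath ?k +++ l) +++ ?k') al"
  using *[of ?k ?k'] by auto
 have c: "l 0 : Y" "l 1 : Y" using e XY by auto
 have "homotopic_paths Y ((reversepath ?k +++ l) +++ ?k') (reversepath ?k +++ l)" by (rule homotopic_paths_rid')
   (use l c in \<open>auto simp: path_image_join pathstart_def, auto simp: joinpaths_def pathfinish_def\<close>)
 moreover have "homotopic_paths Y (reversepath ?k +++ l) l" unfolding reversepath_linepath
  by (rule homotopic_paths_lid') (use l c in \<open>auto simp: pathstart_def\<close>)
 ultimately have "homotopic_paths Y l al" using al(3) homotopic_paths_trans homotopic_paths_sym by blast
 then show ?thesis using al by blast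
qed

lemma thin_complement_path_connected:
 assumes thin: "thin_complement P X Y"
 shows "path_connected X \<longleftrightarrow> path_connected Y"
proof
 assume X: "path_connected X"
 have conn: "\<exists>z\<in>X. path_component Y y z" if y: "y : Y" for y
 proof -
  obtain U where U: "openin (top_of_set Y) U" "y : U" "simply_connected U" "U Int X ~= {}"
   using thin_complementE[OF thin openin_subtopology_self y] by metis
  then obtain z where z: "z : U" "z : X" by auto
  have "path_component U y z"
   using simply_connected_imp_path_connected[OF U(3)] U(2) z by (simp add: path_connected_component)
  then show ?thesis using z path_component_of_subset[OF openin_imp_subset[OF U(1)]] by blast
 qed
 show "path_connected Y" unfolding path_connected_component
 proof (intro ballI)
  fix a b assume "a : Y" "b : Y"
  then obtain a' b' where "a' : X" "path_component Y a a'" "b' : X" "path_component Y b b'" using conn by metis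
  moreover have "path_component Y a' b'" using X calculation path_component_of_subset[OF thin_complement_subset[OF thin]]
   unfolding path_connected_component by blast
  ultimately show "path_component Y a b" by (meson path_component_sym path_component_trans)
 qed
next
 assume Y: "path_connected Y"
 show "path_connected X" unfolding path_connected_def
 proof (intro ballI)
  fix a b assume ab: "a : X" "b : X"
  then obtain g where g: "path g" "track g <= Y" "start g = a" "finish g = b"
   using Y thin_complement_subset[OF thin] unfolding path_connected_def by blast
  then obtain h where "path h" "track h <= X" "homotopic_paths Y g h"
   using thin_complement_push[OF thin g(1,2)] ab by auto
  then show "\<exists>g. path g & track g <= X & start g = a & finish g = b"
   using g homotopic_paths_imp_pathstart homotopic_paths_imp_pathfinish by metis
 qed
qed

text \<open>The transport T in X has no monodromy around the points of Y that are not in X.\<close>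

locale thin_transport = path_functor G X T for G (structure) and X :: "'a::real_normed_vector set" and T +
 fixes Y :: "'a set"
 assumes thin: "thin_complement (%U. \<forall>p. path p --> track p <= U Int X -->
  finish p = start p --> T p = \<one>) X Y"
begin

definition small :: "'a set set" where
 "small = {U. openin (top_of_set Y) U & path_connected (U Int X) & U Int X ~= {} &
   (\<forall>p. path p --> track p <= U Int X --> finish p = start p --> T p = \<one>)}"

lemma small_basis:
 assumes "openin (top_of_set Y) W" "y : W" shows "\<exists>U\<in>small. y : U & U <= W"
 using thin_complementE[OF thin assms] unfolding small_def by (smt (verit) mem_Collect_eq)

lemma small_int:
 assumes "U : small" "V : small" "y : U" "y : V"
 obtains W where "W : small" "y : W" "W <= U" "W <= V"
proof -
 have "openin (top_of_set Y) (U Int V)" using assms by (auto simp: small_def)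
 then show ?thesis using small_basis[of "U Int V" y] assms that by auto
qed

definition tau :: "'a set => 'a => 'a => _" where
 "tau U y z = T (SOME p. path p & track p <= U Int X & start p = y & finish p = z)"

lemma tau_eq:
 assumes U: "U : small" and p: "path p" "track p <= U Int X"
 shows "tau U (start p) (finish p) = T p"
proof -
 define q where "q = (SOME q. path q & track q <= U Int X & start q = start p & finish q = finish p)"
 have q: "path q & track q <= U Int X & start q = start p & finish q = finish p"
  unfolding q_def by (rule someI[of _ p]) (use p in auto)
 have "T (p +++ reversepath q) = \<one>" using U p q unfolding small_def by (auto simp: path_image_join)
 then have "T p \<otimes> inv (T q) = \<one>" using join[of p "reversepath q"] rev[of q] p q by auto
 then have "T p = T q" using closed p q by (metis inv_equality inv_inv le_inf_iff inv_closed)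
 then show ?thesis by (simp add: tau_def q_def)
qed

lemma tau_path:
 assumes "U : small" "y : U Int X" "z : U Int X"
 obtains p where "path p" "track p <= U Int X" "start p = y" "finish p = z" "tau U y z = T p"
proof -
 obtain p where "path p" "track p <= U Int X" "start p = y" "finish p = z"
  using assms unfolding small_def path_connected_def by blast
 then show ?thesis using that tau_eq[OF assms(1), of p] by auto
qed

lemma tau_closed: "U : small ==> y : U Int X ==> z : U Int X ==> tau U y z : carrier G"
 by (metis tau_path closed le_inf_iff)

lemma tau_trans:
 assumes "U : small" "x : U Int X" "y : U Int X" "z : U Int X"
 shows "tau U x y \<otimes> tau U y z = tau U x z"
proof -
 obtain p where p: "path p" "track p <= U Int X" "start p = x" "finish p = y" "tau U x y = T p"
  using tau_path assms by metis
 obtain q where q: "path q" "track q <= U Int X" "start q = y" "finish q = z" "tau U y z = T q"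
  using tau_path assms by metis
 have "tau U x z = T (p +++ q)" using tau_eq[OF assms(1), of "p +++ q"] p q by (auto simp: path_image_join)
 then show ?thesis using join[of p q] p q by auto
qed

lemma tau_mono:
 assumes "U : small" "V : small" "V <= U" "y : V Int X" "z : V Int X"
 shows "tau V y z = tau U y z" using tau_path[OF assms(2,4,5)] tau_eq[OF assms(1)] assms(3)
 by (metis inf_mono order.refl order.trans)

lemma tau_self: assumes "U : small" "y : U Int X" shows "tau U y y = \<one>"
 using tau_trans[OF assms assms(2) assms(2)] tau_closed[OF assms assms(2)] by (simp add: l_cancel_one)

text \<open>
 A point p of Y gets a reference point close by in X. The function \<open>germ p U\<close> compares it with
 the points of U, for each small U around p; the transport from p to q inside U is then read off
 at any point of U.
\<close>

definition ref_nbhd :: "'a => 'a set" where "ref_nbhd p = (SOME U. U : small & p : U)"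

definition ref_point :: "'a => 'a" where
 "ref_point p = (if p : X then p else (SOME z. z : ref_nbhd p Int X))"

definition germ :: "'a => 'a set => 'a => _" where
 "germ p U y = (let z = (SOME z. \<exists>V\<in>small. p : V & V <= U Int ref_nbhd p & z : V Int X)
   in tau (ref_nbhd p) (ref_point p) z \<otimes> tau U z y)"

definition trans_in :: "'a set => 'a => 'a => _" where
 "trans_in U p q = (let y = (SOME y. y : U Int X) in germ p U y \<otimes> inv (germ q U y))"

lemma small_sub: "U : small ==> p : U ==> p : Y"
 using openin_imp_subset unfolding small_def by blast

lemma ref_nbhd: assumes "p : Y" shows "ref_nbhd p : small" "p : ref_nbhd p"
proof -
 have "\<exists>U. U : small & p : U" using small_basis[of Y p] assms by auto
 then have "ref_nbhd p : small & p : ref_nbhd p" unfolding ref_nbhd_def by (rule someI_ex)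
 then show "ref_nbhd p : small" "p : ref_nbhd p" by auto
qed

lemma ref_point: assumes "p : Y" shows "ref_point p : ref_nbhd p Int X"
proof (cases "p : X")
 case False
 have "\<exists>z. z : ref_nbhd p Int X" using ref_nbhd[OF assms] unfolding small_def by blast
 then have "(SOME z. z : ref_nbhd p Int X) : ref_nbhd p Int X" by (rule someI_ex)
 then show ?thesis using False by (simp add: ref_point_def)
qed (use ref_nbhd[OF assms] in \<open>auto simp: ref_point_def\<close>)

text \<open>
 The choice of the auxiliary small set is immaterial: two of them contain a common smaller one around p.
\<close>

lemma germ_eq:
 assumes U: "U : small" "y : U Int X" and V: "V : small" "p : V" "V <= U" "V <= ref_nbhd p" "z : V Int X"
 shows "germ p U y = tau (ref_nbhd p) (ref_point p) z \<otimes> tau U z y"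
proof -
 have p: "p : Y" using small_sub V by blast
 note R = ref_nbhd(1)[OF p] ref_point[OF p]
 define w where "w = (SOME z. \<exists>V\<in>small. p : V & V <= U Int ref_nbhd p & z : V Int X)"
 have "\<exists>V\<in>small. p : V & V <= U Int ref_nbhd p & w : V Int X"
  unfolding w_def by (rule someI[of _ z]) (use V in blast)
 then obtain V' where V': "V' : small" "p : V'" "V' <= U" "V' <= ref_nbhd p" "w : V' Int X" by auto
 obtain W where W: "W : small" "p : W" "W <= V" "W <= V'"
  using small_int[OF V(1) V'(1) V(2) V'(2)] by blast
 then obtain v where v: "v : W Int X" by (auto simp: small_def)
 have key: "tau (ref_nbhd p) (ref_point p) z \<otimes> tau U z y = tau (ref_nbhd p) (ref_point p) v \<otimes> tau U v y"
  if V: "V : small" "V <= U" "V <= ref_nbhd p" "z : V Int X" "v : V Int X" for V z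
 proof -
  have in1: "z : U Int X" "v : U Int X" "z : ref_nbhd p Int X" "v : ref_nbhd p Int X" using V by auto
  have "tau (ref_nbhd p) z v = tau U z v" using tau_mono[OF R(1) V(1,3,4,5)] tau_mono[OF U(1) V(1,2,4,5)] by simp
  then have "tau (ref_nbhd p) (ref_point p) v = tau (ref_nbhd p) (ref_point p) z \<otimes> tau U z v"
   using tau_trans[OF R in1(3,4)] by simp
  moreover have "tau U z y = tau U z v \<otimes> tau U v y" using tau_trans[OF U(1) in1(1,2) U(2)] by simp
  ultimately show ?thesis using tau_closed[OF R in1(3)] tau_closed[OF U(1) in1(1,2)] tau_closed[OF U(1) in1(2) U(2)]
   by (simp add: m_assoc)
 qed
 have "tau (ref_nbhd p) (ref_point p) z \<otimes> tau U z y = tau (ref_nbhd p) (ref_point p) v \<otimes> tau U v y"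
  by (rule key[of V]) (use V W v in auto)
 moreover have "tau (ref_nbhd p) (ref_point p) w \<otimes> tau U w y = tau (ref_nbhd p) (ref_point p) v \<otimes> tau U v y"
  by (rule key[of V']) (use V' W v in auto)
 ultimately show ?thesis unfolding germ_def w_def[symmetric] Let_def by simp
qed

lemma germ_nbhd:
 assumes "U : small" "p : U"
 obtains V z where "V : small" "p : V" "V <= U" "V <= ref_nbhd p" "z : V Int X"
proof -
 have p: "p : Y" using small_sub assms by blast
 obtain V where V: "V : small" "p : V" "V <= U" "V <= ref_nbhd p"
  using small_int[OF assms(1) ref_nbhd(1)[OF p] assms(2) ref_nbhd(2)[OF p]] by blast
 then obtain z where "z : V Int X" by (auto simp: small_def)
 then show ?thesis using V that by blast
qed

lemma germ_closed:
 assumes "U : small" "p : U" "y : U Int X" shows "germ p U y : carrier G"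
proof -
 obtain V z where V: "V : small" "p : V" "V <= U" "V <= ref_nbhd p" "z : V Int X" using germ_nbhd[OF assms(1,2)] .
 have p: "p : Y" using small_sub assms by blast
 show ?thesis unfolding germ_eq[OF assms(1,3) V]
  using tau_closed[OF ref_nbhd(1)[OF p] ref_point[OF p], of z] tau_closed[OF assms(1), of z y] assms V by auto
qed

lemma germ_tau:
 assumes "U : small" "p : U" "y : U Int X" "y' : U Int X" shows "germ p U y' = germ p U y \<otimes> tau U y y'"
proof -
 obtain V z where V: "V : small" "p : V" "V <= U" "V <= ref_nbhd p" "z : V Int X" using germ_nbhd[OF assms(1,2)] .
 have p: "p : Y" using small_sub assms by blast
 have z: "z : U Int X" "z : ref_nbhd p Int X" using V by auto
 show ?thesis unfolding germ_eq[OF assms(1,3) V] germ_eq[OF assms(1,4) V]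
  using tau_trans[OF assms(1) z(1) assms(3,4)] tau_closed[OF ref_nbhd(1)[OF p] ref_point[OF p] z(2)]
   tau_closed[OF assms(1) z(1) assms(3)] tau_closed[OF assms(1,3,4)] by (simp add: m_assoc)
qed

lemma trans_in_eq:
 assumes "U : small" "p : U" "q : U" "y : U Int X"
 shows "trans_in U p q = germ p U y \<otimes> inv (germ q U y)"
proof -
 define w where "w = (SOME y. y : U Int X)"
 have w: "w : U Int X" unfolding w_def by (rule someI[of _ y]) (rule assms)
 show ?thesis
  unfolding trans_in_def w_def[symmetric] Let_def germ_tau[OF assms(1,2) w assms(4)] germ_tau[OF assms(1,3) w assms(4)]
  using germ_closed[OF assms(1,2) w] germ_closed[OF assms(1,3) w] tau_closed[OF assms(1) w assms(4)]
  by (simp add: inv_mult_group m_assoc) (simp add: m_assoc[symmetric])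
qed

lemma trans_in_X:
 assumes "U : small" "p : U Int X" "q : U Int X"
 shows "trans_in U p q = tau U p q"
proof -
 have g: "germ p U q = tau U p q" if "p : U Int X" "q : U Int X" for p q
 proof -
  have p: "p : U" "p : X" "p : Y" using that small_sub assms by auto
  obtain V z where V: "V : small" "p : V" "V <= U" "V <= ref_nbhd p" "z : V Int X" using germ_nbhd[OF assms(1) p(1)] .
  have "p : V Int X" using V p by auto
  from germ_eq[OF assms(1) that(2) V(1-4) this] show ?thesis
   using p tau_self[OF ref_nbhd(1)[OF p(3)]] ref_nbhd(2)[OF p(3)] tau_closed[OF assms(1) that] by (simp add: ref_point_def)
 qed
 show ?thesis unfolding trans_in_eq[OF assms(1) _ _ assms(3), of p q, OF IntD1[OF assms(2)] IntD1[OF assms(3)]]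
   g[OF assms(2,3)] g[OF assms(3,3)] using tau_self[OF assms(1,3)] tau_closed[OF assms] by simp
qed

sublocale LS: local_system G Y small trans_in
proof unfold_locales
 fix W y show "openin (top_of_set Y) W ==> y : W ==> \<exists>U\<in>small. y : U & U <= W" by (rule small_basis)
next
 fix U show "U : small ==> openin (top_of_set Y) U" by (simp add: small_def)
next
 fix U p q assume a: "U : small" "p : U" "q : U"
 then obtain y where y: "y : U Int X" by (auto simp: small_def)
 show "trans_in U p q : carrier G" unfolding trans_in_eq[OF a y] using germ_closed[OF a(1) _ y] a by simp
 fix r assume r: "r : U"
 show "trans_in U p q \<otimes> trans_in U q r = trans_in U p r"
  unfolding trans_in_eq[OF a y] trans_in_eq[OF a(1,2) r y] trans_in_eq[OF a(1,3) r y]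
  using germ_closed[OF a(1) _ y] a r by (simp add: m_assoc) (simp add: m_assoc[symmetric])
next
 fix U V p q assume a: "U : small" "V : small" "V <= U" "p : V" "q : V"
 then obtain y where y: "y : V Int X" by (auto simp: small_def)
 have yU: "y : U Int X" "p : U" "q : U" using y a by auto
 have g: "germ p V y = germ p U y" if pV: "p : V" for p
 proof -
  obtain W z where W: "W : small" "p : W" "W <= V" "W <= ref_nbhd p" "z : W Int X" using germ_nbhd[OF a(2) pV] .
  have WU: "W <= U" and z: "z : V Int X" using W a by auto
  show ?thesis unfolding germ_eq[OF a(2) y W] germ_eq[OF a(1) yU(1) W(1,2) WU W(4,5)] using tau_mono[OF a(1,2,3) z y] by simp
 qed
 show "trans_in V p q = trans_in U p q"
  unfolding trans_in_eq[OF a(2,4,5) y] trans_in_eq[OF a(1) yU(2,3,1)] g[OF a(4)] g[OF a(5)] ..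
qed

lemma flat_path:
 assumes H: "continuous_on UNIV h" "range h <= X"
 shows "LS.flat h {0..1} (%s. T (subpath 0 s h))" unfolding LS.flat_def
proof
 note XY = thin_complement_subset[OF thin]
 have HY: "range h <= Y" using H XY by blast
 fix r :: real assume r: "r : {0..1}"
 obtain U where U: "U : small" "h r : U" using small_basis[of Y "h r"] HY by auto
 obtain M where M: "open M" "r : M" "h ` M <= U" by (rule LS.preimage_nbhd[OF H(1) HY U])
 then obtain e where e: "e > 0" "ball r e <= M" by (meson open_contains_ball)
 have pb: "path h" "track h <= X" using H by (auto simp: path_def path_image_def intro: continuous_on_subset)
 have "LS.flat_on U h (ball r e Int {0..1}) (%s. T (subpath 0 s h))" unfolding LS.flat_on_def
 proof (intro conjI ballI)
  fix s assume s: "s : ball r e Int {0..1}"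
  have ps: "path (subpath a b h)" "track (subpath a b h) <= X" if "a : {0..1}" "b : {0..1}" for a b
   using pb that path_image_subpath_subset[of a b h] by (auto intro: path_subpath)
  show "T (subpath 0 s h) : carrier G" using s ps by (intro closed) auto
  show "h s : U" using s e(2) M(3) by blast
  fix s' assume s': "s' : ball r e Int {0..1}"
  have seg: "closed_segment s s' <= M" using closed_segment_subset[OF _ _ convex_ball[of r e]] s s' e by blast
  have im: "track (subpath s s' h) <= U Int X" using seg M(3) H by (auto simp: path_image_subpath_gen)
  have "T (subpath 0 s h) \<otimes> T (subpath s s' h) = T (subpath 0 s h +++ subpath s s' h)"
   using s s' ps by (intro join[symmetric]) auto
  also have "... = T (subpath 0 s' h)" using s s' pb by (intro homotopic homotopic_join_subpaths) auto
  also have "T (subpath s s' h) = tau U (h s) (h s')" using tau_eq[OF U(1) ps(1) im] s s' by auto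
  also have "... = trans_in U (h s) (h s')" using s s' e(2) M(3) H(2) by (intro trans_in_X[symmetric] U(1)) blast+
  finally show "T (subpath 0 s' h) = T (subpath 0 s h) \<otimes> trans_in U (h s) (h s')" by simp
 qed
 then show "\<exists>U\<in>small. \<exists>N. open N & r : N & LS.flat_on U h (N Int {0..1}) (%s. T (subpath 0 s h))"
  using U(1) e(1) by (intro bexI[of _ U] exI[of _ "ball r e"]) auto
qed

end

context local_system begin

lemma flat_pullback:
 assumes "flat H R s" "continuous_on UNIV f" "f ` Q <= R"
 shows "flat (H o f) Q (s o f)" unfolding flat_def
proof
 fix r assume r: "r : Q"
 then have "f r : R" using assms by auto
 then obtain U N where U: "U : \<U>" "open N" "f r : N" "flat_on U H (N Int R) s"
  using assms unfolding flat_def by blast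
 have "open (f -` N)" using U assms by (intro open_vimage)
 moreover have "flat_on U (H o f) (f -` N Int Q) (s o f)"
  using U(4) assms(3) unfolding flat_on_def by (simp add: image_subset_iff)
 ultimately show "\<exists>U\<in>\<U>. \<exists>N. open N & r : N & flat_on U (H o f) (N Int Q) (s o f)"
  using U by (intro bexI[of _ U] exI[of _ "f -` N"]) auto
qed

end

context thin_transport begin

text \<open>
 A homotopy in Y carries a flat section. Along the sides of the square it is constant, along
 bottom and top it is the transport T.
\<close>

lemma homotopic_in_Y:
 assumes "path b" "track b <= X" "path l" "track l <= X" "homotopic_paths Y b l"
 shows "T b = T l"
proof -
 note XY = thin_complement_subset[OF thin]
 obtain h where h: "continuous_on ({0..1::real} \<times> {0..1::real}) h" "h ` ({0..1} \<times> {0..1}) <= Y"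
  "!!x. x : {0..1} ==> h(0,x) = b x" "!!x. x : {0..1} ==> h(1,x) = l x"
  "!!t. t : {0..1} ==> h(t,0) = start b" "!!t. t : {0..1} ==> h(t,1) = finish b"
  using assms(5) unfolding homotopic_paths by (force simp: pathstart_def pathfinish_def)
 define c :: "real => real" where "c x = max 0 (min 1 x)" for x
 have c: "continuous_on UNIV c" "!!x. c x : {0..1}" "!!x. x : {0..1} ==> c x = x"
  unfolding c_def by (auto intro!: continuous_intros)
 define H where "H x = h (c (fst x), c (snd x))" for x :: "real \<times> real"
 have "continuous_on UNIV H" unfolding H_def by (rule continuous_on_compose2[OF h(1)])
   (use c in \<open>auto intro!: continuous_intros continuous_on_compose2[OF c(1)]\<close>)
 moreover have HY: "range H <= Y" using h(2) c(2) unfolding H_def by (auto simp: image_subset_iff)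
 ultimately obtain s where s: "LS.flat H ({0..1} \<times> {0..1}) s" using LS.flat_square by blast
 have scl: "s x : carrier G" if "x : {0..1} \<times> {0..1}" for x using LS.flat_closed[OF s that] .
 have key: "s (f 0) \<otimes> T p = s (f 1)"
  if f: "continuous_on UNIV f" "f ` {0..1} <= {0..1} \<times> {0..1}" "!!t. H (f t) = p (c t)"
   and p: "path p" "track p <= X" for f and p :: "real => 'a"
 proof -
  define q where "q t = p (c t)" for t
  have q: "continuous_on UNIV q" "range q <= X" using p c unfolding q_def path_def path_image_def
   by (auto intro!: continuous_on_compose2[of "{0..1}" p UNIV c])
  have qY: "range q <= Y" using q XY by blast
  have e: "H o f = q" using f(3) by (auto simp: q_def)
  have "(s o f) 0 \<otimes> inv (T (subpath 0 0 q)) = (s o f) 1 \<otimes> inv (T (subpath 0 1 q))"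
   using LS.flat_unique[OF q(1) qY flat_path[OF q] LS.flat_pullback[OF s f(1,2), unfolded e], of 0 1] by simp
  moreover have "T (subpath 0 0 q) = \<one>" using q by (auto simp: subpath_refl intro!: const)
  moreover have "T (subpath 0 1 q) = T p"
   using p by (intro homotopic homotopic_paths_sym[OF homotopic_paths_eq]) (auto simp: q_def c)
  moreover have "s (f 0) : carrier G" "s (f 1) : carrier G" "T p : carrier G"
   using f(2) p by (auto intro!: scl closed)
  ultimately show ?thesis using inv_solve_right' by fastforce
 qed
 have a: "start b : X" "finish b : X" using assms by (auto intro: subsetD)
 have "s (0,0) \<otimes> T b = s (0,1)"
  by (rule key[of "%t. (0,t)" b]) (use assms h c in \<open>auto intro!: continuous_intros simp: H_def\<close>)
 moreover have "s (1,0) \<otimes> T l = s (1,1)"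
  by (rule key[of "%t. (1,t)" l]) (use assms h c in \<open>auto intro!: continuous_intros simp: H_def\<close>)
 moreover have "s (0,0) \<otimes> T (linepath (start b) (start b)) = s (1,0)"
 proof (rule key[of "%t. (t,0)"])
  show "H (t,0) = linepath (start b) (start b) (c t)" for t
   using h(5,6)[OF c(2)[of t]] c(3) by (simp add: H_def linepath_refl)
 qed (use a in \<open>auto intro!: continuous_intros\<close>)
 moreover have "s (0,1) \<otimes> T (linepath (finish b) (finish b)) = s (1,1)"
 proof (rule key[of "%t. (t,1)"])
  show "H (t,1) = linepath (finish b) (finish b) (c t)" for t
   using h(5,6)[OF c(2)[of t]] c(3) by (simp add: H_def linepath_refl)
 qed (use a in \<open>auto intro!: continuous_intros\<close>)
 moreover have "s (0,0) : carrier G" "s (0,1) : carrier G" by (auto intro!: scl)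
 ultimately have "s (1,0) \<otimes> T b = s (1,0) \<otimes> T l" "s (1,0) : carrier G" using a const by auto
 then show ?thesis using closed assms Units_l_cancel Units_eq by metis
qed

text \<open>
 Paths between points of X are pushed into X, with a well-defined transport by homotopic_in_Y. Other
 paths are first prolonged into X by fixed paths, which are constant at the points of X so that nothing
 changes there.
\<close>

theorem extend_transport: "\<exists>T'. path_functor G Y T' & (\<forall>p. path p --> track p <= X --> T' p = T p)"
proof -
 note XY = thin_complement_subset[OF thin]
 define f where "f p = T (SOME a. path a & track a <= X & homotopic_paths Y p a)" for p
 have f: "f p = T a" if "path a" "track a <= X" "homotopic_paths Y p a" for p a
 proof -
  define b where "b = (SOME a. path a & track a <= X & homotopic_paths Y p a)"
  have "path b & track b <= X & homotopic_paths Y p b"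
   unfolding b_def by (rule someI[of _ a]) (use that in auto)
  moreover have "homotopic_paths Y b a" using that calculation homotopic_paths_trans homotopic_paths_sym by metis
  ultimately show ?thesis using homotopic_in_Y that unfolding f_def b_def by blast
 qed
 have fX: "f p = T p" if "path p" "track p <= X" for p using f[of p p] that XY by auto
 have "\<exists>q. path q & track q <= Y & start q : X & finish q = y & (y : X --> q = linepath y y)"
  if y: "y : Y" for y
 proof (cases "y : X")
  case True
  then show ?thesis using y by (intro exI[of _ "linepath y y"]) auto
 next
  case False
  obtain U where U: "openin (top_of_set Y) U" "y : U" "simply_connected U" "U Int X ~= {}"
   by (rule thin_complementE[OF thin openin_subtopology_self y])
  then obtain z where z: "z : U" "z : X" by auto
  then obtain q where "path q" "track q <= U" "start q = z" "finish q = y"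
   using simply_connected_imp_path_connected[OF U(3)] U(2) unfolding path_connected_def by metis
  then show ?thesis using z False openin_imp_subset[OF U(1)] by (intro exI[of _ q]) auto
 qed
 then obtain k where k: "!!y. y : Y ==> path (k y) & track (k y) <= Y & start (k y) : X & finish (k y) = y &
   (y : X --> k y = linepath y y)" by metis
 let ?T = "%p. f (k (start p) +++ (p +++ reversepath (k (finish p))))"
 have push: "\<exists>a. path a & track a <= X & homotopic_paths Y p a"
  if "path p" "track p <= Y" "start p : X" "finish p : X" for p
  by (rule thin_complement_push[OF thin that])
 have "path_functor G Y ?T"
 proof (rule path_functor_conjugate_by_paths[where C = X])
  show "group G" by (rule group_axioms)
  fix p assume "p : {p. path p & track p <= Y & start p : X & finish p : X}"
  then have p: "path p" "track p <= Y" "start p : X" "finish p : X" by auto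
  obtain a where a: "path a" "track a <= X" "homotopic_paths Y p a" using push p by blast
  show "f p : carrier G" using f[OF a] closed a by simp
  {
   fix q assume "q : {p. path p & track p <= Y & start p : X & finish p : X}"
    and pq: "finish p = start q"
   then have q: "path q" "track q <= Y" "start q : X" "finish q : X" by auto
   obtain b where b: "path b" "track b <= X" "homotopic_paths Y q b" using push q by blast
   have ab: "finish a = start b"
    using homotopic_paths_imp_pathfinish[OF a(3)] homotopic_paths_imp_pathstart[OF b(3)] pq by simp
   have "homotopic_paths Y (p +++ q) (a +++ b)" by (rule homotopic_paths_join[OF a(3) b(3) pq])
   then show "f (p +++ q) = f p \<otimes> f q"
    using f[of "a +++ b" "p +++ q"] f[OF a] f[OF b] a b ab join[of a b] by (simp add: path_image_join)
  }
  fix q assume "homotopic_paths Y p q"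
  then have "homotopic_paths Y q a" using a(3) homotopic_paths_trans homotopic_paths_sym by metis
  then show "f p = f q" using f a by metis
 qed (use k in auto)
 moreover have "?T p = T p" if p: "path p" "track p <= X" for p
 proof -
  have e: "start p : X" "finish p : X" using p by (auto intro: subsetD)
  have kk: "k (start p) = linepath (start p) (start p)" "k (finish p) = linepath (finish p) (finish p)"
   using k e XY by auto
  have "homotopic_paths Y (k (start p) +++ (p +++ reversepath (k (finish p)))) (p +++ reversepath (k (finish p)))"
   unfolding kk by (rule homotopic_paths_lid') (use e XY p in \<open>auto simp: path_image_join\<close>)
  moreover have "homotopic_paths Y (p +++ reversepath (k (finish p))) p"
   unfolding kk reversepath_linepath by (rule homotopic_paths_rid') (use e XY p in \<open>auto simp: path_image_join\<close>)
  ultimately show ?thesis using f[OF p] homotopic_paths_trans by metis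
 qed
 ultimately show ?thesis by blast
qed

end

section \<open>Loops around an axis\<close>

definition punctured_tube :: "real => (complex \<times> real) set" where
 "punctured_tube d = (ball 0 d - {0}) \<times> ball 0 d"

definition axis_circle :: "real => real => complex \<times> real" where
 "axis_circle r s = (of_real r * turn s, 0)"

lemma path_axis_circle [simp]: "path (axis_circle r)" unfolding axis_circle_def path_def by (intro continuous_intros)

lemma axis_circle_closed [simp]: "finish (axis_circle r) = start (axis_circle r)"
 by (simp add: pathfinish_def pathstart_def axis_circle_def)

lemma path_image_axis_circle:
 assumes "0 < r" "r < d" shows "track (axis_circle r) <= punctured_tube d"
 using assms by (auto simp: path_image_def axis_circle_def punctured_tube_def norm_mult)

locale tube_functor = path_functor G "punctured_tube \<delta>" T for G (structure) and \<delta> T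
begin

text \<open>
 The exponential map unrolls the punctured tube to a convex set, in which transport depends on
 the end points only; a loop lifts to a path whose end points differ by its winding number of
 periods.
\<close>

lemma punctured_tube_loop:
 assumes r: "0 < r" "r < \<delta>"
  and p: "path p" "track p <= punctured_tube \<delta>" "finish p = start p"
  and n: "winding_number (fst o p) 0 = of_int n"
 shows "\<exists>g\<in>carrier G. T p = g \<otimes> (T (axis_circle r) [^] n) \<otimes> inv g"
proof -
 define E where "E = {z. Re z < ln \<delta>} \<times> ball (0::real) \<delta>"
 define e where "e y = (exp (fst y), snd y)" for y :: "complex \<times> real"
 have \<delta>: "\<delta> > 0" using r by simp
 have eX: "e ` E <= punctured_tube \<delta>"
  using \<delta> by (auto simp: e_def E_def punctured_tube_def) (metis exp_less_mono exp_ln)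
 have ce: "continuous_on A e" for A unfolding e_def by (intro continuous_intros)
 interpret S: path_functor G E "%q. T (e o q)" by (rule compose[OF ce eX])
 have cE: "convex E" unfolding E_def by (intro convex_Times convex_halfspace_Re_lt convex_ball)
 define V where "V a b = T (e o linepath a b)" for a b
 have line: "track (linepath a b) <= E" if "a : E" "b : E" for a b
  using that cE by (simp add: closed_segment_subset)
 have V: "T (e o q) = V (start q) (finish q)" if q: "path q" "track q <= E" for q unfolding V_def
  by (rule S.simply_connected_eq[OF convex_imp_simply_connected[OF cE]])
   (use q line[of "start q" "finish q"] in \<open>auto intro: subsetD\<close>)
 have Vcl: "V a b : carrier G" if "a : E" "b : E" for a b
  unfolding V_def using line[OF that] by (intro S.closed) auto
 have Vtr: "V a b \<otimes> V b c = V a c" if "a : E" "b : E" "c : E" for a b c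
  using S.join[of "linepath a b" "linepath b c"] V[of "linepath a b +++ linepath b c"] line that
  by (simp add: V_def[symmetric] path_image_join)
 have Vself: "V a a = \<one>" if "a : E" for a using Vtr[OF that that that] Vcl[OF that that] by (simp add: l_cancel_one)
 \<comment> \<open>The deck transformations of the exponential map.\<close>
 define sh where "sh m a = (fst a + 2 * pi * \<i> * of_int m, snd a)" for m :: int and a :: "complex \<times> real"
 have shE: "sh m a : E" if "a : E" for m a using that by (auto simp: E_def sh_def)
 have esh: "e (sh m a) = e a" for m a by (simp add: e_def sh_def exp_add exp_eq_1)
 have Vsh: "V (sh m a) (sh m b) = V a b" for m a b
 proof -
  have "linepath (sh m a) (sh m b) = sh m o linepath a b"
   by (auto simp: fun_eq_iff linepath_def sh_def prod_eq_iff algebra_simps scaleR_conv_of_real)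
  then have "e o linepath (sh m a) (sh m b) = e o linepath a b" using esh by (simp add: fun_eq_iff)
  then show ?thesis by (simp add: V_def)
 qed
 define z where "z = (complex_of_real (ln r), 0::real)"
 have z: "z : E" using r \<delta> by (simp add: E_def z_def)
 define c where "c = V z (sh 1 z)"
 have c: "c : carrier G" unfolding c_def using z shE Vcl by blast
 have Vstep: "V z (sh (m + 1) z) = V z (sh m z) \<otimes> c" for m
 proof -
  have "sh (m + 1) z = sh m (sh 1 z)" by (simp add: sh_def algebra_simps)
  then show ?thesis using Vtr[OF z shE[OF z, of m] shE[OF shE[OF z], of m 1]] Vsh[of m z "sh 1 z"] by (simp add: c_def)
 qed
 have pow: "V z (sh m z) = c [^] m" for m
 proof (induction m rule: int_induct[where k = 0])
  case base
  have "sh 0 z = z" by (simp add: sh_def)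
  then show ?case using Vself z by simp
 next
  case (step1 i)
  then show ?case using Vstep[of i] c by (simp add: int_pow_mult)
 next
  case (step2 i)
  have "c [^] i = c [^] (i - 1) \<otimes> c" using int_pow_mult[OF c, of "i - 1" 1] c by simp
  moreover have "c [^] i = V z (sh (i - 1) z) \<otimes> c" using Vstep[of "i - 1"] step2 by simp
  ultimately show ?case using c Vcl[OF z shE[OF z]] right_cancel by (metis int_pow_closed)
 qed
 have circ: "T (axis_circle r) = c"
 proof -
  have "T (e o linepath z (sh 1 z)) = T (axis_circle r)"
  proof (intro homotopic homotopic_paths_eq)
   show "path (e o linepath z (sh 1 z))" by (intro path_continuous_image ce) auto
   show "track (e o linepath z (sh 1 z)) <= punctured_tube \<delta>"
    using eX line[OF z shE[OF z]] by (auto simp: path_image_compose)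
   fix s :: real
   have "linepath z (sh 1 z) s = (complex_of_real (ln r) + 2 * pi * \<i> * s, 0)"
    by (auto simp: linepath_def z_def sh_def algebra_simps scaleR_conv_of_real)
   then show "(e o linepath z (sh 1 z)) s = axis_circle r s"
    using r by (simp add: e_def axis_circle_def exp_add exp_of_real cis_conv_exp mult_ac)
  qed
  then show ?thesis by (simp add: c_def V_def)
 qed
 have fp: "path (fst o p)" using p by (intro path_continuous_image continuous_intros)
 have "0 ~: track (fst o p)" using p by (auto simp: path_image_compose punctured_tube_def)
 then obtain q where q: "path q" "finish q - start q = 2 * of_real pi * \<i> * winding_number (fst o p) 0"
   "!!t. t : {0..1} ==> (fst o p) t = 0 + exp (q t)"
  using winding_number_as_continuous_log[OF fp] by blast
 define u where "u t = (q t, snd (p t))" for t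
 have pu: "path u" using q p unfolding u_def path_def by (intro continuous_intros) auto
 have eu: "e (u t) = p t" if "t : {0..1}" for t using q(3)[OF that] by (simp add: e_def u_def prod_eq_iff)
 have "track u <= E"
 proof (clarsimp simp: path_image_def)
  fix t :: real assume t: "0 <= t" "t <= 1"
  then have "p t : punctured_tube \<delta>" using p by (auto simp: path_image_def)
  then have "norm (exp (q t)) < \<delta>" "\<bar>snd (p t)\<bar> < \<delta>"
   using q(3)[of t] t by (auto simp: punctured_tube_def)
  then show "u t : E" using \<delta> by (auto simp: E_def u_def) (metis exp_less_cancel_iff exp_ln)
 qed
 note u = pu this
 define a where "a = start u"
 have a: "a : E" using u by (auto simp: a_def)
 have fin: "finish u = sh n a"
  using q(2) p(3) by (auto simp: a_def u_def pathfinish_def pathstart_def sh_def n algebra_simps)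
 have "T p = T (e o u)" by (intro homotopic homotopic_paths_eq) (use p eu in auto)
 also have "... = V a (sh n a)" using V[OF u] fin by (simp add: a_def)
 also have "... = V a z \<otimes> V z (sh n z) \<otimes> V (sh n z) (sh n a)" using Vtr a z shE Vcl by simp
 also have "... = V a z \<otimes> (c [^] n) \<otimes> V z a" by (simp add: pow Vsh)
 also have "V z a = inv (V a z)" using Vtr[OF z a z] Vself[OF z] Vcl a z by (simp add: inv_equality)
 finally show ?thesis unfolding circ using Vcl[OF a z] by blast
qed

lemma punctured_tube_trivial:
 assumes "0 < r" "r < \<delta>" "T (axis_circle r) = \<one>"
  and p: "path p" "track p <= punctured_tube \<delta>" "finish p = start p"
 shows "T p = \<one>"
proof -
 have fp: "path (fst o p)" using p by (intro path_continuous_image continuous_intros)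
 have "0 ~: track (fst o p)" using p by (auto simp: path_image_compose punctured_tube_def)
 then obtain n where "winding_number (fst o p) 0 = of_int n"
  using integer_winding_number[OF fp] p(3) by (auto simp: pathfinish_compose pathstart_compose elim: Ints_cases)
 from punctured_tube_loop[OF assms(1,2) p this] show ?thesis using assms(3) by auto
qed

text \<open>
 S stands for a condition on meridians, invariant under conjugation and inversion.
\<close>

lemma punctured_tube_winding_1:
 assumes r: "0 < r" "r < \<delta>"
  and p: "path p" "track p <= punctured_tube \<delta>" "finish p = start p"
  and n: "winding_number (fst o p) 0 : {1, -1}"
  and S: "!!g a. g : carrier G ==> a : S ==> a : carrier G ==> g \<otimes> a \<otimes> inv g : S"
   "!!a. a : S ==> a : carrier G ==> inv a : S"
 shows "T p : S \<longleftrightarrow> T (axis_circle r) : S"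
proof -
 define c where "c = T (axis_circle r)"
 have c: "c : carrier G" unfolding c_def using path_image_axis_circle[OF r] by (intro closed) auto
 obtain m :: int where m: "m = 1 | m = -1" "winding_number (fst o p) 0 = of_int m"
  using n by (metis insert_iff of_int_1 of_int_minus singletonD)
 have cm: "c [^] m : {c, inv c}" using m c by (auto simp: int_pow_neg)
 obtain g where g: "g : carrier G" "T p = g \<otimes> (c [^] m) \<otimes> inv g"
  using punctured_tube_loop[OF r p m(2)] unfolding c_def by blast
 have "c : S" if "T p : S"
 proof -
  have "inv g \<otimes> T p \<otimes> inv (inv g) : S" by (rule S(1)[OF _ that]) (use g(1) closed[OF p(1,2)] in auto)
  also have "inv g \<otimes> T p \<otimes> inv (inv g) = c [^] m" unfolding g(2) using g(1) c
   by (simp add: m_assoc) (simp add: m_assoc[symmetric])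
  finally show ?thesis using cm S(2) c by (metis empty_iff insert_iff int_pow_closed inv_inv)
 qed
 moreover have "T p : S" if "c : S" using g S(1)[OF g(1), of "c [^] m"] cm that S(2) c by auto
 ultimately show ?thesis unfolding c_def by blast
qed

end

section \<open>Signs of loops in the punctured plane\<close>

definition plane_loop :: "(real => complex) => bool" where
 "plane_loop g \<longleftrightarrow> path g & finish g = start g & 0 ~: track g"

definition loop_sign :: "(real => complex) => real" where
 "loop_sign g = cos (pi * Re (winding_number g 0))"

lemma plane_loop_int:
 assumes "plane_loop g" obtains n :: int where "winding_number g 0 = of_int n"
 using assms integer_winding_number[of g 0] unfolding plane_loop_def by (auto elim: Ints_cases)

lemma cos_pi_int: "cos (pi * of_int n) = (if even n then 1 else -1)"
proof (cases "even n")
 case True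
 then obtain m where "n = 2 * m" by auto
 then show ?thesis using cos_int_2pin[of m] by (simp add: mult_ac)
next
 case False
 then obtain m where "n = 2 * m + 1" by (auto elim: oddE)
 then have "pi * of_int n = of_int m * (2 * pi) + pi" by (simp add: algebra_simps)
 then show ?thesis using False sin_int_2pin[of m] cos_int_2pin[of m] by (simp add: cos_add mult_ac)
qed

lemma loop_sign_odd_even:
 assumes "winding_number g 0 = of_int n" shows "loop_sign g = (if even n then 1 else -1)"
 by (simp add: loop_sign_def assms cos_pi_int)

lemma loop_sign_values: assumes "plane_loop g" shows "loop_sign g = 1 | loop_sign g = -1"
 using plane_loop_int[OF assms] loop_sign_odd_even by metis

lemma loop_sign_square [simp]: assumes "plane_loop g" shows "loop_sign g * loop_sign g = 1"
 using loop_sign_values[OF assms] by auto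

lemma plane_loop_mult: "plane_loop g ==> plane_loop h ==> plane_loop (%s. g s * h s)"
 unfolding plane_loop_def path_def pathstart_def pathfinish_def path_image_def by (auto intro!: continuous_intros)

lemma plane_loop_cnj: "plane_loop g ==> plane_loop (%s. cnj (g s))"
 unfolding plane_loop_def path_def pathstart_def pathfinish_def path_image_def by (auto intro!: continuous_intros)

lemma plane_loop_prod: "finite A ==> (!!i. i : A ==> plane_loop (g i)) ==> plane_loop (%s. \<Prod>i\<in>A. g i s)"
 unfolding plane_loop_def path_def pathstart_def pathfinish_def path_image_def
 by (auto intro!: continuous_intros) (metis atLeastAtMost_iff image_eqI)

lemma loop_sign_homotopic: "homotopic_loops (-{0}) g h ==> loop_sign g = loop_sign h"
 by (simp add: loop_sign_def winding_number_homotopic_loops)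

lemma winding_number_mult:
 assumes "plane_loop g" "plane_loop h"
 shows "winding_number (%s. g s * h s) 0 = winding_number g 0 + winding_number h 0"
proof -
 obtain q where q: "path q" "finish q - start q = 2 * of_real pi * \<i> * winding_number g 0"
  "!!t. t : {0..1} ==> g t = 0 + exp (q t)"
  using winding_number_as_continuous_log assms(1) unfolding plane_loop_def by metis
 obtain u where u: "path u" "finish u - start u = 2 * of_real pi * \<i> * winding_number h 0"
  "!!t. t : {0..1} ==> h t = 0 + exp (u t)"
  using winding_number_as_continuous_log assms(2) unfolding plane_loop_def by metis
 have p: "path (%s. q s + u s)" using q u unfolding path_def by (intro continuous_intros)
 have "winding_number (%s. g s * h s) 0 = winding_number (exp o (%s. q s + u s)) 0"
  by (rule winding_number_cong) (simp add: q u exp_add)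
 also have "... = (finish (%s. q s + u s) - start (%s. q s + u s)) / (2 * of_real pi * \<i>)"
  by (rule winding_number_compose_exp[OF p])
 also have "finish (%s. q s + u s) - start (%s. q s + u s) =
   2 * of_real pi * \<i> * (winding_number g 0 + winding_number h 0)"
  using q(2) u(2) by (simp add: pathfinish_def pathstart_def algebra_simps)
 finally show ?thesis by simp
qed

lemma loop_sign_mult:
 assumes "plane_loop g" "plane_loop h"
 shows "loop_sign (%s. g s * h s) = loop_sign g * loop_sign h"
proof -
 obtain n where n: "winding_number g 0 = of_int n" using plane_loop_int[OF assms(1)] .
 obtain m where m: "winding_number h 0 = of_int m" using plane_loop_int[OF assms(2)] .
 have "winding_number (%s. g s * h s) 0 = of_int (n + m)" using winding_number_mult[OF assms] n m by simp
 from loop_sign_odd_even[OF this] loop_sign_odd_even[OF n] loop_sign_odd_even[OF m] show ?thesis by simp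
qed

lemma loop_sign_cnj: assumes "plane_loop g" shows "loop_sign (%s. cnj (g s)) = loop_sign g"
proof -
 obtain n where n: "winding_number g 0 = of_int n" using plane_loop_int[OF assms] .
 have "winding_number (cnj o g) 0 = of_int (-n)" using winding_number_cnj[of g 0] assms n by (simp add: plane_loop_def)
 from loop_sign_odd_even[OF this] loop_sign_odd_even[OF n] show ?thesis by (simp add: o_def)
qed

lemma loop_sign_linear:
 assumes "plane_loop g" "plane_loop h" "!!s. s : {0..1} ==> 0 ~: closed_segment (g s) (h s)"
 shows "loop_sign g = loop_sign h"
 using winding_number_loops_linear_eq[of g h 0] assms unfolding loop_sign_def plane_loop_def by simp

lemma loop_sign_const: assumes "c ~= 0" shows "loop_sign (%s. c) = 1"
proof -
 have "winding_number (%s::real. c) 0 = 0" using winding_number_trivial[of 0 c] assms unfolding linepath_refl by auto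
 then show ?thesis by (simp add: loop_sign_def)
qed

lemma loop_sign_Re_pos:
 assumes "plane_loop g" "!!s. s : {0..1} ==> Re (g s) > 0"
 shows "loop_sign g = 1"
proof -
 have one: "plane_loop (%s. 1)" by (auto simp: plane_loop_def path_def pathstart_def pathfinish_def)
 have "loop_sign g = loop_sign (%s. 1)"
 proof (rule loop_sign_linear[OF assms(1) one])
  fix s :: real assume "s : {0..1}"
  then have "closed_segment (g s) 1 <= {z. Re z > 0}"
   using assms(2) by (intro closed_segment_subset convex_halfspace_Re_gt) auto
  then show "0 ~: closed_segment (g s) 1" by auto
 qed
 also have "... = 1" by (simp add: loop_sign_const)
 finally show ?thesis .
qed

lemma loop_sign_prod:
 assumes "finite A" "!!i. i : A ==> plane_loop (g i)"
 shows "loop_sign (%s. \<Prod>i\<in>A. g i s) = (\<Prod>i\<in>A. loop_sign (g i))" using assms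
proof (induction A rule: finite_induct)
 case empty
 then show ?case by (simp, intro loop_sign_Re_pos) (auto simp: plane_loop_def path_def pathstart_def pathfinish_def)
next
 case (insert x F)
 then show ?case by (simp add: loop_sign_mult plane_loop_prod)
qed

lemma loop_sign_join:
 assumes "plane_loop g" "plane_loop h" "start g = start h"
 shows "loop_sign (g +++ h) = loop_sign g * loop_sign h"
proof -
 obtain n where n: "winding_number g 0 = of_int n" using plane_loop_int[OF assms(1)] .
 obtain m where m: "winding_number h 0 = of_int m" using plane_loop_int[OF assms(2)] .
 have "winding_number (g +++ h) 0 = of_int (n + m)"
  using winding_number_join[of g 0 h] n m assms by (simp add: plane_loop_def)
 from loop_sign_odd_even[OF this] loop_sign_odd_even[OF n] loop_sign_odd_even[OF m] show ?thesis by simp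
qed

lemma loop_sign_convex:
 fixes D :: "'a::real_normed_vector set"
 assumes D: "convex D" and f: "continuous_on D f" "!!x. x : D ==> f x ~= 0"
  and c: "path c" "finish c = start c" "track c <= D"
 shows "loop_sign (f o c) = 1"
proof -
 have in_D: "start c : D" using c by (auto intro: subsetD)
 have "homotopic_loops D c (linepath (start c) (start c))"
 proof (rule homotopic_loops_linear)
  fix t :: real assume t: "t : {0..1}"
  then have "c t : D" using c(3) by (auto simp: path_image_def)
  then show "closed_segment (c t) (linepath (start c) (start c) t) <= D"
   using D in_D by (intro closed_segment_subset) (auto simp: linepath_refl)
 qed (use c in auto)
 then have "homotopic_loops (-{0}) (f o c) (f o linepath (start c) (start c))"
  by (rule homotopic_loops_continuous_image) (use f in auto)
 then have "loop_sign (f o c) = loop_sign (f o linepath (start c) (start c))"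
  by (rule loop_sign_homotopic)
 also have "... = 1" using f in_D by (simp add: linepath_refl o_def loop_sign_const)
 finally show ?thesis .
qed

lemma plane_loop_comp:
 assumes "continuous_on K f" "!!x. x : K ==> f x ~= 0"
  and "path c" "finish c = start c" "track c <= K"
 shows "plane_loop (f o c)" unfolding plane_loop_def
 using assms path_continuous_image[OF assms(3) continuous_on_subset[OF assms(1,5)]]
 by (auto simp: path_image_compose pathstart_compose pathfinish_compose)

text \<open>The loop runs through the half-planes above and below the real axis one after the other.\<close>

lemma loop_sign_crossing:
 assumes g: "plane_loop g" and C: "C ~= (0::real)"
  and Im: "!!s. s : {0..1} ==> Im (g s) = C * sin (2 * pi * s)"
  and Re: "Re (g 0) < 0" "Re (g (1/2)) > 0"
 shows "loop_sign g = -1"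
proof -
 have pl: "plane_loop (%s. turn s)"
  by (auto simp: plane_loop_def path_def path_image_def pathstart_def pathfinish_def intro!: continuous_intros)
 have m: "plane_loop (%s. -1)" by (auto simp: plane_loop_def path_def pathstart_def pathfinish_def)
 have "winding_number (%s. turn s) 0 = winding_number (circlepath 0 1) 0"
  by (rule winding_number_cong) (simp add: circlepath cis_conv_exp mult_ac)
 then have "loop_sign (%s. turn s) = -1" by (simp add: loop_sign_def winding_number_circlepath_centre)
 moreover have "loop_sign (%s. -1) = 1" by (simp add: loop_sign_const)
 ultimately have base: "loop_sign (%s. -1 * turn s) = -1" using loop_sign_mult[OF m pl] by simp
 have pb: "plane_loop (%s. -1 * turn s)" by (rule plane_loop_mult[OF m pl])
 \<comment> \<open>The circle h is on the same side of the real axis as g at all times.\<close>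
 define h where "h s = (if C < 0 then -1 * turn s else cnj (-1 * turn s))" for s
 have h: "plane_loop h" "loop_sign h = -1"
  using pb plane_loop_cnj[OF pb] base loop_sign_cnj[OF pb] unfolding h_def by (cases "C < 0"; simp)+
 have "0 ~: closed_segment (g s) (h s)" if s: "s : {0..1}" for s
 proof (cases "sin (2 * pi * s) = 0")
  case False
  define e where "e = C * sin (2 * pi * s)"
  have e: "e ~= 0" "Im (g s) = e" "e * Im (h s) > 0"
   using False C Im[OF s] by (auto simp: e_def h_def zero_less_mult_iff mult_less_0_iff)
  show ?thesis
  proof (cases "e > 0")
   case True
   then have "closed_segment (g s) (h s) <= {z. Im z > 0}"
    using e by (intro closed_segment_subset convex_halfspace_Im_gt) (auto simp: zero_less_mult_iff)
   then show ?thesis by auto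
  next
   case False
   then have "closed_segment (g s) (h s) <= {z. Im z < 0}"
    using e by (intro closed_segment_subset convex_halfspace_Im_lt) (auto simp: zero_less_mult_iff)
   then show ?thesis by auto
  qed
 next
  case True
  have "s = 0 | s = 1/2 | s = 1"
  proof -
   obtain k :: int where k: "2 * pi * s = of_int k * pi" using True by (auto simp: sin_zero_iff_int2)
   then have "2 * s = of_int k" by simp
   moreover from this s have "0 <= k & k <= 2" by auto
   ultimately show ?thesis by (cases "k = 0"; cases "k = 1"; cases "k = 2") auto
  qed
  moreover have "g 1 = g 0" using g by (simp add: plane_loop_def pathstart_def pathfinish_def)
  ultimately have "Re (g s) < 0 & Re (h s) < 0 | Re (g s) > 0 & Re (h s) > 0"
   using Re by (elim disjE; hypsubst) (simp_all add: h_def)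
  then show ?thesis
  proof
   assume "Re (g s) < 0 & Re (h s) < 0"
   then have "closed_segment (g s) (h s) <= {z. Re z < 0}"
    by (intro closed_segment_subset convex_halfspace_Re_lt) auto
   then show ?thesis by auto
  next
   assume "Re (g s) > 0 & Re (h s) > 0"
   then have "closed_segment (g s) (h s) <= {z. Re z > 0}"
    by (intro closed_segment_subset convex_halfspace_Re_gt) auto
   then show ?thesis by auto
  qed
 qed
 then show ?thesis using loop_sign_linear[OF g h(1)] h(2) by simp
qed

section \<open>Linking signs by Bargmann products\<close>

type_synonym R3 = "complex \<times> real"

text \<open>
 For v = (w, h) the Hermitian matrix with rows (norm v + h, cnj w) and (w, norm v - h) has rank
 one, and spinor v is a vector that spans its range: this is the line over v in the Hopf bundle.
 A spinor cannot be chosen continuously in v, but cyclic products of brackets of spinors are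
 traces of products of these matrices and hence continuous.
\<close>

definition spinor :: "R3 => complex \<times> complex" where
 "spinor v = (if norm v + snd v > 0
   then (of_real (sqrt (norm v + snd v)), fst v / of_real (sqrt (norm v + snd v)))
   else (0, of_real (sqrt (norm v - snd v))))"

definition herm :: "complex \<times> complex => complex \<times> complex => complex" where
 "herm x y = cnj (fst x) * fst y + cnj (snd x) * snd y"

definition bracket :: "R3 => R3 => complex" where
 "bracket u v = herm (spinor u) (spinor v)"

lemma norm_R3: "(norm (v::R3))\<^sup>2 = (cmod (fst v))\<^sup>2 + (snd v)\<^sup>2" by (cases v) (simp add: norm_Pair)

lemma abs_snd_le_norm: "\<bar>snd (v::R3)\<bar> <= norm v" by (metis norm_snd_le prod.collapse real_norm_def)

lemma spinor_matrix:
 fixes v :: R3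
 defines "a == fst (spinor v)" and "b == snd (spinor v)"
 shows "a * cnj a = of_real (norm v + snd v)" "b * cnj b = of_real (norm v - snd v)"
  "b * cnj a = fst v" "a * cnj b = cnj (fst v)"
proof -
 have "a * cnj a = of_real (norm v + snd v) & b * cnj b = of_real (norm v - snd v) & b * cnj a = fst v"
 proof (cases "norm v + snd v > 0")
  case True
  define q where "q = sqrt (norm v + snd v)"
  have q: "q > 0" "q * q = norm v + snd v" using True by (auto simp: q_def)
  have "(cmod (fst v))\<^sup>2 = (norm v - snd v) * (q * q)"
   unfolding q(2) using norm_R3[of v] by (simp add: algebra_simps power2_eq_square)
  moreover have "fst v * cnj (fst v) = of_real ((cmod (fst v))\<^sup>2)" by (rule complex_norm_square[symmetric])
  ultimately have eq: "fst v * cnj (fst v) = of_real (norm v - snd v) * (of_real q * of_real q)" by simp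
  have ab: "a = of_real q" "b = fst v / of_real q" using True by (auto simp: a_def b_def spinor_def q_def)
  have "b * cnj b = fst v * cnj (fst v) / (of_real q * of_real q)" using ab by simp
  then have "b * cnj b = of_real (norm v - snd v)" using eq q(1) by simp
  moreover have "a * cnj a = of_real (norm v + snd v)" using ab by (simp flip: q(2))
  moreover have "b * cnj a = fst v" using ab q(1) by simp
  ultimately show ?thesis by blast
 next
  case False
  then have h: "snd v = - norm v" using abs_snd_le_norm[of v] by linarith
  then have "fst v = 0" using norm_R3[of v] by simp
  then show ?thesis using False h by (simp add: a_def b_def spinor_def flip: of_real_mult)
 qed
 then show "a * cnj a = of_real (norm v + snd v)" "b * cnj b = of_real (norm v - snd v)"
  "b * cnj a = fst v" by auto
 then show "a * cnj b = cnj (fst v)" by (metis complex_cnj_cnj complex_cnj_mult mult.commute)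
qed

lemma inner_R3: "u \<bullet> v = Re (fst u * cnj (fst v)) + snd u * snd v" for u v :: R3
 by (cases u; cases v) (simp add: inner_Pair inner_complex_def)

lemma bracket_cnj: "bracket v u = cnj (bracket u v)" by (simp add: bracket_def herm_def mult_ac)

lemma bracket_square: "bracket u v * bracket v u = of_real (2 * (norm u * norm v + u \<bullet> v))"
proof -
 define a b c d where "a = fst (spinor u)" and "b = snd (spinor u)" and "c = fst (spinor v)" and "d = snd (spinor v)"
 note U = spinor_matrix[of u, folded a_def b_def] and V = spinor_matrix[of v, folded c_def d_def]
 have "bracket u v * bracket v u = (a * cnj a) * (c * cnj c) + (b * cnj a) * (c * cnj d) + (a * cnj b) * (d * cnj c) + (b * cnj b) * (d * cnj d)"
  by (simp add: bracket_def herm_def a_def b_def c_def d_def algebra_simps)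
 also have "... = of_real (2 * (norm u * norm v + u \<bullet> v))"
  unfolding U V by (simp add: inner_R3 complex_eq_iff algebra_simps)
 finally show ?thesis .
qed

lemma bracket_self: "bracket v v = of_real (2 * norm v)"
 using spinor_matrix(1,2)[of v] by (simp add: bracket_def herm_def mult.commute)

lemma segment_opposite:
 fixes u v :: "'a::real_inner"
 assumes "norm u * norm v + u \<bullet> v = 0" shows "0 : closed_segment u v"
proof (cases "norm u + norm v = 0")
 case True
 then have "norm u = 0" using norm_ge_zero[of u] norm_ge_zero[of v] by linarith
 then show ?thesis by simp
next
 case False
 then have p: "norm u + norm v > 0" by (metis add_nonneg_nonneg less_eq_real_def norm_ge_zero)
 define t where "t = norm u / (norm u + norm v)"
 have t: "0 <= t" "t <= 1" using p by (auto simp: t_def field_simps)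
 have "(norm (norm v *\<^sub>R u + norm u *\<^sub>R v))\<^sup>2 = 2 * norm u * norm v * (norm u * norm v + u \<bullet> v)"
  by (simp add: power2_norm_eq_inner inner_add inner_commute algebra_simps)
   (simp add: power2_norm_eq_inner[symmetric] power2_eq_square)
 then have z: "norm v *\<^sub>R u + norm u *\<^sub>R v = 0" using assms by simp
 have "(1 - t) *\<^sub>R u + t *\<^sub>R v = (1 / (norm u + norm v)) *\<^sub>R (norm v *\<^sub>R u + norm u *\<^sub>R v)"
  using p by (simp add: t_def scaleR_add_right field_simps)
 then have "0 = (1 - t) *\<^sub>R u + t *\<^sub>R v" using z by simp
 then show ?thesis using t by (auto simp: in_segment)
qed

text \<open>Spinors are orthogonal only over opposite directions.\<close>

lemma bracket_nonzero:
 assumes "0 ~: closed_segment u v" shows "bracket u v ~= 0"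
proof
 assume "bracket u v = 0"
 then have "complex_of_real (2 * (norm u * norm v + u \<bullet> v)) = 0" using bracket_square[of u v] by simp
 then have "2 * (norm u * norm v + u \<bullet> v) = 0" by (simp only: of_real_eq_0_iff)
 then show False using segment_opposite[of u v] assms by simp
qed

text \<open>
 The imaginary part is twice the triple product of u, v, w, and the argument is half the solid angle of
 the triangle up to sign: the product winds once around 0 along a loop that pierces the triangle once.
\<close>

lemma triangle_Re:
 "Re (bracket u v * bracket v w * bracket w u) =
   2 * (norm u * norm v * norm w + norm u * (v \<bullet> w) + norm v * (u \<bullet> w) + norm w * (u \<bullet> v))"
and triangle_Im:
 "Im (bracket u v * bracket v w * bracket w u) =
   2 * (snd u * Im (cnj (fst v) * fst w) + snd v * Im (cnj (fst w) * fst u) + snd w * Im (cnj (fst u) * fst v))"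
proof -
 define a b where "a = fst (spinor u)" and "b = snd (spinor u)"
 define c d where "c = fst (spinor v)" and "d = snd (spinor v)"
 define e f where "e = fst (spinor w)" and "f = snd (spinor w)"
 note U = spinor_matrix[of u, folded a_def b_def] and V = spinor_matrix[of v, folded c_def d_def]
  and W = spinor_matrix[of w, folded e_def f_def]
 have "bracket u v * bracket v w * bracket w u =
  (cnj a * c + cnj b * d) * (cnj c * e + cnj d * f) * (cnj e * a + cnj f * b)"
  by (simp add: bracket_def herm_def a_def b_def c_def d_def e_def f_def)
 also have "... = (a * cnj a) * (c * cnj c) * (e * cnj e) + (a * cnj a) * (c * cnj d) * (f * cnj e)
   + (a * cnj b) * (d * cnj c) * (e * cnj e) + (a * cnj b) * (d * cnj d) * (f * cnj e)
   + (b * cnj a) * (c * cnj c) * (e * cnj f) + (b * cnj a) * (c * cnj d) * (f * cnj f)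
   + (b * cnj b) * (d * cnj c) * (e * cnj f) + (b * cnj b) * (d * cnj d) * (f * cnj f)" by (simp add: algebra_simps)
 finally have eq: "bracket u v * bracket v w * bracket w u = ..." .
 show "Re (bracket u v * bracket v w * bracket w u) =
   2 * (norm u * norm v * norm w + norm u * (v \<bullet> w) + norm v * (u \<bullet> w) + norm w * (u \<bullet> v))"
  unfolding eq U V W by (simp add: inner_R3 algebra_simps)
 show "Im (bracket u v * bracket v w * bracket w u) =
   2 * (snd u * Im (cnj (fst v) * fst w) + snd v * Im (cnj (fst w) * fst u) + snd w * Im (cnj (fst u) * fst v))"
  unfolding eq U V W by (simp add: algebra_simps)
qed

text \<open>The trace of the product of the matrices of f 0, ..., f n.\<close>

fun spin_chain :: "(nat => R3) => nat => complex \<times> complex => complex \<times> complex" where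
 "spin_chain f 0 y = y"
| "spin_chain f (Suc n) y = (let z = spin_chain f n y; v = f n in
   (of_real (norm v + snd v) * fst z + cnj (fst v) * snd z, fst v * fst z + of_real (norm v - snd v) * snd z))"

lemma spin_chain_step: "spin_chain f (Suc n) y =
 (fst (spinor (f n)) * herm (spinor (f n)) (spin_chain f n y), snd (spinor (f n)) * herm (spinor (f n)) (spin_chain f n y))"
proof -
 define a b where "a = fst (spinor (f n))" and "b = snd (spinor (f n))"
 note V = spinor_matrix[of "f n", folded a_def b_def]
 let ?z = "spin_chain f n y"
 have "a * herm (spinor (f n)) ?z = (a * cnj a) * fst ?z + (a * cnj b) * snd ?z"
  "b * herm (spinor (f n)) ?z = (b * cnj a) * fst ?z + (b * cnj b) * snd ?z"
  by (simp_all add: herm_def a_def b_def algebra_simps)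
 then show ?thesis unfolding V by (simp add: Let_def a_def b_def)
qed

lemma spin_chain_eq:
 "spin_chain f (Suc n) y =
  (let c = (\<Prod>i<n. bracket (f (Suc i)) (f i)) * herm (spinor (f 0)) y in (fst (spinor (f n)) * c, snd (spinor (f n)) * c))"
proof (induction n)
 case 0
 show ?case by (subst spin_chain_step) (simp add: Let_def)
next
 case (Suc n)
 have "herm (spinor (f (Suc n))) (spin_chain f (Suc n) y) =
   bracket (f (Suc n)) (f n) * ((\<Prod>i<n. bracket (f (Suc i)) (f i)) * herm (spinor (f 0)) y)"
  unfolding Suc Let_def by (simp add: bracket_def herm_def algebra_simps)
 then show ?case by (subst spin_chain_step) (simp add: Let_def mult_ac)
qed

lemma bracket_cycle_trace:
 assumes "f (Suc n) = f 0"
 shows "(\<Prod>i<Suc n. bracket (f (Suc i)) (f i)) = fst (spin_chain f (Suc n) (1, 0)) + snd (spin_chain f (Suc n) (0, 1))"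
proof -
 have "(\<Prod>i<Suc n. bracket (f (Suc i)) (f i)) = (\<Prod>i<n. bracket (f (Suc i)) (f i)) * bracket (f 0) (f n)"
  using assms by simp
 then show ?thesis unfolding spin_chain_eq Let_def by (simp add: herm_def bracket_def algebra_simps)
qed

lemma continuous_on_bracket_cycle:
 assumes "!!i. i <= N ==> continuous_on S (f i)" and cyc: "!!s. s : S ==> f N s = f 0 s"
 shows "continuous_on S (%s. \<Prod>i<N. bracket (f (Suc i) s) (f i s))"
proof (cases N)
 case (Suc n)
 have "continuous_on S (%s. spin_chain (%i. f i s) m y)" if "m <= N" for m y using that
 proof (induction m)
  case (Suc m)
  then have "continuous_on S (f m)" "continuous_on S (%s. spin_chain (%i. f i s) m y)" using assms by auto
  then show ?case by (auto simp: Let_def intro!: continuous_intros)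
 qed (auto intro!: continuous_intros)
 then have "continuous_on S (%s. fst (spin_chain (%i. f i s) N (1, 0)) + snd (spin_chain (%i. f i s) N (0, 1)))"
  by (intro continuous_intros) auto
 then show ?thesis by (rule continuous_on_eq) (use bracket_cycle_trace[of "%i. f i s" n for s] cyc Suc in auto)
qed simp

text \<open>
 The linking number of a closed polygon with a loop is the winding number of this product along
 the loop. The product vanishes exactly on the polygon. An isometry Q is carried along to change coordinates.
\<close>

definition cyc :: "(R3 => R3) => (nat => R3) => nat => R3 => complex" where
 "cyc Q f N x = (\<Prod>i<N. bracket (Q (f (Suc i) - x)) (Q (f i - x)))"

locale isometry_R3 = fixes Q :: "R3 => R3" assumes Q: "orthogonal_transformation Q"
begin

lemma linear_Q: "linear Q" using Q by (simp add: orthogonal_transformation_linear)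

lemma norm_Q [simp]: "norm (Q x) = norm x" using Q by (simp add: orthogonal_transformation_norm)

lemma inner_Q [simp]: "Q x \<bullet> Q y = x \<bullet> y" using Q unfolding orthogonal_transformation_def by blast

lemma bracket_Q_nonzero: assumes "x ~: closed_segment a b" shows "bracket (Q (a - x)) (Q (b - x)) ~= 0"
proof (rule bracket_nonzero)
 have "Q ` closed_segment (a - x) (b - x) = closed_segment (Q (a - x)) (Q (b - x))"
  by (rule closed_segment_linear_image[OF linear_Q, symmetric])
 moreover have "0 ~: closed_segment (a - x) (b - x)"
 proof
  assume "0 : closed_segment (a - x) (b - x)"
  then obtain u where "0 <= u" "u <= 1" "0 = (1 - u) *\<^sub>R (a - x) + u *\<^sub>R (b - x)" by (auto simp: in_segment)
  then have "x = (1 - u) *\<^sub>R a + u *\<^sub>R b" by (simp add: algebra_simps)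
  then show False using assms \<open>0 <= u\<close> \<open>u <= 1\<close> by (auto simp: in_segment)
 qed
 ultimately show "0 ~: closed_segment (Q (a - x)) (Q (b - x))" by (metis imageE norm_Q norm_eq_zero)
qed

lemma continuous_on_Q: "continuous_on S f ==> continuous_on S (%x. Q (f x))"
 by (rule continuous_on_compose2[OF linear_continuous_on[OF linear_Q[unfolded linear_conv_bounded_linear], of UNIV]]) auto

lemma cyc_nonzero: "(!!i. i < N ==> x ~: closed_segment (f i) (f (Suc i))) ==> cyc Q f N x ~= 0"
 unfolding cyc_def using bracket_Q_nonzero by (auto simp: closed_segment_commute)

lemma cyc_homotopy:
 fixes f :: "nat => real => R3"
 assumes f: "!!i. i <= N ==> continuous_on {0..1} (f i)" "!!u. u : {0..1} ==> f N u = f 0 u"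
  and c: "path c" "finish c = start c"
  and avoid: "!!u s i. u : {0..1} ==> s : {0..1} ==> i < N ==> c s ~: closed_segment (f i u) (f (Suc i) u)"
 shows "loop_sign (cyc Q (%i. f i 0) N o c) = loop_sign (cyc Q (%i. f i 1) N o c)"
proof (rule loop_sign_homotopic)
 define H where "H x = cyc Q (%i. f i (fst x)) N (c (snd x))" for x :: "real \<times> real"
 let ?A = "{0..1::real} \<times> {0..1::real}"
 have cc: "continuous_on ?A (%x. c (snd x))"
  using c(1) unfolding path_def by (rule continuous_on_compose2) (auto intro!: continuous_intros)
 have cf: "continuous_on ?A (%x. f i (fst x))" if "i <= N" for i
  using f(1)[OF that] by (rule continuous_on_compose2) (auto intro!: continuous_intros)
 have cH: "continuous_on ?A H" unfolding H_def cyc_def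
  by (rule continuous_on_bracket_cycle[where f = "%i x. Q (f i (fst x) - c (snd x))"])
   (use f(2) in \<open>auto intro!: continuous_on_Q continuous_intros cf cc\<close>)
 have iH: "H : ?A \<rightarrow> -{0}"
 proof
  fix x assume "x : ?A"
  then have "cyc Q (%i. f i (fst x)) N (c (snd x)) ~= 0" by (intro cyc_nonzero avoid) auto
  then show "H x : -{0}" by (simp add: H_def)
 qed
 have "c 1 = c 0" using c by (simp add: pathstart_def pathfinish_def)
 then show "homotopic_loops (-{0}) (cyc Q (%i. f i 0) N o c) (cyc Q (%i. f i 1) N o c)"
  unfolding homotopic_loops by (intro exI[of _ H] conjI ballI cH iH) (simp_all add: H_def pathstart_def pathfinish_def)
qed

lemma continuous_on_cyc: "f N = f 0 ==> continuous_on S (cyc Q f N)"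
 unfolding cyc_def by (rule continuous_on_bracket_cycle) (auto intro!: continuous_on_Q continuous_intros)

lemma cyc_plane_loop:
 assumes "f N = f 0" "path c" "finish c = start c"
  "!!i. i < N ==> track c Int closed_segment (f i) (f (Suc i)) = {}"
 shows "plane_loop (cyc Q f N o c)" by (rule plane_loop_comp[where K = "track c"])
  (use assms in \<open>auto intro!: continuous_on_cyc cyc_nonzero\<close>)

text \<open>The polygon is contracted to a point inside C.\<close>

lemma cyc_convex:
 assumes C: "convex C" "!!i. i <= N ==> f i : C" "f N = f 0"
  and c: "path c" "finish c = start c" "track c Int C = {}"
 shows "loop_sign (cyc Q f N o c) = 1"
proof -
 define g where "g i u = (1 - u) *\<^sub>R f i + u *\<^sub>R f 0" for i and u :: real
 have gC: "g i u : C" if "i <= N" "u : {0..1}" for i u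
  using that C(2)[of i] C(2)[of 0] convexD[OF C(1)] unfolding g_def by auto
 have "loop_sign (cyc Q (%i. g i 0) N o c) = loop_sign (cyc Q (%i. g i 1) N o c)"
 proof (rule cyc_homotopy[OF _ _ c(1,2)])
  show "continuous_on {0..1} (g i)" for i unfolding g_def by (intro continuous_intros)
  show "g N u = g 0 u" for u using C(3) by (simp add: g_def)
  fix u s :: real and i assume a: "u : {0..1}" "s : {0..1}" "i < N"
  have "closed_segment (g i u) (g (Suc i) u) <= C" using gC a C(1) by (intro closed_segment_subset) auto
  moreover have "c s : track c" using a(2) by (simp add: path_image_def)
  ultimately show "c s ~: closed_segment (g i u) (g (Suc i) u)" using c(3) by blast
 qed
 also have "(%i. g i 0) = f" by (simp add: g_def)
 also have "(%i. g i 1) = (%i. f 0)" by (simp add: g_def)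
 also have "loop_sign (cyc Q (%i. f 0) N o c) = 1"
 proof (rule loop_sign_Re_pos)
  have d: "f 0 ~: track c" using C(2)[of 0] c(3) by auto
  then show "plane_loop (cyc Q (%i. f 0) N o c)" using c by (intro cyc_plane_loop) auto
  fix s :: real assume s: "s : {0..1}"
  then have "norm (f 0 - c s) > 0" using d by (auto simp: path_image_def)
  moreover have "cyc Q (%i. f 0) N (c s) = of_real ((2 * norm (f 0 - c s)) ^ N)" by (simp add: cyc_def bracket_self)
  ultimately show "0 < Re ((cyc Q (%i. f 0) N o c) s)" by (simp del: of_real_power)
 qed
 finally show ?thesis .
qed

definition fine_mesh :: "(real => R3) => R3 set => nat => bool" where
 "fine_mesh c K N \<longleftrightarrow> N > 0 & (\<exists>e. (\<forall>x\<in>K. \<forall>s\<in>{0..1}. e <= dist (c s) x) &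
   (\<forall>s\<in>{0..1}. \<forall>t\<in>{0..1}. \<bar>s - t\<bar> <= 1 / N --> dist (c s) (c t) < e))"

definition mesh :: "(real => R3) => nat => nat => R3" where "mesh c N i = c (real i / real N)"

lemma fine_mesh_exists:
 assumes c: "path c" and K: "compact K" "K Int track c = {}"
 shows "\<exists>N0. \<forall>N\<ge>N0. fine_mesh c K N"
proof -
 obtain e where e: "e > 0" "!!x s. x : K ==> s : {0..1} ==> e <= dist (c s) x"
  using separate_compact_closed[OF compact_path_image[OF c] compact_imp_closed[OF K(1)]] K(2)
  unfolding path_image_def by (metis Int_commute imageI)
 have "uniformly_continuous_on {0..1} c" using c by (intro compact_uniformly_continuous) (auto simp: path_def)
 then obtain d where d: "d > 0" "!!s t. s : {0..1} ==> t : {0..1} ==> \<bar>s - t\<bar> < d ==> dist (c s) (c t) < e"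
  unfolding uniformly_continuous_on_def using e(1) by (metis dist_real_def)
 obtain M :: nat where M: "M > 0" "1 / real M < d" using reals_Archimedean[OF d(1)] by (metis inverse_eq_divide of_nat_Suc zero_less_Suc)
 have "fine_mesh c K N" if "N >= M" for N
 proof -
  have "1 / real N <= 1 / real M" using that M by (intro divide_left_mono) auto
  then have "1 / real N < d" using M by simp
  then show ?thesis unfolding fine_mesh_def using that M e d by (intro conjI exI[of _ e]) auto
 qed
 then show ?thesis by blast
qed

lemma fine_mesh_mult: assumes "fine_mesh c K N" "m > 0" shows "fine_mesh c K (N * m)"
proof -
 have "1 / real (N * m) <= 1 / real N" using assms by (intro divide_left_mono) (auto simp: fine_mesh_def)
 then have le: "\<bar>s - t\<bar> <= 1 / real N" if "\<bar>s - t\<bar> <= 1 / real (N * m)" for s t :: real using that by linarith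
 obtain e where "\<forall>x\<in>K. \<forall>s\<in>{0..1}. e <= dist (c s) x"
  "\<forall>s\<in>{0..1}. \<forall>t\<in>{0..1}. \<bar>s - t\<bar> <= 1 / N --> dist (c s) (c t) < e"
  using assms(1) unfolding fine_mesh_def by blast
 then have "\<exists>e. (\<forall>x\<in>K. \<forall>s\<in>{0..1}. e <= dist (c s) x) &
   (\<forall>s\<in>{0..1}. \<forall>t\<in>{0..1}. \<bar>s - t\<bar> <= 1 / real (N * m) --> dist (c s) (c t) < e)"
  using le by (intro exI[of _ e]) blast
 then show ?thesis using assms by (auto simp: fine_mesh_def)
qed

lemma fine_mesh_subset: "fine_mesh c K N ==> K' <= K ==> fine_mesh c K' N"
 unfolding fine_mesh_def by blast

lemma fine_meshD:
 assumes "fine_mesh c K N" "i < N"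
 obtains C where "convex C" "!!s. real i / real N <= s ==> s <= real (Suc i) / real N ==> c s : C" "C Int K = {}"
proof -
 obtain e where e: "!!x s. x : K ==> s : {0..1} ==> e <= dist (c s) x"
  "!!s t. s : {0..1} ==> t : {0..1} ==> \<bar>s - t\<bar> <= 1 / N ==> dist (c s) (c t) < e"
  using assms unfolding fine_mesh_def by metis
 have N: "real N > 0" "real (Suc i) <= real N" using assms by auto
 then have b: "0 <= real i / N" "real i / N <= 1" "real (Suc i) / N <= 1" "real (Suc i) / N = real i / N + 1 / N"
  by (auto simp: field_simps)
 show ?thesis
 proof (rule that[of "ball (c (real i / N)) e"])
  fix s assume s: "real i / real N <= s" "s <= real (Suc i) / real N"
  have "0 <= s" using s(1) b(1) by linarith
  moreover have "s <= 1" using s(2) b(3) by linarith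
  moreover have "\<bar>real i / N - s\<bar> <= 1 / N" using s unfolding b(4) by linarith
  ultimately have "s : {0..1}" "\<bar>real i / N - s\<bar> <= 1 / N" by auto
  then show "c s : ball (c (real i / N)) e" using e(2)[of "real i / N" s] b by auto
 next
  show "ball (c (real i / N)) e Int K = {}" using e(1)[of _ "real i / N"] b by force
 qed auto
qed

lemma mesh_nonzero:
 assumes "fine_mesh c K N" "x : K" shows "cyc Q (mesh c N) N x ~= 0"
proof (rule cyc_nonzero)
 fix i assume i: "i < N"
 obtain C where C: "convex C" "!!s. real i / real N <= s ==> s <= real (Suc i) / real N ==> c s : C" "C Int K = {}"
  using fine_meshD[OF assms(1) i] by blast
 have "closed_segment (mesh c N i) (mesh c N (Suc i)) <= C"
  unfolding mesh_def by (intro closed_segment_subset C) (auto simp: divide_right_mono)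
 then show "x ~: closed_segment (mesh c N i) (mesh c N (Suc i))" using C assms by auto
qed

lemma mesh_closed: "N > 0 ==> finish c = start c ==> mesh c N N = mesh c N 0"
 by (simp add: mesh_def pathfinish_def pathstart_def)

lemma mesh_plane_loop:
 assumes "fine_mesh c K N" "finish c = start c"
  and l: "path l" "finish l = start l" "track l <= K"
 shows "plane_loop (cyc Q (mesh c N) N o l)"
 by (rule plane_loop_comp[OF continuous_on_cyc mesh_nonzero[OF assms(1)] l])
  (use assms mesh_closed in \<open>auto simp: fine_mesh_def\<close>)

text \<open>
 Over each interval of the coarser mesh the finer one differs from it by a closed polygon inside
 a convex set that misses the loop.
\<close>

lemma mesh_refine:
 assumes fm: "fine_mesh c K N" and m: "m > 0" and c: "finish c = start c"
  and l: "path l" "finish l = start l" "track l <= K"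
 shows "loop_sign (cyc Q (mesh c (N * m)) (N * m) o l) = loop_sign (cyc Q (mesh c N) N o l)"
proof -
 have N: "N > 0" using fm by (simp add: fine_mesh_def)
 define f where "f i j = (if j <= m then c (real (i * m + j) / real (N * m)) else c (real i / real N))" for i j
 define B where "B u v x = bracket (Q (u - x)) (Q (v - x))" for u v x
 define E where "E i = cyc Q (f i) (Suc m)" for i
 have f0: "f i 0 = mesh c N i" for i using m by (simp add: f_def mesh_def)
 have fm': "f i m = mesh c N (Suc i)" for i
 proof -
  have "real (i * m + m) / real (N * m) = real (Suc i) / real N" using m N by (simp add: field_simps)
  then show ?thesis by (simp add: f_def mesh_def)
 qed
 have fS: "f i (Suc m) = f i 0" for i using m by (simp add: f_def)
 have trivial: "plane_loop (E i o l)" "loop_sign (E i o l) = 1" if i: "i < N" for i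
 proof -
  obtain C where C: "convex C" "!!s. real i / real N <= s ==> s <= real (Suc i) / real N ==> c s : C" "C Int K = {}"
   using fine_meshD[OF fm i] by blast
  have fC: "f i j : C" for j
  proof -
   have "real i / real N <= real (i * m + j) / real (N * m) & real (i * m + j) / real (N * m) <= real (Suc i) / real N" if "j <= m"
   proof -
    have "real i / real N = real (i * m) / real (N * m)" "real (Suc i) / real N = real (i * m + m) / real (N * m)"
     using m N by (simp_all add: field_simps)
    then show ?thesis using that by (metis add.commute add_le_cancel_left divide_right_mono le_add2 of_nat_0_le_iff of_nat_le_iff)
   qed
   moreover have "c (real i / real N) : C" by (intro C(2)) (auto simp: divide_right_mono)
   ultimately show ?thesis unfolding f_def using C(2) by auto
  qed
  have K: "track l Int C = {}" using C(3) l(3) by auto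
  show "loop_sign (E i o l) = 1" unfolding E_def by (rule cyc_convex[OF C(1) fC fS l(1,2) K])
  show "plane_loop (E i o l)" unfolding E_def
  proof (rule cyc_plane_loop[OF fS l(1,2)])
   fix j have "closed_segment (f i j) (f i (Suc j)) <= C" by (intro closed_segment_subset fC C)
   then show "track l Int closed_segment (f i j) (f i (Suc j)) = {}" using K by auto
  qed
 qed
 have prod: "(\<Prod>i<N. E i x) = cyc Q (mesh c (N * m)) (N * m) x * cnj (cyc Q (mesh c N) N x)" for x
 proof -
  have step: "E i x = (\<Prod>j<m. B (mesh c (N * m) (Suc (i * m + j))) (mesh c (N * m) (i * m + j)) x) * B (mesh c N i) (mesh c N (Suc i)) x" for i
  proof -
   have "(\<Prod>j<m. B (f i (Suc j)) (f i j) x) = (\<Prod>j<m. B (mesh c (N * m) (Suc (i * m + j))) (mesh c (N * m) (i * m + j)) x)"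
    by (intro prod.cong) (auto simp: f_def mesh_def add_ac)
   then show ?thesis by (simp add: E_def cyc_def B_def[symmetric] fS f0 fm')
  qed
  have "(\<Prod>i<N. (\<Prod>j<m. B (mesh c (N * m) (Suc (i * m + j))) (mesh c (N * m) (i * m + j)) x)) =
    (\<Prod>k<N * m. B (mesh c (N * m) (Suc k)) (mesh c (N * m) k) x)"
  proof -
   have "(\<Prod>k<N * m. B (mesh c (N * m) (Suc k)) (mesh c (N * m) k) x) =
    (\<Prod>i<N. prod (%k. B (mesh c (N * m) (Suc k)) (mesh c (N * m) k) x) {i * m..<i * m + m})"
    by (rule prod.nat_group[symmetric])
   also have "... = (\<Prod>i<N. (\<Prod>j<m. B (mesh c (N * m) (Suc (i * m + j))) (mesh c (N * m) (i * m + j)) x))"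
   proof (rule prod.cong[OF refl])
    fix i
    show "prod (%k. B (mesh c (N * m) (Suc k)) (mesh c (N * m) k) x) {i * m..<i * m + m} =
     (\<Prod>j<m. B (mesh c (N * m) (Suc (i * m + j))) (mesh c (N * m) (i * m + j)) x)"
     using prod.shift_bounds_nat_ivl[of "%k. B (mesh c (N * m) (Suc k)) (mesh c (N * m) k) x" 0 "i * m" m]
     by (simp add: add.commute lessThan_atLeast0)
   qed
   finally show ?thesis by simp
  qed
  moreover have "(\<Prod>i<N. B (mesh c N i) (mesh c N (Suc i)) x) = cnj (cyc Q (mesh c N) N x)"
   by (simp add: cyc_def B_def bracket_cnj[symmetric])
  ultimately show ?thesis unfolding step prod.distrib by (simp add: cyc_def B_def)
 qed
 have l1: "plane_loop (cyc Q (mesh c (N * m)) (N * m) o l)" by (rule mesh_plane_loop[OF fine_mesh_mult[OF fm m] c l])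
 have l2: "plane_loop (cyc Q (mesh c N) N o l)" by (rule mesh_plane_loop[OF fm c l])
 have "1 = (\<Prod>i<N. loop_sign (E i o l))" using trivial by simp
 also have "... = loop_sign (%s. \<Prod>i<N. (E i o l) s)" using trivial by (intro loop_sign_prod[symmetric]) auto
 also have "... = loop_sign (%s. (cyc Q (mesh c (N * m)) (N * m) o l) s * cnj ((cyc Q (mesh c N) N o l) s))"
  by (simp add: prod)
 also have "... = loop_sign (cyc Q (mesh c (N * m)) (N * m) o l) * loop_sign (cyc Q (mesh c N) N o l)"
  using loop_sign_mult[OF l1 plane_loop_cnj[OF l2]] loop_sign_cnj[OF l2] by simp
 finally show ?thesis using loop_sign_values[OF l1] loop_sign_values[OF l2] by auto
qed

end

text \<open>The sign is the same for all fine meshes, since any two of them have a common refinement.\<close>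

definition link_sign :: "(R3 => R3) => (real => R3) => (real => R3) => real" where
 "link_sign Q c l = (THE s. \<forall>\<^sub>F N in sequentially. loop_sign (cyc Q (isometry_R3.mesh c N) N o l) = s)"

definition disjoint_loops :: "(real => 'a::topological_space) => (real => 'a) => bool" where
 "disjoint_loops c l \<longleftrightarrow> path c & finish c = start c & path l & finish l = start l &
   track c Int track l = {}"

context isometry_R3 begin

lemma link_sign_eq:
 assumes "disjoint_loops c l" and fm: "fine_mesh c (track l) N"
 shows "link_sign Q c l = loop_sign (cyc Q (mesh c N) N o l)" unfolding link_sign_def
proof (rule the_equality)
 have c: "path c" "finish c = start c" and l: "path l" "finish l = start l"
  and d: "track l Int track c = {}" using assms(1) by (auto simp: disjoint_loops_def)
 obtain N0 where N0: "!!M. M >= N0 ==> fine_mesh c (track l) M"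
  using fine_mesh_exists[OF c(1) compact_path_image[OF l(1)] d] by blast
 have "loop_sign (cyc Q (mesh c M) M o l) = loop_sign (cyc Q (mesh c N) N o l)" if "M >= N0" for M
 proof -
  have fM: "fine_mesh c (track l) M" and p: "M > 0" "N > 0" using N0[OF that] fm by (auto simp: fine_mesh_def)
  show ?thesis using mesh_refine[OF fM p(2) c(2) l order_refl] mesh_refine[OF fm p(1) c(2) l order_refl]
   by (simp add: mult.commute)
 qed
 then show ev: "\<forall>\<^sub>F M in sequentially. loop_sign (cyc Q (mesh c M) M o l) = loop_sign (cyc Q (mesh c N) N o l)"
  unfolding eventually_sequentially by blast
 fix s assume "\<forall>\<^sub>F M in sequentially. loop_sign (cyc Q (mesh c M) M o l) = s"
 with ev have "\<forall>\<^sub>F M in sequentially. s = loop_sign (cyc Q (mesh c N) N o l)" by eventually_elim simp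
 then show "s = loop_sign (cyc Q (mesh c N) N o l)" by simp
qed

lemma fine_mesh_ex:
 assumes "path c" "compact K" "K Int track c = {}" shows "\<exists>N. fine_mesh c K N"
 using fine_mesh_exists[OF assms] by blast

lemma link_sign_values:
 assumes "disjoint_loops c l" shows "link_sign Q c l = 1 | link_sign Q c l = -1"
proof -
 have a: "path c" "compact (track l)" "track l Int track c = {}"
  using assms by (auto simp: disjoint_loops_def)
 obtain N where N: "fine_mesh c (track l) N" using fine_mesh_ex[OF a] by blast
 show ?thesis unfolding link_sign_eq[OF assms N]
  by (rule loop_sign_values[OF mesh_plane_loop[OF N]]) (use assms in \<open>auto simp: disjoint_loops_def\<close>)
qed

lemma link_sign_homotopic:
 assumes c: "path c" "finish c = start c" and h: "homotopic_loops (- track c) l l'"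
 shows "link_sign Q c l = link_sign Q c l'"
proof -
 let ?A = "{0..1::real} \<times> {0..1::real}"
 obtain H where H: "continuous_on ?A H" "H ` ?A <= - track c" "!!x. x : {0..1} ==> H (0, x) = l x"
  "!!x. x : {0..1} ==> H (1, x) = l' x" "!!t. t : {0..1} ==> finish (H o Pair t) = start (H o Pair t)"
  using h by (force simp: homotopic_loops homotopic_with)
 define K where "K = H ` ?A"
 have K: "compact K" "K Int track c = {}"
  using H(2) unfolding K_def by (auto intro!: compact_continuous_image H(1) compact_Times)
 have hK: "homotopic_loops K l l'" unfolding homotopic_loops by (rule exI[of _ H]) (use H in \<open>auto simp: K_def\<close>)
 have l: "track l <= K" "track l' <= K" "path l" "path l'"
  "finish l = start l" "finish l' = start l'"
  using homotopic_loops_imp_subset[OF hK] homotopic_loops_imp_path[OF hK] homotopic_loops_imp_loop[OF hK] by auto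
 obtain N where N: "fine_mesh c K N" using fine_mesh_ex[OF c(1) K] by blast
 have d: "disjoint_loops c l" "disjoint_loops c l'" using c l K by (auto simp: disjoint_loops_def)
 have "N > 0" using N by (simp add: fine_mesh_def)
 then have "homotopic_loops (-{0}) (cyc Q (mesh c N) N o l) (cyc Q (mesh c N) N o l')"
  by (intro homotopic_loops_continuous_image[OF hK] continuous_on_cyc mesh_closed c)
   (use mesh_nonzero[OF N] in auto)
 then show ?thesis using link_sign_eq[OF d(1) fine_mesh_subset[OF N l(1)]] link_sign_eq[OF d(2) fine_mesh_subset[OF N l(2)]]
   loop_sign_homotopic by simp
qed

lemma link_sign_join:
 assumes "disjoint_loops c l" "disjoint_loops c l'" "start l = start l'"
 shows "link_sign Q c (l +++ l') = link_sign Q c l * link_sign Q c l'"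
proof -
 let ?K = "track l Un track l'"
 have a: "path c" "compact ?K" "?K Int track c = {}" using assms by (auto simp: disjoint_loops_def)
 obtain N where N: "fine_mesh c ?K N" using fine_mesh_ex[OF a] by blast
 have j: "track (l +++ l') = ?K" using assms by (intro path_image_join) (auto simp: disjoint_loops_def)
 have d: "disjoint_loops c (l +++ l')" unfolding disjoint_loops_def j using assms by (auto simp: disjoint_loops_def)
 let ?f = "cyc Q (mesh c N) N"
 have "loop_sign (?f o (l +++ l')) = loop_sign (?f o l) * loop_sign (?f o l')" unfolding path_compose_join
  by (intro loop_sign_join mesh_plane_loop[OF N]) (use assms in \<open>auto simp: disjoint_loops_def pathstart_compose\<close>)
 then show ?thesis
  using link_sign_eq[OF d] link_sign_eq[OF assms(1) fine_mesh_subset[OF N]] link_sign_eq[OF assms(2) fine_mesh_subset[OF N]] N j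
  by simp
qed

lemma link_sign_disc:
 assumes d: "disjoint_loops c l" and D: "convex D" "compact D" "track l <= D" "D Int track c = {}"
 shows "link_sign Q c l = 1"
proof -
 have a: "path c" "compact D" "D Int track c = {}" using d D by (auto simp: disjoint_loops_def)
 obtain N where N: "fine_mesh c D N" using fine_mesh_ex[OF a] by blast
 show ?thesis unfolding link_sign_eq[OF d fine_mesh_subset[OF N D(3)]]
  by (rule loop_sign_convex[OF D(1) continuous_on_cyc mesh_nonzero[OF N]])
   (use N d D mesh_closed[of N c] in \<open>auto simp: disjoint_loops_def fine_mesh_def\<close>)
qed

lemma link_sign_affine: "link_sign id (%s. Q (c s) + a) (%s. Q (l s) + a) = link_sign Q c l"
proof -
 have "cyc id (mesh (%s. Q (c s) + a) N) N o (%s. Q (l s) + a) = cyc Q (mesh c N) N o l" for N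
  by (simp add: cyc_def mesh_def fun_eq_iff linear_diff[OF linear_Q])
 then show ?thesis unfolding link_sign_def by simp
qed

end

definition det3 :: "R3 => R3 => R3 => real" where
 "det3 u v w = snd u * Im (cnj (fst v) * fst w) + snd v * Im (cnj (fst w) * fst u) + snd w * Im (cnj (fst u) * fst v)"

lemma det3_linear_combinations:
 "det3 (a1 *\<^sub>R p + b1 *\<^sub>R q + c1 *\<^sub>R k) (a2 *\<^sub>R p + b2 *\<^sub>R q + c2 *\<^sub>R k) (a3 *\<^sub>R p + b3 *\<^sub>R q + c3 *\<^sub>R k) =
  (a1 * (b2 * c3 - c2 * b3) - b1 * (a2 * c3 - c2 * a3) + c1 * (a2 * b3 - b2 * a3)) * det3 p q k"
 by (simp add: det3_def) algebra

context isometry_R3 begin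

text \<open>The circle links the triangle with vertices A, B, E once: it meets it only at r.\<close>

lemma triangle_links_axis_circle:
 fixes j :: real
 assumes r: "r > 0" and j: "j = 1 | j = -1"
 defines "A == (0, -j * r)" and "B == (0, j * r)" and "E == (of_real (4 * r), 0)"
 defines "tri == %x. bracket (Q (A - x)) (Q (E - x)) * bracket (Q (E - x)) (Q (B - x)) * bracket (Q (B - x)) (Q (A - x))"
 assumes loop: "plane_loop (tri o axis_circle r)"
 shows "loop_sign (tri o axis_circle r) = -1"
proof -
 define p q k where "p = Q (1, 0)" and "q = Q (\<i>, 0)" and "k = Q (0, 1)"
 define C where "C = 16 * j * r ^ 3 * det3 p q k"
 have Qv: "Q (z, t) = Re z *\<^sub>R p + Im z *\<^sub>R q + t *\<^sub>R k" for z t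
 proof -
  have "(z, t) = Re z *\<^sub>R (1, 0) + Im z *\<^sub>R (\<i>, 0) + t *\<^sub>R (0, 1)" by (simp add: complex_eq_iff)
  then have "Q (z, t) = Q (Re z *\<^sub>R (1, 0) + Im z *\<^sub>R (\<i>, 0) + t *\<^sub>R (0, 1))" by simp
  also have "... = Re z *\<^sub>R p + Im z *\<^sub>R q + t *\<^sub>R k"
   unfolding p_def q_def k_def linear_add[OF linear_Q] linear_scale[OF linear_Q] ..
  finally show ?thesis .
 qed
 have Im: "Im ((tri o axis_circle r) s) = C * sin (2 * pi * s)" for s
 proof -
  define a b where "a = r * cos (2 * pi * s)" and "b = r * sin (2 * pi * s)"
  have x: "axis_circle r s = (Complex a b, 0)" by (simp add: axis_circle_def a_def b_def complex_eq_iff)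
  have "Im (tri (axis_circle r s)) = 2 * det3 (Q (A - axis_circle r s)) (Q (E - axis_circle r s)) (Q (B - axis_circle r s))"
   unfolding tri_def triangle_Im det3_def ..
  also have "det3 (Q (A - axis_circle r s)) (Q (E - axis_circle r s)) (Q (B - axis_circle r s)) =
   det3 ((-a) *\<^sub>R p + (-b) *\<^sub>R q + (-j * r) *\<^sub>R k) ((4 * r - a) *\<^sub>R p + (-b) *\<^sub>R q + 0 *\<^sub>R k) ((-a) *\<^sub>R p + (-b) *\<^sub>R q + (j * r) *\<^sub>R k)"
   unfolding x A_def B_def E_def by (simp add: Qv)
  also have "... = 8 * j * r^2 * b * det3 p q k"
   unfolding det3_linear_combinations by (simp add: algebra_simps power2_eq_square)
  finally show ?thesis by (simp add: C_def b_def power2_eq_square power3_eq_cube)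
 qed
 have Re: "Re (tri (of_real y, 0)) = 4 * (y^2 * \<bar>4 * r - y\<bar> - sqrt (y^2 + r^2) * y * (4 * r - y))" for y
 proof -
  let ?x = "(complex_of_real y, 0::real)"
  have s1: "j * j = 1" using j by auto
  have nA: "norm (A - ?x) = sqrt (y^2 + r^2)" "norm (B - ?x) = sqrt (y^2 + r^2)" "norm (E - ?x) = \<bar>4 * r - y\<bar>"
  proof -
   have e: "A - ?x = (of_real (-y), -j * r)" "B - ?x = (of_real (-y), j * r)" "E - ?x = (of_real (4 * r - y), 0)"
    by (simp_all add: A_def B_def E_def)
   have "j^2 = 1" using s1 by (simp add: power2_eq_square)
   then show "norm (A - ?x) = sqrt (y^2 + r^2)" "norm (B - ?x) = sqrt (y^2 + r^2)" "norm (E - ?x) = \<bar>4 * r - y\<bar>"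
    unfolding e norm_Pair norm_of_real by (simp_all add: power_mult_distrib)
  qed
  have i: "(E - ?x) \<bullet> (B - ?x) = - y * (4 * r - y)" "(A - ?x) \<bullet> (B - ?x) = y^2 - r^2" "(A - ?x) \<bullet> (E - ?x) = - y * (4 * r - y)"
   using s1 unfolding A_def B_def E_def by (auto simp: inner_R3 power2_eq_square algebra_simps)
  have sq: "sqrt (y^2 + r^2) * sqrt (y^2 + r^2) = y^2 + r^2" by simp
  have "Re (tri ?x) = 2 * (sqrt (y^2 + r^2) * \<bar>4 * r - y\<bar> * sqrt (y^2 + r^2) + sqrt (y^2 + r^2) * (- y * (4 * r - y)) +
    \<bar>4 * r - y\<bar> * (y^2 - r^2) + sqrt (y^2 + r^2) * (- y * (4 * r - y)))"
   unfolding tri_def triangle_Re inner_Q norm_Q nA i ..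
  also have "sqrt (y^2 + r^2) * \<bar>4 * r - y\<bar> * sqrt (y^2 + r^2) = (y^2 + r^2) * \<bar>4 * r - y\<bar>"
   using sq by (metis mult.assoc mult.commute)
  finally show ?thesis by (simp add: algebra_simps)
 qed
 have s2: "sqrt (r^2 + r^2) = sqrt 2 * r" using r by (simp add: real_sqrt_mult flip: mult_2)
 have s3: "sqrt 2 > (1::real)" by simp
 have R0: "Re ((tri o axis_circle r) 0) < 0"
 proof -
  have e: "axis_circle r 0 = (of_real r, 0)" by (simp add: axis_circle_def)
  have "Re ((tri o axis_circle r) 0) = 12 * r ^ 3 * (1 - sqrt 2)"
   unfolding o_def e Re s2 using r by (simp add: power2_eq_square power3_eq_cube algebra_simps)
  also have "... < 0" using r s3 by (intro mult_pos_neg) auto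
  finally show ?thesis .
 qed
 have R1: "Re ((tri o axis_circle r) (1/2)) > 0"
 proof -
  have e: "axis_circle r (1/2) = (of_real (-r), 0)" by (simp add: axis_circle_def)
  have s4: "sqrt ((-r)^2 + r^2) = sqrt 2 * r" using s2 by simp
  have "Re ((tri o axis_circle r) (1/2)) = 20 * r ^ 3 * (1 + sqrt 2)"
   unfolding o_def e Re s4 using r by (simp add: power2_eq_square power3_eq_cube algebra_simps)
  also have "... > 0" using r by (simp add: add_pos_pos)
  finally show ?thesis .
 qed
 have "C ~= 0"
 proof
  assume C: "C = 0"
  have pt: "path (tri o axis_circle r)" using loop by (simp add: plane_loop_def)
  have "continuous_on {0..1/2} (tri o axis_circle r)" using pt unfolding path_def by (rule continuous_on_subset) auto
  then have "continuous_on {0..1/2} (%s. Re ((tri o axis_circle r) s))" by (rule continuous_on_Re)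
  then obtain s where s: "0 <= s" "s <= 1/2" "Re ((tri o axis_circle r) s) = 0"
   using IVT'[of "%s. Re ((tri o axis_circle r) s)" 0 0 "1/2"] R0 R1 by auto
  then have "(tri o axis_circle r) s = 0" using Im[of s] C by (simp add: complex_eq_iff)
  moreover have "(tri o axis_circle r) s : track (tri o axis_circle r)"
   using s unfolding path_image_def by (intro imageI) auto
  ultimately show False using loop by (metis plane_loop_def)
 qed
 then show ?thesis by (rule loop_sign_crossing[OF loop _ Im R0 R1])
qed

end

lemma axis_circle_norm:
 assumes "r > 0" shows "cmod (fst (axis_circle r s)) = r" "snd (axis_circle r s) = 0"
 using assms by (simp_all add: axis_circle_def norm_mult)

lemma prod_shift_cyclic:
 fixes g :: "nat => 'a::comm_monoid_mult"
 assumes "g N = g 0" shows "(\<Prod>i<N. g (Suc i)) = (\<Prod>i<N. g i)"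
proof (cases N)
 case (Suc n)
 then have "(\<Prod>i<N. g (Suc i)) = (\<Prod>i<n. g (Suc i)) * g 0" using assms by simp
 then show ?thesis unfolding Suc by (simp only: prod.lessThan_Suc_shift mult.commute)
qed simp

context isometry_R3 begin

definition quad :: "R3 => R3 => R3 => R3 => nat => R3" where
 "quad A B C D i = [A, B, C, D, A] ! i"

lemma cyc_quad: "cyc Q (quad A B C D) 4 x = bracket (Q (B - x)) (Q (A - x)) * bracket (Q (C - x)) (Q (B - x)) *
  bracket (Q (D - x)) (Q (C - x)) * bracket (Q (A - x)) (Q (D - x))" by (simp add: cyc_def quad_def eval_nat_numeral)

lemma quad_simps [simp]: "quad A B C D 0 = A" "quad A B C D 4 = A" by (simp_all add: quad_def)

lemma less_4_cases: "i < 4 ==> i = 0 | i = 1 | i = 2 | i = (3::nat)" by auto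

text \<open>
 The side from A to B lies inside the cylinder over the circle and that from C to D beyond a tangent
 plane of it; the other two meet the plane of the circle at most in C and D.
\<close>

lemma quad_avoids_axis_circle:
 fixes \<sigma> :: real
 assumes r: "r > 0"
  and A: "cmod (fst A) < r" "\<sigma> * snd A < 0" and B: "cmod (fst B) < r" "\<sigma> * snd B > 0"
  and C: "Re (fst C) > r" "\<sigma> * snd C >= 0" and D: "Re (fst D) > r" "\<sigma> * snd D <= 0" and i: "i < 4"
 shows "axis_circle r s ~: closed_segment (quad A B C D i) (quad A B C D (Suc i))"
proof
 let ?x = "axis_circle r s"
 assume x: "?x : closed_segment (quad A B C D i) (quad A B C D (Suc i))"
 note n = axis_circle_norm[OF r, of s]
 have notC: "Re (fst ?x) <= r" using complex_Re_le_cmod[of "fst ?x"] n by simp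
 have "convex {v::R3. cmod (fst v) < r}"
 proof -
  have "{v::R3. cmod (fst v) < r} = ball 0 r \<times> UNIV" by auto
  then show ?thesis by (simp add: convex_Times)
 qed
 then have ab: "?x ~: closed_segment A B" using closed_segment_subset[of A "{v. cmod (fst v) < r}" B] A B n by auto
 have "convex {v::R3. Re (fst v) > r}"
 proof -
  have "{v::R3. Re (fst v) > r} = {z. Re z > r} \<times> UNIV" by auto
  then show ?thesis by (simp add: convex_Times convex_halfspace_Re_gt)
 qed
 then have cd: "?x ~: closed_segment C D" using closed_segment_subset[of C "{v. Re (fst v) > r}" D] C D notC by force
 have bc: "?x ~: closed_segment B C"
 proof
  assume "?x : closed_segment B C"
  then obtain u where u: "0 <= u" "u <= 1" "?x = (1 - u) *\<^sub>R B + u *\<^sub>R C" by (auto simp: in_segment)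
  have "\<sigma> * snd ?x = (1 - u) * (\<sigma> * snd B) + u * (\<sigma> * snd C)" unfolding u(3) by (simp add: algebra_simps)
  then have z: "(1 - u) * (\<sigma> * snd B) + u * (\<sigma> * snd C) = 0" using n by simp
  have "u * (\<sigma> * snd C) >= 0" using u C by simp
  then have "(1 - u) * (\<sigma> * snd B) <= 0" using z by linarith
  then have "~ 0 < 1 - u" using mult_pos_pos[of "1 - u" "\<sigma> * snd B"] B(2) by linarith
  then have "u = 1" using u by simp
  then show False using u(3) C notC by simp
 qed
 have da: "?x ~: closed_segment D A"
 proof
  assume "?x : closed_segment D A"
  then obtain u where u: "0 <= u" "u <= 1" "?x = (1 - u) *\<^sub>R D + u *\<^sub>R A" by (auto simp: in_segment)
  have "\<sigma> * snd ?x = (1 - u) * (\<sigma> * snd D) + u * (\<sigma> * snd A)" unfolding u(3) by (simp add: algebra_simps)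
  then have z: "(1 - u) * (\<sigma> * snd D) + u * (\<sigma> * snd A) = 0" using n by simp
  have "(1 - u) * (\<sigma> * snd D) <= 0" using u D by (simp add: mult_nonneg_nonpos)
  then have "u * (\<sigma> * snd A) >= 0" using z by linarith
  then have "~ 0 < u" using mult_pos_neg[of u "\<sigma> * snd A"] A(2) by linarith
  then have "u = 0" using u by simp
  then show False using u(3) D notC by simp
 qed
 show False using x less_4_cases[OF i] ab bc cd da by (auto simp: quad_def eval_nat_numeral)
qed

text \<open>The quadrilateral is deformed, off the circle, until C and D coincide and a triangle remains.\<close>

lemma quad_links_axis_circle:
 fixes \<sigma> :: real
 assumes r: "r > 0" and \<sigma>: "\<sigma> = 1 | \<sigma> = -1"
  and A: "cmod (fst A) < r" "\<sigma> * snd A < 0" and B: "cmod (fst B) < r" "\<sigma> * snd B > 0"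
  and C: "Re (fst C) > r" "\<sigma> * snd C >= 0" and D: "Re (fst D) > r" "\<sigma> * snd D <= 0"
 shows "loop_sign (cyc Q (quad A B C D) 4 o axis_circle r) = -1"
proof -
 define A0 B0 E where "A0 = (0::complex, -\<sigma> * r)" and "B0 = (0::complex, \<sigma> * r)" and "E = (complex_of_real (4 * r), 0::real)"
 have s1: "\<sigma> * \<sigma> = 1" using \<sigma> by auto
 have A0: "cmod (fst A0) < r" "\<sigma> * snd A0 < 0" and B0: "cmod (fst B0) < r" "\<sigma> * snd B0 > 0"
  and E: "Re (fst E) > r" "\<sigma> * snd E >= 0" "\<sigma> * snd E <= 0"
  using r s1 by (auto simp: A0_def B0_def E_def simp flip: mult.assoc)
 define f where "f i u = (1 - u) *\<^sub>R quad A B C D i + u *\<^sub>R quad A0 B0 E E i" for i and u :: real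
 have "loop_sign (cyc Q (%i. f i 0) 4 o axis_circle r) = loop_sign (cyc Q (%i. f i 1) 4 o axis_circle r)"
 proof (rule cyc_homotopy)
  show "continuous_on {0..1} (f i)" for i unfolding f_def by (intro continuous_intros)
  show "f 4 u = f 0 u" for u by (simp add: f_def)
  fix u s :: real and i :: nat assume a: "u : {0..1}" "s : {0..1}" "i < 4"
  then have u: "0 <= u" "0 <= 1 - u" "(1 - u) + u = 1" by auto
  define mix where "mix X Y = (1 - u) *\<^sub>R X + u *\<^sub>R Y" for X Y :: R3
  have fq: "f i u = quad (mix A A0) (mix B B0) (mix C E) (mix D E) i" if "i <= 4" for i
   using that less_4_cases[of i] by (cases "i = 4") (auto simp: f_def mix_def quad_def eval_nat_numeral)
  have snd_mix: "\<sigma> * snd (mix X Y) = (1 - u) * (\<sigma> * snd X) + u * (\<sigma> * snd Y)" for X Y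
   by (simp add: mix_def algebra_simps)
  have cmix: "cmod (fst (mix X Y)) < r" if "cmod (fst X) < r" "cmod (fst Y) < r" for X Y
  proof -
   have "(1 - u) *\<^sub>R fst X + u *\<^sub>R fst Y : ball 0 r" using that by (intro convexD[OF convex_ball] u) auto
   then show ?thesis by (simp add: mix_def)
  qed
  have rmix: "Re (fst (mix X Y)) > r" if "Re (fst X) > r" "Re (fst Y) > r" for X Y
  proof -
   have "(1 - u) *\<^sub>R fst X + u *\<^sub>R fst Y : {z. Re z > r}"
    using that by (intro convexD[OF convex_halfspace_Re_gt] u) auto
   then show ?thesis by (simp add: mix_def)
  qed
  have pos: "(1 - u) * x + u * y > 0" if "x > 0" "y > 0" for x y :: real
   using that u by (cases "u = 0") (auto intro: add_nonneg_pos)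
  have neg: "(1 - u) * x + u * y < 0" if "x < 0" "y < 0" for x y :: real
   using pos[of "-x" "-y"] that by (simp add: algebra_simps)
  have nn: "(1 - u) * x + u * y >= 0" if "x >= 0" "y >= 0" for x y :: real using that u by simp
  have np: "(1 - u) * x + u * y <= 0" if "x <= 0" "y <= 0" for x y :: real
   using nn[of "-x" "-y"] that by (simp add: algebra_simps)
  have "axis_circle r s ~: closed_segment (quad (mix A A0) (mix B B0) (mix C E) (mix D E) i) (quad (mix A A0) (mix B B0) (mix C E) (mix D E) (Suc i))"
   by (rule quad_avoids_axis_circle[OF r, where \<sigma> = \<sigma>, OF _ _ _ _ _ _ _ _ a(3)])
    (auto simp: snd_mix intro!: cmix rmix pos neg nn np A A0 B B0 C D E)
  then show "axis_circle r s ~: closed_segment (f i u) (f (Suc i) u)" using fq a by simp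
 qed auto
 also have "(%i. f i 0) = quad A B C D" by (simp add: f_def fun_eq_iff)
 also have "(%i. f i 1) = quad A0 B0 E E" by (simp add: f_def fun_eq_iff)
 also have "loop_sign (cyc Q (quad A0 B0 E E) 4 o axis_circle r) = -1"
 proof -
  define tri where "tri x = bracket (Q (A0 - x)) (Q (E - x)) * bracket (Q (E - x)) (Q (B0 - x)) * bracket (Q (B0 - x)) (Q (A0 - x))" for x
  define pos where "pos s = complex_of_real (2 * norm (E - axis_circle r s))" for s
  have eq: "cyc Q (quad A0 B0 E E) 4 (axis_circle r s) = (tri o axis_circle r) s * pos s" for s
   by (simp add: cyc_quad tri_def pos_def bracket_self mult_ac)
  have ne: "axis_circle r s ~= E" for s
  proof
   assume "axis_circle r s = E"
   then have "Re (fst (axis_circle r s)) > r" using E by simp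
   then show False using complex_Re_le_cmod[of "fst (axis_circle r s)"] axis_circle_norm[OF r, of s] by simp
  qed
  have pp: "plane_loop pos"
  proof -
   have "path pos" unfolding pos_def path_def using path_axis_circle[of r] by (auto intro!: continuous_intros simp: path_def)
   moreover have "axis_circle r 1 = axis_circle r 0" by (simp add: axis_circle_def)
   moreover have "pos s ~= 0" for s using ne[of s] unfolding pos_def by simp
   ultimately show ?thesis unfolding plane_loop_def path_image_def pathstart_def pathfinish_def by (auto simp: pos_def)
  qed
  have ls: "loop_sign pos = 1" by (rule loop_sign_Re_pos[OF pp]) (use ne in \<open>auto simp: pos_def\<close>)
  have "cyc Q (%i. [A0, B0, E, A0] ! i) 3 x = tri x" for x by (simp add: cyc_def tri_def eval_nat_numeral mult_ac)
  moreover have "plane_loop (cyc Q (%i. [A0, B0, E, A0] ! i) 3 o axis_circle r)"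
  proof (rule cyc_plane_loop)
   fix i :: nat assume i: "i < 3"
   have "track (axis_circle r) Int closed_segment (quad A0 B0 E E j) (quad A0 B0 E E (Suc j)) = {}" if "j < 4" for j
    using quad_avoids_axis_circle[OF r A0 B0 E(1,2) E(1,3) that] by (auto simp: path_image_def)
   from this[of 0] this[of 1] this[of 3] i
   show "track (axis_circle r) Int closed_segment ([A0, B0, E, A0] ! i) ([A0, B0, E, A0] ! Suc i) = {}"
    by (auto simp: quad_def eval_nat_numeral less_Suc_eq)
  qed auto
  ultimately have pt: "plane_loop (tri o axis_circle r)" by (simp add: o_def)
  have "loop_sign (tri o axis_circle r) = -1"
   using triangle_links_axis_circle[OF r \<sigma>, folded A0_def B0_def E_def, folded tri_def] pt by blast
  then have "loop_sign (%s. (tri o axis_circle r) s * pos s) = -1" using loop_sign_mult[OF pt pp] ls by simp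
  then show ?thesis by (simp add: eq o_def)
 qed
 finally show ?thesis .
qed

end

context isometry_R3 begin

lemma bracket_square_pos:
 assumes "x ~: closed_segment a b"
 obtains t where "t > 0" "bracket (Q (a - x)) (Q (b - x)) * bracket (Q (b - x)) (Q (a - x)) = of_real t"
proof -
 define t where "t = 2 * (norm (a - x) * norm (b - x) + (a - x) \<bullet> (b - x))"
 have eq: "bracket (Q (a - x)) (Q (b - x)) * bracket (Q (b - x)) (Q (a - x)) = of_real t"
  unfolding bracket_square by (simp add: t_def)
 have "t ~= 0"
  using bracket_Q_nonzero[OF assms] bracket_Q_nonzero[of x b a] assms eq closed_segment_commute[of a b] by auto
 moreover have "t >= 0" using Cauchy_Schwarz_ineq2[of "a - x" "b - x"] by (auto simp: t_def abs_le_iff)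
 ultimately show ?thesis using that[of t] eq by linarith
qed

text \<open>
 Pushing the strand of c that crosses the disc over its boundary changes the sign: of the thin
 quadrilaterals between the two curves only the one at the crossing links the circle.
\<close>

lemma link_sign_push_across:
 fixes z :: real
 assumes c: "path c" "finish c = start c" and r: "r > 0" and z: "z = 1 | z = -1"
  and d: "d > 0" "0 < s0 - 2 * d" "s0 + 2 * d < 1"
  and near: "!!s. \<bar>s - s0\<bar> < 2 * d ==> cmod (fst (c s)) < r"
  and h0: "snd (c s0) = 0"
  and below: "!!s. s0 - 2 * d < s ==> s < s0 ==> z * snd (c s) < 0"
  and above: "!!s. s0 < s ==> s < s0 + 2 * d ==> z * snd (c s) > 0"
  and avoid: "track c Int track (axis_circle r) = {}"
 defines "c' == %s. c s + (of_real (4 * r * max 0 (1 - \<bar>s - s0\<bar> / d)), 0)"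
 shows "disjoint_loops c' (axis_circle r)" "link_sign Q c (axis_circle r) = - link_sign Q c' (axis_circle r)"
proof -
 \<comment> \<open>The factor 4 * r pushes the strand beyond the circle at the crossing.\<close>
 define b where "b s = 4 * r * max 0 (1 - \<bar>s - s0\<bar> / d)" for s
 have c'b: "c' s = c s + (of_real (b s), 0)" for s by (simp add: c'_def b_def)
 have b0: "b s = 0" if "\<bar>s - s0\<bar> >= d" for s using that d r by (simp add: b_def max_def field_simps)
 have b3: "b s >= 3 * r" if "\<bar>s - s0\<bar> <= d / 4" for s
 proof -
  have "\<bar>s - s0\<bar> / d <= 1/4" using that d by (simp add: field_simps)
  then have m: "3/4 <= max 0 (1 - \<bar>s - s0\<bar> / d)" by linarith
  have "4 * r * (3/4) <= b s" unfolding b_def by (rule mult_left_mono[OF m]) (use r in simp)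
  then show ?thesis by simp
 qed
 have pc': "path c'" unfolding c'b path_def b_def using c(1) d(1) by (auto intro!: continuous_intros simp: path_def)
 have "b 0 = 0" "b 1 = 0" using d by (auto intro!: b0)
 then have cl': "finish c' = start c'" using c(2) by (simp add: c'b pathfinish_def pathstart_def)
 have snd': "snd (c' s) = snd (c s)" for s by (simp add: c'b)
 have sndne: "snd (c s) ~= 0" if "\<bar>s - s0\<bar> < 2 * d" "s ~= s0" for s
  using below[of s] above[of s] that by (cases "s < s0") force+
 have Re': "Re (fst (c' s)) > r" if "\<bar>s - s0\<bar> <= d / 4" for s
  using near[of s] b3[OF that] that d abs_Re_le_cmod[of "fst (c s)"] r by (simp add: c'b)
 have circ: "p ~: track (axis_circle r)" if "snd p ~= 0 | Re (fst p) > r" for p :: R3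
  using that axis_circle_norm[OF r] complex_Re_le_cmod[of "fst p"] by (force simp: path_image_def)
 have avoid': "track c' Int track (axis_circle r) = {}"
 proof -
  have "c' s ~: track (axis_circle r)" if s: "s : {0..1}" for s
  proof (cases "\<bar>s - s0\<bar> < d")
   case True
   then show ?thesis using circ[of "c' s"] sndne[of s] Re'[of s] snd' d by (cases "s = s0") auto
  next
   case False
   then have "c' s = c s" using b0[of s] by (simp add: c'b flip: zero_prod_def)
   moreover have "c s : track c" using s by (simp add: path_image_def)
   ultimately show ?thesis using avoid by auto
  qed
  then show ?thesis by (auto simp: path_image_def[of c'])
 qed
 show dl': "disjoint_loops c' (axis_circle r)" using pc' cl' avoid' by (simp add: disjoint_loops_def)
 have dl: "disjoint_loops c (axis_circle r)" using c avoid by (simp add: disjoint_loops_def)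
 have K: "compact (track (axis_circle r))" by (simp add: compact_path_image)
 obtain N1 where N1: "!!N. N >= N1 ==> fine_mesh c (track (axis_circle r)) N"
  using fine_mesh_exists[OF c(1) K] avoid by blast
 obtain N2 where N2: "!!N. N >= N2 ==> fine_mesh c' (track (axis_circle r)) N"
  using fine_mesh_exists[OF pc' K] avoid' by blast
 obtain N3 :: nat where N3: "N3 > 0" "1 / real N3 < d / 4"
  using reals_Archimedean[of "d / 4"] d by (metis divide_pos_pos inverse_eq_divide of_nat_Suc zero_less_Suc zero_less_numeral)
 define M where "M = N1 + N2 + N3"
 \<comment> \<open>The crossing should not be a mesh point; it cannot be one for two consecutive mesh sizes.\<close>
 have "\<exists>N\<ge>M. \<forall>i. real i / real N ~= s0"
 proof (rule ccontr)
  assume "~ ?thesis"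
  then obtain i j where ij: "real i / real M = s0" "real j / real (Suc M) = s0" by (metis le_refl le_Suc_eq)
  have "real M > 0" using N3 by (simp add: M_def)
  then have "s0 * real M = real i" "s0 * (real M + 1) = real j" using ij by (auto simp: field_simps)
  then have "s0 = real_of_int (int j - int i)" by (simp add: algebra_simps)
  moreover have "0 < s0" "s0 < 1" using d by auto
  ultimately show False by (metis of_int_0_less_iff of_int_less_1_iff linorder_not_less zless_imp_add1_zle add_0)
 qed
 then obtain N where N: "N >= M" and ns0: "!!i. real i / real N ~= s0" by blast
 have Np: "real N > 0" using N N3 by (simp add: M_def)
 have fm: "fine_mesh c (track (axis_circle r)) N" and fm': "fine_mesh c' (track (axis_circle r)) N"
  using N1[of N] N2[of N] N by (auto simp: M_def)
 have "1 / real N <= 1 / real N3" using N N3 by (intro divide_left_mono) (auto simp: M_def)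
 then have Nd: "1 / real N < d / 4" using N3 by simp
 have step: "real (Suc i) / real N = real i / real N + 1 / real N" for i by (simp add: add_divide_distrib)
 define i0 where "i0 = nat \<lfloor>s0 * N\<rfloor>"
 have s0N: "0 < s0 * N" "s0 * N < N" using d Np by auto
 have i0: "real i0 / N < s0" "s0 < real (Suc i0) / N" "i0 < N"
 proof -
  have "real i0 = of_int \<lfloor>s0 * N\<rfloor>" using s0N by (simp add: i0_def)
  then have le: "real i0 <= s0 * N" "s0 * N < real i0 + 1" by linarith+
  have "real i0 / N <= s0" using le Np by (simp add: field_simps)
  then show "real i0 / N < s0" using ns0[of i0] by simp
  show "s0 < real (Suc i0) / N" using le Np by (simp add: field_simps)
  have "real i0 < real N" using le s0N by linarith
  then show "i0 < N" by simp
 qed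
 let ?\<mu> = "axis_circle r"
 define f f' where "f = mesh c N" and "f' = mesh c' N"
 define q where "q i = cyc Q (quad (f i) (f (Suc i)) (f' (Suc i)) (f' i)) 4" for i
 have fN: "f N = f 0" "f' N = f' 0" using Np mesh_closed c(2) cl' by (auto simp: f_def f'_def)
 have t: "real i / N : {0..1}" if "i <= N" for i using that Np by auto
 have fi: "f i = c (real i / N)" "f' i = c' (real i / N)" for i by (auto simp: f_def f'_def mesh_def)
 have chord: "track ?\<mu> Int closed_segment (f i) (f' i) = {}" if i: "i <= N" for i
 proof (cases "\<bar>real i / N - s0\<bar> < d")
  case True
  have "snd p = snd (f i)" if p: "p : closed_segment (f i) (f' i)" for p
  proof -
   obtain u where "p = (1 - u) *\<^sub>R f i + u *\<^sub>R f' i" using p by (auto simp: in_segment)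
   then have "snd p = (1 - u) * snd (f i) + u * snd (f' i)" by simp
   moreover have "snd (f' i) = snd (f i)" by (simp add: fi snd')
   ultimately show ?thesis by (simp add: algebra_simps)
  qed
  moreover have "snd (f i) ~= 0" using sndne True ns0 d unfolding fi by auto
  ultimately show ?thesis using circ by (metis disjoint_iff)
 next
  case False
  then have "f' i = f i" using b0 by (simp add: fi c'b flip: zero_prod_def)
  moreover have "f i : track c" using t[OF i] by (auto simp: fi path_image_def)
  ultimately show ?thesis using avoid by auto
 qed
 have edge: "track ?\<mu> Int closed_segment (f i) (f (Suc i)) = {}" "track ?\<mu> Int closed_segment (f' i) (f' (Suc i)) = {}"
  if i: "i < N" for i
 proof -
  obtain C where C: "convex C" "!!s. real i / real N <= s ==> s <= real (Suc i) / real N ==> c s : C" "C Int track ?\<mu> = {}"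
   using fine_meshD[OF fm i] by blast
  have "closed_segment (f i) (f (Suc i)) <= C"
   unfolding fi by (intro closed_segment_subset C) (auto simp: divide_right_mono)
  then show "track ?\<mu> Int closed_segment (f i) (f (Suc i)) = {}" using C(3) by blast
  obtain C' where C': "convex C'" "!!s. real i / real N <= s ==> s <= real (Suc i) / real N ==> c' s : C'" "C' Int track ?\<mu> = {}"
   using fine_meshD[OF fm' i] by blast
  have "closed_segment (f' i) (f' (Suc i)) <= C'"
   unfolding fi by (intro closed_segment_subset C') (auto simp: divide_right_mono)
  then show "track ?\<mu> Int closed_segment (f' i) (f' (Suc i)) = {}" using C'(3) by blast
 qed
 have qseg: "track ?\<mu> Int closed_segment (quad (f i) (f (Suc i)) (f' (Suc i)) (f' i) j) (quad (f i) (f (Suc i)) (f' (Suc i)) (f' i) (Suc j)) = {}"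
  if i: "i < N" and j: "j < 4" for i j using less_4_cases[OF j] edge[OF i] chord[of i] chord[of "Suc i"] i
  by (auto simp: quad_def eval_nat_numeral closed_segment_commute)
 have pq: "plane_loop (q i o ?\<mu>)" if i: "i < N" for i
  unfolding q_def by (rule cyc_plane_loop) (use qseg[OF i] in auto)
 have sq: "loop_sign (q i o ?\<mu>) = (if i = i0 then -1 else 1)" if i: "i < N" for i
 proof -
  let ?s = "real i / N" and ?t = "real (Suc i) / N"
  have st: "?t = ?s + 1 / N" by (rule step)
  have ab1: "?s < s0 ==> ?t < s0 | i = i0" and ab2: "s0 < ?t ==> s0 < ?s | i = i0"
  proof -
   show "?t < s0 | i = i0" if "?s < s0"
   proof (rule ccontr)
    assume a: "~ (?t < s0 | i = i0)"
    then have "s0 < ?t" using ns0[of "Suc i"] by simp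
    then have "real i0 / N < ?t" "?s < real (Suc i0) / N" using i0 that by linarith+
    then have "i0 < Suc i" "i < Suc i0" using Np by (auto simp: divide_less_cancel)
    then show False using a by simp
   qed
   then show "s0 < ?s | i = i0" if "s0 < ?t" using that ns0[of i] by force
  qed
  consider (cross) "i = i0" | (far) "i ~= i0" "\<bar>?s - s0\<bar> >= d" "\<bar>?t - s0\<bar> >= d"
   | (lower) "i ~= i0" "s0 - 2 * d < ?s" "?t < s0" | (upper) "i ~= i0" "s0 < ?s" "?t < s0 + 2 * d"
   using ab1 ab2 ns0[of i] st Nd d by linarith
  then show ?thesis
  proof cases
   case cross
   have e: "\<bar>?s - s0\<bar> <= d / 4" "\<bar>?t - s0\<bar> <= d / 4" using i0(1,2)[folded cross] st Nd by linarith+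
   have o: "s0 - 2 * d < ?s" "?s < s0" "s0 < ?t" "?t < s0 + 2 * d" using i0(1,2)[folded cross] e d by linarith+
   have "loop_sign (cyc Q (quad (f i) (f (Suc i)) (f' (Suc i)) (f' i)) 4 o ?\<mu>) = -1"
   proof (rule quad_links_axis_circle[OF r z])
    show "cmod (fst (f i)) < r" "cmod (fst (f (Suc i))) < r" unfolding fi using o by (auto intro!: near)
    show "z * snd (f i) < 0" unfolding fi by (rule below) (use o in auto)
    then show "z * snd (f' i) <= 0" by (simp add: fi snd')
    show "z * snd (f (Suc i)) > 0" unfolding fi by (rule above) (use o in auto)
    then show "z * snd (f' (Suc i)) >= 0" by (simp add: fi snd')
    show "Re (fst (f' (Suc i))) > r" "Re (fst (f' i)) > r" unfolding fi using e by (auto intro!: Re')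
   qed
   then show ?thesis using cross by (simp add: q_def)
  next
   case far
   then have ff: "f' i = f i" "f' (Suc i) = f (Suc i)" using b0 by (auto simp: fi c'b simp flip: zero_prod_def)
   have "loop_sign (q i o ?\<mu>) = 1"
   proof (rule loop_sign_Re_pos[OF pq[OF i]])
    fix s :: real assume s: "s : {0..1}"
    let ?x = "?\<mu> s"
    have x: "?x : track ?\<mu>" using s by (simp add: path_image_def)
    then have "?x ~: closed_segment (f i) (f (Suc i))" using edge[OF i] by blast
    then obtain p where p: "p > 0" "bracket (Q (f i - ?x)) (Q (f (Suc i) - ?x)) * bracket (Q (f (Suc i) - ?x)) (Q (f i - ?x)) = of_real p"
     by (rule bracket_square_pos)
    have ne: "f i ~= ?x" "f (Suc i) ~= ?x" using \<open>?x ~: closed_segment (f i) (f (Suc i))\<close> by auto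
    have "q i ?x = of_real (p * (2 * norm (f i - ?x)) * (2 * norm (f (Suc i) - ?x)))"
     unfolding q_def cyc_quad ff bracket_self norm_Q using p(2) by (simp add: mult_ac)
    then show "0 < Re ((q i o ?\<mu>) s)" using p(1) ne by (simp del: of_real_mult)
   qed
   then show ?thesis using far by simp
  next
   case lower
   let ?C = "{v::R3. z * snd v < 0}"
   have "?C = UNIV \<times> {x. z * x < 0}" by auto
   then have cC: "convex ?C" using convex_halfspace_lt[of z 0] by (simp add: convex_Times)
   have s: "z * snd (f i) < 0" "z * snd (f (Suc i)) < 0"
   proof -
    have "1 / N > 0" using Np by simp
    then have "?s < s0" "s0 - 2 * d < ?t" using lower st by linarith+
    then show "z * snd (f i) < 0" "z * snd (f (Suc i)) < 0" unfolding fi using lower below by blast+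
   qed
   have "loop_sign (q i o ?\<mu>) = 1" unfolding q_def
   proof (rule cyc_convex[OF cC])
    fix j :: nat assume "j <= 4"
    then show "quad (f i) (f (Suc i)) (f' (Suc i)) (f' i) j : ?C"
     using s less_4_cases[of j] by (cases "j = 4") (auto simp: quad_def eval_nat_numeral fi snd')
   qed (use axis_circle_norm(2)[OF r] in \<open>auto simp: path_image_def\<close>)
   then show ?thesis using lower by simp
  next
   case upper
   let ?C = "{v::R3. z * snd v > 0}"
   have "?C = UNIV \<times> {x. z * x > 0}" by auto
   then have cC: "convex ?C" using convex_halfspace_gt[of 0 z] by (simp add: convex_Times)
   have s: "z * snd (f i) > 0" "z * snd (f (Suc i)) > 0"
   proof -
    have "1 / N > 0" using Np by simp
    then have "?s < s0 + 2 * d" "s0 < ?t" using upper st by linarith+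
    then show "z * snd (f i) > 0" "z * snd (f (Suc i)) > 0" unfolding fi using upper above by blast+
   qed
   have "loop_sign (q i o ?\<mu>) = 1" unfolding q_def
   proof (rule cyc_convex[OF cC])
    fix j :: nat assume "j <= 4"
    then show "quad (f i) (f (Suc i)) (f' (Suc i)) (f' i) j : ?C"
     using s less_4_cases[of j] by (cases "j = 4") (auto simp: quad_def eval_nat_numeral fi snd')
   qed (use axis_circle_norm(2)[OF r] in \<open>auto simp: path_image_def\<close>)
   then show ?thesis using upper by simp
  qed
 qed
 define B where "B u v x = bracket (Q (u - x)) (Q (v - x))" for u v x
 \<comment> \<open>Each chord between the curves occurs twice, in opposite directions, and contributes a positive factor.\<close>
 define p where "p i s = B (f' i) (f i) (?\<mu> s) * B (f i) (f' i) (?\<mu> s)" for i s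
 have pp: "plane_loop (p i)" "loop_sign (p i) = 1" if i: "i < N" for i
 proof -
  have fp: "\<exists>t>0. p i s = of_real t" if "s : {0..1}" for s
  proof -
   have "?\<mu> s : track ?\<mu>" using that by (simp add: path_image_def)
   then have "?\<mu> s ~: closed_segment (f' i) (f i)"
    using chord[of i] i unfolding closed_segment_commute[of "f' i"] by auto
   then obtain t where "t > 0" "bracket (Q (f' i - ?\<mu> s)) (Q (f i - ?\<mu> s)) * bracket (Q (f i - ?\<mu> s)) (Q (f' i - ?\<mu> s)) = of_real t"
    by (rule bracket_square_pos)
   then show ?thesis unfolding p_def B_def by blast
  qed
  define c2 where "c2 j = (if j = (1::nat) then f' i else f i)" for j
  have "p i = cyc Q c2 2 o ?\<mu>" by (simp add: fun_eq_iff p_def B_def cyc_def c2_def eval_nat_numeral)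
  moreover have "plane_loop (cyc Q c2 2 o ?\<mu>)"
  proof (rule cyc_plane_loop)
   fix j :: nat assume "j < 2"
   then have "j = 0 | j = 1" by auto
   then show "track ?\<mu> Int closed_segment (c2 j) (c2 (Suc j)) = {}"
    using chord[of i] i by (auto simp: c2_def closed_segment_commute)
  qed (auto simp: c2_def)
  ultimately show pl: "plane_loop (p i)" by simp
  show "loop_sign (p i) = 1"
  proof (rule loop_sign_Re_pos[OF pl])
   fix s :: real assume "s : {0..1}"
   then obtain t where "t > 0" "p i s = of_real t" using fp by blast
   then show "Re (p i s) > 0" by simp
  qed
 qed
 have prod: "(\<Prod>i<N. (q i o ?\<mu>) s) = ((cyc Q f N o ?\<mu>) s * cnj ((cyc Q f' N o ?\<mu>) s)) * (\<Prod>i<N. p i s)" for s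
 proof -
  let ?x = "?\<mu> s"
  have "(\<Prod>i<N. q i ?x) = (\<Prod>i<N. B (f (Suc i)) (f i) ?x * B (f' (Suc i)) (f (Suc i)) ?x * B (f' i) (f' (Suc i)) ?x * B (f i) (f' i) ?x)"
   unfolding q_def cyc_quad B_def ..
  also have "... = (\<Prod>i<N. B (f (Suc i)) (f i) ?x) * (\<Prod>i<N. B (f' (Suc i)) (f (Suc i)) ?x) * (\<Prod>i<N. B (f' i) (f' (Suc i)) ?x) * (\<Prod>i<N. B (f i) (f' i) ?x)"
   by (simp add: prod.distrib)
  also have "(\<Prod>i<N. B (f' (Suc i)) (f (Suc i)) ?x) = (\<Prod>i<N. B (f' i) (f i) ?x)"
   by (rule prod_shift_cyclic) (simp add: fN)
  also have "(\<Prod>i<N. B (f' i) (f' (Suc i)) ?x) = cnj (cyc Q f' N ?x)"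
   by (simp add: cyc_def B_def bracket_cnj[symmetric])
  also have "(\<Prod>i<N. B (f (Suc i)) (f i) ?x) = cyc Q f N ?x" by (simp add: cyc_def B_def)
  finally show ?thesis by (simp add: p_def prod.distrib mult_ac)
 qed
 have l1: "plane_loop (cyc Q f N o ?\<mu>)" unfolding f_def by (rule mesh_plane_loop[OF fm c(2)]) auto
 have l2: "plane_loop (cyc Q f' N o ?\<mu>)" unfolding f'_def by (rule mesh_plane_loop[OF fm' cl']) auto
 have "(\<Prod>i<N. loop_sign (q i o ?\<mu>)) = (\<Prod>i<N. if i = i0 then -1 else 1)" using sq by (intro prod.cong) auto
 also have "... = -1" using i0(3) by (simp add: prod.delta)
 finally have "-1 = (\<Prod>i<N. loop_sign (q i o ?\<mu>))" by simp
 also have "... = loop_sign (%s. \<Prod>i<N. (q i o ?\<mu>) s)" using pq by (intro loop_sign_prod[symmetric]) auto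
 also have "... = loop_sign (%s. ((cyc Q f N o ?\<mu>) s * cnj ((cyc Q f' N o ?\<mu>) s)) * (\<Prod>i<N. p i s))" unfolding prod ..
 also have "... = loop_sign (cyc Q f N o ?\<mu>) * loop_sign (cyc Q f' N o ?\<mu>) * loop_sign (%s. \<Prod>i<N. p i s)"
  using loop_sign_mult[OF plane_loop_mult[OF l1 plane_loop_cnj[OF l2]] plane_loop_prod[of "{..<N}" p]]
   loop_sign_mult[OF l1 plane_loop_cnj[OF l2]] loop_sign_cnj[OF l2] pp by simp
 also have "loop_sign (%s. \<Prod>i<N. p i s) = 1" using loop_sign_prod[of "{..<N}" p] pp by simp
 finally have "link_sign Q c ?\<mu> * link_sign Q c' ?\<mu> = -1"
  using link_sign_eq[OF dl fm] link_sign_eq[OF dl' fm'] by (simp add: f_def f'_def o_def)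
 then show "link_sign Q c ?\<mu> = - link_sign Q c' ?\<mu>" using link_sign_values[OF dl] link_sign_values[OF dl'] by auto
qed

end

definition flat_disc :: "real => R3 set" where "flat_disc r = {v. cmod (fst v) <= r & snd v = 0}"

definition crosses_plane :: "(real => R3) => real => bool" where
 "crosses_plane c s0 \<longleftrightarrow> (\<exists>z e. (z = 1 | z = -1) & e > (0::real) &
   (\<forall>s. s0 - e < s --> s < s0 --> z * snd (c s) < 0) & (\<forall>s. s0 < s --> s < s0 + e --> z * snd (c s) > 0))"

context isometry_R3 begin

lemma axis_circle_subset_flat_disc: "r > 0 ==> track (axis_circle r) <= flat_disc r"
 using axis_circle_norm by (auto simp: path_image_def flat_disc_def)

text \<open>
 The crossings are pushed out of the disc one by one; a path that misses the disc does not link its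
 boundary.
\<close>

theorem link_sign_axis_circle:
 assumes "path c" "finish c = start c" and r: "r > 0"
  and "finite {s : {0..1}. c s : flat_disc r}"
  and "!!s. s : {0..1} ==> c s : flat_disc r ==> s : {0<..<1} & cmod (fst (c s)) < r & crosses_plane c s"
 shows "link_sign Q c (axis_circle r) = (-1) ^ card {s : {0..1}. c s : flat_disc r}" using assms(1,2,4,5)
proof (induction "card {s : {0..1}. c s : flat_disc r}" arbitrary: c)
 case 0
 then have e: "{s : {0..1}. c s : flat_disc r} = {}" by simp
 then have d: "flat_disc r Int track c = {}" by (auto simp: path_image_def)
 then have "disjoint_loops c (axis_circle r)" using 0 axis_circle_subset_flat_disc[OF r] by (auto simp: disjoint_loops_def)
 moreover have "flat_disc r = cball 0 r \<times> {0}" by (auto simp: flat_disc_def)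
 then have "convex (flat_disc r)" "compact (flat_disc r)" by (simp_all add: convex_Times compact_Times)
 ultimately have "link_sign Q c (axis_circle r) = 1" using link_sign_disc axis_circle_subset_flat_disc[OF r] d by blast
 then show ?case unfolding e by simp
next
 case (Suc n)
 define V where "V = {s : {0..1}. c s : flat_disc r}"
 have cV: "card V = Suc n" using Suc by (simp add: V_def)
 then obtain s0 where s0: "s0 : V" by (metis card.empty ex_in_conv nat.distinct(1))
 then have s0p: "s0 : {0<..<1}" "cmod (fst (c s0)) < r" "crosses_plane c s0" "snd (c s0) = 0"
  using Suc.prems(4)[of s0] by (auto simp: V_def flat_disc_def)
 obtain z e where z: "z = 1 | z = -1" and e: "e > (0::real)"
  "!!s. s0 - e < s ==> s < s0 ==> z * snd (c s) < 0" "!!s. s0 < s ==> s < s0 + e ==> z * snd (c s) > 0"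
  using s0p(3) unfolding crosses_plane_def by metis
 have "continuous_on {0..1} (%s. cmod (fst (c s)))"
  using Suc.prems(1) unfolding path_def by (intro continuous_intros)
 then have "\<exists>d>0. \<forall>s\<in>{0..1}. dist s s0 < d --> dist (cmod (fst (c s))) (cmod (fst (c s0))) < r - cmod (fst (c s0))"
  using s0p by (auto simp: continuous_on_iff)
 then obtain a where a: "a > 0" "!!s. s : {0..1} ==> \<bar>s - s0\<bar> < a ==> cmod (fst (c s)) < r"
  by (fastforce simp: dist_real_def)
 define m where "m = min (min e a) (min s0 (1 - s0))"
 have m: "m > 0" "m <= e" "m <= a" "m <= s0" "m <= 1 - s0" using e(1) a(1) s0p(1) by (auto simp: m_def)
 define d where "d = m / 3"
 have d: "d > 0" "2 * d < e" "2 * d < a" "0 < s0 - 2 * d" "s0 + 2 * d < 1" using m unfolding d_def by linarith+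
 define c' where "c' s = c s + (of_real (4 * r * max 0 (1 - \<bar>s - s0\<bar> / d)), 0)" for s
 have near: "cmod (fst (c s)) < r" if "\<bar>s - s0\<bar> < 2 * d" for s using that d by (intro a(2)) auto
 have below: "z * snd (c s) < 0" if "s0 - 2 * d < s" "s < s0" for s using that d by (intro e) auto
 have above: "z * snd (c s) > 0" if "s0 < s" "s < s0 + 2 * d" for s using that d by (intro e) auto
 have avoid: "track c Int track (axis_circle r) = {}"
 proof -
  have "c s ~= axis_circle r t" if s: "s : {0..1}" for s t
  proof
   assume eq: "c s = axis_circle r t"
   then have "c s : flat_disc r" using axis_circle_norm[OF r] by (simp add: flat_disc_def)
   then show False using Suc.prems(4)[OF s] axis_circle_norm[OF r, of t] eq by simp
  qed
  then show ?thesis unfolding path_image_def by blast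
 qed
 note push = link_sign_push_across[OF Suc.prems(1,2) r z d(1,4,5) near s0p(4) below above avoid, folded c'_def]
 have c'p: "path c'" "finish c' = start c'" using push(1) by (auto simp: disjoint_loops_def)
 have eqc: "c' s = c s" if "\<bar>s - s0\<bar> >= d" for s
  using that d by (simp add: c'_def max_def field_simps flip: zero_prod_def)
 have snd_c': "snd (c' s) = snd (c s)" for s by (simp add: c'_def)
 have V': "{s : {0..1}. c' s : flat_disc r} = V - {s0}"
 proof (intro equalityI subsetI)
  fix s assume s: "s : {s : {0..1}. c' s : flat_disc r}"
  show "s : V - {s0}"
  proof (cases "\<bar>s - s0\<bar> < d")
   case True
   have "s = s0" using below[of s] above[of s] s snd_c'[of s] True d by (force simp: flat_disc_def abs_less_iff)
   moreover have "c' s0 ~: flat_disc r"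
   proof -
    have "Re (fst (c' s0)) > r" using abs_Re_le_cmod[of "fst (c s0)"] s0p(2) r by (simp add: c'_def)
    then show ?thesis using complex_Re_le_cmod[of "fst (c' s0)"] by (auto simp: flat_disc_def)
   qed
   ultimately show ?thesis using s by simp
  next
   case False
   then show ?thesis using s eqc[of s] d by (auto simp: V_def)
  qed
 next
  fix s assume s: "s : V - {s0}"
  then have "snd (c s) = 0" by (simp add: V_def flat_disc_def)
  then have "\<bar>s - s0\<bar> >= 2 * d" using below[of s] above[of s] s by (force simp: abs_less_iff not_le)
  then show "s : {s : {0..1}. c' s : flat_disc r}" using s eqc[of s] d by (auto simp: V_def)
 qed
 have fV: "finite V" using Suc.prems(3) by (simp add: V_def)
 have "link_sign Q c' (axis_circle r) = (-1) ^ card {s : {0..1}. c' s : flat_disc r}"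
 proof (rule Suc.hyps(1)[OF _ c'p])
  show "n = card {s : {0..1}. c' s : flat_disc r}" unfolding V' using cV s0 fV by simp
  show "finite {s : {0..1}. c' s : flat_disc r}" unfolding V' using fV by simp
  fix s assume "s : {0..1}" "c' s : flat_disc r"
  then have s: "s : V" "s ~= s0" using V' by auto
  then have sp: "s : {0<..<1}" "cmod (fst (c s)) < r" "crosses_plane c s" "snd (c s) = 0"
   using Suc.prems(4)[of s] by (auto simp: V_def flat_disc_def)
  have far: "\<bar>s - s0\<bar> >= 2 * d" using below[of s] above[of s] sp s by (force simp: abs_less_iff not_le)
  obtain v u where u: "v = 1 | v = -1" "u > (0::real)"
   "!!t. s - u < t ==> t < s ==> v * snd (c t) < 0" "!!t. s < t ==> t < s + u ==> v * snd (c t) > 0"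
   using sp(3) unfolding crosses_plane_def by metis
  have "crosses_plane c' s" unfolding crosses_plane_def snd_c' using u by blast
  then show "s : {0<..<1} & cmod (fst (c' s)) < r & crosses_plane c' s" using sp eqc[of s] far d by simp
 qed
 then show ?case using push(2) cV s0 fV unfolding V' V_def[symmetric] by simp
qed

end

section \<open>Smooth maps\<close>

lemma C_k_on_SucI:
 assumes "!!x. x : S ==> (f has_derivative D x) (at x)" "!!v. C_k_on k S (%x. D x v)"
 shows "C_k_on (Suc k) S f" using assms by (auto intro!: exI[of _ D])

lemma C_k_on_SucE:
 assumes "C_k_on (Suc k) S f"
 obtains D where "!!x. x : S ==> (f has_derivative D x) (at x)" "!!v. C_k_on k S (%x. D x v)"
 using assms by auto

lemma C_k_on_Suc_imp: "C_k_on (Suc k) S f ==> C_k_on k S f"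
proof (induction k arbitrary: f)
 case 0
 from C_k_on_SucE[OF this] obtain D where "!!x. x : S ==> (f has_derivative D x) (at x)" by metis
 then show ?case by (auto intro!: continuous_at_imp_continuous_on dest: has_derivative_continuous)
next
 case (Suc k)
 obtain D where D: "!!x. x : S ==> (f has_derivative D x) (at x)" "!!v. C_k_on (Suc k) S (%x. D x v)"
  using C_k_on_SucE[OF Suc.prems] by blast
 show ?case by (rule C_k_on_SucI[OF D(1)]) (use Suc.IH D(2) in auto)
qed

lemma C_k_on_const: "C_k_on k S (%x. c)"
proof (induction k arbitrary: c)
 case (Suc k)
 show ?case by (rule C_k_on_SucI[where D = "%x v. 0"]) (auto simp: Suc)
qed auto

lemma C_k_on_bounded_linear: assumes "bounded_linear L" shows "C_k_on k S L"
proof (cases k)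
 case (Suc n)
 then show ?thesis
  using assms by (auto intro!: C_k_on_SucI[where D = "%x. L"] C_k_on_const bounded_linear_imp_has_derivative simp del: C_k_on.simps)
qed (auto intro: linear_continuous_on assms)

lemma C_k_on_add: "C_k_on k S f ==> C_k_on k S g ==> C_k_on k S (%x. f x + g x)"
proof (induction k arbitrary: f g)
 case (Suc k)
 obtain D where D: "!!x. x : S ==> (f has_derivative D x) (at x)" "!!v. C_k_on k S (%x. D x v)"
  using C_k_on_SucE[OF Suc.prems(1)] by blast
 obtain E where E: "!!x. x : S ==> (g has_derivative E x) (at x)" "!!v. C_k_on k S (%x. E x v)"
  using C_k_on_SucE[OF Suc.prems(2)] by blast
 show ?case by (rule C_k_on_SucI[where D = "%x v. D x v + E x v"])
  (use D E Suc.IH in \<open>auto intro: has_derivative_add\<close>)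
qed (auto intro: continuous_intros)

lemma C_k_on_bilinear:
 assumes "bounded_bilinear b"
 shows "C_k_on k S f ==> C_k_on k S g ==> C_k_on k S (%x. b (f x) (g x))"
proof (induction k arbitrary: f g)
 case 0
 then show ?case using bounded_bilinear.continuous_on[OF assms] by auto
next
 case (Suc k)
 obtain D where D: "!!x. x : S ==> (f has_derivative D x) (at x)" "!!v. C_k_on k S (%x. D x v)"
  using C_k_on_SucE[OF Suc.prems(1)] by blast
 obtain E where E: "!!x. x : S ==> (g has_derivative E x) (at x)" "!!v. C_k_on k S (%x. E x v)"
  using C_k_on_SucE[OF Suc.prems(2)] by blast
 show ?case
 proof (rule C_k_on_SucI[where D = "%x v. b (f x) (E x v) + b (D x v) (g x)"])
  have fg: "C_k_on k S f" "C_k_on k S g" using Suc.prems by (auto intro: C_k_on_Suc_imp simp del: C_k_on.simps)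
  show "C_k_on k S (%x. b (f x) (E x v) + b (D x v) (g x))" for v by (intro C_k_on_add Suc.IH fg D E)
 qed (rule bounded_bilinear.FDERIV[OF assms D(1) E(1)])
qed

lemma C_k_on_inverse:
 fixes u :: "'a::euclidean_space => real"
 assumes "!!x. x : S ==> u x ~= 0"
 shows "C_k_on k S u ==> C_k_on k S (%x. inverse (u x))"
proof (induction k)
 case 0
 then show ?case using assms by (auto intro!: continuous_intros)
next
 case (Suc k)
 obtain D where D: "!!x. x : S ==> (u has_derivative D x) (at x)" "!!v. C_k_on k S (%x. D x v)"
  using C_k_on_SucE[OF Suc.prems] by blast
 have I: "C_k_on k S (%x. inverse (u x))" using Suc C_k_on_Suc_imp by blast
 show ?case
 proof (rule C_k_on_SucI[where D = "%x v. (-1) * ((inverse (u x) * D x v) * inverse (u x))"])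
  show "((%x. inverse (u x)) has_derivative (%v. (-1) * ((inverse (u x) * D x v) * inverse (u x)))) (at x)"
   if "x : S" for x using Deriv.has_derivative_inverse[OF assms[OF that] D(1)[OF that]] by simp
  show "C_k_on k S (%x. (-1) * ((inverse (u x) * D x v) * inverse (u x)))" for v
   by (intro C_k_on_bilinear[OF bounded_bilinear_mult] C_k_on_const I D)
 qed
qed

lemma C_k_on_affine:
 fixes f :: "real => 'b::real_normed_vector"
 assumes "!!u. u : S' ==> a + b * u : S"
 shows "C_k_on k S f ==> C_k_on k S' (%u. f (a + b * u))"
proof (induction k arbitrary: f)
 case 0
 then show ?case using assms by (auto intro!: continuous_on_compose2[of S f S' "%u. a + b * u"] continuous_intros)
next
 case (Suc k)
 obtain D where D: "!!x. x : S ==> (f has_derivative D x) (at x)" "!!v. C_k_on k S (%x. D x v)"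
  using C_k_on_SucE[OF Suc.prems] by blast
 show ?case
 proof (rule C_k_on_SucI[where D = "%u v. D (a + b * u) (b * v)"])
  fix u assume u: "u : S'"
  have "((%u. a + b * u) has_derivative (%v. b * v)) (at u)" by (auto intro!: derivative_eq_intros)
  from diff_chain_at[OF this, of f "D (a + b * u)"] D(1)[OF assms[OF u]]
  show "((%u. f (a + b * u)) has_derivative (%v. D (a + b * u) (b * v))) (at u)" by (simp add: o_def)
 next
  show "C_k_on k S' (%u. D (a + b * u) (b * v))" for v using Suc.IH[OF D(2)] .
 qed
qed

lemma C_k_on_subset: "C_k_on k S f ==> S' <= S ==> C_k_on k S' f"
proof (induction k arbitrary: f)
 case (Suc k)
 obtain D where D: "!!x. x : S ==> (f has_derivative D x) (at x)" "!!v. C_k_on k S (%x. D x v)"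
  using C_k_on_SucE[OF Suc.prems(1)] by blast
 show ?case by (rule C_k_on_SucI[where D = D]) (use D Suc in auto)
qed (auto elim: continuous_on_subset)

lemma smooth_on_subset: "smooth_on S f ==> S' <= S ==> smooth_on S' f"
 unfolding smooth_on_def using C_k_on_subset by blast

lemma smooth_on_C1_curve:
 fixes f :: "real => 'b::real_normed_vector"
 assumes "smooth_on S f"
 obtains f' where "!!s. s : S ==> (f has_vector_derivative f' s) (at s)" "continuous_on S f'"
proof -
 have "C_k_on (Suc 0) S f" using assms unfolding smooth_on_def by blast
 then obtain D where D: "!!x. x : S ==> (f has_derivative D x) (at x)" "!!v. C_k_on 0 S (%x. D x v)"
  using C_k_on_SucE by blast
 show ?thesis
 proof (rule that[of "%s. D s 1"])
  fix s assume "s : S"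
  from D(1)[OF this] have d: "(f has_derivative D s) (at s)" .
  have "D s v = v *\<^sub>R D s 1" for v using linear_scale[OF has_derivative_linear[OF d], of v 1] by simp
  then have "D s = (%v. v *\<^sub>R D s 1)" by (rule ext)
  with d show "(f has_vector_derivative D s 1) (at s)" unfolding has_vector_derivative_def by simp
 qed (use D(2) in auto)
qed

lemma tangent_vectors_scale:
 assumes "v : tangent_vectors M p" shows "a *\<^sub>R v : tangent_vectors M p"
proof -
 obtain c e where e: "0 < e" "smooth_on {-e<..<e::real} c" "c ` {-e<..<e} <= M" "c 0 = p"
  "(c has_vector_derivative v) (at 0)" using assms unfolding tangent_vectors_def by blast
 define e' where "e' = e / (\<bar>a\<bar> + 1)"
 have e': "e' > 0" using e(1) by (simp add: e'_def)
 have sub: "0 + a * u : {-e<..<e}" if "u : {-e'<..<e'}" for u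
 proof -
  have "\<bar>a * u\<bar> <= \<bar>a\<bar> * e'" using that by (auto simp: abs_mult intro!: mult_left_mono)
  also have "... < e" using e(1) by (simp add: e'_def field_simps)
  finally show ?thesis by (auto simp: abs_less_iff)
 qed
 have d: "((%u. a * u) has_vector_derivative a) (at 0)"
  by (auto intro!: derivative_eq_intros simp: has_vector_derivative_def mult.commute)
 have "((c o (%u. a * u)) has_vector_derivative a *\<^sub>R v) (at 0)"
  by (rule vector_diff_chain_at[OF d]) (use e(5) in simp)
 moreover have "smooth_on {-e'<..<e'} (%u. c (a * u))" unfolding smooth_on_def
 proof
  fix k have "C_k_on k {-e<..<e} c" using e(2) by (simp add: smooth_on_def)
  from C_k_on_affine[where a = 0 and b = a and S' = "{-e'<..<e'}", OF sub this]
  show "C_k_on k {-e'<..<e'} (%u. c (a * u))" by (simp del: C_k_on.simps)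
 qed
 moreover have "(%u. c (a * u)) ` {-e'<..<e'} <= M" using sub e(3) by auto
 ultimately show ?thesis unfolding tangent_vectors_def
  using e' e(4) by (intro CollectI exI[of _ "%u. c (a * u)"] exI[of _ e']) (auto simp: o_def)
qed

lemma tangent_vectors_local:
 assumes "open U" "p : U" "M Int U <= M'" shows "tangent_vectors M p <= tangent_vectors M' p"
proof
 fix v assume "v : tangent_vectors M p"
 then obtain c e where e: "0 < e" "smooth_on {-e<..<e::real} c" "c ` {-e<..<e} <= M" "c 0 = p"
  "(c has_vector_derivative v) (at 0)" unfolding tangent_vectors_def by blast
 have "isCont c 0" using e(5) has_vector_derivative_continuous by blast
 then have "\<forall>\<^sub>F u in at 0. c u : U" using assms(1,2) e(4) by (metis topological_tendstoD isContD)
 then obtain d where d: "d > 0" "!!u. u ~= 0 ==> \<bar>u\<bar> < d ==> c u : U"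
  unfolding eventually_at by (auto simp: dist_real_def)
 define e' where "e' = min d e"
 have "c u : U" if "\<bar>u\<bar> < e'" for u using d(2)[of u] that e(4) assms(2) by (cases "u = 0") (auto simp: e'_def)
 then have "c ` {-e'<..<e'} <= M'" using e(3) assms(3) by (force simp: e'_def)
 moreover have "smooth_on {-e'<..<e'} c" by (rule smooth_on_subset[OF e(2)]) (auto simp: e'_def)
 ultimately show "v : tangent_vectors M' p" unfolding tangent_vectors_def
  using e d by (intro CollectI exI[of _ c] exI[of _ e']) (auto simp: e'_def)
qed

section \<open>Stereographic coordinates\<close>

definition reflect :: "'a::real_inner => 'a => 'a" where
 "reflect m y = y - (2 * (y \<bullet> m) / (m \<bullet> m)) *\<^sub>R m"

lemma linear_reflect: "linear (reflect m)"
 by (rule linearI) (simp_all add: reflect_def inner_add_left add_divide_distrib algebra_simps)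

lemma reflect_reflect [simp]: "reflect m (reflect m y) = y" by (cases "m = 0") (simp_all add: reflect_def inner_diff_left)

lemma inner_reflect [simp]: "reflect m x \<bullet> reflect m y = x \<bullet> y"
proof (cases "m = 0")
 case False
 then have "m \<bullet> m ~= 0" by simp
 then show ?thesis by (simp add: reflect_def inner_diff_left inner_diff_right inner_commute field_simps)
qed (simp add: reflect_def)

lemma norm_reflect [simp]: "norm (reflect m y) = norm y" by (simp add: norm_eq_sqrt_inner)

lemma reflect_maps: assumes "norm a = norm b" shows "reflect (a - b) a = b"
proof (cases "a = b")
 case False
 have ab: "a \<bullet> a = b \<bullet> b" using assms by (simp add: norm_eq)
 have eq: "(a - b) \<bullet> (a - b) = 2 * (a \<bullet> (a - b))"
  using ab by (simp add: inner_diff_left inner_diff_right inner_commute)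
 have ne: "(a - b) \<bullet> (a - b) ~= 0" using False by simp
 have c: "2 * (a \<bullet> (a - b)) / ((a - b) \<bullet> (a - b)) = 1" unfolding eq[symmetric] by (rule divide_self[OF ne])
 show ?thesis unfolding reflect_def c by simp
qed (simp add: reflect_def)

text \<open>
 A is the orthogonal projection along p0, followed by an isometry from the orthogonal complement of p0 to
 \<open>R3\<close> with inverse B. In these frames, st is the stereographic projection from p0, and un is
 its inverse.
\<close>

locale stereographic =
 fixes p0 :: R4 and A :: "R4 => R3" and B :: "R3 => R4"
 assumes pole: "norm p0 = 1" and linear_A: "linear A" and linear_B: "linear B"
  and AB [simp]: "!!y. A (B y) = y" and BA: "!!x. B (A x) = x - (x \<bullet> p0) *\<^sub>R p0"
  and norm_B [simp]: "!!y. norm (B y) = norm y" and B_pole [simp]: "!!y. B y \<bullet> p0 = 0"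
begin

definition st :: "R4 => R3" where "st x = (1 / (1 - x \<bullet> p0)) *\<^sub>R A x"

definition un :: "R3 => R4" where
 "un y = inverse (1 + y \<bullet> y) *\<^sub>R (2 *\<^sub>R B y + (y \<bullet> y - 1) *\<^sub>R p0)"

lemma pole_inner [simp]: "p0 \<bullet> p0 = 1" using pole by (simp add: norm_eq_1)

lemma A_pole [simp]: "A p0 = 0"
proof -
 have "B (A p0) = 0" by (simp add: BA)
 then have "A (B (A p0)) = A 0" by simp
 then show ?thesis by (simp add: linear_0[OF linear_A])
qed

lemma norm_A: "x : S3 ==> A x \<bullet> A x = 1 - (x \<bullet> p0)\<^sup>2"
proof -
 assume "x : S3"
 then have x: "x \<bullet> x = 1" by (simp add: S3_def norm_eq_1)
 have "A x \<bullet> A x = B (A x) \<bullet> B (A x)" by (simp add: norm_B flip: power2_norm_eq_inner)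
 also have "... = 1 - (x \<bullet> p0)\<^sup>2"
  unfolding BA by (simp add: inner_diff_left inner_diff_right inner_commute x power2_eq_square)
 finally show ?thesis .
qed

lemma pos1: "1 + y \<bullet> y > 0" for y :: R3 by (simp add: add_pos_nonneg)

lemma un_pole: "un y \<bullet> p0 = (y \<bullet> y - 1) / (1 + y \<bullet> y)"
 by (simp add: un_def inner_add_left divide_inverse mult.commute)

lemma one_minus_un_pole: "1 - un y \<bullet> p0 = 2 / (1 + y \<bullet> y)"
 using pos1[of y] by (simp add: un_pole field_simps)

lemma B_inner [simp]: "B y \<bullet> B y = y \<bullet> y" by (simp flip: power2_norm_eq_inner)

lemma un_S3: "un y : S3"
proof -
 have w: "(2 *\<^sub>R B y + w *\<^sub>R p0) \<bullet> (2 *\<^sub>R B y + w *\<^sub>R p0) = 4 * (y \<bullet> y) + w\<^sup>2" for w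
  by (simp add: inner_add_left inner_add_right inner_commute[of p0 "B y"] power2_eq_square)
 have "un y \<bullet> un y = (inverse (1 + y \<bullet> y))\<^sup>2 * (4 * (y \<bullet> y) + (y \<bullet> y - 1)\<^sup>2)"
  unfolding un_def inner_scaleR_left inner_scaleR_right w by (simp add: power2_eq_square)
 also have "4 * (y \<bullet> y) + (y \<bullet> y - 1)\<^sup>2 = (1 + y \<bullet> y)\<^sup>2" by (simp add: power2_eq_square algebra_simps)
 also have "(inverse (1 + y \<bullet> y))\<^sup>2 * (1 + y \<bullet> y)\<^sup>2 = 1"
  using pos1[of y] unfolding power_mult_distrib[symmetric] by simp
 finally have "un y \<bullet> un y = 1" .
 then show ?thesis by (simp add: S3_def norm_eq_1)
qed

lemma un_ne_pole: "un y ~= p0" using one_minus_un_pole[of y] pos1[of y] by auto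

lemma st_un [simp]: "st (un y) = y"
proof -
 have "A (un y) = inverse (1 + y \<bullet> y) *\<^sub>R (2 *\<^sub>R y)"
  by (simp add: un_def linear_scale[OF linear_A] linear_add[OF linear_A])
 then show ?thesis unfolding st_def one_minus_un_pole using pos1[of y] by simp
qed

lemma inner_pole_less_1: assumes "x : S3" "x ~= p0" shows "x \<bullet> p0 < 1"
proof -
 have "x \<bullet> p0 <= 1" using norm_cauchy_schwarz[of x p0] assms pole by (simp add: S3_def)
 moreover have "x \<bullet> p0 ~= 1"
 proof
  assume "x \<bullet> p0 = 1"
  then have "(x - p0) \<bullet> (x - p0) = 0" using assms
   by (simp add: inner_diff_left inner_diff_right inner_commute S3_def norm_eq_1)
  then show False using assms by simp
 qed
 ultimately show ?thesis by simp
qed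

lemma norm_st: assumes "x : S3" "x ~= p0" shows "st x \<bullet> st x = (1 + x \<bullet> p0) / (1 - x \<bullet> p0)"
proof -
 have c: "1 - x \<bullet> p0 > 0" using inner_pole_less_1[OF assms] by simp
 have "st x \<bullet> st x = (1 - (x \<bullet> p0)\<^sup>2) / (1 - x \<bullet> p0)\<^sup>2"
  using norm_A[OF assms(1)] by (simp add: st_def power2_eq_square)
 also have "1 - (x \<bullet> p0)\<^sup>2 = (1 + x \<bullet> p0) * (1 - x \<bullet> p0)" by (simp add: power2_eq_square algebra_simps)
 finally show ?thesis using c by (simp add: power2_eq_square)
qed

lemma un_st [simp]: assumes "x : S3" "x ~= p0" shows "un (st x) = x"
proof -
 define c where "c = x \<bullet> p0"
 have c: "1 - c > 0" using inner_pole_less_1[OF assms] by (simp add: c_def)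
 have n: "st x \<bullet> st x = (1 + c) / (1 - c)" using norm_st[OF assms] by (simp add: c_def)
 have e1: "inverse (1 + (1 + c) / (1 - c)) = (1 - c) / 2" using c by (simp add: field_simps)
 have e2: "(1 + c) / (1 - c) - 1 = 2 * c / (1 - c)" using c by (simp add: field_simps)
 have "B (st x) = (1 / (1 - c)) *\<^sub>R (x - c *\<^sub>R p0)" by (simp add: st_def linear_scale[OF linear_B] BA c_def)
 then have "un (st x) = ((1 - c) / 2) *\<^sub>R (2 *\<^sub>R ((1 / (1 - c)) *\<^sub>R (x - c *\<^sub>R p0)) + (2 * c / (1 - c)) *\<^sub>R p0)"
  unfolding un_def n e1 e2 by simp
 also have "... = x"
 proof -
  have k: "(1 - c) / 2 * (2 * (1 / (1 - c))) = 1" "(1 - c) / 2 * (2 * c / (1 - c)) = c"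
   using c by (simp_all add: field_simps)
  show ?thesis by (simp only: scaleR_add_right scaleR_scaleR k) simp
 qed
 finally show ?thesis .
qed

lemma bounded_linear_A: "bounded_linear A" using linear_A by (simp add: linear_conv_bounded_linear)
lemma bounded_linear_B: "bounded_linear B" using linear_B by (simp add: linear_conv_bounded_linear)

lemma un_smooth:
 assumes "bounded_linear L" shows "smooth_on S (%z. un (L z + c))" unfolding smooth_on_def
proof
 fix k
 have a: "C_k_on k S (%z. L z + c)" by (intro C_k_on_add C_k_on_bounded_linear assms C_k_on_const)
 have i: "C_k_on k S (%z. (L z + c) \<bullet> (L z + c))" by (rule C_k_on_bilinear[OF bounded_bilinear_inner a a])
 have b: "C_k_on k S (%z. B (L z) + B c)"
  by (intro C_k_on_add C_k_on_const C_k_on_bounded_linear bounded_linear_compose[OF bounded_linear_B assms])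
 have eq: "B (L z + c) = B (L z) + B c" for z by (rule linear_add[OF linear_B])
 show "C_k_on k S (%z. un (L z + c))" unfolding un_def diff_conv_add_uminus eq
  by (intro C_k_on_bilinear[OF bounded_bilinear_scaleR] C_k_on_inverse C_k_on_add C_k_on_const b i)
   (use pos1 in \<open>auto simp: less_le\<close>)
qed

lemma un_differentiable: obtains D where "(un has_derivative D) (at y)"
proof -
 have "C_k_on (Suc 0) UNIV un"
  using un_smooth[OF bounded_linear_ident, of UNIV 0] unfolding smooth_on_def by (simp del: C_k_on.simps)
 then show ?thesis using that by (elim C_k_on_SucE) blast
qed

lemma continuous_on_un: "continuous_on S un"
 using un_differentiable has_derivative_continuous by (metis continuous_at_imp_continuous_on)

lemma st_has_derivative:
 assumes "x \<bullet> p0 ~= 1"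
 shows "(st has_derivative (%v. (1 / (1 - x \<bullet> p0)) *\<^sub>R A v + ((v \<bullet> p0) / (1 - x \<bullet> p0)\<^sup>2) *\<^sub>R A x)) (at x)"
proof -
 have "((%x. inverse (1 - x \<bullet> p0) *\<^sub>R A x) has_derivative
   (%v. inverse (1 - x \<bullet> p0) *\<^sub>R A v + (- (inverse (1 - x \<bullet> p0) * (0 - v \<bullet> p0) * inverse (1 - x \<bullet> p0))) *\<^sub>R A x)) (at x)"
  using assms by (intro has_derivative_scaleR Deriv.has_derivative_inverse has_derivative_diff has_derivative_const
   has_derivative_inner_left has_derivative_ident bounded_linear_imp_has_derivative bounded_linear_A) auto
 then show ?thesis unfolding st_def[abs_def] by (simp add: divide_inverse power2_eq_square mult_ac)
qed

lemma continuous_on_st: "p0 ~: S ==> S <= S3 ==> continuous_on S st"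
proof (intro continuous_at_imp_continuous_on ballI)
 fix x assume "p0 ~: S" "S <= S3" "x : S"
 then have "x : S3" "x ~= p0" by auto
 then have "x \<bullet> p0 ~= 1" using inner_pole_less_1[of x] by force
 then show "isCont st x" by (rule has_derivative_continuous[OF st_has_derivative])
qed

lemma homeomorphism_un: "homeomorphism UNIV (S3 - {p0}) un st"
 by (rule homeomorphismI) (use un_S3 un_ne_pole in \<open>auto intro!: continuous_on_un continuous_on_st\<close>)

lemma reflect_frame: "stereographic p0 (%x. reflect m (A x)) (%y. B (reflect m y))"
proof (unfold stereographic_def, intro conjI allI)
 show "linear (%x. reflect m (A x))" using linear_compose[OF linear_A linear_reflect] by (simp add: o_def)
 show "linear (%x. B (reflect m x))" using linear_compose[OF linear_reflect linear_B] by (simp add: o_def)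
qed (auto simp: pole BA)

end

lemma stereographic_change:
 assumes "stereographic p0 A B" "stereographic p0 A' B'"
 shows "orthogonal_transformation (%y. A' (B y))"
  "stereographic.st p0 A' x = A' (B (stereographic.st p0 A x))"
proof -
 interpret F: stereographic p0 A B by fact
 interpret F': stereographic p0 A' B' by fact
 have n: "norm (A' (B y)) = norm y" for y
 proof -
  have "norm (A' (B y)) = norm (B' (A' (B y)))" by simp
  also have "B' (A' (B y)) = B y" using F'.BA[of "B y"] by simp
  finally show ?thesis by simp
 qed
 have l: "linear (%y. A' (B y))" using linear_compose[OF F.linear_B F'.linear_A] by (simp add: o_def)
 show "orthogonal_transformation (%y. A' (B y))" unfolding orthogonal_transformation using l n by auto
 have "A' (B (A x)) = A' x" unfolding F.BA by (simp add: linear_diff[OF F'.linear_A] linear_scale[OF F'.linear_A])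
 then show "F'.st x = A' (B (F.st x))"
  unfolding F.st_def F'.st_def by (simp add: linear_scale[OF F.linear_B] linear_scale[OF F'.linear_A])
qed

lemma stereographic_exists:
 assumes "p0 : S3" shows "\<exists>A B. stereographic p0 A B"
proof -
 define e where "e i = (axis i 1 :: R4)" for i
 have ee: "e i \<bullet> e j = (if i = j then 1 else 0)" for i j by (simp add: e_def inner_axis_axis)
 have n0: "norm p0 = 1" using assms by (simp add: S3_def)
 define H where "H = reflect (p0 - e 4)"
 have lH: "linear H" and HH: "H (H y) = y" and nH: "norm (H y) = norm y" and iH: "H y \<bullet> H z = y \<bullet> z" for y z
  by (simp_all add: H_def linear_reflect)
 have Hp: "H p0 = e 4" unfolding H_def by (rule reflect_maps) (simp add: n0 e_def)
 define a where "a x = (Complex (x $ 1) (x $ 2), x $ 3)" for x :: R4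
 define b where "b y = Re (fst y) *\<^sub>R e 1 + Im (fst y) *\<^sub>R e 2 + snd y *\<^sub>R e 3" for y :: R3
 have la: "linear a" by (rule linearI) (auto simp: a_def complex_eq_iff)
 have lb: "linear b" by (rule linearI) (auto simp: b_def algebra_simps)
 have comp: "b y $ 1 = Re (fst y)" "b y $ 2 = Im (fst y)" "b y $ 3 = snd y" "b y $ 4 = 0" for y
  by (simp_all add: b_def e_def axis_def)
 have ab: "a (b y) = y" for y unfolding a_def comp by (simp add: prod_eq_iff)
 have ba: "b (a x) = x - (x \<bullet> e 4) *\<^sub>R e 4" for x
 proof -
  have "x \<bullet> e 4 = x $ 4" by (simp add: e_def inner_axis)
  then show ?thesis unfolding vec_eq_iff forall_4 by (simp add: b_def a_def e_def axis_def)
 qed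
 have nb: "norm (b y) = norm y" for y
 proof -
  have "b y \<bullet> b y = y \<bullet> y"
   unfolding inner_R3 by (simp add: b_def inner_add_left inner_add_right ee power2_eq_square)
  then show ?thesis by (simp add: norm_eq_sqrt_inner)
 qed
 have "stereographic p0 (%x. a (H x)) (%y. H (b y))"
 proof (unfold stereographic_def, intro conjI allI)
  show "linear (%x. a (H x))" using linear_compose[OF lH la] by (simp add: o_def)
  show "linear (%y. H (b y))" using linear_compose[OF lb lH] by (simp add: o_def)
  show "H (b (a (H x))) = x - (x \<bullet> p0) *\<^sub>R p0" for x
  proof -
   have "H (e 4) = p0" using Hp HH by metis
   moreover have "H x \<bullet> e 4 = x \<bullet> p0" using iH[of x p0] Hp by simp
   ultimately show ?thesis unfolding ba linear_diff[OF lH] linear_scale[OF lH] HH by simp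
  qed
  show "H (b y) \<bullet> p0 = 0" for y
  proof -
   have "H (b y) \<bullet> p0 = b y \<bullet> e 4" using iH[of "b y" "H p0"] unfolding HH unfolding Hp .
   also have "... = 0" by (simp add: b_def inner_add_left ee)
   finally show ?thesis .
  qed
 qed (simp_all add: n0 HH ab nH nb)
 then show ?thesis by blast
qed

section \<open>Straightening a curve\<close>

text \<open>
 In suitable stereographic coordinates around an interior point q of M, the curve M is the graph
 of g over the third coordinate axis. The map tube_map straightens it to the axis; it is only a
 homeomorphism, while differentiability of g is needed to compare tangent vectors.
\<close>

locale tube = stereographic p0 A B for p0 A B +
 fixes M :: "R4 set" and q :: R4 and g g' :: "real => complex" and \<delta> :: real
 assumes M_S3: "M <= S3" and centre: "q : S3" "q ~= p0" and \<delta>: "\<delta> > 0" and g0 [simp]: "g 0 = 0" and g'0 [simp]: "g' 0 = 0"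
  and g_deriv: "!!t. \<bar>t\<bar> < \<delta> ==> (g has_vector_derivative g' t) (at t)"
  and in_M: "!!w t. cmod w < \<delta> ==> \<bar>t\<bar> < \<delta> ==> un ((w + g t, t) + st q) : M \<longleftrightarrow> w = 0"
  and tangent: "!!t D. \<bar>t\<bar> < \<delta> ==> (un has_derivative D) (at ((g t, t) + st q)) ==>
   D (g' t, 1) : tangent_vectors M (un ((g t, t) + st q))"

text \<open>
 A reflection of the coordinates makes the velocity of the chart at q vertical. Then the height is a
 local parameter of the curve, which is thus a graph over the vertical axis with horizontal derivative
 zero at q. That a neighbourhood of q contains no other part of M holds because the chart is a
 homeomorphism onto a relatively open set.
\<close>

theorem tube_exists:
 assumes M: "M <= S3" "manifold_interior_point M q" and p0: "p0 : S3" "p0 ~= q"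
 shows "\<exists>A B g g' dl. tube p0 A B M q g g' dl"
proof -
 obtain U h j where U: "open U" and sm: "smooth_on {-1<..<1::real} h" and h0: "h 0 = q"
  and hom: "homeomorphism {-1<..<1} (M Int U) h j"
  and ne0: "!!t. t : {-1<..<1} ==> vector_derivative h (at t) ~= 0"
  using M(2) unfolding manifold_interior_point_def by blast
 obtain h' where h': "!!s. s : {-1<..<1} ==> (h has_vector_derivative h' s) (at s)" "continuous_on {-1<..<1} h'"
  using smooth_on_C1_curve[OF sm] by metis
 have hM: "h s : M" if "s : {-1<..<1}" for s using hom that by (auto simp: homeomorphism_def)
 have h'0: "h' 0 ~= 0" using ne0[of 0] h'(1)[of 0] vector_derivative_at by force
 have q: "q : S3" using M(1) hM[of 0] h0 by auto
 obtain A1 B1 where F1: "stereographic p0 A1 B1" using stereographic_exists[OF p0(1)] by blast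
 interpret F1: stereographic p0 A1 B1 by fact
 have ch: "continuous_on {-1<..<1} h" using hom by (simp add: homeomorphism_def)
 have "\<forall>\<^sub>F s in at 0. h s ~= p0"
 proof -
  have "isCont h 0" using h'(1)[of 0] has_vector_derivative_continuous by force
  then have "(h \<longlongrightarrow> q) (at 0)" using h0 by (simp add: isCont_def)
  then have "\<forall>\<^sub>F s in at 0. h s : - {p0}" using p0 by (intro topological_tendstoD) auto
  then show ?thesis by simp
 qed
 then obtain e0 where e0: "e0 > 0" "!!s. s ~= 0 ==> \<bar>s\<bar> < e0 ==> h s ~= p0"
  unfolding eventually_at by (auto simp: dist_real_def)
 define e1 where "e1 = min e0 1"
 have "h s ~= p0" if "\<bar>s\<bar> < e0" for s using e0(2)[of s] that h0 p0 by (cases "s = 0") auto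
 then have e1: "e1 > 0" "e1 <= 1" "!!s. \<bar>s\<bar> < e1 ==> h s ~= p0" using e0(1) by (auto simp: e1_def)
 have ne1: "1 - h s \<bullet> p0 ~= 0" "h s \<bullet> p0 ~= 1" if "\<bar>s\<bar> < e1" for s
  using F1.inner_pole_less_1[of "h s"] hM[of s] M(1) that e1 by force+
 have hS: "h s : S3" "h s ~= p0" if "\<bar>s\<bar> < e1" for s
 proof -
  have "s : {-1<..<1}" using that e1(2) by auto
  then show "h s : S3" using hM M(1) by blast
 qed (rule e1(3)[OF that])
 define l1 where "l1 s = F1.st (h s) - F1.st q" for s
 define l1' where "l1' s = (1 / (1 - h s \<bullet> p0)) *\<^sub>R A1 (h' s) + ((h' s \<bullet> p0) / (1 - h s \<bullet> p0)\<^sup>2) *\<^sub>R A1 (h s)" for s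
 have d1: "(l1 has_vector_derivative l1' s) (at s)" if "\<bar>s\<bar> < e1" for s
 proof -
  have "(h has_vector_derivative h' s) (at s)" using that e1 by (intro h') auto
  moreover have "(F1.st has_derivative (%v. (1 / (1 - h s \<bullet> p0)) *\<^sub>R A1 v + ((v \<bullet> p0) / (1 - h s \<bullet> p0)\<^sup>2) *\<^sub>R A1 (h s))) (at (h s) within range h)"
   by (rule has_derivative_at_withinI[OF F1.st_has_derivative]) (use ne1[OF that] in auto)
  ultimately have "((F1.st o h) has_vector_derivative l1' s) (at s)"
   unfolding l1'_def by (rule vector_derivative_diff_chain_within)
  then show ?thesis unfolding l1_def[abs_def] o_def by (auto intro!: derivative_eq_intros)
 qed
 have cA: "continuous_on S (%s. A1 (f s))" if "continuous_on S f" for S and f :: "real => R4"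
  by (rule continuous_on_compose2[OF linear_continuous_on[OF F1.bounded_linear_A, of UNIV] that]) auto
 have sub1: "{-e1<..<e1} <= {-1<..<1}" using e1 by auto
 have c1: "continuous_on {-e1<..<e1} l1'"
  unfolding l1'_def using ne1 continuous_on_subset[OF h'(2) sub1] continuous_on_subset[OF ch sub1]
  by (auto intro!: continuous_intros cA)
 have "l1' 0 ~= 0"
 proof
  assume z: "l1' 0 = 0"
  obtain D where D: "(F1.un has_derivative D) (at (F1.st q))" by (rule F1.un_differentiable)
  have "((%s. l1 s + F1.st q) has_vector_derivative 0) (at 0)"
   using d1[of 0] e1 z by (auto intro!: derivative_eq_intros)
  moreover have "(F1.un has_derivative D) (at (l1 0 + F1.st q) within range (%s. l1 s + F1.st q))"
   using D h0 by (auto simp: l1_def intro: has_derivative_at_withinI)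
  ultimately have "((F1.un o (%s. l1 s + F1.st q)) has_vector_derivative D 0) (at 0)"
   by (rule vector_derivative_diff_chain_within)
  then have "(h has_vector_derivative D 0) (at 0)"
  proof (rule has_vector_derivative_transform_within_open)
   show "open {-e1<..<e1}" "0 : {-e1<..<e1}" using e1 by auto
   fix s assume s: "s : {-e1<..<e1}"
   then have "\<bar>s\<bar> < e1" by auto
   then have "h s : S3" "h s ~= p0" by (rule hS)+
   then show "(F1.un o (%s. l1 s + F1.st q)) s = h s" by (simp add: l1_def)
  qed
  moreover have "D 0 = 0" using D has_derivative_linear linear_0 by blast
  ultimately show False using h'0 h'(1)[of 0] vector_derivative_unique_at by force
 qed
 define a where "a = norm (l1' 0)"
 have a: "a > 0" using \<open>l1' 0 ~= 0\<close> by (simp add: a_def)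
 define m where "m = l1' 0 - (0, a)"
 define A B where "A = (%x. reflect m (A1 x))" and "B = (%y. B1 (reflect m y))"
 have F: "stereographic p0 A B" unfolding A_def B_def by (rule F1.reflect_frame)
 interpret F: stereographic p0 A B by fact
 have stF: "F.st x = reflect m (F1.st x)" for x
  unfolding F.st_def F1.st_def by (simp add: A_def linear_scale[OF linear_reflect])
 define l l' where "l s = F.st (h s) - F.st q" and "l' s = reflect m (l1' s)" for s
 have leq: "l s = reflect m (l1 s)" for s by (simp add: l_def l1_def stF linear_diff[OF linear_reflect])
 have bl: "bounded_linear (reflect m)" for m :: R3 unfolding linear_conv_bounded_linear[symmetric] by (rule linear_reflect)
 have d: "(l has_vector_derivative l' s) (at s)" if "\<bar>s\<bar> < e1" for s
  unfolding leq[abs_def] l'_def by (rule bounded_linear.has_vector_derivative[OF bl d1[OF that]])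
 have c: "continuous_on {-e1<..<e1} l'"
  unfolding l'_def by (rule continuous_on_compose2[OF linear_continuous_on[OF bl, of UNIV] c1]) auto
 have l'0: "l' 0 = (0, a)" unfolding l'_def m_def by (rule reflect_maps) (use a in \<open>simp add: a_def\<close>)
 have l0: "l 0 = 0" by (simp add: l_def h0)
 define ta ta' where "ta s = snd (l s)" and "ta' s = snd (l' s)" for s
 have dta: "(ta has_field_derivative ta' s) (at s)" if "\<bar>s\<bar> < e1" for s
  using bounded_linear.has_vector_derivative[OF bounded_linear_snd d[OF that]]
  unfolding ta_def[abs_def] ta'_def by (simp add: has_real_derivative_iff_has_vector_derivative)
 have "continuous_on {-e1<..<e1} ta'" unfolding ta'_def using c by (intro continuous_intros)
 then have "isCont ta' 0" using e1 by (simp add: continuous_on_eq_continuous_at)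
 then have "(ta' \<longlongrightarrow> a) (at 0)" using l'0 by (simp add: isCont_def ta'_def)
 then have "\<forall>\<^sub>F s in at 0. ta' s > 0" using a by (rule order_tendstoD)
 then obtain e2 where e2: "e2 > 0" "!!s. s ~= 0 ==> \<bar>s\<bar> < e2 ==> ta' s > 0"
  unfolding eventually_at by (auto simp: dist_real_def)
 define e where "e = min e1 e2 / 2"
 have e: "e > 0" "e < e1" "e < 1" using e1 e2 by (auto simp: e_def)
 have pos: "ta' s > 0" if "\<bar>s\<bar> <= e" for s
  using e2(2)[of s] that e1 e2(1) a l'0 by (cases "s = 0") (auto simp: e_def ta'_def)
 have mono: "ta s < ta t" if "-e <= s" "s < t" "t <= e" for s t by (rule DERIV_pos_imp_increasing[OF that(2)])
   (use that e dta pos in \<open>force intro!: exI\<close>)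
 have ta0: "ta 0 = 0" by (simp add: ta_def l0)
 define lo hi where "lo = ta (-e)" and "hi = ta e"
 have lohi: "lo < 0" "0 < hi" using mono[of "-e" 0] mono[of 0 e] e ta0 by (auto simp: lo_def hi_def)
 have inj: "inj_on ta {-e..e}" by (rule linorder_inj_onI) (use mono in \<open>force+\<close>)
 define \<theta> where "\<theta> = the_inv_into {-e..e} ta"
 have \<theta>ta: "\<theta> (ta s) = s" if "s : {-e..e}" for s unfolding \<theta>_def by (rule the_inv_into_f_f[OF inj that])
 have cta: "isCont ta s" if "\<bar>s\<bar> <= e" for s using dta[of s] that e by (intro DERIV_isCont) auto
 have \<theta>: "\<theta> t : {-e<..<e}" "ta (\<theta> t) = t" if "lo < t" "t < hi" for t
 proof -
  have "\<exists>s\<ge>-e. s <= e & ta s = t"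
   by (rule IVT) (use that cta e in \<open>auto simp: lo_def hi_def\<close>)
  then obtain s where s: "-e <= s" "s <= e" "ta s = t" by blast
  moreover have "s ~= -e" "s ~= e" using s that by (auto simp: lo_def hi_def)
  ultimately show "\<theta> t : {-e<..<e}" "ta (\<theta> t) = t" using \<theta>ta[of s] by auto
 qed
 have \<theta>0: "\<theta> 0 = 0" using \<theta>ta[of 0] ta0 e by simp
 have d\<theta>: "(\<theta> has_field_derivative inverse (ta' (\<theta> t))) (at t)" if t: "lo < t" "t < hi" for t
 proof (rule DERIV_inverse_function[of ta _ _ _ lo hi])
  have th: "\<theta> t : {-e<..<e}" "ta (\<theta> t) = t" using \<theta> t by auto
  show "(ta has_real_derivative ta' (\<theta> t)) (at (\<theta> t))" using th e by (intro dta) auto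
  show "ta' (\<theta> t) ~= 0" using pos[of "\<theta> t"] th by force
  have "isCont \<theta> (ta (\<theta> t))" by (rule isCont_inverse_function2[of "-e" _ e]) (use th \<theta>ta cta in auto)
  then show "isCont \<theta> t" using th by simp
 qed (use t \<theta> in auto)
 define g g' where "g t = fst (l (\<theta> t))" and "g' t = inverse (ta' (\<theta> t)) *\<^sub>R fst (l' (\<theta> t))" for t
 have l\<theta>: "(g t, t) = l (\<theta> t)" if "lo < t" "t < hi" for t
  using \<theta>[OF that] by (simp add: g_def ta_def prod_eq_iff)
 have dg: "(g has_vector_derivative g' t) (at t)" if t: "lo < t" "t < hi" for t
 proof -
  have a1: "(l has_vector_derivative l' (\<theta> t)) (at (\<theta> t))" using \<theta>[OF t] e by (intro d) auto
  have a2: "(\<theta> has_vector_derivative inverse (ta' (\<theta> t))) (at t)"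
   using d\<theta>[OF t] by (simp add: has_real_derivative_iff_has_vector_derivative)
  have "((l o \<theta>) has_vector_derivative inverse (ta' (\<theta> t)) *\<^sub>R l' (\<theta> t)) (at t)"
   by (rule vector_diff_chain_at[OF a2 a1])
  from bounded_linear.has_vector_derivative[OF bounded_linear_fst this]
  show ?thesis by (simp add: g_def[abs_def] g'_def o_def)
 qed
 have "openin (top_of_set (M Int U)) ((M Int U) Int j -` {-e<..<e})"
  using hom by (intro continuous_openin_preimage_gen) (auto simp: homeomorphism_def)
 then obtain O' where O': "open O'" "(M Int U) Int j -` {-e<..<e} = M Int U Int O'" unfolding openin_open by blast
 have j: "j (h s) = s" if "s : {-1<..<1}" for s using hom that by (simp add: homeomorphism_def)
 have qUO: "q : U Int O'"
 proof -
  have "q : M Int U" using hom h0 by (force simp: homeomorphism_def)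
  moreover have "j q = 0" using j[of 0] h0 by simp
  ultimately have "q : (M Int U) Int j -` {-e<..<e}" using e by simp
  then show ?thesis using O' by blast
 qed
 define K where "K v = F.un ((fst v + g (snd v), snd v) + F.st q)" for v
 have "isCont g 0" using dg[of 0] lohi has_vector_derivative_continuous by force
 then have "isCont (%v. g (snd v)) (0::complex, 0::real)" by (intro isCont_o2[of _ snd g]) (auto intro: continuous_intros)
 then have i1: "isCont (%v. (fst v + g (snd v), snd v) + F.st q) (0, 0)" by (intro continuous_intros) auto
 have i2: "isCont F.un y" for y using F.continuous_on_un[of UNIV] continuous_on_eq_continuous_at[OF open_UNIV] by blast
 have "isCont K (0, 0)" unfolding K_def by (rule isCont_o2[OF i1 i2])
 moreover have K0: "K (0, 0) = q" using q p0 by (simp add: K_def g_def \<theta>0 l0 flip: zero_prod_def)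
 ultimately have "(K \<longlongrightarrow> q) (at (0, 0))" by (simp add: isCont_def)
 then have "\<forall>\<^sub>F v in at (0, 0). K v : U Int O'" using U O' qUO by (intro topological_tendstoD) auto
 then obtain d0 where d0: "d0 > 0" "!!v. v ~= (0, 0) ==> dist v (0, 0) < d0 ==> K v : U Int O'"
  unfolding eventually_at by auto
 define dl where "dl = min (min (-lo) hi) (d0 / 2)"
 have dl: "dl > 0" "dl <= -lo" "dl <= hi" using lohi d0 by (auto simp: dl_def)
 have KU: "K (w, t) : U Int O'" if "cmod w < dl" "\<bar>t\<bar> < dl" for w t
 proof (cases "(w, t) = (0, 0)")
  case False
  have "dist (w, t) (0, 0) <= cmod w + \<bar>t\<bar>" using norm_Pair_le[of w t] by (simp add: dist_norm)
  also have "... < d0" using that by (auto simp: dl_def)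
  finally show ?thesis using d0(2) False by blast
 qed (use K0 qUO in simp)
 have "tube p0 A B M q g g' dl"
 proof unfold_locales
  show "M <= S3" "q : S3" "q ~= p0" "dl > 0" using M(1) q p0 dl by auto
  show "g 0 = 0" by (simp add: g_def \<theta>0 l0)
  show "g' 0 = 0" by (simp add: g'_def \<theta>0 l'0)
  fix t :: real assume t: "\<bar>t\<bar> < dl"
  then have tt: "lo < t" "t < hi" using dl by auto
  show "(g has_vector_derivative g' t) (at t)" by (rule dg[OF tt])
  have th: "\<theta> t : {-e<..<e}" "\<theta> t : {-1<..<1}" "\<bar>\<theta> t\<bar> < e1" using \<theta>[OF tt] e by auto
  have on_curve: "F.un ((g t, t) + F.st q) = h (\<theta> t)"
   using l\<theta>[OF tt] hM[OF th(2)] M(1) e1(3)[OF th(3)] by (auto simp: l_def)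
  show "F.un ((w + g t, t) + F.st q) : M \<longleftrightarrow> w = 0" if w: "cmod w < dl" for w
  proof
   assume "w = 0" then show "F.un ((w + g t, t) + F.st q) : M" using on_curve hM[OF th(2)] by simp
  next
   assume "F.un ((w + g t, t) + F.st q) : M"
   moreover have "F.un ((w + g t, t) + F.st q) = K (w, t)" by (simp add: K_def)
   ultimately have "K (w, t) : (M Int U) Int j -` {-e<..<e}" using KU[OF w t] O'(2) by auto
   then obtain s where s: "s : {-e<..<e}" "h s = K (w, t)" using hom by (auto simp: homeomorphism_def)
   then have "l s = (w + g t, t)" by (simp add: l_def K_def)
   moreover from this have "s = \<theta> t" using \<theta>ta[of s] s by (simp add: ta_def)
   ultimately show "w = 0" using l\<theta>[OF tt] by simp
  qed
  fix D assume D: "(F.un has_derivative D) (at ((g t, t) + F.st q))"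
  have lD: "linear D" using D has_derivative_linear by blast
  have "((%s. l s + F.st q) has_vector_derivative l' (\<theta> t)) (at (\<theta> t))"
   using d[OF th(3)] by (auto intro!: derivative_eq_intros)
  moreover have "(F.un has_derivative D) (at (l (\<theta> t) + F.st q) within range (%s. l s + F.st q))"
   using D l\<theta>[OF tt] by (auto intro: has_derivative_at_withinI)
  ultimately have "((F.un o (%s. l s + F.st q)) has_vector_derivative D (l' (\<theta> t))) (at (\<theta> t))"
   by (rule vector_derivative_diff_chain_within)
  then have "(h has_vector_derivative D (l' (\<theta> t))) (at (\<theta> t))"
  proof (rule has_vector_derivative_transform_within_open)
   show "open {-e1<..<e1}" "\<theta> t : {-e1<..<e1}" using th by auto
   fix s assume s: "s : {-e1<..<e1}"
   then have "\<bar>s\<bar> < e1" by auto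
   then have "h s : S3" "h s ~= p0" by (rule hS)+
   then show "(F.un o (%s. l s + F.st q)) s = h s" by (simp add: l_def)
  qed
  moreover have "D (l' (\<theta> t)) = ta' (\<theta> t) *\<^sub>R D (g' t, 1)"
  proof -
   have "ta' (\<theta> t) > 0" using pos[of "\<theta> t"] th by auto
   then have "l' (\<theta> t) = ta' (\<theta> t) *\<^sub>R (g' t, 1)" by (simp add: g'_def ta'_def prod_eq_iff)
   then show ?thesis using linear_scale[OF lD] by metis
  qed
  ultimately have dd: "(h has_vector_derivative ta' (\<theta> t) *\<^sub>R D (g' t, 1)) (at (\<theta> t))" by simp
  define b where "b = 1 - \<bar>\<theta> t\<bar>"
  have b: "b > 0" using th by (auto simp: b_def)
  have sh: "\<theta> t + 1 * u : {-1<..<1}" if "u : {-b<..<b}" for u using that by (auto simp: b_def)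
  have "ta' (\<theta> t) *\<^sub>R D (g' t, 1) : tangent_vectors M (h (\<theta> t))" unfolding tangent_vectors_def
  proof (intro CollectI exI conjI)
   show "0 < b" by (rule b)
   show "smooth_on {-b<..<b} (%u. h (\<theta> t + 1 * u))"
    unfolding smooth_on_def using C_k_on_affine[OF sh] sm[unfolded smooth_on_def] by blast
   show "(%u. h (\<theta> t + 1 * u)) ` {-b<..<b} <= M" using sh hM by blast
   have "((%u. \<theta> t + 1 * u) has_vector_derivative 1) (at 0)" by (auto intro!: derivative_eq_intros)
   from vector_diff_chain_at[OF this, of h] dd
   show "((%u. h (\<theta> t + 1 * u)) has_vector_derivative ta' (\<theta> t) *\<^sub>R D (g' t, 1)) (at 0)" by (simp add: o_def)
  qed simp
  from tangent_vectors_scale[OF this, of "inverse (ta' (\<theta> t))"] pos[of "\<theta> t"] th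
  have "D (g' t, 1) : tangent_vectors M (h (\<theta> t))" by (auto simp: less_le)
  then show "D (g' t, 1) : tangent_vectors M (F.un ((g t, t) + F.st q))" using on_curve by simp
 qed
 then show ?thesis by blast
qed

lemma winding_number_unit_circle: "winding_number (%s. turn s) 0 = 1" "plane_loop (%s. turn s)"
proof -
 have "winding_number (%s. turn s) 0 = winding_number (circlepath 0 1) 0"
  by (rule winding_number_cong) (simp add: circlepath cis_conv_exp mult_ac)
 then show "winding_number (%s. turn s) 0 = 1" by (simp add: winding_number_circlepath_centre)
 show "plane_loop (%s. turn s)"
  by (auto simp: plane_loop_def path_def path_image_def pathstart_def pathfinish_def intro!: continuous_intros)
qed

lemma winding_number_scaled_circle:
 assumes "a ~= 0"
 shows "winding_number (%s. a * turn s) 0 = 1" "winding_number (%s. a * cnj (turn s)) 0 = -1"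
proof -
 have c: "plane_loop (%s. a)" using assms by (auto simp: plane_loop_def path_def path_image_def pathstart_def pathfinish_def)
 have c0: "winding_number (%s::real. a) 0 = 0"
  using winding_number_trivial[of 0 a] assms unfolding linepath_refl by auto
 note u = winding_number_unit_circle
 show "winding_number (%s. a * turn s) 0 = 1" using winding_number_mult[OF c u(2)] c0 u(1) by simp
 have "winding_number (cnj o (%s. turn s)) (cnj 0) = - cnj (winding_number (%s. turn s) 0)"
  by (rule winding_number_cnj) (use u(2) in \<open>auto simp: plane_loop_def\<close>)
 then have "winding_number (rim cnj) 0 = -1" using u(1) by (simp add: o_def)
 then show "winding_number (%s. a * cnj (turn s)) 0 = -1"
  using winding_number_mult[OF c plane_loop_cnj[OF u(2)]] c0 by simp
qed

text \<open>
 W z = a * z + b * cnj z, where injectivity means that a and b have different modulus; the larger term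
 decides.
\<close>

lemma winding_number_real_linear:
 fixes W :: "complex => complex"
 assumes W: "linear W" "inj W" and r: "r > 0"
 shows "winding_number (rim (%z. W (of_real r * z))) 0 : {1, -1}"
proof -
 define a b where "a = (W 1 - \<i> * W \<i>) / 2" and "b = (W 1 + \<i> * W \<i>) / 2"
 have Wab: "W z = a * z + b * cnj z" for z
 proof -
  have "z = Re z *\<^sub>R 1 + Im z *\<^sub>R \<i>" by (simp add: complex_eq_iff)
  then have "W z = W (Re z *\<^sub>R 1 + Im z *\<^sub>R \<i>)" by (rule arg_cong)
  also have "... = of_real (Re z) * W 1 + of_real (Im z) * W \<i>"
   by (simp only: linear_add[OF W(1)] linear_scale[OF W(1)]) (simp only: scaleR_conv_of_real)
  also have "... = a * z + b * cnj z" by (simp add: a_def b_def complex_eq_iff field_simps)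
  finally show ?thesis .
 qed
 have "cmod a ~= cmod b"
 proof
  assume ab: "cmod a = cmod b"
  show False
  proof (cases "a = 0")
   case True
   then have "b = 0" using ab by simp
   then have "W 1 = W 0" using True unfolding Wab[of 1] Wab[of 0] by simp
   from injD[OF W(2) this] show False by simp
  next
   case False
   define z where "z = csqrt (- b / a)"
   have z2: "z ^ 2 = - b / a" by (simp add: z_def)
   have "cmod (z ^ 2) = 1" unfolding z2 using ab False by (auto simp: norm_divide)
   then have n: "cmod z = 1" using norm_ge_zero[of z] by (auto simp add: norm_power power2_eq_1_iff)
   then have "z * cnj z = 1" by (simp flip: complex_norm_square)
   moreover have "z * (a * z + b * cnj z) = a * z ^ 2 + b * (z * cnj z)" by (simp add: power2_eq_square algebra_simps)
   ultimately have "z * (a * z + b * cnj z) = 0" using False by (simp add: z2)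
   then have "z * W z = 0" unfolding Wab[of z] .
   moreover have "z ~= 0" using n by auto
   ultimately have "W z = 0" by simp
   moreover have "W 0 = 0" unfolding Wab[of 0] by simp
   ultimately have "W z = W 0" by simp
   from injD[OF W(2) this] show False using \<open>z ~= 0\<close> by simp
  qed
 qed
 define L where "L s = W (of_real r * turn s)" for s
 have L: "L s = (a * of_real r) * turn s + (b * of_real r) * cnj (turn s)" for s
  unfolding L_def Wab[of "of_real r * turn s"] by (simp add: algebra_simps)
 have pL: "path L" unfolding L path_def by (intro continuous_intros)
 have cL: "finish L = start L" by (simp add: L_def pathfinish_def pathstart_def)
 show ?thesis
 proof (cases "cmod a > cmod b")
  case True
  then have "a * of_real r ~= 0" using r by auto
  moreover have "winding_number L 0 = winding_number (%s. (a * of_real r) * turn s) 0"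
  proof (rule winding_number_nearby_loops_eq[OF _ pL _ cL])
   show "path (%s. (a * of_real r) * turn s)" unfolding path_def by (intro continuous_intros)
   show "cmod (L s - (a * of_real r) * turn s) < cmod ((a * of_real r) * turn s - 0)" for s
    unfolding L using True r by (simp add: norm_mult)
  qed (simp add: pathfinish_def pathstart_def)
  ultimately show ?thesis using winding_number_scaled_circle(1) by (simp add: L_def[symmetric])
 next
  case False
  then have ab: "cmod b > cmod a" using \<open>cmod a ~= cmod b\<close> by simp
  then have "b * of_real r ~= 0" using r by auto
  moreover have "winding_number L 0 = winding_number (%s. (b * of_real r) * cnj (turn s)) 0"
  proof (rule winding_number_nearby_loops_eq[OF _ pL _ cL])
   show "path (%s. (b * of_real r) * cnj (turn s))" unfolding path_def by (intro continuous_intros)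
   show "cmod (L s - (b * of_real r) * cnj (turn s)) < cmod ((b * of_real r) * cnj (turn s) - 0)" for s
    unfolding L using ab r by (simp add: norm_mult)
  qed (simp add: pathfinish_def pathstart_def)
  ultimately show ?thesis using winding_number_scaled_circle(2) by (simp add: L_def[symmetric])
 qed
qed

context tube begin

definition coord :: "R4 => R3" where "coord x = st x - st q"

definition tube_map :: "R3 => R4" where "tube_map v = un ((fst v + g (snd v), snd v) + st q)"

definition region :: "real => R4 set" where "region h = tube_map ` (ball 0 h \<times> ball 0 h)"

definition flat :: "real => complex => R4" where "flat r z = un ((of_real r * z, 0) + st q)"

lemma tube_map_S3: "tube_map v : S3" "tube_map v ~= p0" by (simp_all add: tube_map_def un_S3 un_ne_pole)

lemma coord_tube_map [simp]: "coord (tube_map v) = (fst v + g (snd v), snd v)" by (simp add: coord_def tube_map_def)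

lemma tube_map_coord:
 assumes "x : S3" "x ~= p0" shows "tube_map (fst (coord x) - g (snd (coord x)), snd (coord x)) = x"
proof -
 have "(fst (coord x), snd (coord x)) + st q = coord x + st q" by simp
 also have "... = st x" by (simp add: coord_def)
 finally have "(fst (coord x), snd (coord x)) + st q = st x" .
 then show ?thesis using assms by (simp add: tube_map_def)
qed

lemma tube_map_0: "tube_map (0, 0) = q" using centre by (simp add: tube_map_def flip: zero_prod_def)

lemma tube_map_axis_circle: "tube_map o axis_circle r = (rim (flat r))"
 by (simp add: fun_eq_iff tube_map_def flat_def axis_circle_def)

lemma region_iff:
 "x : region h \<longleftrightarrow> x : S3 & x ~= p0 & cmod (fst (coord x) - g (snd (coord x))) < h & \<bar>snd (coord x)\<bar> < h"
proof
 assume "x : region h"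
 then show "x : S3 & x ~= p0 & cmod (fst (coord x) - g (snd (coord x))) < h & \<bar>snd (coord x)\<bar> < h"
  unfolding region_def using tube_map_S3 by auto
next
 assume "x : S3 & x ~= p0 & cmod (fst (coord x) - g (snd (coord x))) < h & \<bar>snd (coord x)\<bar> < h"
 then show "x : region h" unfolding region_def
  by (intro image_eqI[of _ _ "(fst (coord x) - g (snd (coord x)), snd (coord x))"]) (auto simp: tube_map_coord)
qed

lemma region_S3: "region h <= S3 - {p0}" by (auto simp: region_iff)

lemma q_in_region: "h > 0 ==> q : region h" using centre by (simp add: region_iff coord_def)

lemma tube_map_in_M:
 "v : ball 0 \<delta> \<times> ball 0 \<delta> ==> tube_map v : M \<longleftrightarrow> fst v = 0"
 using in_M[of "fst v" "snd v"] by (auto simp: tube_map_def)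

lemma region_minus_M: "h <= \<delta> ==> region h - M = tube_map ` punctured_tube h"
proof
 assume e: "h <= \<delta>"
 then have s: "ball 0 h \<times> ball 0 h <= (ball 0 \<delta> \<times> ball 0 \<delta> :: R3 set)" by auto
 show "region h - M <= tube_map ` punctured_tube h"
  using tube_map_in_M s unfolding region_def punctured_tube_def by (auto intro!: imageI)
 show "tube_map ` punctured_tube h <= region h - M"
  using tube_map_in_M s unfolding region_def punctured_tube_def by auto
qed

lemma continuous_on_g: "continuous_on (ball 0 \<delta>) g"
proof (intro continuous_at_imp_continuous_on ballI)
 fix t :: real assume "t : ball 0 \<delta>"
 then have "(g has_vector_derivative g' t) (at t)" by (intro g_deriv) auto
 then show "isCont g t" by (rule has_vector_derivative_continuous)
qed

lemma continuous_on_tube_map: "continuous_on (ball 0 \<delta> \<times> ball 0 \<delta>) tube_map" unfolding tube_map_def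
 by (intro continuous_on_compose2[OF continuous_on_un[of UNIV]] continuous_intros
   continuous_on_compose2[OF continuous_on_g]) auto

lemma continuous_on_coord: "S <= S3 - {p0} ==> continuous_on S coord"
 unfolding coord_def using continuous_on_st[of S] by (auto intro!: continuous_intros)

lemma openin_region: assumes "h <= \<delta>" shows "openin (top_of_set S3) (region h)"
proof -
 define V where "V = {x : S3 - {p0}. snd (coord x) : ball 0 h}"
 have o0: "openin (top_of_set S3) (S3 - {p0})" by (auto simp: openin_open intro!: exI[of _ "-{p0}"])
 have "continuous_on (S3 - {p0}) (%x. snd (coord x))" by (intro continuous_intros continuous_on_coord) auto
 then have "openin (top_of_set (S3 - {p0})) V"
  unfolding V_def using continuous_openin_preimage_gen[of "S3 - {p0}" "%x. snd (coord x)" "ball 0 h"]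
  by (simp add: vimage_def Int_def)
 then have V: "openin (top_of_set S3) V" using o0 openin_trans by blast
 have "continuous_on V (%x. fst (coord x) - g (snd (coord x)))"
  using assms by (intro continuous_intros continuous_on_coord continuous_on_compose2[OF continuous_on_g]) (auto simp: V_def)
 from continuous_openin_preimage_gen[OF this open_ball[of 0 h]]
 have "openin (top_of_set V) {x : V. fst (coord x) - g (snd (coord x)) : ball 0 h}" by (simp add: vimage_def Int_def)
 moreover have "{x : V. fst (coord x) - g (snd (coord x)) : ball 0 h} = region h" by (auto simp: V_def region_iff)
 ultimately show ?thesis using V openin_trans by metis
qed

lemma region_small:
 assumes "open W" "q : W" obtains h where "0 < h" "h <= \<delta>" "region h <= W"
proof -
 have "isCont tube_map (0, 0)"
  using continuous_on_tube_map \<delta> continuous_on_eq_continuous_at[of "ball 0 \<delta> \<times> ball 0 \<delta>" tube_map]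
  by (auto simp: open_Times)
 then have "(tube_map \<longlongrightarrow> q) (at (0, 0))" using tube_map_0 by (simp add: isCont_def)
 then have "\<forall>\<^sub>F v in at (0, 0). tube_map v : W" using assms by (intro topological_tendstoD) auto
 then obtain d where d: "d > 0" "!!v. v ~= (0, 0) ==> dist v (0, 0) < d ==> tube_map v : W"
  unfolding eventually_at by auto
 define h where "h = min \<delta> (d / 2)"
 have "tube_map v : W" if "v : ball 0 h \<times> ball 0 h" for v
 proof (cases "v = (0, 0)")
  case False
  have "dist v (0, 0) <= cmod (fst v) + \<bar>snd v\<bar>"
   using norm_Pair_le[of "fst v" "snd v"] by (simp add: dist_norm flip: zero_prod_def)
  also have "... < d" using that by (auto simp: h_def)
  finally show ?thesis using d(2) False by blast
 qed (use tube_map_0 assms in simp)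
 then have "region h <= W" unfolding region_def by blast
 moreover have "0 < h" "h <= \<delta>" using \<delta> d by (auto simp: h_def)
 ultimately show ?thesis using that by blast
qed

lemma homeomorphism_tube_map:
 assumes "h <= \<delta>"
 shows "homeomorphism (ball 0 h \<times> ball 0 h) (region h) tube_map (%x. (fst (coord x) - g (snd (coord x)), snd (coord x)))"
proof (rule homeomorphismI)
 show "continuous_on (ball 0 h \<times> ball 0 h) tube_map"
  by (rule continuous_on_subset[OF continuous_on_tube_map]) (use assms in auto)
 show "continuous_on (region h) (%x. (fst (coord x) - g (snd (coord x)), snd (coord x)))" using assms region_S3
  by (intro continuous_intros continuous_on_coord continuous_on_compose2[OF continuous_on_g]) (auto simp: region_iff)
qed (auto simp: region_def tube_map_coord tube_map_S3)

lemma simply_connected_region: assumes "h <= \<delta>" shows "simply_connected (region h)"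
proof -
 have "(ball 0 h \<times> ball 0 h :: R3 set) homeomorphic region h"
  using homeomorphism_tube_map[OF assms] unfolding homeomorphic_def by blast
 moreover have "simply_connected (ball 0 h \<times> ball 0 h :: R3 set)"
  by (intro convex_imp_simply_connected convex_Times convex_ball)
 ultimately show ?thesis using homeomorphic_simply_connected_eq by blast
qed

lemma path_connected_region_minus_M:
 assumes "0 < h" "h <= \<delta>" shows "path_connected (region h - M)" "region h - M ~= {}"
proof -
 have "path_connected (ball (0::complex) h - {0})" by (intro path_connected_open_delete) auto
 then have "path_connected (punctured_tube h)"
  unfolding punctured_tube_def by (rule path_connected_Times[OF _ convex_imp_path_connected[OF convex_ball]])
 moreover have "continuous_on (punctured_tube h) tube_map"
  by (rule continuous_on_subset[OF continuous_on_tube_map]) (use assms in \<open>auto simp: punctured_tube_def\<close>)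
 ultimately show "path_connected (region h - M)"
  unfolding region_minus_M[OF assms(2)] by (rule path_connected_continuous_image[rotated])
 have "(of_real (h / 2), 0) : punctured_tube h" using assms by (auto simp: punctured_tube_def)
 then show "region h - M ~= {}" unfolding region_minus_M[OF assms(2)] by blast
qed

lemma flat_in_region: "0 < r ==> r < h ==> z : cball 0 1 ==> flat r z : region h"
proof -
 assume r: "0 < r" "r < h" and z: "z : cball 0 1"
 have "r * cmod z < h" using r z by (metis less_eq_real_def mem_cball_0 mult_left_le order_le_less_trans)
 then show ?thesis using r by (simp add: region_iff flat_def un_S3 un_ne_pole coord_def norm_mult)
qed

lemma flat_in_M_iff:
 assumes "0 < r" "r < \<delta>" "z : cball 0 1" shows "flat r z : M \<longleftrightarrow> z = 0"
proof -
 have "r * cmod z < \<delta>" using assms by (metis less_eq_real_def mem_cball_0 mult_left_le order_le_less_trans)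
 then show ?thesis using in_M[of "of_real r * z" 0] assms \<delta> by (simp add: flat_def norm_mult)
qed

lemma flat_0 [simp]: "flat r 0 = q" using centre by (simp add: flat_def flip: zero_prod_def)

lemma un_derivative_inj:
 assumes "(un has_derivative D) (at y)" "D v = 0" shows "v = 0"
proof -
 have "un y \<bullet> p0 ~= 1" using inner_pole_less_1[OF un_S3 un_ne_pole, of y] by simp
 from diff_chain_at[OF assms(1) st_has_derivative[OF this]]
 have "(id has_derivative (%v. (1 / (1 - un y \<bullet> p0)) *\<^sub>R A (D v) + ((D v \<bullet> p0) / (1 - un y \<bullet> p0)\<^sup>2) *\<^sub>R A (un y))) (at y)"
  by (simp add: o_def id_def)
 then have "(%v. (1 / (1 - un y \<bullet> p0)) *\<^sub>R A (D v) + ((D v \<bullet> p0) / (1 - un y \<bullet> p0)\<^sup>2) *\<^sub>R A (un y)) = id"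
  using has_derivative_unique has_derivative_id by blast
 from fun_cong[OF this, of v] show ?thesis using assms(2) by (simp add: linear_0[OF linear_A])
qed

text \<open>A path in M through q is on the graph of g, and g' 0 = 0, so that its velocity there is vertical.\<close>

lemma tangent_vertical:
 assumes D: "(un has_derivative D) (at (st q))" and v: "v : tangent_vectors M q"
 shows "\<exists>c. v = D (0, c)"
proof -
 obtain l e where e: "0 < e" "smooth_on {-e<..<e::real} l" "l ` {-e<..<e} <= M" "l 0 = q"
  "(l has_vector_derivative v) (at 0)" using v unfolding tangent_vectors_def by blast
 have q1: "q \<bullet> p0 ~= 1" using inner_pole_less_1[OF centre] by simp
 define E where "E = (%v. (1 / (1 - q \<bullet> p0)) *\<^sub>R A v + ((v \<bullet> p0) / (1 - q \<bullet> p0)\<^sup>2) *\<^sub>R A q)"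
 have dst: "(st has_derivative E) (at q)" unfolding E_def by (rule st_has_derivative[OF q1])
 have "((st o l) has_vector_derivative E v) (at 0)"
  by (rule vector_derivative_diff_chain_within[OF e(5)]) (use dst e(4) in \<open>auto intro: has_derivative_at_withinI\<close>)
 then have dc: "((%s. coord (l s)) has_vector_derivative E v) (at 0)"
  unfolding coord_def o_def by (auto intro!: derivative_eq_intros)
 define t where "t s = snd (coord (l s))" for s
 have dt: "(t has_vector_derivative snd (E v)) (at 0)"
  unfolding t_def by (rule bounded_linear.has_vector_derivative[OF bounded_linear_snd dc])
 have dw: "((%s. fst (coord (l s))) has_vector_derivative fst (E v)) (at 0)"
  by (rule bounded_linear.has_vector_derivative[OF bounded_linear_fst dc])
 have t0: "t 0 = 0" using e(4) by (simp add: t_def coord_def)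
 have "(g has_vector_derivative 0) (at (t 0))" using g_deriv[of 0] \<delta> t0 by simp
 from vector_diff_chain_at[OF dt this] have dg: "((%s. g (t s)) has_vector_derivative 0) (at 0)" by (simp add: o_def)
 have cl: "isCont l 0" using e(5) has_vector_derivative_continuous by blast
 obtain O' where O': "open O'" "region \<delta> = S3 Int O'" using openin_region[OF order_refl] by (auto simp: openin_open)
 have qO: "q : O'" using q_in_region[OF \<delta>] O'(2) by blast
 then have "\<forall>\<^sub>F s in at 0. l s : O'"
  using cl O'(1) e(4) by (intro topological_tendstoD) (auto simp: isCont_def)
 then obtain d where d: "d > 0" "!!s. s ~= 0 ==> \<bar>s\<bar> < d ==> l s : O'"
  unfolding eventually_at by (auto simp: dist_real_def)
 define e' where "e' = min d e"
 have e': "e' > 0" using d e by (simp add: e'_def)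
 have near: "l s : region \<delta> Int M" if "s : {-e'<..<e'}" for s
 proof -
  have "l s : M" using e(3) that by (auto simp: e'_def)
  moreover have "l s : O'"
  proof (cases "s = 0")
   case False
   have "\<bar>s\<bar> < d" using that by (auto simp: e'_def)
   with d(2) False show ?thesis by blast
  qed (simp only: e(4) qO)
  ultimately show ?thesis using M_S3 unfolding O'(2) by blast
 qed
 have on_graph: "fst (coord (l s)) = g (t s)" if s: "s : {-e'<..<e'}" for s
 proof -
  have r: "l s : region \<delta>" "l s : M" using near[OF s] by auto
  let ?v = "(fst (coord (l s)) - g (t s), t s)"
  have "tube_map ?v = l s" unfolding t_def using r(1) by (intro tube_map_coord) (auto simp: region_iff)
  then show ?thesis using tube_map_in_M[of ?v] r unfolding region_iff t_def by auto
 qed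
 have "((%s. fst (coord (l s))) has_vector_derivative 0) (at 0)"
  by (rule has_vector_derivative_transform_within_open[OF dg, of "{-e'<..<e'}"]) (use e' on_graph in auto)
 then have "fst (E v) = 0" using dw vector_derivative_unique_at by blast
 then have Ev: "E v = (0, snd (E v))" by (simp add: prod_eq_iff)
 have "((%s. coord (l s) + st q) has_vector_derivative E v) (at 0)" using dc by (auto intro!: derivative_eq_intros)
 moreover have "(un has_derivative D) (at (coord (l 0) + st q) within range (%s. coord (l s) + st q))"
  using D e(4) by (auto simp: coord_def intro: has_derivative_at_withinI)
 ultimately have "((un o (%s. coord (l s) + st q)) has_vector_derivative D (E v)) (at 0)"
  by (rule vector_derivative_diff_chain_within)
 then have "(l has_vector_derivative D (E v)) (at 0)"
  by (rule has_vector_derivative_transform_within_open[of _ _ _ "{-e'<..<e'}"])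
   (use e' near in \<open>auto simp: coord_def region_iff\<close>)
 then have "v = D (E v)" using e(5) vector_derivative_unique_at by blast
 then show ?thesis using Ev by metis
qed

end

lemma meridian_discE:
 assumes "meridian_disc M N d"
 obtains D where "continuous_on (cball 0 1) d" "(d has_derivative D) (at 0)" "inj D"
  "tangent_vectors M (d 0) Int range D = {0}" "inj_on d (cball 0 1)" "d ` cball 0 1 <= S3"
  "d ` cball 0 1 Int M = {d 0}" "d ` cball 0 1 Int N = {}"
proof -
 note d = assms[unfolded meridian_disc_def]
 obtain U D where U: "cball 0 1 <= U" "smooth_on U d"
  and D: "\<forall>z\<in>cball 0 1. (d has_derivative D z) (at z) & inj (D z)" "tangent_vectors M (d 0) Int range (D 0) = {0}"
  using conjunct1[OF d] by (elim exE conjE) (rule that)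
 have "C_k_on 0 U d" using U(2) unfolding smooth_on_def by blast
 then have "continuous_on (cball 0 1) d" using U(1) continuous_on_subset by auto
 moreover have "(d has_derivative D 0) (at 0) & inj (D 0)" using D(1) by simp
 ultimately show ?thesis using that[of "D 0"] D(2) conjunct2[OF d] by simp
qed

text \<open>
 The part of a meridian disc away from its centre lies in the complement, so that the disc can
 be shrunk without changing the free homotopy class of its boundary.
\<close>

lemma meridian_disc_shrink:
 assumes d: "meridian_disc M N d" and r: "0 < r" "r <= 1"
 shows "homotopic_loops (S3 - (M Un N)) (rim d) (rim (%z. d (of_real r * z)))"
proof -
 from d obtain D where cd: "continuous_on (cball 0 1) d" and inj: "inj_on d (cball 0 1)"
  and dS: "d ` cball 0 1 <= S3" and dM: "d ` cball 0 1 Int M = {d 0}" and dN: "d ` cball 0 1 Int N = {}"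
  by (rule meridian_discE)
 define h where "h = (%(u::real, t). d (of_real ((1 - u) * 1 + u * r) * turn t))"
 have fac: "0 < (1 - u) * 1 + u * r" "(1 - u) * 1 + u * r <= 1" if "u : {0..1}" for u :: real
 proof -
  show "0 < (1 - u) * 1 + u * r" using convex_bound_lt[of "-1" 0 "-r" "1 - u" u] that r by (auto simp: algebra_simps)
  show "(1 - u) * 1 + u * r <= 1" using convex_bound_le[of 1 1 r "1 - u" u] that r by auto
 qed
 have nrm: "cmod (of_real ((1 - u) * 1 + u * r) * cis a) = (1 - u) * 1 + u * r" if "u : {0..1}" for u a :: real
  using fac(1)[OF that] by (simp only: norm_mult norm_of_real norm_cis mult_1_right abs_of_pos)
 have disc: "of_real ((1 - u) * 1 + u * r) * cis a : cball 0 1 - {0}" if "u : {0..1}" for u a :: real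
  using nrm[OF that, of a] fac[OF that] by (metis DiffI mem_cball_0 norm_zero order_less_irrefl singletonD)
 show ?thesis unfolding homotopic_loops
 proof (intro exI[of _ h] conjI ballI)
  show "continuous_on ({0..1} \<times> {0..1}) h" unfolding h_def case_prod_unfold
  proof (rule continuous_on_compose2[OF cd])
   show "continuous_on ({0..1} \<times> {0..1}) (%p::real \<times> real. of_real ((1 - fst p) * 1 + fst p * r) * turn (snd p))"
    by (intro continuous_intros)
   show "(%p::real \<times> real. of_real ((1 - fst p) * 1 + fst p * r) * turn (snd p)) ` ({0..1} \<times> {0..1}) <= cball 0 1"
    using disc by force
  qed
  show "h : {0..1} \<times> {0..1} \<rightarrow> S3 - (M Un N)"
  proof
   fix x :: "real \<times> real" assume "x : {0..1} \<times> {0..1}"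
   then obtain u t where x: "x = (u, t)" "u : {0..1}" by auto
   let ?z = "of_real ((1 - u) * 1 + u * r) * turn t"
   have z: "?z : cball 0 1" "?z ~= 0" using disc[OF x(2), of "2 * pi * t"] by blast+
   have "d ?z ~= d 0" using inj_onD[OF inj _ z(1), of 0] z(2) by auto
   then show "h x : S3 - (M Un N)" using z(1) dS dM dN unfolding x(1) h_def prod.case by blast
  qed
 qed (auto simp: h_def pathstart_def pathfinish_def)
qed

context tube begin

lemma meridian_disc_flat:
 assumes r: "0 < r" "r < h" and h: "h <= \<delta>" "region h Int N = {}"
 shows "meridian_disc M N (flat r)" unfolding meridian_disc_def
proof (intro conjI)
 have bl: "bounded_linear (%z::complex. (of_real r * z, 0::real))"
  by (intro bounded_linear_Pair bounded_linear_mult_right bounded_linear_zero)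
 have "\<exists>D. (un has_derivative D) (at y)" for y using un_differentiable by metis
 then obtain D where D: "!!y. (un has_derivative D y) (at y)" by metis
 define E where "E z = D ((of_real r * z, 0) + st q) o (%z. (of_real r * z, 0))" for z
 have E: "(flat r has_derivative E z) (at z)" for z unfolding flat_def[abs_def] E_def o_def
  by (rule has_derivative_compose[OF has_derivative_add_const[OF bounded_linear_imp_has_derivative[OF bl]] D])
 have linD: "linear (D y)" for y using has_derivative_linear[OF D] .
 have inE: "E z v = 0 ==> v = 0" for z v
  using un_derivative_inj[OF D, of _ "(of_real r * v, 0)"] r unfolding E_def o_def by (simp add: zero_prod_def)
 have linE: "linear (E z)" for z using has_derivative_linear[OF E] .
 have "tangent_vectors M (flat r 0) Int range (E 0) = {0}"
 proof (intro subset_antisym subsetI)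
  fix v assume v: "v : tangent_vectors M (flat r 0) Int range (E 0)"
  have s: "(of_real r * 0, 0) + st q = st q" by (simp flip: zero_prod_def)
  obtain c where c: "v = D (st q) (0, c)" using v tangent_vertical[OF D] by auto
  obtain z where z: "v = D (st q) (of_real r * z, 0)" using v unfolding E_def o_def s by blast
  have "D (st q) ((0, c) - (of_real r * z, 0)) = 0" using c z unfolding linear_diff[OF linD] by simp
  from un_derivative_inj[OF D this] have "c = 0" by (simp add: zero_prod_def)
  then show "v : {0}" using c linear_0[OF linD] by (simp flip: zero_prod_def)
 next
  fix v :: R4 assume "v : {0}"
  moreover have "q : M" using tube_map_in_M[of "(0, 0)"] \<delta> by (simp add: tube_map_0)
  moreover have "D ((g 0, 0) + st q) (g' 0, 1) : tangent_vectors M (un ((g 0, 0) + st q))"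
   using tangent[OF _ D, of 0] \<delta> by simp
  then have "0 *\<^sub>R D ((g 0, 0) + st q) (g' 0, 1) : tangent_vectors M (un ((g 0, 0) + st q))"
   by (rule tangent_vectors_scale)
  moreover have "un ((g 0, 0) + st q) = q" using centre by (simp flip: zero_prod_def)
  ultimately have "v : tangent_vectors M q" by simp
  moreover have "v = E 0 0" using \<open>v : {0}\<close> linear_0[OF linE] by simp
  ultimately show "v : tangent_vectors M (flat r 0) Int range (E 0)" by simp
 qed
 then show "\<exists>U D. open U & cball 0 1 <= U & smooth_on U (flat r) &
   (\<forall>z\<in>cball 0 1. (flat r has_derivative D z) (at z) & inj (D z)) &
   tangent_vectors M (flat r 0) Int range (D 0) = {0}"
  using E inE linE un_smooth[OF bl, of UNIV "st q"] unfolding flat_def[abs_def]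
  by (intro exI[of _ UNIV] exI[of _ E]) (auto simp: linear_injective_0)
 show "inj_on (flat r) (cball 0 1)"
 proof (rule inj_onI)
  fix x y assume "flat r x = flat r y"
  then have "coord (flat r x) = coord (flat r y)" by simp
  then show "x = y" using r by (simp add: flat_def coord_def)
 qed
 show "flat r ` cball 0 1 <= S3" by (auto simp: flat_def un_S3)
 have "flat r z : M \<longleftrightarrow> z = 0" if "z : cball 0 1" for z by (rule flat_in_M_iff) (use r h that in auto)
 moreover have "(0::complex) : cball 0 1" by simp
 ultimately show "flat r ` cball 0 1 Int M = {flat r 0}" by blast
 show "flat r ` cball 0 1 Int N = {}" using flat_in_region[OF r] h(2) by blast
qed

text \<open>
 In the coordinates of the tube a small disc transverse to M maps to the plane by a map whose
 derivative is injective, by transversality, so that small circles wind once around M.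
\<close>

lemma transverse_disc_loops:
 assumes D: "(d has_derivative D) (at 0)" "inj D" and cd: "continuous_on (cball 0 1) d"
  and dS: "d ` cball 0 1 <= S3" and d0: "d 0 : region \<delta>" "d 0 : M"
  and tr: "tangent_vectors M (d 0) Int range D <= {0}"
 obtains r p where "0 < r" "r <= 1" "path p" "track p <= punctured_tube \<delta>"
  "finish p = start p" "winding_number (fst o p) 0 : {1, -1}"
  "!!s. tube_map (p s) = d (of_real r * turn s)"
proof -
 define y where "y = coord (d 0)"
 define t0 where "t0 = snd y"
 have y: "d 0 : S3" "d 0 ~= p0" "\<bar>t0\<bar> < \<delta>" using d0(1) unfolding region_iff y_def t0_def by auto
 have yM: "y = (g t0, t0)" using tube_map_in_M[of "(fst y - g t0, t0)"] d0 tube_map_coord[OF y(1,2)]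
  unfolding region_iff y_def t0_def by (auto simp: prod_eq_iff)
 have y_st: "(g t0, t0) + st q = st (d 0)" using yM by (simp add: y_def coord_def algebra_simps)
 obtain D' where D': "(un has_derivative D') (at (st (d 0)))" using un_differentiable by blast
 define E where "E = (%v. (1 / (1 - d 0 \<bullet> p0)) *\<^sub>R A v + ((v \<bullet> p0) / (1 - d 0 \<bullet> p0)\<^sup>2) *\<^sub>R A (d 0))"
 have "d 0 \<bullet> p0 ~= 1" using inner_pole_less_1[OF y(1,2)] by simp
 then have E: "(st has_derivative E) (at (d 0))" unfolding E_def by (rule st_has_derivative)
 define h where "h z = E (D z)" for z
 have ch: "((%z. coord (d z)) has_derivative h) (at 0)"
  unfolding coord_def h_def using has_derivative_diff[OF has_derivative_compose[OF D(1) E] has_derivative_const[of "st q"]] by simp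

 have linh: "linear h" by (rule has_derivative_linear[OF ch])
 obtain O' where O': "open O'" "region \<delta> = S3 Int O'" using openin_region[OF order_refl] by (auto simp: openin_open)
 have "(d \<longlongrightarrow> d 0) (at 0)" using has_derivative_continuous[OF D(1)] by (simp add: isCont_def)
 moreover have "d 0 : O'" using d0(1) O'(2) by blast
 ultimately have "\<forall>\<^sub>F z in at 0. d z : O'" using O'(1) topological_tendstoD by blast
 then obtain u' where u': "u' > 0" "!!z. z ~= 0 ==> cmod z < u' ==> d z : O'"
  unfolding eventually_at by (auto simp: dist_norm)
 have nearby: "d z : region \<delta>" if "cmod z < min 1 u'" for z
 proof (cases "z = 0")
  case False
  then have "d z : O'" "d z : S3" using u'(2)[OF False] dS that by auto
  then show ?thesis using O'(2) by blast
 qed (use d0 in simp)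
 have hD: "D z = D' (h z)" for z
 proof -
  have "((%z. un (st (d z))) has_derivative (%z. D' (h z))) (at 0)"
   unfolding h_def by (rule has_derivative_compose[OF has_derivative_compose[OF D(1) E] D'])
  then have "(d has_derivative (%z. D' (h z))) (at 0)"
   by (rule has_derivative_transform_within[of _ _ _ UNIV "min 1 u'"])
    (use nearby u'(1) in \<open>auto simp: region_iff\<close>)
  then have "D = (%z. D' (h z))" by (rule has_derivative_unique[OF D(1)])
  then show ?thesis by (rule fun_cong)
 qed
 define W where "W z = fst (h z) - snd (h z) *\<^sub>R g' t0" for z
 have linW: "linear W" unfolding W_def[abs_def]
  by (intro linear_compose_sub linear_compose[OF linh linear_fst, unfolded o_def]
    linear_compose[OF linear_compose[OF linh linear_snd] linear_scaleR_left, unfolded o_def])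
 have W0: "z = 0" if "W z = 0" for z
 proof -
  have "h z = snd (h z) *\<^sub>R (g' t0, 1)" using that by (simp add: W_def prod_eq_iff)
  then have "D z = snd (h z) *\<^sub>R D' (g' t0, 1)" using hD[of z] linear_scale[OF has_derivative_linear[OF D']] by metis
  moreover have "D' (g' t0, 1) : tangent_vectors M (d 0)" using tangent[OF y(3), of D'] D' y by (simp add: y_st)
  ultimately have "D z : tangent_vectors M (d 0)" using tangent_vectors_scale by metis
  then have "D z = 0" using tr by blast
  then show "z = 0" using D(2) linear_injective_0[OF has_derivative_linear[OF D(1)]] by blast
 qed
 then have injW: "inj W" using linear_injective_0[OF linW] by blast
 obtain m where m: "m > 0" "!!z. m * cmod z <= cmod (W z)" using linear_inj_bounded_below_pos[OF linW injW] by blast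
 define f where "f z = fst (coord (d z)) - g (snd (coord (d z)))" for z
 have "(g has_derivative (%s. s *\<^sub>R g' t0)) (at (snd (coord (d 0))))"
  using g_deriv[OF y(3)] by (simp add: has_vector_derivative_def y_def t0_def)
 from has_derivative_compose[OF has_derivative_snd[OF ch] this]
 have df: "(f has_derivative W) (at 0)" unfolding f_def W_def by (intro has_derivative_diff has_derivative_fst[OF ch])
 have f0: "f 0 = 0" using yM by (simp add: f_def flip: y_def)
 obtain u where u: "u > 0" "!!z. cmod z < u ==> cmod (f z - W z) <= m / 2 * cmod z"
  using df[unfolded has_derivative_at_alt] m(1) f0 by (auto simp: dest!: spec[of _ "m / 2"])
 define r0 where "r0 = min 1 (min u u')"
 have r0: "r0 > 0" "r0 <= 1" "r0 <= u" "r0 <= u'" using u(1) u'(1) by (auto simp: r0_def)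
 define r where "r = r0 / 2"
 have r: "0 < r" "r < r0" using r0 by (auto simp: r_def)
  define z where "z s = of_real r * turn s" for s
  have nz: "cmod (z s) = r" for s using r by (simp add: z_def norm_mult)
  define p where "p s = (f (z s), snd (coord (d (z s))))" for s
  have zr: "d (z s) : region \<delta>" for s using nearby[of "z s"] nz[of s] r r0 by simp
  have near: "cmod (f (z s) - W (z s)) < cmod (W (z s))" for s
  proof -
   have "cmod (f (z s) - W (z s)) <= m / 2 * r" using u(2)[of "z s"] nz[of s] r r0 by simp
   also have "... < m * r" using m(1) r by simp
   also have "... <= cmod (W (z s))" using m(2)[of "z s"] nz[of s] by simp
   finally show ?thesis .
  qed
  have cz: "continuous_on {0..1} z" unfolding z_def by (intro continuous_intros)
  have cdz: "continuous_on {0..1} (%s. d (z s))" using nz r r0 by (intro continuous_on_compose2[OF cd cz]) auto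
  have ccd: "continuous_on {0..1} (%s. coord (d (z s)))"
   using zr region_S3[of \<delta>] by (intro continuous_on_compose2[OF continuous_on_coord[OF region_S3] cdz]) auto
  have cf: "continuous_on {0..1} (%s. f (z s))" unfolding f_def
   using zr by (intro continuous_intros ccd continuous_on_compose2[OF continuous_on_g continuous_on_snd[OF ccd]])
    (auto simp: region_iff)
  have ends: "z 1 = z 0" by (simp add: z_def)
  have "path p" unfolding path_def p_def by (intro continuous_intros cf ccd)
  moreover have "p s : punctured_tube \<delta>" for s
   using zr[of s] near[of s] unfolding punctured_tube_def p_def f_def region_iff by auto
  then have "track p <= punctured_tube \<delta>" by (auto simp: path_image_def)
  moreover have "finish p = start p" by (simp add: p_def pathfinish_def pathstart_def ends)
  moreover have "winding_number (fst o p) 0 = winding_number (%s. W (z s)) 0"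
  proof (rule winding_number_nearby_loops_eq)
   show "path (%s. W (z s))" unfolding path_def
    by (intro continuous_on_compose2[OF linear_continuous_on[OF linear_conv_bounded_linear[THEN iffD1, OF linW]] cz]) auto
   show "path (fst o p)" unfolding path_def o_def p_def using cf by simp
   show "cmod ((fst o p) s - W (z s)) < cmod (W (z s) - 0)" for s using near[of s] by (simp add: p_def)
  qed (simp_all add: p_def pathfinish_def pathstart_def ends)
  then have "winding_number (fst o p) 0 : {1, -1}"
   using winding_number_real_linear[OF linW injW r(1)] by (simp only: z_def)
  moreover have "tube_map (p s) = d (z s)" for s
   unfolding p_def f_def using zr[of s] by (intro tube_map_coord) (auto simp: region_iff)
  ultimately show ?thesis using that[of r p] r r0 unfolding z_def by auto
qed

text \<open>
 The transport around any small transverse disc is, up to conjugation and inversion, that around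
 a standard circle of the tube.
\<close>

lemma meridian_disc_transport:
 assumes T: "path_functor BD X T" "region \<delta> - M <= X"
  and d: "meridian_disc C N d" "d 0 : region \<delta>" "d 0 : M"
   "tangent_vectors M (d 0) <= tangent_vectors C (d 0)"
  and e: "0 < e" "e < \<delta>"
  and S: "!!g a. g : carrier BD ==> a : S ==> a : carrier BD ==> g \<cdot> a \<cdot> inv_BD g : S"
   "!!a. a : S ==> a : carrier BD ==> inv_BD a : S"
 obtains r where "0 < r" "r <= 1" "track (rim (%z. d (of_real r * z))) <= region \<delta> - M"
  "T (rim (%z. d (of_real r * z))) : S \<longleftrightarrow> T (rim (flat e)) : S"
proof -
 from d(1) obtain D where cd: "continuous_on (cball 0 1) d" and D0: "(d has_derivative D) (at 0)" "inj D"
  and tr: "tangent_vectors C (d 0) Int range D = {0}" and dS: "d ` cball 0 1 <= S3" by (rule meridian_discE)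
 have tr': "tangent_vectors M (d 0) Int range D <= {0}" using tr d(4) by blast
 obtain r p where r: "0 < r" "r <= 1" and p: "path p" "track p <= punctured_tube \<delta>" "finish p = start p"
  "winding_number (fst o p) 0 : {1, -1}" "!!s. tube_map (p s) = d (of_real r * turn s)"
  by (rule transverse_disc_loops[OF D0 cd dS d(2,3) tr'], rule that)
 interpret T: path_functor BD X T by fact
 have ct: "continuous_on (punctured_tube \<delta>) tube_map"
  by (rule continuous_on_subset[OF continuous_on_tube_map]) (auto simp: punctured_tube_def)
 have im: "tube_map ` punctured_tube \<delta> <= X" using T(2) region_minus_M[OF order_refl] by simp
 have "path_functor BD (punctured_tube \<delta>) (%p. T (tube_map o p))" by (rule T.compose[OF ct im])
 then interpret P: tube_functor BD \<delta> "%p. T (tube_map o p)" unfolding tube_functor_def .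
 have iff: "T (tube_map o p) : S \<longleftrightarrow> T (tube_map o axis_circle e) : S"
  by (rule P.punctured_tube_winding_1[OF e p(1-4) S])
 have eq: "(tube_map o p) s = d (of_real r * turn s)" for s using p(5) by simp
 have cp: "path (tube_map o p)" by (rule path_continuous_image[OF p(1) continuous_on_subset[OF ct p(2)]])
 have pim: "track (tube_map o p) <= region \<delta> - M"
  using p(2) region_minus_M[OF order_refl] by (auto simp: path_image_compose)
 have "homotopic_paths X (tube_map o p) (rim (%z. d (of_real r * z)))"
  by (rule homotopic_paths_eq[OF cp]) (use pim T(2) eq in auto)
 from T.homotopic[OF this] iff
 have "T (rim (%z. d (of_real r * z))) : S \<longleftrightarrow> T (rim (flat e)) : S"
  by (simp add: tube_map_axis_circle)
 moreover have "track (rim (%z. d (of_real r * z))) = track (tube_map o p)"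
  unfolding path_image_def using eq by (intro image_cong) auto
 ultimately show ?thesis using that r pim by simp
qed

end

definition curve_chart :: "real set => 'a::real_normed_vector set => (real => 'a) => bool" where
 "curve_chart I M f \<longleftrightarrow> openin (top_of_set M) (f ` I) & (\<exists>h. homeomorphism I (f ` I) f h)"

lemma curve_chart_restrict:
 assumes "curve_chart I M f" "openin (top_of_set I) J" shows "curve_chart J M f"
proof -
 obtain l where h: "homeomorphism I (f ` I) f l" using assms(1) unfolding curve_chart_def by blast
 have "J <= I" using assms(2) openin_imp_subset by blast
 then have "homeomorphism J (f ` J) f l" by (intro homeomorphism_of_subsets[OF h, of _ "f ` I"]) auto
 moreover have "openin (top_of_set (f ` I)) (f ` J)" by (rule homeomorphism_imp_open_map[OF h assms(2)])
 ultimately show ?thesis using assms(1) openin_trans unfolding curve_chart_def by blast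
qed

lemma curve_chart_continuous: "curve_chart I M f ==> continuous_on I f"
 and curve_chart_inj: "curve_chart I M f ==> inj_on f I"
 and curve_chart_subset: "curve_chart I M f ==> f ` I <= M"
 unfolding curve_chart_def homeomorphism_def by (blast, metis inj_on_inverseI, metis openin_imp_subset)

lemma curve_chart_small:
 assumes "curve_chart I M f" "openin (top_of_set M) W" "f 0 : W" "0 : I"
 obtains h where "0 < h" "h < 1" "f ` (I Int {-h<..<h}) <= W"
proof -
 obtain O' where O': "open O'" "W = M Int O'" using assms(2) by (auto simp: openin_open)
 have "openin (top_of_set I) (I Int f -` O')"
  by (rule continuous_openin_preimage_gen[OF curve_chart_continuous[OF assms(1)] O'(1)])
 then obtain Q where Q: "open Q" "I Int f -` O' = I Int Q" by (auto simp: openin_open)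
 have "0 : Q" using assms O' Q(2) by blast
 then obtain e where e: "e > 0" "ball 0 e <= Q" using Q(1) open_contains_ball by blast
 define h where "h = min e (1 / 2)"
 have "f ` (I Int {-h<..<h}) <= W"
 proof
  fix x assume "x : f ` (I Int {-h<..<h})"
  then obtain s where s: "x = f s" "s : I" "\<bar>s\<bar> < h" by auto
  then have "s : Q" using e(2) by (auto simp: h_def)
  then show "x : W" using s Q(2) O'(2) curve_chart_subset[OF assms(1)] by blast
 qed
 then show ?thesis using that[of h] e(1) by (auto simp: h_def)
qed

text \<open>
 An injective continuous function on an interval is strictly monotone, so it has no interior
 minimum: a curve cannot run through an end point of another curve.
\<close>

lemma curve_through_end_point:
 fixes u :: "real => 'a::real_normed_vector"
 assumes u: "continuous_on {a<..<b} u" "inj_on u {a<..<b}" "t0 : {a<..<b}"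
  and w: "homeomorphism {0..<1::real} T w w'" "u ` {a<..<b} <= T" "u t0 = w 0"
 shows False
proof -
 define f where "f = w' o u"
 have cw: "continuous_on T w'" and iw: "!!y. y : T ==> w (w' y) = y" "!!x. x : {0..<1} ==> w' (w x) = x"
  and im: "w' ` T = {0..<1}" using w(1) unfolding homeomorphism_def by blast+
 define a' b' where "a' = (a + t0) / 2" and "b' = (b + t0) / 2"
 have ab: "a < a'" "a' < t0" "t0 < b'" "b' < b" using u(3) by (auto simp: a'_def b'_def field_simps)
 then have s: "{a'..b'} <= {a<..<b}" by auto
 have uT: "u ` {a'..b'} <= T" using s w(2) by blast
 have "continuous_on {a'..b'} f" unfolding f_def
  by (intro continuous_on_compose continuous_on_subset[OF u(1) s] continuous_on_subset[OF cw uT])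
 moreover have "inj_on f {a'..b'}" unfolding f_def
 proof (rule comp_inj_on)
  show "inj_on u {a'..b'}" using u(2) s inj_on_subset by blast
  show "inj_on w' (u ` {a'..b'})" using iw(1) w(2) s by (intro inj_on_inverseI[of _ w]) blast
 qed
 ultimately have "(f a' < f t0 & f t0 < f b') | (f b' < f t0 & f t0 < f a')"
  by (rule continuous_inj_imp_mono[OF ab(2,3)])
 moreover have "f t0 = 0" using iw(2)[of 0] w(3) by (simp add: f_def)
 moreover have "f s >= 0" if "s : {a'..b'}" for s
 proof -
  have "f s : {0..<1}" using imageI[OF subsetD[OF uT imageI[OF that]], of w'] im by (simp add: f_def)
  then show ?thesis by simp
 qed
 then have "f a' >= 0" "f b' >= 0" using ab by auto
 ultimately show False by linarith
qed

lemma arc_half_open: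
 fixes p :: "real => 'a::real_normed_vector"
 assumes "arc p" shows "\<exists>h. homeomorphism {0..<1} (p ` {0..<1}) p h"
proof -
 from assms obtain h where h: "homeomorphism {0..1} (track p) p h" by (rule homeomorphism_arc)
 have "homeomorphism {0..<1} (p ` {0..<1}) p h"
  by (rule homeomorphism_of_subsets[OF h, of _ "track p"]) (auto simp: path_image_def)
 then show ?thesis by blast
qed

lemma affine_image_open_interval:
 assumes ab: "a < (b::real)" shows "(%s. (b - a) * s + a) ` {0<..<1} = {a<..<b}"
 proof (intro subset_antisym subsetI)
  fix t assume t: "t : {a<..<b}"
  show "t : (%s. (b - a) * s + a) ` {0<..<1}" by (rule image_eqI[of _ _ "(t - a) / (b - a)"]) (use t ab in auto)
 next
  fix t assume "t : (%s. (b - a) * s + a) ` {0<..<1}"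
  then obtain s where s: "t = (b - a) * s + a" "0 < s" "s < 1" unfolding image_iff Bex_def greaterThanLessThan_iff by blast
  have "(b - a) * s < (b - a) * 1" "0 < (b - a) * s" using ab s by (auto intro: mult_strict_left_mono)
  then show "t : {a<..<b}" using s(1) by simp
 qed

lemma curve_chart_arc:
 assumes c: "curve_chart I M f" and I: "{a..b} <= I" "openin (top_of_set I) {a<..<b}" and ab: "a < b"
 defines "g == %s. f ((b - a) * s + a)"
 shows "arc g" "track g = f ` {a..b}" "openin (top_of_set M) (g ` {0<..<1})"
proof -
 have im: "(%s. (b - a) * s + a) ` {0..1} = {a..b}" using ab by (subst image_affinity_atLeastAtMost) auto
 have "inj_on (f o (%s. (b - a) * s + a)) {0..1}"
 proof (rule comp_inj_on)
  show "inj_on (%s. (b - a) * s + a) {0..1}" using ab by (auto simp: inj_on_def)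
  show "inj_on f ((%s. (b - a) * s + a) ` {0..1})" unfolding im by (rule inj_on_subset[OF curve_chart_inj[OF c] I(1)])
 qed
 then show "arc g" unfolding arc_def path_def g_def o_def
  using im I(1) by (auto intro!: continuous_on_compose2[OF curve_chart_continuous[OF c]] continuous_intros)
 show "track g = f ` {a..b}" unfolding path_image_def g_def im[symmetric] by (simp add: image_image)
 note affine_image_open_interval[OF ab]
 then have "g ` {0<..<1} = f ` {a<..<b}" unfolding g_def by (metis image_image)
 then show "openin (top_of_set M) (g ` {0<..<1})" using curve_chart_restrict[OF c I(2)] unfolding curve_chart_def by simp
qed

definition curve_interior :: "'a::real_normed_vector set => 'a => bool" where
 "curve_interior M p \<longleftrightarrow> (\<exists>f. f 0 = p & curve_chart {-1<..<1} M f)"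

definition curve_end :: "'a::real_normed_vector set => 'a => bool" where
 "curve_end M p \<longleftrightarrow> (\<exists>f. f 0 = p & curve_chart {0..<1} M f)"

lemma curve_arc_cover:
 fixes M :: "'a::real_normed_vector set"
 assumes M: "compact M" "!!p. p : M ==> curve_interior M p | curve_end M p"
 obtains G :: "(real => 'a) set" where "finite G" "M = \<Union>(track ` G)"
  "!!g. g : G ==> arc g" "!!g. g : G ==> openin (top_of_set M) (g ` {0<..<1})"
proof -
 have "\<exists>W g. openin (top_of_set M) W & p : W & W <= track g & track g <= M & arc g & openin (top_of_set M) (g ` {0<..<1})"
  if p: "p : M" for p
 proof -
  obtain I f where I: "I = {-1<..<1} | I = {0..<1}" "f 0 = p" and c: "curve_chart I M f"
   using M(2)[OF p] unfolding curve_interior_def curve_end_def by blast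
  have "\<exists>a J. {a..1/2} <= I & openin (top_of_set I) {a<..<1/2} & openin (top_of_set I) J & 0 : J & J <= {a..1/2} & a < 1/2"
   using I(1)
  proof
   assume I: "I = {-1<..<1}"
   have o: "openin (top_of_set I) {-(1/2)<..<1/2}" unfolding I openin_open by (rule exI[of _ "{-(1/2)<..<1/2}"]) auto
   have "{-(1/2)..1/2} <= I" "(0::real) : {-(1/2)<..<1/2}" "{-(1/2)<..<1/2} <= {-(1/2)..1/2::real}" "-(1/2) < (1/2::real)"
    by (auto simp: I)
   with o show ?thesis by blast
  next
   assume I: "I = {0..<1}"
   have o: "openin (top_of_set I) {0<..<1/2}" unfolding I openin_open by (rule exI[of _ "{0<..<1/2}"]) auto
   have "openin (top_of_set I) {0..<1/2}" unfolding I openin_open by (rule exI[of _ "{-1<..<1/2}"]) auto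
   moreover have "{0..1/2} <= I" "(0::real) : {0..<1/2}" "{0..<1/2} <= {0..1/2::real}" "0 < (1/2::real)"
    by (auto simp: I)
   ultimately show ?thesis using o by blast
  qed
  then obtain a J where J: "{a..1/2} <= I" "openin (top_of_set I) {a<..<1/2}" "openin (top_of_set I) J" "0 : J" "J <= {a..1/2}" "a < 1/2"
   by blast
  note A = curve_chart_arc[OF c J(1,2,6)]
  show ?thesis
  proof (intro exI conjI)
   show "openin (top_of_set M) (f ` J)" using curve_chart_restrict[OF c J(3)] unfolding curve_chart_def by blast
   show "f ` J <= track (%s. f ((1/2 - a) * s + a))" using A(2) J(5) by blast
   show "track (%s. f ((1/2 - a) * s + a)) <= M" using A(2) J(1) curve_chart_subset[OF c] by blast
  qed (use A J I in auto)
 qed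
 then have "\<forall>p\<in>M. \<exists>Wg. openin (top_of_set M) (fst Wg) & p : fst Wg & fst Wg <= track (snd Wg) &
   track (snd Wg) <= M & arc (snd Wg) & openin (top_of_set M) (snd Wg ` {0<..<1})"
  by (metis fst_conv snd_conv)
 from bchoice[OF this] obtain Wg where Wg: "!!p. p : M ==> openin (top_of_set M) (fst (Wg p)) & p : fst (Wg p) &
   fst (Wg p) <= track (snd (Wg p)) & track (snd (Wg p)) <= M & arc (snd (Wg p)) &
   openin (top_of_set M) (snd (Wg p) ` {0<..<1})" by blast
 define W g where "W p = fst (Wg p)" and "g p = snd (Wg p)" for p
 have W: "openin (top_of_set M) (W p)" "p : W p" and g: "W p <= track (g p)" "track (g p) <= M" "arc (g p)"
   "openin (top_of_set M) (g p ` {0<..<1})" if "p : M" for p using Wg[OF that] unfolding W_def g_def by auto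
 have "\<forall>c\<in>W ` M. openin (top_of_set M) c" "M <= \<Union>(W ` M)" using W by auto
 then obtain D where "D <= W ` M" "finite D" "M <= \<Union>D"
  using M(1) unfolding compact_eq_openin_cover by meson
 then obtain F where F: "F <= M" "finite F" "M <= \<Union>(W ` F)" by (metis finite_subset_image)
 have gF: "track (g p) <= M" "W p <= track (g p)" "arc (g p)" "openin (top_of_set M) (g p ` {0<..<1})" if "p : F" for p
  using g[OF subsetD[OF F(1) that]] by simp_all
 show ?thesis
 proof (rule that[of "g ` F"])
  show "M = \<Union>(track ` g ` F)"
  proof (rule subset_antisym)
   show "M <= \<Union>(track ` g ` F)" by (rule subset_trans[OF F(3)]) (use gF(2) in fastforce)
   show "\<Union>(track ` g ` F) <= M" using gF(1) by fast
  qed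
  show "finite (g ` F)" using F(2) by simp
  show "arc h" if "h : g ` F" for h using that gF(3) by auto
  show "openin (top_of_set M) (h ` {0<..<1})" if "h : g ` F" for h using that gF(4) by auto
 qed
qed

text \<open>
 The finitely many end points of the arcs that cover a compact curve cut it into open arcs: each
 covering arc is cut at finitely many parameters, and a piece between two cuts is open in M and
 closed in the complement of the cut points, so it is a whole component of that complement.
\<close>

lemma component_between_cuts:
 fixes M :: "'a::real_normed_vector set"
 assumes G: "finite G" "M = \<Union>(track ` G)" "!!g. g : G ==> arc g"
   "!!g. g : G ==> openin (top_of_set M) (g ` {0<..<1})"
  and V: "V = start ` G Un finish ` G"
  and C: "C : components (M - V)"
 shows "\<exists>g\<in>G. \<exists>a b. a < b & a : {s : {0..1}. g s : V} & b : {s : {0..1}. g s : V} & C = g ` {a<..<b}"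
proof -
 obtain x where x: "x : C" using C in_components_nonempty by blast
 then have xM: "x : M" "x ~: V" using in_components_subset[OF C] by auto
 then obtain g t where g: "g : G" and t: "t : {0..1}" "x = g t" unfolding G(2) path_image_def by blast
 have inj: "inj_on g {0..1}" and pg: "path g" using G(3)[OF g] by (auto simp: arc_def)
 have gM: "g ` {0..1} <= M" using g unfolding G(2) path_image_def by blast
 define S where "S = {s : {0..1}. g s : V}"
 have "finite V" unfolding V using G(1) by simp
 then have finS: "finite S" unfolding S_def using finite_vimage_IntI[OF _ inj, of V] by (simp add: vimage_def Int_def conj_commute)
 have S01: "0 : S" "1 : S" using g unfolding S_def V by (auto simp: pathstart_def pathfinish_def)
 have tS: "t ~: S" using xM t by (simp add: S_def)
 define a b where "a = Max {s\<in>S. s < t}" and "b = Min {s\<in>S. t < s}"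
 have t01: "0 < t" "t < 1" using t tS S01 by (auto simp: less_le)
 have "a : {s\<in>S. s < t}" unfolding a_def using finS S01 t01 by (intro Max_in) auto
 moreover have "b : {s\<in>S. t < s}" unfolding b_def using finS S01 t01 by (intro Min_in) auto
 ultimately have ab: "a : S" "b : S" "a < t" "t < b" by auto
 have gap: "s ~: S" if "s : {a<..<b}" for s
 proof
  assume s: "s : S"
  have "s ~= t" using s tS by auto
  then consider "s < t" | "t < s" by linarith
  then show False
  proof cases
   case 1
   then have "s <= a" unfolding a_def using finS s by (intro Max_ge) auto
   then show False using that by simp
  next
   case 2
   then have "b <= s" unfolding b_def using finS s by (intro Min_le) auto
   then show False using that by simp
  qed
 qed
 have ab01: "0 <= a" "b <= 1" using ab(1,2) by (auto simp: S_def)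
 define P where "P = g ` {a<..<b}"
 have sub: "{a<..<b} <= {0<..<1}" "{a<..<b} <= {0..1}" "{a..b} <= {0..1}" using ab01 by auto
 have PM: "P <= M - V"
 proof
  fix y assume "y : P"
  then obtain s where s: "s : {a<..<b}" "y = g s" unfolding P_def by blast
  then have "s : {0..1}" using sub(2) by blast
  then show "y : M - V" using gap[OF s(1)] gM s(2) unfolding S_def by blast
 qed
 have "connected P" unfolding P_def
  by (intro connected_continuous_image continuous_on_subset[OF pg[unfolded path_def] sub(2)]) simp
 moreover have xP: "x : P" unfolding P_def t(2) using ab by auto
 ultimately have PC: "P <= C" using components_maximal[OF C _ PM] x by blast
 obtain h where h: "homeomorphism {0..1} (track g) g h" using homeomorphism_arc[OF G(3)[OF g]] by metis
 have "homeomorphism {0<..<1} (g ` {0<..<1}) g h"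
  by (rule homeomorphism_of_subsets[OF h, of _ "track g"]) (auto simp: path_image_def)
 moreover have "openin (top_of_set {0<..<1}) {a<..<b}" unfolding openin_open by (rule exI[of _ "{a<..<b}"]) (use sub in auto)
 ultimately have "openin (top_of_set (g ` {0<..<1})) P" unfolding P_def by (rule homeomorphism_imp_open_map)
 then have "openin (top_of_set M) P" using G(4)[OF g] openin_trans by blast
 then have oP: "openin (top_of_set C) P" using openin_subset_trans[of M P C] PC in_components_subset[OF C] by blast
 have "P = C Int g ` {a..b}"
 proof (intro subset_antisym subsetI)
  fix y assume y: "y : C Int g ` {a..b}"
  then obtain s where s: "y = g s" "s : {a..b}" by blast
  have "y ~: V" using y in_components_subset[OF C] by blast
  then have "s ~: S" using s by (auto simp: S_def)
  then have "s ~= a" "s ~= b" using ab by auto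
  then show "y : P" using s by (auto simp: P_def)
 next
  fix y assume "y : P"
  moreover have "P <= g ` {a..b}" unfolding P_def by (intro image_mono) auto
  ultimately show "y : C Int g ` {a..b}" using PC by blast
 qed
 moreover have "closed (g ` {a..b})"
  by (intro compact_imp_closed compact_continuous_image continuous_on_subset[OF pg[unfolded path_def] sub(3)]) simp
 ultimately have "closedin (top_of_set C) P" by (metis closedin_closed)
 then have "P = C" using oP xP in_components_connected[OF C] unfolding connected_clopen by blast
 then show ?thesis using ab g unfolding P_def S_def by (intro bexI[of _ g] exI[of _ a] exI[of _ b]) auto
qed

lemma arc_subpath_interior:
 assumes "arc g" "a < b" "0 <= a" "b <= 1"
 shows "arc (subpath a b g)" "subpath a b g ` {0<..<1} = g ` {a<..<b}" "track (subpath a b g) <= track g"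
proof -
 show "arc (subpath a b g)" using assms by (intro arc_subpath_arc) auto
 show "track (subpath a b g) <= track g" using assms by (intro path_image_subpath_subset) auto
 have "(%s. (b - a) * s + a) ` {0<..<1} = {a<..<b}" by (rule affine_image_open_interval[OF assms(2)])
 then show "subpath a b g ` {0<..<1} = g ` {a<..<b}" unfolding subpath_def by (metis image_image)
qed

lemma no_through_arc:
 fixes e :: "real => 'a::real_normed_vector"
 assumes c: "curve_chart {-1<..<1} M f" and u: "0 < u" "u < 1"
  and e: "arc e" "f ` {-u<..<u} <= e ` {0<..<1} Un {f 0}" "f 0 : {start e, finish e}"
 shows False
proof -
 define p where "p = (if f 0 = start e then e else reversepath e)"
 have p: "arc p" "f 0 = p 0"
  subgoal using e(1) arc_reversepath[OF e(1)] by (simp add: p_def)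
  subgoal using e(3) by (auto simp: p_def pathstart_def pathfinish_def reversepath_def)
  done
 have "(%s. 1 - s) ` {0<..<1::real} = {0<..<1}"
 proof (intro subset_antisym subsetI)
  fix x :: real assume "x : {0<..<1}"
  then show "x : (%s. 1 - s) ` {0<..<1}" by (intro image_eqI[of _ _ "1 - x"]) auto
 qed auto
 then have "reversepath e ` {0<..<1} = e ` {0<..<1}" unfolding reversepath_def by (metis image_image)
 then have "p ` {0<..<1} = e ` {0<..<1}" by (simp add: p_def)
 moreover have "p ` {0<..<1} <= p ` {0..<1}" "p 0 : p ` {0..<1}" by auto
 ultimately have "e ` {0<..<1} Un {f 0} <= p ` {0..<1}" unfolding p(2) by (metis Un_subset_iff empty_subsetI insert_subset)
 with e(2) have sub: "f ` {-u<..<u} <= p ` {0..<1}" by (rule order_trans)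
 obtain h where h: "homeomorphism {0..<1} (p ` {0..<1}) p h" using arc_half_open[OF p(1)] by blast
 have s: "{-u<..<u} <= {-1<..<1}" using u by auto
 show False by (rule curve_through_end_point[OF continuous_on_subset[OF curve_chart_continuous[OF c] s]
     inj_on_subset[OF curve_chart_inj[OF c] s] _ h sub p(2)]) (use u in auto)
qed

text \<open>
 The edges are the closures of the components of M without the cut points. A vertex has two sides in the
 interior of the curve and one side at the boundary. Each side lies in one edge, and an edge cannot
 contain both sides, since a curve does not run through the end point of an arc. The resulting degrees
 are what makes parity arguments possible.
\<close>

theorem curve_subdivision:
 fixes M :: "'a::real_normed_vector set"
 assumes M: "compact M" "!!p. p : M ==> curve_interior M p | curve_end M p"
 obtains V and E :: "(real => 'a) set" where "finite V" "V <= M" "finite E"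
  "\<forall>e\<in>E. arc e & track e <= M & start e : V & finish e : V"
  "\<forall>q\<in>M - V. \<exists>!e. e : E & q : track e"
  "\<forall>v\<in>V. curve_interior M v --> card {e : E. v : {start e, finish e}} = 2"
  "\<forall>v. curve_end M v --> v : V & card {e : E. v : {start e, finish e}} = 1"
proof -
 obtain G :: "(real => 'a) set" where G: "finite G" "M = \<Union>(track ` G)"
  "!!g. g : G ==> arc g" "!!g. g : G ==> openin (top_of_set M) (g ` {0<..<1})"
  by (rule curve_arc_cover[OF M]) blast+
 define V where "V = start ` G Un finish ` G"
 have finV: "finite V" unfolding V_def using G(1) by simp
 have VM: "V <= M" unfolding V_def G(2) using pathstart_in_path_image pathfinish_in_path_image by fastforce
 define cuts where "cuts g = {s : {0..1}. g s : V}" for g :: "real => 'a"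
 have cuts: "finite (cuts g)" if "g : G" for g using finite_vimage_IntI[OF finV, of g "{0..1}"] G(3)[OF that]
  by (simp add: cuts_def arc_def vimage_def Int_def conj_commute)
 have comp: "\<exists>g\<in>G. \<exists>a b. a < b & a : cuts g & b : cuts g & C = g ` {a<..<b}" if "C : components (M - V)" for C
  using component_between_cuts[OF G(1,2) _ _ V_def that] G(3,4) unfolding cuts_def by blast
 have "components (M - V) <= (\<Union>g\<in>G. (%(a, b). g ` {a<..<b}) ` (cuts g \<times> cuts g))"
 proof
  fix C assume "C : components (M - V)"
  from comp[OF this] obtain g a b where "g : G" "a : cuts g" "b : cuts g" "C = g ` {a<..<b}" by blast
  then show "C : (\<Union>g\<in>G. (%(a, b). g ` {a<..<b}) ` (cuts g \<times> cuts g))" by force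
 qed
 then have finC: "finite (components (M - V))" by (rule finite_subset) (use G(1) cuts in auto)
 have "\<exists>p. arc p & track p <= M & p ` {0<..<1} = C & start p : V & finish p : V & openin (top_of_set M) C"
  if "C : components (M - V)" for C
 proof -
  from comp[OF that] obtain g a b where g: "g : G" "a < b" "a : cuts g" "b : cuts g" "C = g ` {a<..<b}" by blast
  have ab: "0 <= a" "b <= 1" "g a : V" "g b : V" using g by (auto simp: cuts_def)
  note sp = arc_subpath_interior[OF G(3)[OF g(1)] g(2) ab(1,2)]
  obtain h where h: "homeomorphism {0..1} (track g) g h" using homeomorphism_arc[OF G(3)[OF g(1)]] by metis
  have "homeomorphism {0<..<1} (g ` {0<..<1}) g h"
   by (rule homeomorphism_of_subsets[OF h, of _ "track g"]) (auto simp: path_image_def)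
  moreover have "openin (top_of_set {0<..<1}) {a<..<b}" unfolding openin_open by (rule exI[of _ "{a<..<b}"]) (use ab in auto)
  ultimately have "openin (top_of_set (g ` {0<..<1})) C" unfolding g(5) by (rule homeomorphism_imp_open_map)
  then have "openin (top_of_set M) C" using G(4)[OF g(1)] openin_trans by blast
  moreover have "track (subpath a b g) <= M" using sp(3) g(1) unfolding G(2) by blast
  ultimately show ?thesis using sp ab g(5) by (intro exI[of _ "subpath a b g"]) auto
 qed
 then have "\<forall>C\<in>components (M - V). \<exists>p. arc p & track p <= M & p ` {0<..<1} = C & start p : V & finish p : V & openin (top_of_set M) C"
  by blast
 from bchoice[OF this] obtain P where P0: "\<forall>C\<in>components (M - V). arc (P C) & track (P C) <= M & P C ` {0<..<1} = C &
   start (P C) : V & finish (P C) : V & openin (top_of_set M) C" ..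
 note P = bspec[OF P0]
 have Pim: "track (P C) = C Un {start (P C), finish (P C)}" if "C : components (M - V)" for C
 proof -
  have "{0..1} = {0<..<1} Un {0, 1::real}" by auto
  then have "track (P C) = P C ` ({0<..<1} Un {0, 1})" by (simp only: path_image_def)
  then show ?thesis using P[OF that] by (simp only: image_Un) (simp add: pathstart_def pathfinish_def)
 qed
 define E where "E = P ` components (M - V)"
 have CV: "C Int V = {}" if "C : components (M - V)" for C using in_components_subset[OF that] by blast
 have injP: "inj_on P (components (M - V))" using P by (metis inj_onI)
 define ends where "ends v = {C : components (M - V). v : {start (P C), finish (P C)}}" for v
 have cardE: "card {e : E. v : {start e, finish e}} = card (ends v)" for v
 proof -
  have "{e : E. v : {start e, finish e}} = P ` ends v" unfolding E_def ends_def by blast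
  moreover have "inj_on P (ends v)" by (rule inj_on_subset[OF injP]) (auto simp: ends_def)
  ultimately show ?thesis by (simp add: card_image)
 qed
 have near: "\<exists>Q. open Q & s0 : Q & P C ` ({0..1} Int Q) <= N"
  if C: "C : components (M - V)" and N: "openin (top_of_set M) N" "P C s0 : N" "s0 : {0..1}" for C N s0
 proof -
  obtain O' where O': "open O'" "N = M Int O'" using N(1) by (auto simp: openin_open)
  have "continuous_on {0..1} (P C)" using P[OF C] by (simp add: arc_def path_def)
  from continuous_openin_preimage_gen[OF this O'(1)] obtain Q where Q: "open Q" "{0..1} Int P C -` O' = {0..1} Int Q"
   by (auto simp: openin_open)
  have "P C ` {0..1} <= M" using P[OF C] by (simp add: path_image_def)
  then have "P C ` ({0..1} Int Q) <= N" using Q(2) O'(2) by blast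
  moreover have "s0 : Q" using N Q(2) O'(2) by blast
  ultimately show ?thesis using Q(1) by blast
 qed
 have localize: "\<exists>u>0. u < 1 & f ` (I Int {-u<..<u}) Int V <= {f 0}" if c: "curve_chart I M f" "0 : I" for I f
 proof -
  have "openin (top_of_set M) (M Int - (V - {f 0}))" using finV by (intro openin_open_Int open_Compl finite_imp_closed) auto
  moreover have "f 0 : M Int - (V - {f 0})" using curve_chart_subset[OF c(1)] c(2) by blast
  ultimately obtain u where e: "0 < u" "u < 1" "f ` (I Int {-u<..<u}) <= M Int - (V - {f 0})"
   by (rule curve_chart_small[OF c(1) _ _ c(2)])
  have "f ` (I Int {-u<..<u}) Int V <= {f 0}" using e(3) by blast
  then show ?thesis using e(1,2) by blast
 qed
 have side: "\<exists>C\<in>ends (f 0). f ` J <= C"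
  if c: "curve_chart I M f" "f 0 : V" and e: "f ` (I Int {-u<..<u}) Int V <= {f 0}"
   and J: "connected J" "J ~= {}" "J <= I Int {-u<..<u} - {0}" "0 : closure J" "closure J <= I" for I f u J
 proof -
  have cJ: "continuous_on (closure J) f" by (rule continuous_on_subset[OF curve_chart_continuous[OF c(1)] J(5)])
  have 0: "0 : I" using J by blast
  have "f ` J <= M - V"
  proof
   fix y assume "y : f ` J"
   then obtain s where s: "s : J" "y = f s" by blast
   then have sI: "s : I" "s ~= 0" using J(3) by auto
   then have "f s ~= f 0" using inj_onD[OF curve_chart_inj[OF c(1)] _ sI(1) 0] by blast
   moreover have "f s : f ` (I Int {-u<..<u})" using J(3) s(1) by blast
   ultimately show "y : M - V" using e s(2) sI curve_chart_subset[OF c(1)] by blast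
  qed
  moreover have "connected (f ` J)" by (intro connected_continuous_image J(1) continuous_on_subset[OF cJ closure_subset])
  ultimately obtain C where C: "C : components (M - V)" "f ` J <= C"
   using exists_component_superset[of "f ` J" "M - V"] J(2) by blast
  have "closed (track (P C))" using P[OF C(1)] closed_path_image arc_imp_path by blast
  moreover have "f ` J <= track (P C)" using C Pim by blast
  ultimately have "f ` closure J <= track (P C)" by (rule image_closure_subset[OF cJ])
  then have "f 0 : track (P C)" using J(4) by blast
  then have "C : ends (f 0)" unfolding ends_def using C(1) Pim[OF C(1)] CV[OF C(1)] c(2) by blast
  then show ?thesis using C(2) by blast
 qed
 have meets: "C Int f ` (I Int {-u<..<u} - {0}) ~= {}"
  if c: "curve_chart I M f" "f 0 : V" "0 : I" "u > 0" and C: "C : ends (f 0)" for I f u C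
 proof -
  have C': "C : components (M - V)" using C by (simp add: ends_def)
  have "openin (top_of_set I) (I Int {-u<..<u})" by (simp add: openin_open_Int)
  from curve_chart_restrict[OF c(1) this] have N: "openin (top_of_set M) (f ` (I Int {-u<..<u}))"
   unfolding curve_chart_def by blast
  obtain s0 :: real where s0: "s0 = 0 | s0 = 1" "P C s0 = f 0"
   using C unfolding ends_def pathstart_def pathfinish_def by (metis (mono_tags, lifting) insert_iff mem_Collect_eq singletonD)
  have "P C s0 : f ` (I Int {-u<..<u})" unfolding s0(2) using c by auto
  from near[OF C' N this] s0(1) obtain Q where Q: "open Q" "s0 : Q" "P C ` ({0..1} Int Q) <= f ` (I Int {-u<..<u})" by auto
  obtain r where r: "r > 0" "ball s0 r <= Q" using Q(1,2) open_contains_ball by blast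
  define s where "s = (if s0 = 0 then min (r / 2) (1 / 2) else 1 - min (r / 2) (1 / 2))"
  have s: "s : {0<..<1}" "s : ball s0 r" using r(1) s0(1) by (auto simp: s_def dist_real_def)
  have "P C s : C" using P[OF C'] s(1) by blast
  moreover have "s : {0..1} Int Q" using s r(2) by auto
  then have "P C s : f ` (I Int {-u<..<u})" using Q(3) by blast
  moreover have "P C s ~= f 0" using CV[OF C'] c(2) \<open>P C s : C\<close> by auto
  ultimately show ?thesis by blast
 qed
 have same: "C = C'" if "C : ends v" "C' : ends v" "C Int C' ~= {}" for C C' v
  using that components_eq[of C "M - V" C'] by (auto simp: ends_def)
 have two: "card (ends v) = 2" if v: "v : V" "curve_interior M v" for v
 proof -
  obtain f where f: "f 0 = v" and c: "curve_chart {-1<..<1} M f" using v(2) unfolding curve_interior_def by blast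
  obtain u where e: "u > 0" "u < 1" "f ` ({-1<..<1} Int {-u<..<u}) Int V <= {f 0}" using localize[OF c] by auto
  have v': "f 0 : V" using f v(1) by simp
  have ex1: "\<exists>C\<in>ends (f 0). f ` {0<..<u} <= C" by (rule side[OF c v' e(3)]) (use e in auto)
  have ex2: "\<exists>C\<in>ends (f 0). f ` {-u<..<0} <= C" by (rule side[OF c v' e(3)]) (use e in auto)
  from ex1 obtain C1 where C1: "C1 : ends v" "f ` {0<..<u} <= C1" unfolding f by blast
  from ex2 obtain C2 where C2: "C2 : ends v" "f ` {-u<..<0} <= C2" unfolding f by blast
  have un: "{-1<..<1} Int {-u<..<u} - {0} = {0<..<u} Un {-u<..<0}" using e(1,2) by auto
  have "C = C1 | C = C2" if C: "C : ends v" for C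
  proof -
   have "C : ends (f 0)" using C f by simp
   from meets[OF c v' _ e(1) this] have "C Int (f ` {0<..<u} Un f ` {-u<..<0}) ~= {}" unfolding un image_Un by simp
   then have "C Int C1 ~= {} | C Int C2 ~= {}" using C1(2) C2(2) by blast
   then show ?thesis using same[OF C C1(1)] same[OF C C2(1)] by blast
  qed
  then have "ends v = {C1, C2}" using C1(1) C2(1) by blast
  moreover have "C1 ~= C2"
  proof
   assume eq: "C1 = C2"
   have C1': "C1 : components (M - V)" "v : {start (P C1), finish (P C1)}" using C1(1) by (auto simp: ends_def)
   have "{-u<..<u} = {0<..<u} Un {-u<..<0} Un {0}" using e(1) by auto
   then have "f ` {-u<..<u} <= P C1 ` {0<..<1} Un {f 0}" using C1(2) C2(2) eq P[OF C1'(1)] by auto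
   from no_through_arc[OF c e(1,2) _ this] show False using P[OF C1'(1)] C1'(2) f by simp
  qed
  ultimately show ?thesis by simp
 qed
 have one: "v : V & card (ends v) = 1" if v: "curve_end M v" for v
 proof
  obtain f where f: "f 0 = v" and c: "curve_chart {0..<1} M f" using v unfolding curve_end_def by blast
  have vM: "v : M" using curve_chart_subset[OF c] f by auto
  show vV: "v : V"
  proof (rule ccontr)
   assume "v ~: V"
   then obtain C where C: "C : components (M - V)" "v : C" using vM Union_components[of "M - V"] by blast
   have "v : P C ` {0<..<1}" using P[OF C(1)] C(2) by simp
   then obtain t0 where t0: "t0 : {0<..<1}" "P C t0 = v" by (elim imageE) simp
   obtain l where N: "openin (top_of_set M) (f ` {0..<1})" and h: "homeomorphism {0..<1} (f ` {0..<1}) f l"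
    using c unfolding curve_chart_def by blast
   have "P C t0 : f ` {0..<1}" using t0(2) f by (intro image_eqI[of _ _ 0]) auto
   moreover have "t0 : {0..1}" using t0(1) by simp
   ultimately obtain Q where Q: "open Q" "t0 : Q" "P C ` ({0..1} Int Q) <= f ` {0..<1}"
    using near[OF C(1) N] by blast
   have "open (Q Int {0<..<1})" "t0 : Q Int {0<..<1}" using Q t0 by auto
   then obtain r where r: "r > 0" "ball t0 r <= Q Int {0<..<1}" using open_contains_ball by blast
   then have b: "{t0 - r<..<t0 + r} <= Q Int {0<..<1}" by (simp add: ball_eq_greaterThanLessThan)
   also have "... <= {0..1}" by auto
   finally have s: "{t0 - r<..<t0 + r} <= {0..1}" .
   have a: "continuous_on {0..1} (P C)" "inj_on (P C) {0..1}" using P[OF C(1)] by (auto simp: arc_def path_def)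
   show False
   proof (rule curve_through_end_point[OF continuous_on_subset[OF a(1) s] inj_on_subset[OF a(2) s] _ h])
    show "t0 : {t0 - r<..<t0 + r}" using r(1) by simp
    have "{t0 - r<..<t0 + r} <= {0..1} Int Q" using b s by simp
    then show "P C ` {t0 - r<..<t0 + r} <= f ` {0..<1}" using Q(3) by (meson image_mono subset_trans)
    show "P C t0 = f 0" using t0(2) f by simp
   qed
  qed
  obtain u where e: "u > 0" "u < 1" "f ` ({0..<1} Int {-u<..<u}) Int V <= {f 0}" using localize[OF c] by auto
  have v': "f 0 : V" using f vV by simp
  have "\<exists>C\<in>ends (f 0). f ` {0<..<u} <= C" by (rule side[OF c v' e(3)]) (use e in auto)
  then obtain C1 where C1: "C1 : ends v" "f ` {0<..<u} <= C1" unfolding f by blast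
  have un: "{0..<1} Int {-u<..<u} - {0} = {0<..<u}" using e(1,2) by auto
  have "C = C1" if C: "C : ends v" for C
  proof -
   have "C : ends (f 0)" using C f by simp
   from meets[OF c v' _ e(1) this] have "C Int f ` {0<..<u} ~= {}" unfolding un by simp
   then have "C Int C1 ~= {}" using C1(2) by blast
   then show ?thesis using same[OF C C1(1)] by blast
  qed
  then have "ends v = {C1}" using C1(1) by blast
  then show "card (ends v) = 1" by simp
 qed
 show ?thesis
 proof (rule that[of V E])
  show "finite E" unfolding E_def using finC by simp
  show "\<forall>e\<in>E. arc e & track e <= M & start e : V & finish e : V"
   unfolding E_def using P by simp
  show "\<forall>q\<in>M - V. \<exists>!e. e : E & q : track e"
  proof
   fix q assume q: "q : M - V"
   obtain C where C: "C : components (M - V)" "q : C" using q Union_components[of "M - V"] by blast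
   show "\<exists>!e. e : E & q : track e"
   proof (rule ex1I[of _ "P C"])
    show "P C : E & q : track (P C)" using C Pim[OF C(1)] unfolding E_def by blast
    fix e assume "e : E & q : track e"
    then obtain C' where C': "C' : components (M - V)" "e = P C'" "q : track (P C')" unfolding E_def by blast
    then have "q : C'" using Pim[OF C'(1)] P[OF C'(1)] q by auto
    then have "C' = C" using components_eq[OF C'(1) C(1)] C(2) by blast
    then show "e = P C" using C'(2) by simp
   qed
  qed
 qed (use finV VM two one cardE in auto)
qed

lemma curve_interior_manifold: "manifold_interior_point M p ==> curve_interior M p"
 and curve_end_manifold: "manifold_boundary_point M p ==> curve_end M p"
proof -
 have c: "curve_chart I M f" if "open U" "homeomorphism I (M Int U) f h" for I f h U
 proof -
  have "f ` I = M Int U" using that(2) by (simp add: homeomorphism_def)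
  then show ?thesis using that unfolding curve_chart_def by (auto simp: openin_open_Int)
 qed
 show "manifold_interior_point M p ==> curve_interior M p"
  unfolding manifold_interior_point_def curve_interior_def using c by blast
 show "manifold_boundary_point M p ==> curve_end M p"
  unfolding manifold_boundary_point_def curve_end_def using c by blast
qed

lemma locally_path_connected_curve:
 fixes M :: "'a::real_normed_vector set"
 assumes "!!p. p : M ==> curve_interior M p"
 shows "locally path_connected M"
proof (rule locallyI)
 fix w x assume w: "openin (top_of_set M) w" "x : w"
 then have "x : M" using openin_imp_subset by blast
 then obtain f where f: "f 0 = x" and c: "curve_chart {-1<..<1} M f" using assms unfolding curve_interior_def by blast
 have "f 0 : w" "(0::real) : {-1<..<1}" using f w(2) by simp_all
 from curve_chart_small[OF c w(1) this] obtain h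
  where e: "0 < h" "h < 1" "f ` ({-1<..<1} Int {-h<..<h}) <= w" by metis
 let ?I = "{-1<..<1} Int {-h<..<h}"
 have "openin (top_of_set M) (f ` ?I)"
  using curve_chart_restrict[OF c openin_open_Int[OF open_greaterThanLessThan]] unfolding curve_chart_def by blast
 moreover have "path_connected (f ` ?I)"
 proof (rule path_connected_continuous_image)
  show "continuous_on ?I f" by (rule continuous_on_subset[OF curve_chart_continuous[OF c]]) auto
  show "path_connected ?I" by (intro convex_imp_path_connected convex_Int convex_real_interval)
 qed
 moreover have "x : f ` ?I" using f e(1) by (intro image_eqI[of _ _ 0]) auto
 ultimately show "\<exists>u v. openin (top_of_set M) u & path_connected v & x : u & u <= v & v <= w" using e(3) by blast
qed

lemma components_path_connected:
 assumes "locally path_connected M" "C : components M" shows "path_connected C" "openin (top_of_set M) C"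
proof -
 obtain x where x: "x : M" "C = connected_component_set M x" using assms(2) by (elim componentsE) blast
 then have "C = path_component_set M x" using path_component_eq_connected_component_set[OF assms(1)] by simp
 then show "path_connected C" by simp
 show "openin (top_of_set M) C"
  by (rule openin_components_locally_connected[OF locally_path_connected_imp_locally_connected[OF assms(1)] assms(2)])
qed

section \<open>Joining arcs to closed paths\<close>

text \<open>
 A path passes well through q if it meets q finitely often, never at its ends, and is injective
 near each passage. This is what is needed to count crossings with a small disc through q.
\<close>

definition visits :: "(real => 'a) => 'a => real set" where
 "visits p q = {s : {0..1}. p s = q}"

definition passes_well :: "'a => (real => 'a) => bool" where
 "passes_well q p \<longleftrightarrow> finite (visits p q) &
   (\<forall>s\<in>visits p q. \<exists>e>0. {s-e<..<s+e} <= {0..1} & inj_on p {s-e<..<s+e})"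

lemma visits_empty: "q ~: track p ==> visits p q = {}" by (auto simp: visits_def path_image_def)

lemma passes_well_reversepath:
 assumes "passes_well q p"
 shows "passes_well q (reversepath p)" "card (visits (reversepath p) q) = card (visits p q)"
proof -
 have v: "visits (reversepath p) q = (%s. 1 - s) ` visits p q"
 proof (intro subset_antisym subsetI)
  fix s assume "s : visits (reversepath p) q"
  then show "s : (%s. 1 - s) ` visits p q"
   by (intro image_eqI[of _ _ "1 - s"]) (auto simp: visits_def reversepath_def)
 qed (auto simp: visits_def reversepath_def)
 have inj: "inj_on (%s::real. 1 - s) A" for A by (auto simp: inj_on_def)
 show "card (visits (reversepath p) q) = card (visits p q)" unfolding v by (rule card_image[OF inj])
 show "passes_well q (reversepath p)" unfolding passes_well_def v
 proof (intro conjI ballI)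
  show "finite ((%s. 1 - s) ` visits p q)" using assms by (simp add: passes_well_def)
  fix s assume "s : (%s. 1 - s) ` visits p q"
  then have "1 - s : visits p q" by auto
  then obtain h where e: "h > 0" "{1-s-h<..<1-s+h} <= {0..1}" "inj_on p {1-s-h<..<1-s+h}"
   using assms unfolding passes_well_def by blast
  have m: "1 - u : {1-s-h<..<1-s+h}" if "u : {s-h<..<s+h}" for u using that by auto
  have "u : {0..1}" if "u : {s-h<..<s+h}" for u using subsetD[OF e(2) m[OF that]] by auto
  moreover have "inj_on (reversepath p) {s-h<..<s+h}"
   unfolding reversepath_def using inj_onD[OF e(3) _ m m] by (intro inj_onI) force
  ultimately show "\<exists>h>0. {s-h<..<s+h} <= {0..1} & inj_on (reversepath p) {s-h<..<s+h}" using e(1) by blast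
 qed
qed

lemma passes_well_join:
 assumes p: "passes_well q p" and r: "passes_well q r" and q: "finish p = start r" "q ~= start r"
 shows "passes_well q (p +++ r)" "card (visits (p +++ r) q) = card (visits p q) + card (visits r q)"
proof -
 have p1: "s < 1" if "s : visits p q" for s
 proof -
  have "s ~= 1" using that q by (auto simp: visits_def pathfinish_def)
  then show ?thesis using that by (auto simp: visits_def)
 qed
 have r0: "0 < s" if "s : visits r q" for s
 proof -
  have "s ~= 0" using that q by (auto simp: visits_def pathstart_def)
  then show ?thesis using that by (auto simp: visits_def)
 qed
 define a b where "a s = s / 2" and "b s = (s + 1) / 2" for s :: real
 have v: "visits (p +++ r) q = a ` visits p q Un b ` visits r q"
 proof (intro subset_antisym subsetI)
  fix s assume s: "s : visits (p +++ r) q"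
  show "s : a ` visits p q Un b ` visits r q"
  proof (cases "s <= 1/2")
   case True
   then have "2 * s : visits p q" "s = a (2 * s)" using s by (auto simp: visits_def joinpaths_def a_def)
   then show ?thesis by blast
  next
   case False
   then have "2 * s - 1 : visits r q" "s = b (2 * s - 1)" using s by (auto simp: visits_def joinpaths_def b_def)
   then show ?thesis by blast
  qed
 next
  fix s assume "s : a ` visits p q Un b ` visits r q"
  then consider u where "u : visits p q" "s = a u" | u where "u : visits r q" "s = b u" by blast
  then show "s : visits (p +++ r) q"
  proof cases
   case 1
   have "2 * a u = u" by (simp add: a_def)
   moreover have "a u <= 1 / 2" "0 <= a u" using 1(1) by (auto simp: visits_def a_def)
   ultimately show ?thesis using 1 by (auto simp: visits_def joinpaths_def)
  next
   case 2
   have "~ b u <= 1 / 2" "2 * b u - 1 = u" using r0[OF 2(1)] by (simp_all add: b_def field_simps)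
   moreover have "0 <= b u" "b u <= 1" using 2(1) by (auto simp: visits_def b_def)
   ultimately show ?thesis using 2 by (auto simp: visits_def joinpaths_def)
  qed
 qed
 have fin: "finite (visits p q)" "finite (visits r q)" using p r by (auto simp: passes_well_def)
 have "a s < 1/2" if "s : visits p q" for s using p1[OF that] by (simp add: a_def)
 moreover have "1/2 < b s" if "s : visits r q" for s using r0[OF that] by (simp add: b_def)
 ultimately have "a ` visits p q Int b ` visits r q = {}" by fastforce
 moreover have "inj_on a A" "inj_on b A" for A by (auto simp: inj_on_def a_def b_def)
 ultimately show "card (visits (p +++ r) q) = card (visits p q) + card (visits r q)"
  unfolding v using fin by (simp add: card_Un_disjoint card_image)
 show "passes_well q (p +++ r)" unfolding passes_well_def
 proof (intro conjI ballI)
  show "finite (visits (p +++ r) q)" unfolding v using fin by simp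
  fix s assume "s : visits (p +++ r) q"
  then consider u where "u : visits p q" "s = a u" | u where "u : visits r q" "s = b u" unfolding v by blast
  then show "\<exists>ep>0. {s-ep<..<s+ep} <= {0..1} & inj_on (p +++ r) {s-ep<..<s+ep}"
  proof cases
   case 1
   obtain ep where e: "ep > 0" "{u-ep<..<u+ep} <= {0..1}" "inj_on p {u-ep<..<u+ep}"
    using p 1(1) unfolding passes_well_def by blast
   have m: "2 * x : {u-ep<..<u+ep}" if "x : {s-ep/2<..<s+ep/2}" for x using that 1(2) by (auto simp: a_def)
   have h: "x <= 1/2" "0 <= x" if "x : {s-ep/2<..<s+ep/2}" for x using subsetD[OF e(2) m[OF that]] by auto
   have "inj_on (p +++ r) {s-ep/2<..<s+ep/2}"
   proof (rule inj_onI)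
    fix x y assume x: "x : {s-ep/2<..<s+ep/2}" and y: "y : {s-ep/2<..<s+ep/2}" and eq: "(p +++ r) x = (p +++ r) y"
    have "p (2 * x) = p (2 * y)" using eq h(1)[OF x] h(1)[OF y] by (simp add: joinpaths_def)
    then show "x = y" using inj_onD[OF e(3) _ m[OF x] m[OF y]] by simp
   qed
   moreover have "{s-ep/2<..<s+ep/2} <= {0..1}" using h by force
   ultimately show ?thesis using e(1) by (intro exI[of _ "ep/2"]) simp
  next
   case 2
   obtain ep where e: "ep > 0" "{u-ep<..<u+ep} <= {0..1}" "inj_on r {u-ep<..<u+ep}"
    using r 2(1) unfolding passes_well_def by blast
   have u0: "u > 0" using r0[OF 2(1)] .
   define d where "d = min ep u"
   have m: "2 * x - 1 : {u-ep<..<u+ep}" "1/2 < x" if "x : {s-d/2<..<s+d/2}" for x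
    using that 2(2) by (auto simp: b_def d_def min_def field_simps split: if_splits)
   have h: "x <= 1" "0 <= x" if "x : {s-d/2<..<s+d/2}" for x using subsetD[OF e(2) m(1)[OF that]] by auto
   have "inj_on (p +++ r) {s-d/2<..<s+d/2}"
   proof (rule inj_onI)
    fix x y assume x: "x : {s-d/2<..<s+d/2}" and y: "y : {s-d/2<..<s+d/2}" and eq: "(p +++ r) x = (p +++ r) y"
    have "r (2 * x - 1) = r (2 * y - 1)" using eq m(2)[OF x] m(2)[OF y] by (simp add: joinpaths_def)
    then show "x = y" using inj_onD[OF e(3) _ m(1)[OF x] m(1)[OF y]] by simp
   qed
   moreover have "{s-d/2<..<s+d/2} <= {0..1}" using h by force
   moreover have "d > 0" using e(1) u0 by (simp add: d_def)
   ultimately show ?thesis by (intro exI[of _ "d/2"]) simp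
  qed
 qed
qed

definition ends_in :: "'a::topological_space set => (real => 'a) => nat" where
 "ends_in K e = of_bool (start e : K) + of_bool (finish e : K)"

text \<open>
 Euler's argument: an arc is prolonged at its end through the class containing that end, along
 another arc with an end in the same class, until it can be closed up within a class.
\<close>

lemma even_ends_closed_paths:
 fixes es :: "(real => 'a::real_normed_vector) list"
 assumes K: "!!K. K : \<K> ==> path_connected K" "!!K K'. K : \<K> ==> K' : \<K> ==> K Int K' ~= {} ==> K = K'"
  and es: "!!e. e : set es ==> path e & start e : \<Union>\<K> & finish e : \<Union>\<K>"
  and ev: "!!K. K : \<K> ==> even (sum_list (map (ends_in K) es))"
 shows "\<exists>cs. (\<forall>c\<in>set cs. path c & finish c = start c & track c <= \<Union>(track ` set es) Un \<Union>\<K>) &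
   (\<forall>q. q ~: \<Union>\<K> --> (\<forall>e\<in>set es. passes_well q e) --> (\<forall>c\<in>set cs. passes_well q c) &
    (\<Sum>c\<leftarrow>cs. card (visits c q)) = (\<Sum>e\<leftarrow>es. card (visits e q)))" using es ev
proof (induction "length es" arbitrary: es rule: less_induct)
 case less
 note es = less.prems(1) and ev = less.prems(2)
 show ?case
 proof (cases es)
  case Nil
  then show ?thesis by (intro exI[of _ "[]"]) simp
 next
  case (Cons e es')
  have e: "path e" "start e : \<Union>\<K>" "finish e : \<Union>\<K>" using es[of e] Cons by auto
  obtain K where K1: "K : \<K>" "finish e : K" using e by blast
  have avoid: "passes_well q k" "card (visits k q) = 0" if "track k <= \<Union>\<K>" "q ~: \<Union>\<K>" for q k
  proof -
   have "visits k q = {}" using that by (intro visits_empty) blast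
   then show "passes_well q k" "card (visits k q) = 0" by (auto simp: passes_well_def)
  qed
  show ?thesis
  proof (cases "start e : K")
   case True
   obtain k where k: "path k" "track k <= K" "start k = finish e" "finish k = start e"
    using K(1)[OF K1(1)] K1(2) True unfolding path_connected_def by blast
   then have kK: "track k <= \<Union>\<K>" using K1(1) by blast
   have ends: "ends_in K' e = (if K' = K then 2 else 0)" if "K' : \<K>" for K'
    using K(2)[OF that K1(1)] K1(2) True by (auto simp: ends_in_def)
   have "even (sum_list (map (ends_in K') es'))" if "K' : \<K>" for K'
    using ev[OF that] ends[OF that] unfolding Cons by (auto split: if_splits)
   then obtain cs where cs: "\<forall>c\<in>set cs. path c & finish c = start c & track c <= \<Union>(track ` set es') Un \<Union>\<K>"
    "\<forall>q. q ~: \<Union>\<K> --> (\<forall>e\<in>set es'. passes_well q e) --> (\<forall>c\<in>set cs. passes_well q c) &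
     (\<Sum>c\<leftarrow>cs. card (visits c q)) = (\<Sum>e\<leftarrow>es'. card (visits e q))"
    using less.hyps[of es'] es unfolding Cons by auto
   have im: "track (e +++ k) = track e Un track k" using k by (simp add: path_image_join)
   show ?thesis unfolding Cons
   proof (intro exI[of _ "(e +++ k) # cs"] conjI ballI allI impI)
    fix c assume c: "c : set ((e +++ k) # cs)"
    have "path c & finish c = start c & track c <= \<Union>(track ` set (e # es')) Un \<Union>\<K>"
    proof (cases "c = e +++ k")
     case True
     moreover have "track (e +++ k) <= \<Union>(track ` set (e # es')) Un \<Union>\<K>" unfolding im using kK by auto
     ultimately show ?thesis using e(1) k by simp
    next
     case False
     then have "c : set cs" using c by simp
     moreover have "\<Union>(track ` set es') Un \<Union>\<K> <= \<Union>(track ` set (e # es')) Un \<Union>\<K>" by auto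
     ultimately show ?thesis using cs(1) by (meson subset_trans)
    qed
    then show "path c" "finish c = start c" "track c <= \<Union>(track ` set (e # es')) Un \<Union>\<K>"
     by blast+
   next
    fix q assume q: "q ~: \<Union>\<K>" "\<forall>e\<in>set (e # es'). passes_well q e"
    have 1: "finish e = start k" "q ~= start k" using k q(1) e(3) by auto
    have pe: "passes_well q e" using q(2) by simp
    note j = passes_well_join[OF pe avoid(1)[OF kK q(1)] 1]
    have cs': "(\<forall>c\<in>set cs. passes_well q c) & (\<Sum>c\<leftarrow>cs. card (visits c q)) = (\<Sum>e\<leftarrow>es'. card (visits e q))"
     using cs(2) q by simp
    show "passes_well q c" if "c : set ((e +++ k) # cs)" for c using that cs' j(1) by auto
    show "(\<Sum>c\<leftarrow>(e +++ k) # cs. card (visits c q)) = (\<Sum>e\<leftarrow>e # es'. card (visits e q))"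
     using cs' j(2) avoid(2)[OF kK q(1)] by simp
   qed
  next
   case False
   have "odd (ends_in K e)" using K1(2) False by (simp add: ends_in_def)
   then have "odd (sum_list (map (ends_in K) es'))" using ev[OF K1(1)] unfolding Cons by simp
   then obtain f where f: "f : set es'" "odd (ends_in K f)" by (induction es') (auto split: if_splits)
   \<comment> \<open>By parity some other arc f has just one end in K; e, a path inside K and f form a single longer arc.\<close>
   define f' where "f' = (if start f : K then f else reversepath f)"
   have fp: "path f" "start f : \<Union>\<K>" "finish f : \<Union>\<K>" using es[of f] f(1) Cons by auto
   have f': "path f'" "track f' = track f" "start f' : K" "finish f' : \<Union>\<K>" "ends_in K' f' = ends_in K' f" for K'
    using fp f(2) by (auto simp: f'_def ends_in_def)
   have f'v: "passes_well q f'" "card (visits f' q) = card (visits f q)" if "passes_well q f" for q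
    using that passes_well_reversepath[OF that] by (auto simp: f'_def)
   obtain k where k: "path k" "track k <= K" "start k = finish e" "finish k = start f'"
    using K(1)[OF K1(1)] K1(2) f'(3) unfolding path_connected_def by blast
   then have kK: "track k <= \<Union>\<K>" using K1(1) by blast
   define j where "j = e +++ k +++ f'"
   define es2 where "es2 = j # remove1 f es'"
   have len: "length es2 < length es" using f(1) Cons length_pos_if_in_set[OF f(1)] by (simp add: es2_def length_remove1)
   have jp: "path j" "start j = start e" "finish j = finish f'" "track j = track e Un track k Un track f"
    using e(1) f' k by (auto simp: j_def path_image_join)
   have ends: "even (ends_in K' j) \<longleftrightarrow> even (ends_in K' e + ends_in K' f)" if "K' : \<K>" for K'
   proof -
    have "finish e : K' \<longleftrightarrow> start f' : K'" using K(2)[OF that K1(1)] K1(2) f'(3) by blast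
    then have "even (ends_in K' j) \<longleftrightarrow> even (ends_in K' e + ends_in K' f')" by (auto simp: ends_in_def jp)
    then show ?thesis unfolding f'(5) .
   qed
   have sub: "set (remove1 f es') <= set es'" by (rule set_remove1_subset)
   have "\<exists>cs. (\<forall>c\<in>set cs. path c & finish c = start c & track c <= \<Union>(track ` set es2) Un \<Union>\<K>) &
    (\<forall>q. q ~: \<Union>\<K> --> (\<forall>e\<in>set es2. passes_well q e) --> (\<forall>c\<in>set cs. passes_well q c) &
     (\<Sum>c\<leftarrow>cs. card (visits c q)) = (\<Sum>e\<leftarrow>es2. card (visits e q)))"
   proof (rule less.hyps[OF len])
    show "path e' & start e' : \<Union>\<K> & finish e' : \<Union>\<K>" if "e' : set es2" for e'
     using that jp e f'(4) es sub unfolding es2_def Cons by auto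
    fix K' assume K': "K' : \<K>"
    have "sum_list (map (ends_in K') es') = ends_in K' f + sum_list (map (ends_in K') (remove1 f es'))"
     by (rule sum_list_map_remove1[OF f(1)])
    then show "even (sum_list (map (ends_in K') es2))" using ev[OF K'] ends[OF K'] unfolding es2_def Cons by auto
   qed
   then obtain cs where cs: "\<forall>c\<in>set cs. path c & finish c = start c & track c <= \<Union>(track ` set es2) Un \<Union>\<K>"
    "\<forall>q. q ~: \<Union>\<K> --> (\<forall>e\<in>set es2. passes_well q e) --> (\<forall>c\<in>set cs. passes_well q c) &
     (\<Sum>c\<leftarrow>cs. card (visits c q)) = (\<Sum>e\<leftarrow>es2. card (visits e q))" by (elim exE conjE) simp
   have "track j <= \<Union>(track ` set es) Un \<Union>\<K>" using kK f(1) unfolding jp Cons by auto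
   moreover have "track e' <= \<Union>(track ` set es) Un \<Union>\<K>" if "e' : set (remove1 f es')" for e'
    using that sub unfolding Cons by auto
   ultimately have im: "\<Union>(track ` set es2) <= \<Union>(track ` set es) Un \<Union>\<K>" unfolding es2_def by auto
   show ?thesis
   proof (intro exI[of _ cs] conjI ballI allI impI)
    fix c assume "c : set cs"
    then show "path c" "finish c = start c" "track c <= \<Union>(track ` set es) Un \<Union>\<K>"
     using cs(1) im by (simp_all, blast)
   next
    fix q assume q: "q ~: \<Union>\<K>" "\<forall>e\<in>set es. passes_well q e"
    have pe: "passes_well q e" "passes_well q f" using q(2) f(1) Cons by auto
    have 1: "finish k = start f'" "q ~= start f'" using k q(1) f'(3) K1(1) by auto
    have 2: "finish e = start (k +++ f')" "q ~= start (k +++ f')" using k q(1) e(3) by auto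
    note j1 = passes_well_join[OF avoid(1)[OF kK q(1)] f'v(1)[OF pe(2)] 1]
    note j2 = passes_well_join[OF pe(1) j1(1) 2]
    have "\<forall>e\<in>set es2. passes_well q e" using j2(1) sub q(2) unfolding es2_def j_def Cons by auto
    then have cs': "(\<forall>c\<in>set cs. passes_well q c) & (\<Sum>c\<leftarrow>cs. card (visits c q)) = (\<Sum>e\<leftarrow>es2. card (visits e q))"
     using cs(2) q(1) by simp
    show "passes_well q c" if "c : set cs" for c using that cs' by blast
    have "(\<Sum>e\<leftarrow>es2. card (visits e q)) = card (visits e q) + card (visits f q) + (\<Sum>e\<leftarrow>remove1 f es'. card (visits e q))"
     unfolding es2_def j_def using j2(2) j1(2) f'v(2)[OF pe(2)] avoid(2)[OF kK q(1)] by simp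
    also have "... = (\<Sum>e\<leftarrow>es. card (visits e q))"
     using sum_list_map_remove1[OF f(1), of "%e. card (visits e q)"] unfolding Cons by simp
    finally show "(\<Sum>c\<leftarrow>cs. card (visits c q)) = (\<Sum>e\<leftarrow>es. card (visits e q))" using cs' by simp
   qed
  qed
 qed
qed

lemma passes_well_arc:
 assumes e: "arc e" "q ~= start e" "q ~= finish e"
 shows "passes_well q e" "card (visits e q) = of_bool (q : track e)"
proof -
 have inj: "inj_on e {0..1}" using e(1) by (simp add: arc_def)
 have "visits e q = {} & q ~: track e | (\<exists>s\<in>{0<..<1}. visits e q = {s} & q : track e)"
 proof (cases "q : track e")
  case True
  then obtain s where s: "s : {0..1}" "q = e s" unfolding path_image_def by blast
  then have "s ~= 0" "s ~= 1" using e(2,3) by (auto simp: pathstart_def pathfinish_def)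
  then have "s : {0<..<1}" using s(1) by auto
  moreover have "visits e q = {s}" using s inj by (auto simp: visits_def dest: inj_onD)
  ultimately show ?thesis using True by blast
 qed (use visits_empty in blast)
 then have "passes_well q e & card (visits e q) = of_bool (q : track e)"
 proof
  assume "\<exists>s\<in>{0<..<1}. visits e q = {s} & q : track e"
  then obtain s where s: "s : {0<..<1}" "visits e q = {s}" "q : track e" by blast
  let ?h = "min s (1 - s)"
  have "{s-?h<..<s+?h} <= {0..1}" by auto
  moreover have "?h > 0" using s(1) by simp
  ultimately have "\<exists>h>0. {s-h<..<s+h} <= {0..1} & inj_on e {s-h<..<s+h}" using inj_on_subset[OF inj] by blast
  then show ?thesis using s(2,3) by (simp add: passes_well_def)
 qed (auto simp: passes_well_def)
 then show "passes_well q e" "card (visits e q) = of_bool (q : track e)" by auto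
qed

lemma sum_indicator_card: "finite A ==> (\<Sum>x\<in>A. of_bool (P x)) = card {x : A. P x}"
 by (simp add: Int_def)

text \<open>
 Double counting of pairs of a vertex and an edge that ends there. Vertices on L are boundary points of
 the marking and have degree one, all others have degree two.
\<close>

lemma marking_edges:
 assumes \<omega>: "marking_data L \<omega>"
 obtains V es where "finite V" "V <= \<omega>" "manifold_boundary \<omega> <= V"
  "\<forall>e\<in>set es. path e & track e <= \<omega> & start e : V & finish e : V"
  "\<forall>q. q ~: V --> (\<forall>e\<in>set es. passes_well q e) & (\<Sum>e\<leftarrow>es. card (visits e q)) = of_bool (q : \<omega>)"
  "\<forall>K. sum_list (map (ends_in K) es) = (\<Sum>v\<in>V Int K. if v : L then 1 else 2)"
proof -
 have comp: "compact \<omega>" and bd: "manifold_boundary \<omega> = \<omega> Int L" and sub: "submanifold1 \<omega>"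
  using \<omega> by (auto simp: marking_data_def)
 have "p : \<omega> ==> curve_interior \<omega> p | curve_end \<omega> p" for p
  using sub curve_interior_manifold curve_end_manifold unfolding submanifold1_def by blast
 then obtain V and E :: "(real => R4) set" where V: "finite V" "V <= \<omega>" "finite E"
  and E0: "\<forall>e\<in>E. arc e & track e <= \<omega> & start e : V & finish e : V"
  and ex1: "\<forall>q\<in>\<omega> - V. \<exists>!e. e : E & q : track e"
  and two: "\<forall>v\<in>V. curve_interior \<omega> v --> card {e : E. v : {start e, finish e}} = 2"
  and one: "\<forall>v. curve_end \<omega> v --> v : V & card {e : E. v : {start e, finish e}} = 1"
  by (rule curve_subdivision[OF comp])
 note E = bspec[OF E0]
 obtain es where es: "set es = E" "distinct es" using finite_distinct_list[OF V(3)] by blast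
 have end_iff: "v : \<omega> Int L ==> curve_end \<omega> v" for v
  using bd curve_end_manifold unfolding manifold_boundary_def by blast
 have deg: "card {e : E. v : {start e, finish e}} = (if v : L then 1 else 2)" if "v : V" for v
 proof (cases "v : L")
  case True
  then have "curve_end \<omega> v" using end_iff that V(2) by blast
  then show ?thesis using one True by simp
 next
  case False
  then have "v ~: manifold_boundary \<omega>" using bd by blast
  then have "manifold_interior_point \<omega> v"
   using sub that V(2) unfolding submanifold1_def manifold_boundary_def by blast
  then show ?thesis using two that curve_interior_manifold False by simp
 qed
 show ?thesis
 proof (rule that[of V es])
  show "manifold_boundary \<omega> <= V" using bd one end_iff by blast
  show "\<forall>e\<in>set es. path e & track e <= \<omega> & start e : V & finish e : V"
   using E0 arc_imp_path unfolding es by blast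
  show "\<forall>q. q ~: V --> (\<forall>e\<in>set es. passes_well q e) & (\<Sum>e\<leftarrow>es. card (visits e q)) = of_bool (q : \<omega>)"
  proof (intro allI impI conjI ballI)
   fix q assume q: "q ~: V"
   have pw: "passes_well q e" "card (visits e q) = of_bool (q : track e)" if "e : E" for e
    by (rule passes_well_arc; use E[OF that] q in blast)+
   show "passes_well q e" if "e : set es" for e using pw that es by blast
   have "(\<Sum>e\<leftarrow>es. card (visits e q)) = (\<Sum>e\<in>E. card (visits e q))"
    using sum_list_distinct_conv_sum_set[OF es(2), of "%e. card (visits e q)"] es(1) by simp
   also have "... = (\<Sum>e\<in>E. of_bool (q : track e))" using pw by (intro sum.cong) auto
   also have "... = card {e : E. q : track e}" using V(3) by (simp add: Int_def)
   also have "... = of_bool (q : \<omega>)"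
   proof (cases "q : \<omega>")
    case True
    then obtain e where "e : E" "q : track e" "\<forall>e'. e' : E & q : track e' --> e' = e" using ex1 q by blast
    then have "{e : E. q : track e} = {e}" by blast
    then show ?thesis using True by simp
   next
    case False
    then have "{e : E. q : track e} = {}" using E by blast
    then show ?thesis using False by (simp only: card.empty of_bool_eq simp_thms)
   qed
   finally show "(\<Sum>e\<leftarrow>es. card (visits e q)) = of_bool (q : \<omega>)" .
  qed
  show "\<forall>K. sum_list (map (ends_in K) es) = (\<Sum>v\<in>V Int K. if v : L then 1 else 2)"
  proof
   fix K
   have one_end: "ends_in K e = (\<Sum>v\<in>V Int K. of_bool (v : {start e, finish e}))" if "e : E" for e
   proof -
    have ne: "start e ~= finish e" using arc_distinct_ends[OF conjunct1[OF E[OF that]]] by (rule not_sym)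
    have "(\<Sum>v\<in>V Int K. of_bool (v : {start e, finish e})) = card ((V Int K) Int {start e, finish e})"
     using sum_indicator_card[OF finite_Int[OF disjI1[OF V(1)]]] by (simp only: Int_def[of "V Int K"])
    also have "(V Int K) Int {start e, finish e} = K Int {start e, finish e}" using E[OF that] by blast
    also have "card ... = ends_in K e" using ne by (auto simp: ends_in_def Int_insert_right)
    finally show ?thesis by simp
   qed
   have "sum_list (map (ends_in K) es) = (\<Sum>e\<in>E. ends_in K e)"
    using sum_list_distinct_conv_sum_set[OF es(2)] es(1) by simp
   also have "... = (\<Sum>e\<in>E. \<Sum>v\<in>V Int K. of_bool (v : {start e, finish e}))"
    using one_end by (rule sum.cong[OF refl])
   also have "... = (\<Sum>v\<in>V Int K. \<Sum>e\<in>E. of_bool (v : {start e, finish e}))" by (rule sum.swap)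
   also have "... = (\<Sum>v\<in>V Int K. if v : L then 1 else 2)"
   proof (rule sum.cong[OF refl])
    fix v assume "v : V Int K"
    have "(\<Sum>e\<in>E. of_bool (v : {start e, finish e})) = card {e : E. v : {start e, finish e}}"
     by (rule sum_indicator_card[OF V(3)])
    also have "... = (if v : L then 1 else 2)" by (rule deg) (use \<open>v : V Int K\<close> in blast)
    finally show "(\<Sum>e\<in>E. of_bool (v : {start e, finish e})) = (if v : L then 1 else 2::nat)" .
   qed
   finally show "sum_list (map (ends_in K) es) = (\<Sum>v\<in>V Int K. if v : L then 1 else 2)" .
  qed
 qed (use V in auto)
qed

text \<open>
 As the markings have the same parity on each component of L, their edges join, through L, to
 closed paths: mod 2 the two markings and part of the link form a cycle.
\<close>

theorem marking_closed_paths: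
 assumes L: "link L" and \<omega>: "marking_data L \<omega>" "marking_data L \<omega>'"
  and par: "!!C. C : components L ==>
   even (card (manifold_boundary \<omega> Int C)) \<longleftrightarrow> even (card (manifold_boundary \<omega>' Int C))"
 obtains V cs where "finite V" "(\<omega> Un \<omega>') Int L <= V"
  "\<forall>c\<in>set cs. path c & finish c = start c & track c <= L Un \<omega> Un \<omega>'"
  "\<forall>q. q ~: L Un V --> (\<forall>c\<in>set cs. passes_well q c) &
    (\<Sum>c\<leftarrow>cs. card (visits c q)) = of_bool (q : \<omega>) + of_bool (q : \<omega>')"
proof -
 obtain V1 es1 where V1: "finite V1" "V1 <= \<omega>" "manifold_boundary \<omega> <= V1"
  "\<forall>e\<in>set es1. path e & track e <= \<omega> & start e : V1 & finish e : V1"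
  "\<forall>q. q ~: V1 --> (\<forall>e\<in>set es1. passes_well q e) & (\<Sum>e\<leftarrow>es1. card (visits e q)) = of_bool (q : \<omega>)"
  "\<forall>K. sum_list (map (ends_in K) es1) = (\<Sum>v\<in>V1 Int K. if v : L then 1 else 2)"
  by (rule marking_edges[OF \<omega>(1)])
 obtain V2 es2 where V2: "finite V2" "V2 <= \<omega>'" "manifold_boundary \<omega>' <= V2"
  "\<forall>e\<in>set es2. path e & track e <= \<omega>' & start e : V2 & finish e : V2"
  "\<forall>q. q ~: V2 --> (\<forall>e\<in>set es2. passes_well q e) & (\<Sum>e\<leftarrow>es2. card (visits e q)) = of_bool (q : \<omega>')"
  "\<forall>K. sum_list (map (ends_in K) es2) = (\<Sum>v\<in>V2 Int K. if v : L then 1 else 2)"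
  by (rule marking_edges[OF \<omega>(2)])
 \<comment> \<open>Ends of edges on L may be joined inside a component of L; other ends have to coincide.\<close>
 define \<K> where "\<K> = components L Un (%v. {v}) ` ((V1 Un V2) - L)"
 have un: "\<Union>\<K> = L Un (V1 Un V2)" unfolding \<K>_def by auto
 have bd: "manifold_boundary \<omega> = \<omega> Int L" "manifold_boundary \<omega>' = \<omega>' Int L" using \<omega> by (auto simp: marking_data_def)
 have "curve_interior L p" if "p : L" for p
  using L that curve_interior_manifold unfolding link_def submanifold1_def manifold_boundary_def by blast
 then have lpc: "locally path_connected L" by (rule locally_path_connected_curve)
 have K1: "path_connected K" if "K : \<K>" for K using that components_path_connected[OF lpc] by (auto simp: \<K>_def)
 have K2: "K = K'" if "K : \<K>" "K' : \<K>" "K Int K' ~= {}" for K K'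
  using that components_eq[of K L K'] in_components_subset[of K L] in_components_subset[of K' L] by (auto simp: \<K>_def)
 have contr: "even (\<Sum>v\<in>V Int K. if v : L then 1 else 2::nat) \<longleftrightarrow> even (card (manifold_boundary w Int K)) | K Int L = {}"
  if K: "K : \<K>" and w: "manifold_boundary w <= V" "V <= w" "manifold_boundary w = w Int L" for K V w
 proof (cases "K : components L")
  case True
  then have KL: "K <= L" "K ~= {}" using in_components_subset in_components_nonempty by auto
  then have "V Int K = manifold_boundary w Int K" using w by blast
  moreover have "(\<Sum>v\<in>V Int K. if v : L then 1 else 2::nat) = (\<Sum>v\<in>V Int K. 1)" using KL by (intro sum.cong) auto
  ultimately show ?thesis using KL by auto
 next
  case False
  then have KL: "K Int L = {}" using K by (auto simp: \<K>_def)
  then have "(\<Sum>v\<in>V Int K. if v : L then 1 else 2::nat) = (\<Sum>v\<in>V Int K. 2)" by (intro sum.cong) auto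
  then show ?thesis using KL by simp
 qed
 have ev: "even (sum_list (map (ends_in K) (es1 @ es2)))" if K: "K : \<K>" for K
 proof -
  have "K : components L | K Int L = {}" using K by (auto simp: \<K>_def)
  then have "even (card (manifold_boundary \<omega> Int K)) = even (card (manifold_boundary \<omega>' Int K)) | K Int L = {}" using par by blast
  then show ?thesis using contr[OF K V1(3,2) bd(1)] contr[OF K V2(3,2) bd(2)] V1(6) V2(6) by auto
 qed
 have es: "path e & start e : \<Union>\<K> & finish e : \<Union>\<K>" if "e : set (es1 @ es2)" for e
  using that V1(4) V2(4) unfolding un by auto
 have "\<exists>cs. (\<forall>c\<in>set cs. path c & finish c = start c & track c <= \<Union>(track ` set (es1 @ es2)) Un \<Union>\<K>) &
   (\<forall>q. q ~: \<Union>\<K> --> (\<forall>e\<in>set (es1 @ es2). passes_well q e) --> (\<forall>c\<in>set cs. passes_well q c) &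
    (\<Sum>c\<leftarrow>cs. card (visits c q)) = (\<Sum>e\<leftarrow>es1 @ es2. card (visits e q)))"
  by (rule even_ends_closed_paths) (fact K1 | fact K2 | fact es | fact ev)+
 then obtain cs where cs: "\<forall>c\<in>set cs. path c & finish c = start c & track c <= \<Union>(track ` set (es1 @ es2)) Un \<Union>\<K>"
   "\<forall>q. q ~: \<Union>\<K> --> (\<forall>e\<in>set (es1 @ es2). passes_well q e) --> (\<forall>c\<in>set cs. passes_well q c) &
    (\<Sum>c\<leftarrow>cs. card (visits c q)) = (\<Sum>e\<leftarrow>es1 @ es2. card (visits e q))"
  by (elim exE conjE) (rule that)
 have sub: "\<Union>(track ` set (es1 @ es2)) Un \<Union>\<K> <= L Un \<omega> Un \<omega>'"
  unfolding un using V1(2,4) V2(2,4) by auto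
 show ?thesis
 proof (rule that[of "V1 Un V2" cs])
  show "finite (V1 Un V2)" using V1(1) V2(1) by simp
  show "(\<omega> Un \<omega>') Int L <= V1 Un V2" using V1(3) V2(3) bd by blast
  show "\<forall>c\<in>set cs. path c & finish c = start c & track c <= L Un \<omega> Un \<omega>'"
   using cs(1) sub by (meson subset_trans)
  show "\<forall>q. q ~: L Un (V1 Un V2) --> (\<forall>c\<in>set cs. passes_well q c) &
    (\<Sum>c\<leftarrow>cs. card (visits c q)) = of_bool (q : \<omega>) + of_bool (q : \<omega>')"
  proof (intro allI impI)
   fix q assume q: "q ~: L Un (V1 Un V2)"
   then have 1: "(\<forall>e\<in>set es1. passes_well q e) & (\<Sum>e\<leftarrow>es1. card (visits e q)) = of_bool (q : \<omega>)"
    and 2: "(\<forall>e\<in>set es2. passes_well q e) & (\<Sum>e\<leftarrow>es2. card (visits e q)) = of_bool (q : \<omega>')"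
    using V1(5) V2(5) by blast+
   have "\<forall>e\<in>set (es1 @ es2). passes_well q e" using 1 2 by auto
   then show "(\<forall>c\<in>set cs. passes_well q c) &
     (\<Sum>c\<leftarrow>cs. card (visits c q)) = of_bool (q : \<omega>) + of_bool (q : \<omega>')"
    using cs(2) q 1 2 unfolding un by simp
  qed
 qed
qed

text \<open>The pole p0 is removed as well, so that all linking takes place in one stereographic chart.\<close>

locale linking_character = stereographic p0 A B for p0 A B +
 fixes K :: "R4 set" and cs :: "(real => R4) list"
 assumes K_S3: "K <= S3" and pole_K: "p0 ~: K"
  and cycles: "\<forall>c\<in>set cs. path c & finish c = start c & track c <= K"
begin

abbreviation "X == S3 - (K Un {p0})"

definition total_sign :: "(real => R4) => real" where
 "total_sign l = (\<Prod>c\<leftarrow>cs. link_sign id (st o c) (st o l))"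

sublocale isometry_R3 id by unfold_locales (simp add: id_def orthogonal_transformation_id)

lemma continuous_on_st': "S <= S3 - {p0} ==> continuous_on S st" by (rule continuous_on_st) auto

lemma st_disjoint: "c : set cs ==> S <= X ==> st ` S Int track (st o c) = {}"
proof -
 assume c: "c : set cs" and S: "S <= X"
 have "st x ~= st y" if "x : S" "y : track c" for x y
 proof
  assume "st x = st y"
  then have "un (st x) = un (st y)" by simp
  moreover have "x : S3 - {p0}" "y : S3 - {p0}" "y : K" "x ~: K" using that S c cycles K_S3 pole_K by auto
  ultimately show False by (auto simp: un_st)
 qed
 then show ?thesis unfolding path_image_compose by blast
qed

lemma cycle_st: "c : set cs ==> path (st o c)" "c : set cs ==> finish (st o c) = start (st o c)"
proof -
 assume c: "c : set cs"
 then have "track c <= S3 - {p0}" using cycles K_S3 pole_K by blast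
 then show "path (st o c)" using c cycles by (intro path_continuous_image continuous_on_st') auto
 show "finish (st o c) = start (st o c)" using c cycles by (simp add: pathfinish_compose pathstart_compose)
qed

lemma disjoint_loops_st:
 assumes "c : set cs" "path l" "track l <= X" "finish l = start l"
 shows "disjoint_loops (st o c) (st o l)" unfolding disjoint_loops_def
proof (intro conjI cycle_st[OF assms(1)])
 show "path (st o l)" using assms by (intro path_continuous_image continuous_on_st') auto
 show "finish (st o l) = start (st o l)" using assms by (simp add: pathfinish_compose pathstart_compose)
 show "track (st o c) Int track (st o l) = {}" using st_disjoint[OF assms(1,3)] by (auto simp: path_image_compose)
qed

lemma total_sign_values:
 assumes "path l" "track l <= X" "finish l = start l"
 shows "total_sign l = 1 | total_sign l = -1"
proof -
 have "\<forall>c\<in>set cs. link_sign id (st o c) (st o l) = 1 | link_sign id (st o c) (st o l) = -1"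
  using link_sign_values[OF disjoint_loops_st] assms by blast
 then show ?thesis unfolding total_sign_def by (induction cs) auto
qed

lemma total_sign_join:
 assumes "path l" "track l <= X" "finish l = start l"
  "path l'" "track l' <= X" "finish l' = start l'" "start l = start l'"
 shows "total_sign (l +++ l') = total_sign l * total_sign l'"
proof -
 have "link_sign id (st o c) (st o (l +++ l')) = link_sign id (st o c) (st o l) * link_sign id (st o c) (st o l')"
  if "c : set cs" for c unfolding path_compose_join[of st]
  using assms that by (intro link_sign_join disjoint_loops_st) (auto simp: pathstart_compose)
 then show ?thesis unfolding total_sign_def by (induction cs) auto
qed

lemma total_sign_homotopic:
 assumes "homotopic_loops X l l'" shows "total_sign l = total_sign l'"
proof -
 have "link_sign id (st o c) (st o l) = link_sign id (st o c) (st o l')" if c: "c : set cs" for c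
 proof (rule link_sign_homotopic[OF cycle_st[OF c]])
  have "st ` X <= - track (st o c)" using st_disjoint[OF c subset_refl] by blast
  moreover have "continuous_on X st" by (rule continuous_on_st') auto
  ultimately show "homotopic_loops (- track (st o c)) (st o l) (st o l')"
   by (intro homotopic_loops_continuous_image[OF assms]) auto
 qed
 then show ?thesis unfolding total_sign_def by (intro arg_cong[of _ _ prod_list] map_cong refl)
qed

definition scalar :: "real => quat" where "scalar a = (of_real a, 0)"

text \<open>
 The sign is invariant under free homotopy, hence unchanged when a loop is joined to a base point by a
 path.
\<close>

theorem total_sign_functor:
 assumes X: "path_connected X" "X ~= {}"
 obtains h where "path_functor BD X h"
  "!!p. path p ==> track p <= X ==> h p = qone | h p = - qone"
  "!!p. path p ==> track p <= X ==> finish p = start p ==> h p = scalar (total_sign p)"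
proof -
 obtain x0 where x0: "x0 : X" using X(2) by blast
 define f where "f p = scalar (total_sign p)" for p
 have "\<exists>k. path k & track k <= X & start k = x0 & finish k = y" if "y : X" for y
  using X(1) x0 that unfolding path_connected_def by blast
 then obtain k where k: "!!y. y : X ==> path (k y) & track (k y) <= X & start (k y) = x0 & finish (k y) = y"
  by metis
 let ?K = "%p. f (k (start p) +++ (p +++ reversepath (k (finish p))))"
 have vals: "f p = qone | f p = - qone" if "path p" "track p <= X" "finish p = start p" for p
  using total_sign_values[OF that] by (auto simp: f_def scalar_def qone_def)
 have func: "path_functor BD X ?K"
 proof (rule path_functor_conjugate_by_paths[OF group_BD, of X "{x0}"])
  fix p assume p: "p : {p. path p & track p <= X & start p : {x0} & finish p : {x0}}"
  then show "f p : carrier BD" using vals[of p] by (auto simp: BD_def S1A_iff qone_def)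
  show "f p = f q" if "homotopic_paths X p q" for q
   unfolding f_def using that p by (intro arg_cong[of _ _ scalar] total_sign_homotopic homotopic_paths_imp_homotopic_loops)
    (auto dest: homotopic_paths_imp_pathstart homotopic_paths_imp_pathfinish)
  fix q assume q: "q : {p. path p & track p <= X & start p : {x0} & finish p : {x0}}"
  have "total_sign (p +++ q) = total_sign p * total_sign q" using p q by (intro total_sign_join) auto
  then show "f (p +++ q) = f p \<cdot> f q" by (simp add: f_def scalar_def BD_def qmult_def)
 qed (use k in auto)
 have loop: "path (k (start p) +++ (p +++ reversepath (k (finish p)))) &
   track (k (start p) +++ (p +++ reversepath (k (finish p)))) <= X &
   finish (k (start p) +++ (p +++ reversepath (k (finish p)))) =
   start (k (start p) +++ (p +++ reversepath (k (finish p))))" if "path p" "track p <= X" for p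
 proof -
  have "start p : X" "finish p : X" using that by (auto intro: subsetD)
  then show ?thesis using k that by (simp add: path_image_join)
 qed
 show ?thesis
 proof (rule that[OF func])
  show "?K p = qone | ?K p = - qone" if "path p" "track p <= X" for p using vals loop[OF that] by blast
  show "?K p = scalar (total_sign p)" if p: "path p" "track p <= X" "finish p = start p" for p
  proof -
   have "start p : X" using p by (auto intro: subsetD)
   then have "homotopic_loops X (k (start p) +++ (p +++ reversepath (k (start p)))) p"
    using k[of "start p"] p by (intro homotopic_loops_conjugate) auto
   from total_sign_homotopic[OF this] show ?thesis using p(3) by (simp add: f_def)
  qed
 qed
qed

end

context tube begin

text \<open>
 In the tube the curve is a graph over the vertical axis, so that a curve inside M that is
 injective near a parameter changes height monotonically there.
\<close>

lemma coord_in_flat_disc: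
 assumes x: "x : S3" "x ~= p0" "coord x : flat_disc r" and r: "r < \<delta>" and M: "x : region \<delta> ==> x : M"
 shows "x = q"
proof -
 have f: "cmod (fst (coord x)) <= r" "snd (coord x) = 0" using x(3) by (auto simp: flat_disc_def)
 then have "x : region \<delta>" using x r \<delta> by (simp add: region_iff)
 moreover have "tube_map (fst (coord x) - g (snd (coord x)), snd (coord x)) = x" by (rule tube_map_coord[OF x(1,2)])
 ultimately have "fst (coord x) = 0"
  using M tube_map_in_M[of "(fst (coord x) - g (snd (coord x)), snd (coord x))"] f \<delta> r by simp
 then show ?thesis using tube_map_coord[OF x(1,2)] f(2) tube_map_0 by simp
qed

lemma on_graph: "x : region \<delta> ==> x : M ==> coord x = (g (snd (coord x)), snd (coord x))"
proof -
 assume x: "x : region \<delta>" "x : M"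
 let ?v = "(fst (coord x) - g (snd (coord x)), snd (coord x))"
 have "tube_map ?v = x" by (rule tube_map_coord) (use x in \<open>auto simp: region_iff\<close>)
 then have "fst ?v = 0" using tube_map_in_M[of ?v] x by (simp add: region_iff)
 then show ?thesis by (simp add: prod_eq_iff)
qed

lemma crosses_plane_coord:
 assumes c: "path c" "track c <= K" and KS: "K <= S3" and K: "K Int region \<delta> <= M" and s0: "s0 : visits c q"
  and e: "ep > 0" "{s0-ep<..<s0+ep} <= {0..1}" "inj_on c {s0-ep<..<s0+ep}"
 shows "crosses_plane (coord o c) s0"
proof -
 obtain O' where O': "open O'" "region \<delta> = S3 Int O'" using openin_region[OF order_refl] by (auto simp: openin_open)
 have s01: "s0 : {0..1}" "c s0 = q" using s0 by (auto simp: visits_def)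
 have qO: "q : O'" using q_in_region[OF \<delta>] O'(2) by blast
 from continuous_openin_preimage_gen[OF c(1)[unfolded path_def] O'(1)] obtain Q
  where Q: "open Q" "{0..1} Int c -` O' = {0..1} Int Q" by (auto simp: openin_open)
 have "s0 : {0..1} Int c -` O'" using s01 qO by simp
 then have "s0 : Q" unfolding Q(2) by simp
 then obtain h where h: "h > 0" "ball s0 h <= Q" using Q(1) open_contains_ball by blast
 define b where "b = min ep h / 2"
 have b: "b > 0" "b < ep" "b < h" using e(1) h(1) by (auto simp: b_def)
 let ?I = "{s0-b..s0+b}"
 have sub: "?I <= {s0-ep<..<s0+ep}" "?I <= ball s0 h" using b by (auto simp: dist_real_def)
 have r: "c s : region \<delta>" "c s : M" if "s : ?I" for s
 proof -
  have s: "s : {0..1}" "s : Q" using that sub e(2) h(2) by blast+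
  then have "s : {0..1} Int c -` O'" unfolding Q(2) by simp
  then have "c s : O'" by simp
  have "c s : K" using s(1) c(2) by (auto simp: path_image_def)
  then show "c s : region \<delta>" using KS O'(2) \<open>c s : O'\<close> by blast
  then show "c s : M" using K \<open>c s : K\<close> by blast
 qed
 define t where "t s = snd (coord (c s))" for s
 have graph: "coord (c s) = (g (t s), t s)" if "s : ?I" for s using on_graph[OF r[OF that]] by (simp add: t_def)
 have "continuous_on ?I c" by (rule continuous_on_subset[OF c(1)[unfolded path_def] subset_trans[OF sub(1) e(2)]])
 then have ct: "continuous_on ?I t" unfolding t_def
  by (intro continuous_on_snd continuous_on_compose2[OF continuous_on_coord[OF region_S3]]) (use r(1) in blast)+
 have inj: "inj_on t ?I"
 proof (rule inj_onI)
  fix x y assume xy: "x : ?I" "y : ?I" "t x = t y"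
  then have co: "coord (c x) = coord (c y)" using graph by simp
  have S: "c x : S3" "c x ~= p0" "c y : S3" "c y ~= p0"
   using r(1)[OF xy(1)] r(1)[OF xy(2)] unfolding region_iff by blast+
  from tube_map_coord[OF S(1,2), unfolded co] tube_map_coord[OF S(3,4)] have "c x = c y" by (rule trans[OF sym])
  then show "x = y" by (rule inj_onD[OF e(3) _ subsetD[OF sub(1) xy(1)] subsetD[OF sub(1) xy(2)]])
 qed
 have t0: "t s0 = 0" using s01(2) by (simp add: t_def coord_def)
 have mono: "t u < t v & t v < t w | t w < t v & t v < t u" if "s0 - b <= u" "u < v" "v < w" "w <= s0 + b" for u v w
 proof -
  have "{u..w} <= ?I" using that by auto
  then show ?thesis by (intro continuous_inj_imp_mono that continuous_on_subset[OF ct] inj_on_subset[OF inj])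
 qed
 have outer: "t (s0 - b) < 0 & 0 < t (s0 + b) | t (s0 + b) < 0 & 0 < t (s0 - b)"
  using mono[of "s0 - b" s0 "s0 + b"] b(1) t0 by auto
 define z :: real where "z = (if 0 < t (s0 + b) then 1 else -1)"
 have "z * t s < 0" if "s0 - b < s" "s < s0" for s using mono[of s s0 "s0 + b"] that b(1) t0 outer by (auto simp: z_def)
 moreover have "z * t s > 0" if "s0 < s" "s < s0 + b" for s
  using mono[of "s0 - b" s0 s] that b(1) t0 outer by (auto simp: z_def)
 moreover have "z = 1 | z = -1" by (simp add: z_def)
 ultimately show ?thesis unfolding crosses_plane_def t_def o_def using b(1) by blast
qed

end

context linking_character begin

text \<open>A small circle around a curve crosses the cycles as often as they pass through its centre.\<close>

lemma total_sign_flat: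
 assumes tube: "tube p0 A' B' M q g g' d" and K: "K Int tube.region p0 A' B' q g d <= M" and r: "0 < r" "r < d"
  and pw: "\<forall>c\<in>set cs. passes_well q c"
 shows "total_sign (%s. stereographic.un p0 B' ((of_real r * turn s, 0) + stereographic.st p0 A' q))
  = (-1) ^ (\<Sum>c\<leftarrow>cs. card (visits c q))"
proof -
 interpret t: tube p0 A' B' M q g g' d by (rule tube)
 have st': "stereographic p0 A' B'" by unfold_locales
 have st0: "stereographic p0 A B" by unfold_locales
 define Q where "Q = (%y. A (B' y))"
 have oQ: "orthogonal_transformation Q" unfolding Q_def by (rule stereographic_change(1)[OF st' st0])
 interpret Q: isometry_R3 Q by (unfold_locales) (rule oQ)
 have stQ: "st x = Q (t.coord x) + Q (t.st q)" for x
  using stereographic_change(2)[OF st' st0, of x] linear_add[OF orthogonal_transformation_linear[OF oQ], of "t.coord x" "t.st q"]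
  by (simp add: Q_def t.coord_def)
 have circ: "t.coord (t.flat r (turn s)) = axis_circle r s" for s by (simp add: t.flat_def t.coord_def axis_circle_def)
 have "link_sign id (st o c) (st o (rim (t.flat r))) = (-1) ^ card (visits c q)" if c: "c : set cs" for c
 proof -
  have cc: "path c" "finish c = start c" "track c <= K" using cycles c by auto
  have cS: "track c <= S3 - {p0}" using cc(3) K_S3 pole_K by blast
  have pwc: "passes_well q c" using pw c by blast
   have eq: "{s : {0..1}. (t.coord o c) s : flat_disc r} = visits c q"
   proof (intro subset_antisym subsetI)
    fix s assume "s : {s : {0..1}. (t.coord o c) s : flat_disc r}"
    then have s: "s : {0..1}" "t.coord (c s) : flat_disc r" by auto
    then have im: "c s : track c" by (auto simp: path_image_def)
    then have "c s : S3" "c s ~= p0" "c s : K" using cS cc(3) by auto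
    then have "c s = q" using t.coord_in_flat_disc[of "c s" r] s(2) r(2) K by blast
    then show "s : visits c q" using s(1) by (simp add: visits_def)
   next
    fix s assume "s : visits c q"
    then show "s : {s : {0..1}. (t.coord o c) s : flat_disc r}"
     using r(1) by (simp add: visits_def t.coord_def flat_disc_def)
   qed
  have "link_sign id (st o c) (st o (rim (t.flat r))) =
    link_sign id (%s. Q ((t.coord o c) s) + Q (t.st q)) (%s. Q (axis_circle r s) + Q (t.st q))"
   by (simp add: o_def stQ circ)
  also have "... = link_sign Q (t.coord o c) (axis_circle r)" by (rule Q.link_sign_affine)
  also have "... = (-1) ^ card {s : {0..1}. (t.coord o c) s : flat_disc r}"
  proof (rule Q.link_sign_axis_circle)
   show "path (t.coord o c)" by (intro path_continuous_image cc(1) t.continuous_on_coord cS)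
   show "finish (t.coord o c) = start (t.coord o c)" using cc(2) by (simp add: pathfinish_compose pathstart_compose)
   show "finite {s : {0..1}. (t.coord o c) s : flat_disc r}" unfolding eq using pwc by (simp add: passes_well_def)
   fix s assume "s : {0..1}" "(t.coord o c) s : flat_disc r"
   then have s: "s : visits c q" using eq by blast
   then obtain h where e: "h > 0" "{s-h<..<s+h} <= {0..1}" "inj_on c {s-h<..<s+h}"
    using pwc unfolding passes_well_def by blast
   have "s - h/2 : {s-h<..<s+h}" "s + h/2 : {s-h<..<s+h}" using e(1) by auto
   then have "s - h/2 : {0..1}" "s + h/2 : {0..1}" using e(2) by blast+
   then have "s : {0<..<1}" using e(1) by auto
   moreover have "cmod (fst ((t.coord o c) s)) < r" using s r(1) by (simp add: visits_def t.coord_def)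
   moreover have "crosses_plane (t.coord o c) s" by (rule t.crosses_plane_coord[OF cc(1,3) K_S3 K s e])
   ultimately show "s : {0<..<1} & cmod (fst ((t.coord o c) s)) < r & crosses_plane (t.coord o c) s" by blast
  qed (rule r(1))
  also have "{s : {0..1}. (t.coord o c) s : flat_disc r} = visits c q" by (rule eq)
  finally show ?thesis .
 qed
 then have "\<forall>c\<in>set cs. link_sign id (st o c) (st o (rim (t.flat r))) = (-1) ^ card (visits c q)" by blast
 then have "total_sign (rim (t.flat r)) = (-1) ^ (\<Sum>c\<leftarrow>cs. card (visits c q))"
  unfolding total_sign_def by (induction cs) (auto simp: power_add)
 then show ?thesis by (simp add: t.flat_def)
qed

end

section \<open>Thin subsets of the sphere\<close>

lemma S3_antipode: assumes "y : S3" shows "- y : S3" "y ~= - y"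
proof -
 show "- y : S3" using assms by (simp add: S3_def)
 show "y ~= - y"
 proof
  assume "y = - y"
  then have "2 *\<^sub>R y = 0" by (metis add.right_inverse scaleR_2)
  then show False using assms by (auto simp: S3_def)
 qed
qed

lemma sphere_chart_ball:
 assumes W: "openin (top_of_set S3) W" "y : W"
 obtains U where "openin (top_of_set S3) U" "y : U" "U <= W" "simply_connected U" "simply_connected (U - {y})" "U - {y} ~= {}"
proof -
 have y: "y : S3" using W openin_imp_subset by blast
 note my = S3_antipode[OF this]
 obtain A B where F: "stereographic (- y) A B" using stereographic_exists[OF my(1)] by blast
 interpret stereographic "- y" A B by (rule F)
 obtain O' where O': "open O'" "W = S3 Int O'" using W(1) by (auto simp: openin_open)
 have uy: "un (st y) = y" by (rule un_st[OF y my(2)])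
 have "open (un -` O')" by (rule open_vimage[OF O'(1) continuous_on_un])
 moreover have "st y : un -` O'" using uy W(2) O'(2) by simp
 ultimately obtain r where r: "r > 0" "ball (st y) r <= un -` O'" using open_contains_ball by blast
 let ?b = "ball (st y) r"
 define U where "U = un ` ?b"
 have o0: "openin (top_of_set S3) (S3 - {- y})" by (auto simp: openin_open intro!: exI[of _ "-{- y}"])
 have "openin (top_of_set UNIV) ?b" by simp
 from homeomorphism_imp_open_map[OF homeomorphism_un this] have "openin (top_of_set (S3 - {- y})) U" by (simp add: U_def)
 then have oU: "openin (top_of_set S3) U" using o0 openin_trans by blast
 have hom: "T homeomorphic un ` T" for T
 proof -
  have "homeomorphism T (un ` T) un st" by (rule homeomorphism_of_subsets[OF homeomorphism_un, of _ "S3 - {- y}"]) auto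
  then show ?thesis unfolding homeomorphic_def by blast
 qed
 have "inj un" by (rule inj_on_inverseI[of _ st]) simp
 then have U': "U - {y} = un ` (?b - {st y})" unfolding U_def by (subst image_set_diff) (simp_all add: uy)
 have 3: "aff_dim ?b = 3" using r(1) by (simp add: aff_dim_open)
 have sc: "simply_connected (?b - {st y})" by (rule simply_connected_punctured_convex) (simp_all add: 3)
 have sb: "simply_connected ?b" by (intro convex_imp_simply_connected convex_ball)
 have ne: "?b ~= {st y}"
 proof
  assume eq: "?b = {st y}"
  show False using 3 unfolding eq by simp
 qed
 show ?thesis
 proof (rule that[OF oU])
  show "y : U" unfolding U_def using r(1) uy by (intro image_eqI[of _ _ "st y"]) auto
  show "U <= W" unfolding U_def O'(2) using r(2) un_S3 by auto
  show "simply_connected U" using homeomorphic_simply_connected_eq[OF hom] sb unfolding U_def by blast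
  show "simply_connected (U - {y})" using homeomorphic_simply_connected_eq[OF hom] sc unfolding U' by blast
  show "U - {y} ~= {}" unfolding U' using ne r(1) by auto
 qed
qed

lemma tube_shrink: "tube p0 A B M q g g' d ==> 0 < h ==> h <= d ==> tube p0 A B M q g g' h"
proof -
 assume t: "tube p0 A B M q g g' d" and e: "0 < h" "h <= d"
 interpret tube p0 A B M q g g' d by (rule t)
 show ?thesis by unfold_locales (use e M_S3 centre g_deriv in_M tangent in auto)
qed

lemma tube_exists_in:
 assumes M: "M <= S3" "manifold_interior_point M q" and p0: "p0 : S3" "p0 ~= q" and W: "open W" "q : W"
 obtains A B g g' d where "tube p0 A B M q g g' d" "tube.region p0 A B q g d <= W"
proof -
 obtain A B g g' d where t: "tube p0 A B M q g g' d" using tube_exists[OF M p0] by blast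
 interpret tube p0 A B M q g g' d by (rule t)
 obtain h where e: "0 < h" "h <= d" "region h <= W" by (rule region_small[OF W])
 show ?thesis by (rule that[OF tube_shrink[OF t e(1,2)] e(3)])
qed

lemma open_curve_complement_nonempty:
 assumes W: "openin (top_of_set S3) W" "W ~= {}" and M: "M <= S3" "!!q. q : W Int M ==> manifold_interior_point M q"
 shows "W - M ~= {}"
proof (cases "W Int M = {}")
 case False
 then obtain q where q: "q : W" "q : M" by blast
 obtain O' where O': "open O'" "W = S3 Int O'" using W(1) by (auto simp: openin_open)
 have mq: "- q : S3" "- q ~= q" "q : O'" using q M(1) O'(2) S3_antipode[of q] by auto
 obtain A B g g' d where t: "tube (- q) A B M q g g' d" and r: "tube.region (- q) A B q g d <= O'"
  using tube_exists_in[OF M(1) M(2) mq(1,2) O'(1) mq(3)] q by blast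
 interpret tube "- q" A B M q g g' d by (rule t)
 show ?thesis using path_connected_region_minus_M(2)[OF \<delta> order_refl] r region_S3 O'(2) by blast
qed (use W(2) in blast)

lemma (in tube) region_curve_infinite: "infinite (region \<delta> Int M)"
proof -
 have "(%t. tube_map (0, t)) ` ball 0 \<delta> <= region \<delta> Int M"
  using tube_map_in_M \<delta> unfolding region_def by auto
 moreover have "inj_on (%t. tube_map (0, t)) (ball 0 \<delta>)"
 proof (rule inj_onI)
  fix s t assume "tube_map (0, s) = tube_map (0, t)"
  then have "coord (tube_map (0, s)) = coord (tube_map (0, t))" by simp
  then show "s = t" by simp
 qed
 moreover have "infinite (ball (0::real) \<delta>)" using \<delta> by (simp add: ball_eq_greaterThanLessThan)
 ultimately show ?thesis using finite_imageD finite_subset by blast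
qed

text \<open>
 The complement of a curve, and of the point p0, is thin: its neighbourhoods are balls, punctured
 balls and tubes without their axis. Only the last ones have nontrivial loops, and transport
 along these is trivial as soon as it is trivial along the circles around the axis.
\<close>

theorem thin_curve_complement:
 assumes T: "path_functor BD (S3 - (N Un M Un {p0})) T" and N: "closed N" and M: "closed M" "M <= S3"
  and p0: "p0 : S3" "p0 ~: N Un M" and int: "!!q. q : M - N ==> manifold_interior_point M q"
  and trivial: "!!q A B g g' d. q : M - N ==> tube p0 A B M q g g' d ==> tube.region p0 A B q g d Int N = {} ==>
   \<exists>u. 0 < u & u < d & T (%t. stereographic.un p0 B ((of_real u * turn t, 0) + stereographic.st p0 A q)) = one_BD"
 shows "thin_complement (%U. \<forall>p. path p --> track p <= U Int (S3 - (N Un M Un {p0})) -->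
  finish p = start p --> T p = one_BD) (S3 - (N Un M Un {p0})) (S3 - N)"
 unfolding thin_complement_def
proof (intro conjI allI impI)
 let ?X = "S3 - (N Un M Un {p0})" and ?Y = "S3 - N"
 interpret T: path_functor BD ?X T by (rule T)
 show "?X <= ?Y" by blast
 have openY: "openin (top_of_set S3) ?Y" using N by (auto simp: openin_open intro!: exI[of _ "- N"])
 fix W y assume W: "openin (top_of_set ?Y) W" "y : W"
 have W3: "openin (top_of_set S3) W" using W(1) openY openin_trans by blast
 have WY: "W <= ?Y" using W(1) openin_imp_subset by blast
 obtain O' where O': "open O'" "W = S3 Int O'" using W3 by (auto simp: openin_open)
 have oX: "openin (top_of_set S3) ?X"
  using N M(1) by (auto simp: openin_open intro!: exI[of _ "- (N Un M Un {p0})"])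
 have oYU: "openin (top_of_set ?Y) U" if "openin (top_of_set S3) U" "U <= W" for U
  using openin_subset_trans[OF that(1)] that(2) WY by blast
 have trivial_sc: "T p = one_BD" if "simply_connected S" "S <= ?X" "path p" "track p <= S" "finish p = start p" for S p
 proof -
  have s: "start p : S" using that(3,4) by (auto intro: subsetD)
  then have "T p = T (linepath (start p) (start p))" using that by (intro T.simply_connected_eq[OF that(1,2)]) auto
  then show ?thesis using T.const[of "start p"] s that(2) by auto
 qed
 consider "y : ?X" | "y = p0" | "y : M - N" using W WY by blast
 then show "\<exists>U. openin (top_of_set ?Y) U & y : U & U <= W & simply_connected U & path_connected (U Int ?X) & U Int ?X ~= {} &
  (\<forall>p. path p --> track p <= U Int ?X --> finish p = start p --> T p = one_BD)"
 proof cases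
  case 1
  have "openin (top_of_set S3) (W Int ?X)" "y : W Int ?X" using W3 oX W(2) 1 by (auto intro: openin_Int)
  then obtain U where U: "openin (top_of_set S3) U" "y : U" "U <= W Int ?X" "simply_connected U"
   by (rule sphere_chart_ball)
  have "U Int ?X = U" using U(3) by blast
  then show ?thesis
   using U oYU[OF U(1)] trivial_sc[OF U(4)] simply_connected_imp_path_connected[OF U(4)] by (intro exI[of _ U]) auto
 next
  case 2
  have "openin (top_of_set S3) (S3 - (N Un M))" using N M(1) by (auto simp: openin_open intro!: exI[of _ "- (N Un M)"])
  then have "openin (top_of_set S3) (W Int (S3 - (N Un M)))" "y : W Int (S3 - (N Un M))"
   using W3 W(2) 2 p0 by (auto intro: openin_Int)
  then obtain U where U: "openin (top_of_set S3) U" "y : U" "U <= W Int (S3 - (N Un M))" "simply_connected U"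
    "simply_connected (U - {y})" "U - {y} ~= {}" by (rule sphere_chart_ball)
  have eq: "U Int ?X = U - {y}" using U(3) 2 by blast
  have "U - {y} <= ?X" using eq by blast
  then show ?thesis
   using U oYU[OF U(1)] trivial_sc[OF U(5)] simply_connected_imp_path_connected[OF U(5)] eq by (intro exI[of _ U]) auto
 next
  case 3
  have y: "p0 ~= y" "y : O'" using 3 p0 W(2) O'(2) by auto
  obtain A B g g' d where t: "tube p0 A B M y g g' d" and r: "tube.region p0 A B y g d <= O'"
   by (rule tube_exists_in[OF M(2) int[OF 3] p0(1) y(1) O'(1) y(2)])
  interpret t: tube p0 A B M y g g' d by (rule t)
  have rW: "t.region d <= W" using r t.region_S3 O'(2) by blast
  then have rN: "t.region d Int N = {}" using WY by blast
  have eq: "t.region d Int ?X = t.region d - M" using rN t.region_S3 by blast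
  obtain u where e: "0 < u" "u < d" "T (rim (t.flat u)) = one_BD" using trivial[OF 3 t rN] unfolding t.flat_def by blast
  have ct: "continuous_on (punctured_tube d) t.tube_map"
   by (rule continuous_on_subset[OF t.continuous_on_tube_map]) (auto simp: punctured_tube_def)
  have im: "t.tube_map ` punctured_tube d <= ?X" using t.region_minus_M[OF order_refl] eq by blast
  have "path_functor BD (punctured_tube d) (%p. T (t.tube_map o p))" by (rule T.compose[OF ct im])
  then interpret P: tube_functor BD d "%p. T (t.tube_map o p)" unfolding tube_functor_def .
  have "T p = one_BD" if p: "path p" "track p <= t.region d Int ?X" "finish p = start p" for p
  proof -
   let ?h = "%x. (fst (t.coord x) - g (snd (t.coord x)), snd (t.coord x))"
   have hom: "homeomorphism (ball 0 d \<times> ball 0 d) (t.region d) t.tube_map ?h" by (rule t.homeomorphism_tube_map[OF order_refl])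
   have ch: "continuous_on (t.region d) ?h" and hh: "!!v. v : ball 0 d \<times> ball 0 d ==> ?h (t.tube_map v) = v"
    using hom unfolding homeomorphism_def by blast+
   have pr: "track p <= t.region d" "track p <= t.tube_map ` punctured_tube d"
    using p(2) t.region_minus_M[OF order_refl] eq by auto
   have hp: "path (?h o p)" by (rule path_continuous_image[OF p(1) continuous_on_subset[OF ch pr(1)]])
   have "?h (t.tube_map v) : punctured_tube d" if "v : punctured_tube d" for v
   proof -
    have "v : ball 0 d \<times> ball 0 d" using that by (auto simp: punctured_tube_def)
    then show ?thesis using hh[of v] that by presburger
   qed
   then have hi: "track (?h o p) <= punctured_tube d" using pr(2) unfolding path_image_compose by blast
   have he: "finish (?h o p) = start (?h o p)" using p(3) by (simp add: pathfinish_def pathstart_def)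
   have e1: "T (t.tube_map o axis_circle u) = one_BD" using e(3) unfolding t.tube_map_axis_circle .
   have one: "T (t.tube_map o (?h o p)) = one_BD" by (rule P.punctured_tube_trivial[OF e(1,2) e1 hp hi he])
   have "homotopic_paths ?X p (t.tube_map o (?h o p))"
   proof (rule homotopic_paths_eq[OF p(1)])
    show "track p <= ?X" using p(2) by blast
    fix s :: real assume "s : {0..1}"
    then have "p s : t.region d" using pr(1) by (auto simp: path_image_def)
    then have "t.tube_map (?h (p s)) = p s" unfolding t.region_iff by (intro t.tube_map_coord) blast+
    then show "p s = (t.tube_map o (?h o p)) s" unfolding o_def by (rule sym)
   qed
   from T.homotopic[OF this] one show ?thesis by (rule trans)
  qed
  moreover have "path_connected (t.region d Int ?X)" "t.region d Int ?X ~= {}"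
   unfolding eq by (rule t.path_connected_region_minus_M[OF t.\<delta> order_refl])+
  ultimately show ?thesis
   using oYU[OF t.openin_region[OF order_refl] rW] t.q_in_region[OF t.\<delta>] rW t.simply_connected_region[OF order_refl]
   by (intro exI[of _ "t.region d"] conjI allI impI)
 qed
qed

section \<open>Representations as path functors\<close>

lemma BD_signs: "qone : carrier BD" "- qone : carrier BD"
  "a : carrier BD ==> qone \<cdot> a = a" "a \<cdot> qone = a" "- qone \<cdot> a = - a" "a \<cdot> (- qone) = - a"
 by (auto simp: BD_def qone_def qmult_def S1A_iff prod_eq_iff)

lemma BD_one: "one_BD = qone" by (simp add: BD_def)

text \<open>
 Free homotopy determines the value at a meridian up to conjugation only, and a meridian may run either
 way.
\<close>

definition meridian_closed :: "quat set => bool" where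
 "meridian_closed S \<longleftrightarrow> (\<forall>g\<in>carrier BD. \<forall>a\<in>carrier BD. a : S --> g \<cdot> a \<cdot> inv_BD g : S) &
   (\<forall>a\<in>carrier BD. a : S --> inv_BD a : S)"

lemma meridian_closed_minus_one: "meridian_closed {- qone}"
proof -
 interpret group BD by (rule group_BD)
 have i: "inv_BD (- qone) = - qone" by (rule inv_equality) (use BD_signs BD_one in auto)
 have "g \<cdot> (- qone) \<cdot> inv_BD g = - qone" if g: "g : carrier BD" for g
 proof -
  have "g \<cdot> (- qone) = (- qone) \<cdot> g" by (simp add: BD_signs)
  then have "g \<cdot> (- qone) \<cdot> inv_BD g = (- qone) \<cdot> (g \<cdot> inv_BD g)"
   using g BD_signs(2) by (simp only: m_assoc inv_closed)
  then show ?thesis using g by (simp add: BD_signs BD_one)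
 qed
 then show ?thesis using i by (auto simp: meridian_closed_def)
qed

lemma meridian_closed_S1B: "meridian_closed S1B"
proof -
 interpret group BD by (rule group_BD)
 have B: "a : S1B \<longleftrightarrow> fst a = 0" if "a : carrier BD" for a
  using that by (auto simp: BD_def S1A_iff S1B_iff)
 have AB: "fst a = 0 | snd a = 0" if "a : carrier BD" for a using that by (auto simp: BD_def S1A_iff S1B_iff)
 have inv0: "fst (inv_BD a) = cnj (fst a) & snd (inv_BD a) = - snd a" if a: "a : carrier BD" for a
 proof -
  let ?y = "(cnj (fst a), - snd a)"
  have "?y : carrier BD" using a by (auto simp: BD_def S1A_iff S1B_iff)
  moreover have "?y \<cdot> a = one_BD"
   using a by (auto simp: BD_def S1A_iff S1B_iff qmult_def qone_def mult.commute complex_norm_square[symmetric])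
  ultimately have "inv_BD a = ?y" using a by (intro inv_equality)
  then show ?thesis by simp
 qed
 show ?thesis unfolding meridian_closed_def
 proof (intro conjI ballI impI)
  fix g a assume a: "g : carrier BD" "a : carrier BD" "a : S1B"
  have f: "fst a = 0" using a B by blast
  have "fst (g \<cdot> a \<cdot> inv_BD g) = 0" using AB[OF a(1)] inv0[OF a(1)] f by (auto simp: BD_def qmult_def)
  then show "g \<cdot> a \<cdot> inv_BD g : S1B" using B a by simp
 next
  fix a assume a: "a : carrier BD" "a : S1B"
  then show "inv_BD a : S1B" using B[of a] B[of "inv_BD a"] inv0[of a] by simp
 qed
qed

lemma loops_at_join_closed:
 assumes "path k" "track k <= Y" "start k = x" "p : loops_at Y (finish k)"
 shows "k +++ (p +++ reversepath k) : loops_at Y x" using assms by (auto simp: loops_at_def path_image_join)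

lemma hom_path_functor:
 assumes r: "r : hom (fundamental_group Y x) BD" and Y: "path_connected Y" "x : Y"
 obtains T where "path_functor BD Y T" "!!p. p : loops_at Y x ==> T p = r (path_class Y p)"
proof -
 have "\<exists>k. path k & track k <= Y & start k = x & finish k = y" if "y : Y" for y
  using Y that unfolding path_connected_def by blast
 then obtain k0 where k0: "!!y. y : Y ==> path (k0 y) & track (k0 y) <= Y & start (k0 y) = x & finish (k0 y) = y"
  by metis
 define k where "k y = (if y = x then linepath x x else k0 y)" for y
 have k: "path (k y)" "track (k y) <= Y" "start (k y) = x" "finish (k y) = y" if "y : Y" for y
  using k0[OF that] Y(2) by (auto simp: k_def)
 have car: "path_class Y p : carrier (fundamental_group Y x)" if "p : loops_at Y x" for p
  using that by (simp add: fundamental_group_def)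
 have loops: "p : {p. path p & track p <= Y & start p : {x} & finish p : {x}} \<longleftrightarrow> p : loops_at Y x" for p
  by (auto simp: loops_at_def)
 show ?thesis
 proof (rule that[OF path_functor_conjugate_by_paths[OF group_BD, of Y "{x}" "%p. r (path_class Y p)" k]])
  fix p assume "p : {p. path p & track p <= Y & start p : {x} & finish p : {x}}"
  then have p: "p : loops_at Y x" unfolding loops .
  show "r (path_class Y p) : carrier BD" using r car[OF p] by (rule hom_in_carrier)
  show "r (path_class Y p) = r (path_class Y q)" if "homotopic_paths Y p q" for q using path_class_eqI[OF that] by simp
  fix q assume "q : {p. path p & track p <= Y & start p : {x} & finish p : {x}}"
  then have q: "q : loops_at Y x" unfolding loops .
  show "r (path_class Y (p +++ q)) = r (path_class Y p) \<cdot> r (path_class Y q)"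
   using hom_mult[OF r car[OF p] car[OF q]] by (simp add: fundamental_group_mult[OF p q])
 next
  fix p assume p: "p : loops_at Y x"
  then have "homotopic_paths Y (linepath x x +++ (p +++ linepath x x)) p"
   by (intro homotopic_paths_trans[OF homotopic_paths_lid' homotopic_paths_rid'])
    (auto simp: loops_at_def path_image_join)
  from path_class_eqI[OF this]
  show "r (path_class Y (k (start p) +++ (p +++ reversepath (k (finish p))))) = r (path_class Y p)"
   using p by (simp add: loops_at_def k_def)
 qed (use k in auto)
qed

lemma path_functor_hom:
 assumes T: "path_functor BD Y T" and x: "x : Y"
 shows "\<exists>r. r : hom (fundamental_group Y x) BD Int extensional (carrier (fundamental_group Y x)) &
  (\<forall>p\<in>loops_at Y x. r (path_class Y p) = T p)"
proof -
 interpret T: path_functor BD Y T by (rule T)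
 let ?G = "fundamental_group Y x"
 have car: "carrier ?G = path_class Y ` loops_at Y x" by (simp add: fundamental_group_def)
 define r where "r = restrict (%a. T (SOME p. p : loops_at Y x & a = path_class Y p)) (carrier ?G)"
 have eq: "r (path_class Y p) = T p" if p: "p : loops_at Y x" for p
 proof -
  define q where "q = (SOME q. q : loops_at Y x & path_class Y p = path_class Y q)"
  have q: "q : loops_at Y x & path_class Y p = path_class Y q" unfolding q_def by (rule someI[of _ p]) (simp add: p)
  then have "homotopic_paths Y p q" using path_class_eq_iff[OF p] by blast
  from T.homotopic[OF this] show ?thesis using p by (simp add: r_def car flip: q_def)
 qed
 have "r : hom ?G BD"
 proof (rule homI)
  fix a assume "a : carrier ?G"
  then obtain p where p: "p : loops_at Y x" "a = path_class Y p" unfolding car by blast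
  show "r a : carrier BD" unfolding p(2) eq[OF p(1)] using p(1) by (intro T.closed) (auto simp: loops_at_def)
  fix b assume "b : carrier ?G"
  then obtain q where q: "q : loops_at Y x" "b = path_class Y q" unfolding car by blast
  have "p +++ q : loops_at Y x" using p q by (auto simp: loops_at_def path_image_join)
  from eq[OF this] show "r (a \<otimes>\<^bsub>?G\<^esub> b) = r a \<cdot> r b"
   unfolding p(2) q(2) fundamental_group_mult[OF p(1) q(1)] eq[OF p(1)] eq[OF q(1)]
   using p(1) q(1) by (simp add: loops_at_def T.join)
 qed
 then show ?thesis using eq by (intro exI[of _ r]) (auto simp: r_def)
qed

text \<open>
 Every disc boundary is freely homotopic to a loop at the base point, so that conditions on
 meridians are conditions on the transport around discs.
\<close>

lemma meridians_iff_discs: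
 assumes T: "path_functor BD Y T" and Y: "path_connected Y" "x : Y" "Y = S3 - (M Un N)" and S: "meridian_closed S"
  and r: "!!p. p : loops_at Y x ==> r (path_class Y p) = T p"
 shows "(\<forall>p. meridian M N x p --> r (path_class Y p) : S) \<longleftrightarrow>
  (\<forall>d. meridian_disc M N d --> T (rim d) : S)"
proof -
 interpret T: path_functor BD Y T by (rule T)
 have conj: "g : carrier BD ==> a : S ==> a : carrier BD ==> g \<cdot> a \<cdot> inv_BD g : S" for g a
  using S by (simp add: meridian_closed_def)
 show ?thesis
 proof (intro iffI allI impI)
  fix p assume d: "\<forall>d. meridian_disc M N d --> T (rim d) : S" and "meridian M N x p"
  then obtain d where d': "meridian_disc M N d" "homotopic_loops Y p (rim d)" and p: "p : loops_at Y x"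
   unfolding meridian_def Y(3) by blast
  have "T p : S" using T.homotopic_loops_conj_iff[OF d'(2), of S] conj d d'(1) by blast
  then show "r (path_class Y p) : S" using r[OF p] by simp
 next
  fix d assume m: "\<forall>p. meridian M N x p --> r (path_class Y p) : S" and d: "meridian_disc M N d"
  let ?b = "%t. d (turn t)"
  from meridian_disc_shrink[OF d, of 1] have "homotopic_loops Y ?b ?b" by (simp add: Y(3))
  then have b: "path ?b" "track ?b <= Y" "finish ?b = start ?b"
   using homotopic_loops_imp_path homotopic_loops_imp_subset homotopic_loops_imp_loop by blast+
  then have "start ?b : Y" by (auto intro: subsetD)
  then obtain k where k: "path k" "track k <= Y" "start k = x" "finish k = start ?b"
   using Y(1,2) unfolding path_connected_def by blast
  have l: "k +++ (?b +++ reversepath k) : loops_at Y x"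
   using b k by (intro loops_at_join_closed) (auto simp: loops_at_def)
  have h: "homotopic_loops Y (k +++ (?b +++ reversepath k)) ?b" using b k by (intro homotopic_loops_conjugate) auto
  then have "meridian M N x (k +++ (?b +++ reversepath k))" using l d unfolding meridian_def Y(3) by blast
  then have "T (k +++ (?b +++ reversepath k)) : S" using m r[OF l] by fastforce
  then show "T ?b : S" using T.homotopic_loops_conj_iff[OF h, of S] conj by blast
 qed
qed

lemma (in tube) flat_circle:
 assumes "0 < e" "e < \<delta>"
 shows "path (rim (flat e))" "track (rim (flat e)) <= region \<delta> - M"
  "finish (rim (flat e)) = start (rim (flat e))"
proof -
 show "path (rim (flat e))" unfolding path_def flat_def
  by (intro continuous_on_compose2[OF continuous_on_un[of UNIV]] continuous_intros) auto
 have "flat e (cis a) : region \<delta> - M" for a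
 proof -
  have z: "cis a : cball 0 1" "cis a ~= 0" by simp_all
  show ?thesis using flat_in_region[OF assms z(1)] flat_in_M_iff[OF assms z(1)] z(2) by blast
 qed
 then show "track (rim (flat e)) <= region \<delta> - M" unfolding path_image_def by blast
qed (simp add: pathfinish_def pathstart_def)

text \<open>
 A standard circle of a second tube centred at a point of M bounds a small disc transverse to M, and is
 thus comparable with the standard circle of the first tube.
\<close>

lemma (in tube) move_circle:
 assumes T: "path_functor BD X T" "region \<delta> - M <= X" and S: "meridian_closed S" and e: "0 < e" "e < \<delta>"
  and t2: "tube p0 A2 B2 M2 q2 g2 g2' \<delta>2" and q2: "q2 : region \<delta>" "q2 : M" and U: "open U" "q2 : U" "M Int U <= M2"
 shows "\<exists>e2. 0 < e2 & e2 < \<delta>2 &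
  (T (rim (tube.flat p0 A2 B2 q2 e2)) : S \<longleftrightarrow> T (rim (flat e)) : S)"
proof -
 interpret t2: tube p0 A2 B2 M2 q2 g2 g2' \<delta>2 by (rule t2)
 have d: "0 < \<delta>2 / 2" "\<delta>2 / 2 < \<delta>2" using t2.\<delta> by auto
 have md: "meridian_disc M2 {} (t2.flat (\<delta>2 / 2))" by (rule t2.meridian_disc_flat[OF d order_refl]) simp
 have c: "t2.flat (\<delta>2 / 2) 0 : region \<delta>" "t2.flat (\<delta>2 / 2) 0 : M" using q2 by simp_all
 have tv: "tangent_vectors M (t2.flat (\<delta>2 / 2) 0) <= tangent_vectors M2 (t2.flat (\<delta>2 / 2) 0)"
  using tangent_vectors_local[OF U] by simp
 obtain r where r: "0 < r" "r <= 1"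
  "T (%t. t2.flat (\<delta>2 / 2) (of_real r * turn t)) : S \<longleftrightarrow> T (rim (flat e)) : S"
  by (rule meridian_disc_transport[OF T md c tv e, of S]) (use S in \<open>auto simp: meridian_closed_def\<close>)
 have "t2.flat (\<delta>2 / 2) (of_real r * z) = t2.flat (\<delta>2 / 2 * r) z" for z by (simp add: t2.flat_def mult.assoc)
 then have "T (%t. t2.flat (\<delta>2 / 2 * r) (turn t)) : S \<longleftrightarrow> T (rim (flat e)) : S"
  using r(3) by simp
 moreover have "0 < \<delta>2 / 2 * r" "\<delta>2 / 2 * r < \<delta>2" using r(1,2) t2.\<delta> mult_left_le[of r "\<delta>2 / 2"] by auto
 ultimately show ?thesis by blast
qed

lemma meridian_disc_centre: "meridian_disc M N d ==> d 0 : M & d 0 ~: N"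
proof -
 assume d: "meridian_disc M N d"
 then obtain D where "d ` cball 0 1 Int M = {d 0}" "d ` cball 0 1 Int N = {}" by (rule meridian_discE)
 moreover have "d 0 : d ` cball 0 1" by simp
 ultimately show ?thesis by blast
qed

lemma meridian_transport_local:
 assumes t: "tube p0 A B M (d 0) g g' h" and d: "meridian_disc M N d"
  and T: "path_functor BD (S3 - (M Un N)) T" and r: "tube.region p0 A B (d 0) g h Int N = {}"
  and S: "meridian_closed S" and e: "0 < e" "e < h"
 shows "T (rim d) : S \<longleftrightarrow> T (rim (tube.flat p0 A B (d 0) e)) : S"
proof -
 interpret t: tube p0 A B M "d 0" g g' h by (rule t)
 interpret T: path_functor BD "S3 - (M Un N)" T by (rule T)
 have rY: "t.region h - M <= S3 - (M Un N)" using r t.region_S3 by blast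
 have S': "g : carrier BD ==> a : S ==> a : carrier BD ==> g \<cdot> a \<cdot> inv_BD g : S"
  "a : S ==> a : carrier BD ==> inv_BD a : S" for g a
  using S by (auto simp: meridian_closed_def)
 obtain s where s: "0 < s" "s <= 1"
  "T (rim (%z. d (of_real s * z))) : S \<longleftrightarrow> T (rim (t.flat e)) : S"
  by (rule t.meridian_disc_transport[OF T rY d t.q_in_region[OF t.\<delta>] conjunct1[OF meridian_disc_centre[OF d]] subset_refl e S'])
 from T.homotopic_loops_conj_iff[OF meridian_disc_shrink[OF d s(1,2)] S'(1)] s(3) show ?thesis by simp
qed

locale marking_pair = linking_character p0 A B K cs for p0 A B K cs +
 fixes L \<omega> \<omega>' V :: "R4 set"
 assumes K_eq: "K = L Un (\<omega> Un \<omega>')" and p0_S3: "p0 : S3" and link: "link L"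
  and mark: "marking_data L \<omega>" "marking_data L \<omega>'" and finite_V: "finite V" and ends_V: "(\<omega> Un \<omega>') Int L <= V"
  and visits: "\<forall>q. q ~: L Un V --> (\<forall>c\<in>set cs. passes_well q c) &
    (\<Sum>c\<leftarrow>cs. card (visits c q)) = of_bool (q : \<omega>) + of_bool (q : \<omega>')"
  and connected: "path_connected X"

lemma marking_pair_swap: "marking_pair p0 A B K cs L \<omega> \<omega>' V ==> marking_pair p0 A B K cs L \<omega>' \<omega> V"
 unfolding marking_pair_def marking_pair_axioms_def by (elim conjE, intro conjI) (simp_all add: Un_commute add.commute)

lemma link_interior: "link L ==> q : L ==> manifold_interior_point L q"
 unfolding link_def submanifold1_def manifold_boundary_def by blast

lemma marking_interior: "marking_data L \<omega> ==> q : \<omega> - L ==> manifold_interior_point \<omega> q"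
 unfolding marking_data_def submanifold1_def manifold_boundary_def by blast

lemma component_interior:
 assumes "link L" "C : components L" "q : C" shows "manifold_interior_point C q"
proof -
 have "q : L" using assms in_components_subset by blast
 obtain U f h where U: "open U" "smooth_on {-1<..<1::real} f" "f 0 = q"
  "homeomorphism {-1<..<1} (L Int U) f h" "\<forall>t\<in>{-1<..<1}. vector_derivative f (at t) ~= 0"
  using link_interior[OF assms(1) \<open>q : L\<close>] unfolding manifold_interior_point_def by blast
 have "curve_interior L p" if "p : L" for p using link_interior[OF assms(1) that] by (rule curve_interior_manifold)
 then have "openin (top_of_set L) C" using components_path_connected(2)[OF locally_path_connected_curve assms(2)] by blast
 then obtain O' where O': "open O'" "C = L Int O'" by (auto simp: openin_open)
 have im: "f ` {-1<..<1} = L Int U" using U(4) by (simp add: homeomorphism_def)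
 have "connected (f ` {-1<..<1})" using U(4) by (intro connected_continuous_image) (auto simp: homeomorphism_def)
 moreover have "q : f ` {-1<..<1}" using U(3) by (intro image_eqI[of _ _ 0]) auto
 ultimately have "L Int U <= C" unfolding im by (intro components_maximal[OF assms(2)]) (use assms(3) in auto)
 then have "L Int U = C Int U" using in_components_subset[OF assms(2)] by blast
 then show ?thesis using U unfolding manifold_interior_point_def by metis
qed

context marking_pair begin

lemma curves: "closed L" "closed \<omega>" "closed \<omega>'" "L <= S3" "\<omega> <= S3" "\<omega>' <= S3"
 using link mark by (auto simp: link_def marking_data_def submanifold1_def compact_imp_closed)

lemma X_eq: "X = S3 - ((L Un \<omega>') Un \<omega> Un {p0})" "X = S3 - ((L Un \<omega>) Un \<omega>' Un {p0})" unfolding K_eq by auto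

text \<open>
 The point q itself may be a vertex of the cycles; the circle is moved to a point nearby where exactly
 one of them passes, exactly once.
\<close>

lemma total_sign_circle:
 assumes q: "q : \<omega> - (L Un \<omega>')" and t: "tube p0 A' B' \<omega> q g g' d"
  and r: "tube.region p0 A' B' q g d Int (L Un \<omega>') = {}" and h: "0 < h" "h < d"
 shows "total_sign (rim (tube.flat p0 A' B' q h)) = -1"
proof -
 interpret t: tube p0 A' B' \<omega> q g g' d by (rule t)
 have rX: "t.region d - \<omega> <= X" using r t.region_S3 unfolding K_eq by blast
 have "X ~= {}" using t.path_connected_region_minus_M(2)[OF t.\<delta> order_refl] rX by blast
 obtain k where k: "path_functor BD X k"
  "!!p. path p ==> track p <= X ==> finish p = start p ==> k p = scalar (total_sign p)"
  using total_sign_functor[OF connected \<open>X ~= {}\<close>] by metis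
 obtain q2 where q2: "q2 : t.region d" "q2 : \<omega>" "q2 ~: V"
  using t.region_curve_infinite finite_V by (meson IntD1 IntD2 finite_subset subsetI)
 obtain O' where O': "open O'" "t.region d = S3 Int O'" using t.openin_region[OF order_refl] by (auto simp: openin_open)
 have q2': "q2 : \<omega> - L" "p0 ~= q2" "q2 : O'" "q2 ~: L Un V" "q2 ~: \<omega>'" using q2 r O'(2) t.region_S3 by auto
 obtain A2 B2 g2 g2' d2 where t2: "tube p0 A2 B2 \<omega> q2 g2 g2' d2" and r2: "tube.region p0 A2 B2 q2 g2 d2 <= O'"
  by (rule tube_exists_in[OF curves(5) marking_interior[OF mark(1) q2'(1)] p0_S3 q2'(2) O'(1) q2'(3)])
 interpret t2: tube p0 A2 B2 \<omega> q2 g2 g2' d2 by (rule t2)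
 have rr: "t2.region d2 <= t.region d" using r2 O'(2) t2.region_S3 by blast
 obtain h2 where e2: "0 < h2" "h2 < d2"
  "k (rim (t2.flat h2)) : {- qone} \<longleftrightarrow> k (rim (t.flat h)) : {- qone}"
  using t.move_circle[OF k(1) rX meridian_closed_minus_one h t2 q2(1,2) open_UNIV] by auto
 have KM: "K Int t2.region d2 <= \<omega>" using rr r unfolding K_eq by blast
 have pw: "\<forall>c\<in>set cs. passes_well q2 c" and s1: "(\<Sum>c\<leftarrow>cs. card (visits c q2)) = 1"
  using visits q2'(4,5) q2(2) by auto
 have "total_sign (rim (t2.flat h2)) = -1" using total_sign_flat[OF t2 KM e2(1,2) pw] s1 by (simp add: t2.flat_def)
 moreover have "track (rim (t2.flat h2)) <= X" using t2.flat_circle(2)[OF e2(1,2)] rr rX by blast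
 ultimately have "k (rim (t2.flat h2)) = - qone"
  using k(2)[OF t2.flat_circle(1)[OF e2(1,2)] _ t2.flat_circle(3)[OF e2(1,2)]] by (simp add: scalar_def qone_def)
 then have "k (rim (t.flat h)) = - qone" using e2(3) by simp
 moreover have "track (rim (t.flat h)) <= X" using t.flat_circle(2)[OF h] rX by blast
 ultimately have "scalar (total_sign (rim (t.flat h))) = - qone"
  using k(2)[OF t.flat_circle(1)[OF h] _ t.flat_circle(3)[OF h]] by simp
 then have "complex_of_real (total_sign (rim (t.flat h))) = of_real (-1)" by (simp add: scalar_def qone_def)
 then show ?thesis by (simp only: of_real_eq_iff)
qed

text \<open>
 Suppose that T and T' are the transports of the two complements and differ by the total sign. At
 a point where only one of the markings passes, the sign takes care of the change of the
 complement; where both markings pass, the total sign is trivial.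
\<close>

lemma discs_marking:
 assumes T: "path_functor BD (S3 - (L Un \<omega>)) T" and T': "path_functor BD (S3 - (L Un \<omega>')) T'"
  and rel: "!!p. path p ==> track p <= X ==> finish p = start p ==>
   T' p = scalar (total_sign p) \<cdot> T p"
  and disc: "!!d. meridian_disc \<omega> L d ==> T (rim d) = - qone"
  and d: "meridian_disc \<omega>' L d"
 shows "T' (rim d) = - qone"
proof -
 interpret swap: marking_pair p0 A B K cs L \<omega>' \<omega> V by (rule marking_pair_swap) unfold_locales
 interpret T: path_functor BD "S3 - (L Un \<omega>)" T by (rule T)
 interpret T': path_functor BD "S3 - (L Un \<omega>')" T' by (rule T')
 have d0: "d 0 : \<omega>' - L" "d 0 : - L" "p0 ~= d 0" using meridian_disc_centre[OF d] pole_K unfolding K_eq by auto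
 obtain A1 B1 g g' h where t: "tube p0 A1 B1 \<omega>' (d 0) g g' h" and r: "tube.region p0 A1 B1 (d 0) g h <= - L"
  by (rule tube_exists_in[OF curves(6) marking_interior[OF mark(2) d0(1)] p0_S3 d0(3) open_Compl[OF curves(1)] d0(2)])
 interpret t: tube p0 A1 B1 \<omega>' "d 0" g g' h by (rule t)
 have e: "0 < h / 2" "h / 2 < h" using t.\<delta> by auto
 have rL: "t.region h Int L = {}" using r by blast
 have T2: "path_functor BD (S3 - (\<omega>' Un L)) T'" using T' by (simp add: Un_commute)
 have rY: "t.region h - \<omega>' <= S3 - (L Un \<omega>')" using rL t.region_S3 by blast
 note move = t.move_circle[OF T' rY meridian_closed_minus_one e]
 obtain O' where O': "open O'" "t.region h = S3 Int O'" using t.openin_region[OF order_refl] by (auto simp: openin_open)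
 have "T' (rim (t.flat (h / 2))) : {- qone}"
 proof (cases "t.region h Int \<omega>' <= \<omega>")
  case False
  then obtain q where q: "q : t.region h" "q : \<omega>'" "q ~: \<omega>" by blast
  then have q': "q : \<omega>' - L" "q : \<omega>' - (L Un \<omega>)" "p0 ~= q" "q : O' Int - (L Un \<omega>)" using rL O'(2) t.region_S3 by auto
  have oW: "open (O' Int - (L Un \<omega>))" using O'(1) curves(1,2) by (intro open_Int open_Compl closed_Un)
  obtain A2 B2 g2 g2' h2 where t2: "tube p0 A2 B2 \<omega>' q g2 g2' h2" and r2: "tube.region p0 A2 B2 q g2 h2 <= O' Int - (L Un \<omega>)"
   by (rule tube_exists_in[OF curves(6) marking_interior[OF mark(2) q'(1)] p0_S3 q'(3) oW q'(4)])
  interpret t2: tube p0 A2 B2 \<omega>' q g2 g2' h2 by (rule t2)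
  have rN: "t2.region h2 Int (L Un \<omega>) = {}" "t2.region h2 <= S3 - (L Un \<omega>)" "t2.region h2 - \<omega>' <= X"
   using r2 t2.region_S3 unfolding K_eq by blast+
  obtain ep where ep: "0 < ep" "ep < h2"
   "T' (rim (t2.flat ep)) : {- qone} \<longleftrightarrow> T' (rim (t.flat (h / 2))) : {- qone}"
   using move[OF t2 q(1,2) open_UNIV] by auto
  let ?c = "%u. t2.flat ep (turn u)"
  note c = t2.flat_circle[OF ep(1,2)]
  have cX: "track ?c <= X" using c(2) rN(3) by blast
  have sgn: "total_sign ?c = -1" by (rule swap.total_sign_circle[OF q'(2) t2 rN(1) ep(1,2)])
  have s: "start ?c : t2.region h2" using c(1,2) by (auto intro: subsetD)
  have "T ?c = T (linepath (start ?c) (start ?c))"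
   by (rule T.simply_connected_eq[OF t2.simply_connected_region[OF order_refl] rN(2)]) (use c s in auto)
  also have "... = qone" using T.const[of "start ?c"] s rN(2) BD_one by auto
  finally have "T' ?c = - qone" using rel[OF c(1) cX c(3)] sgn by (simp add: scalar_def BD_signs qone_def) (simp add: BD_def qmult_def)
  then show ?thesis using ep(3) by simp
 next
  case True
  obtain q where q: "q : t.region h" "q : \<omega>'" "q ~: V"
   using t.region_curve_infinite finite_V by (meson IntD1 IntD2 finite_subset subsetI)
  then have q': "q : \<omega> - L" "p0 ~= q" "q : O'" "q ~: L Un V" using rL O'(2) t.region_S3 True by auto
  obtain A2 B2 g2 g2' h2 where t2: "tube p0 A2 B2 \<omega> q g2 g2' h2" and r2: "tube.region p0 A2 B2 q g2 h2 <= O'"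
   by (rule tube_exists_in[OF curves(5) marking_interior[OF mark(1) q'(1)] p0_S3 q'(2) O'(1) q'(3)])
  interpret t2: tube p0 A2 B2 \<omega> q g2 g2' h2 by (rule t2)
  have rr: "t2.region h2 <= t.region h" using r2 O'(2) t2.region_S3 by blast
  have rN: "t2.region h2 Int L = {}" "K Int t2.region h2 <= \<omega>" "t2.region h2 - \<omega> <= X"
   using rr rL True t2.region_S3 unfolding K_eq by blast+
  have "\<omega>' Int O' <= \<omega>" using True O'(2) curves(6) by blast
  then obtain ep where ep: "0 < ep" "ep < h2"
   "T' (rim (t2.flat ep)) : {- qone} \<longleftrightarrow> T' (rim (t.flat (h / 2))) : {- qone}"
   using move[OF t2 q(1,2) O'(1) q'(3)] by blast
  let ?c = "%u. t2.flat ep (turn u)"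
  note c = t2.flat_circle[OF ep(1,2)]
  have cX: "track ?c <= X" using c(2) rN(3) by blast
  have pw: "\<forall>c\<in>set cs. passes_well q c" and s1: "(\<Sum>c\<leftarrow>cs. card (visits c q)) = 2"
   using visits q'(1,4) q(2) by auto
  have sgn: "total_sign ?c = 1" using total_sign_flat[OF t2 rN(2) ep(1,2) pw] s1 by (simp add: t2.flat_def)
  have "T ?c = - qone" by (rule disc[OF t2.meridian_disc_flat[OF ep(1,2) order_refl rN(1)]])
  then have "T' ?c = - qone" using rel[OF c(1) cX c(3)] sgn by (simp add: scalar_def qone_def) (simp add: BD_def qmult_def)
  then show ?thesis using ep(3) by simp
 qed
 then show ?thesis using meridian_transport_local[OF t d T2 rL meridian_closed_minus_one e] by simp
qed

end

context marking_pair begin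

text \<open>
 Signs do not matter for S1B. The circle is moved to a point off V, near which neither of the markings
 passes.
\<close>

lemma discs_link:
 assumes T: "path_functor BD (S3 - (L Un \<omega>)) T" and T': "path_functor BD (S3 - (L Un \<omega>')) T'"
  and rel: "!!p. path p ==> track p <= X ==> finish p = start p ==>
   T' p = scalar (total_sign p) \<cdot> T p"
  and C: "C : components L"
  and disc: "!!d. meridian_disc C ((L - C) Un \<omega>) d ==> T (rim d) : S1B"
  and d: "meridian_disc C ((L - C) Un \<omega>') d"
 shows "T' (rim d) : S1B"
proof -
 interpret T: path_functor BD "S3 - (L Un \<omega>)" T by (rule T)
 have CL: "C <= L" using C in_components_subset by blast
 have "curve_interior L p" if "p : L" for p using link_interior[OF link that] by (rule curve_interior_manifold)
 then have "openin (top_of_set L) C" using components_path_connected(2)[OF locally_path_connected_curve C] by blast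
 then have "closedin (top_of_set L) (L - C)" by (simp add: closedin_diff)
 then have clN: "closed (L - C)" using curves(1) closedin_closed_trans by blast
 have d0: "d 0 : C" "d 0 ~: (L - C) Un \<omega>'" using meridian_disc_centre[OF d] by auto
 then have d0': "p0 ~= d 0" "d 0 : - ((L - C) Un \<omega>')" using pole_K CL unfolding K_eq by auto
 have CS: "C <= S3" using CL curves(4) by blast
 have oN: "open (- ((L - C) Un \<omega>'))" using clN curves(3) by (intro open_Compl closed_Un)
 obtain A1 B1 g g' h where t: "tube p0 A1 B1 C (d 0) g g' h" and r: "tube.region p0 A1 B1 (d 0) g h <= - ((L - C) Un \<omega>')"
  by (rule tube_exists_in[OF CS component_interior[OF link C d0(1)] p0_S3 d0'(1) oN d0'(2)])
 interpret t: tube p0 A1 B1 C "d 0" g g' h by (rule t)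
 have e: "0 < h / 2" "h / 2 < h" using t.\<delta> by auto
 have rN: "t.region h Int ((L - C) Un \<omega>') = {}" using r by blast
 have "S3 - (C Un ((L - C) Un \<omega>')) = S3 - (L Un \<omega>')" using CL by blast
 then have T2: "path_functor BD (S3 - (C Un ((L - C) Un \<omega>'))) T'" using T' by simp
 have rY: "t.region h - C <= S3 - (L Un \<omega>')" using rN t.region_S3 by blast
 obtain q where q: "q : t.region h" "q : C" "q ~: V"
  using t.region_curve_infinite finite_V by (meson IntD1 IntD2 finite_subset subsetI)
 have "q ~: \<omega>" using q ends_V CL by blast
 then have q': "p0 ~= q" "q : - ((L - C) Un \<omega> Un \<omega>')" using q rN t.region_S3 by auto
 have oN2: "open (- ((L - C) Un \<omega> Un \<omega>'))" using clN curves(2,3) by (intro open_Compl closed_Un)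
 obtain A2 B2 g2 g2' h2 where t2: "tube p0 A2 B2 C q g2 g2' h2" and r2: "tube.region p0 A2 B2 q g2 h2 <= - ((L - C) Un \<omega> Un \<omega>')"
  by (rule tube_exists_in[OF CS component_interior[OF link C q(2)] p0_S3 q'(1) oN2 q'(2)])
 interpret t2: tube p0 A2 B2 C q g2 g2' h2 by (rule t2)
 obtain ep where ep: "0 < ep" "ep < h2"
  "T' (rim (t2.flat ep)) : S1B \<longleftrightarrow> T' (rim (t.flat (h / 2))) : S1B"
  using t.move_circle[OF T' rY meridian_closed_S1B e t2 q(1,2) open_UNIV] by auto
 let ?c = "%u. t2.flat ep (turn u)"
 note c = t2.flat_circle[OF ep(1,2)]
 have r2X: "t2.region h2 - C <= X" using r2 t2.region_S3 CL unfolding K_eq by blast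
 then have cX: "track ?c <= X" using c(2) by blast
 have "t2.region h2 Int ((L - C) Un \<omega>) = {}" using r2 by blast
 then have "T ?c : S1B" by (intro disc t2.meridian_disc_flat[OF ep(1,2) order_refl])
 then have "T' ?c : S1B" using rel[OF c(1) cX c(3)] total_sign_values[OF c(1) cX c(3)]
  by (auto simp: scalar_def BD_def qmult_def S1B_iff)
 then show ?thesis using ep(3) meridian_transport_local[OF t d T2 rN meridian_closed_S1B e] by blast
qed

lemma trivial_functor: "path_functor BD Z (%_. one_BD)"
 by (intro path_functor.intro path_functor_axioms.intro group_BD) (auto simp: BD_one BD_signs)

lemma thin:
 assumes T: "path_functor BD X T"
  and one: "!!q A' B' g g' d e. q : \<omega> - (L Un \<omega>') ==> tube p0 A' B' \<omega> q g g' d ==>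
   tube.region p0 A' B' q g d Int (L Un \<omega>') = {} ==> 0 < e ==> e < d ==>
   T (rim (tube.flat p0 A' B' q e)) = one_BD"
 shows "thin_transport BD X T (S3 - (L Un \<omega>'))"
proof (intro thin_transport.intro thin_transport_axioms.intro T)
 note X = X_eq(1)
 show "thin_complement (%U. \<forall>p. path p --> track p <= U Int X --> finish p = start p --> T p = one_BD)
   X (S3 - (L Un \<omega>'))" unfolding X
 proof (rule thin_curve_complement)
  show "path_functor BD (S3 - (L Un \<omega>' Un \<omega> Un {p0})) T" using T unfolding X .
  show "closed (L Un \<omega>')" "closed \<omega>" "\<omega> <= S3" "p0 : S3" using curves p0_S3 by (auto intro: closed_Un)
  show "p0 ~: L Un \<omega>' Un \<omega>" using pole_K unfolding K_eq by blast
  show "manifold_interior_point \<omega> q" if "q : \<omega> - (L Un \<omega>')" for q using marking_interior[OF mark(1)] that by blast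
  fix q A' B' g g' d
  assume q: "q : \<omega> - (L Un \<omega>')" and t: "tube p0 A' B' \<omega> q g g' d" and r: "tube.region p0 A' B' q g d Int (L Un \<omega>') = {}"
  interpret t: tube p0 A' B' \<omega> q g g' d by (rule t)
  show "\<exists>e>0. e < d & T (%t. t.un ((of_real e * turn t, 0) + t.st q)) = one_BD"
   using one[OF q t r, of "d / 2"] t.\<delta> by (intro exI[of _ "d / 2"]) (simp add: t.flat_def)
 qed
qed

lemma thin_complement_marking: "thin_complement (%U. \<forall>p. path p --> track p <= U Int X --> finish p = start p --> one_BD = one_BD)
   X (S3 - (L Un \<omega>'))"
 using thin[OF trivial_functor] unfolding thin_transport_def thin_transport_axioms_def by blast

lemma complement_connected: "path_connected (S3 - (L Un \<omega>'))"
 using thin_complement_path_connected[OF thin_complement_marking] connected by blast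

text \<open>
 Around a point of \<omega> off L \<union> \<omega>' the transport and the total sign are both -1 and
 cancel.
\<close>

theorem transport_across:
 assumes T: "path_functor BD (S3 - (L Un \<omega>)) T" and X: "X ~= {}"
  and disc: "!!d. meridian_disc \<omega> L d ==> T (rim d) = - qone"
 obtains T' where "path_functor BD (S3 - (L Un \<omega>')) T'"
  "!!p. path p ==> track p <= X ==> finish p = start p ==> T' p = scalar (total_sign p) \<cdot> T p"
proof -
 interpret T: path_functor BD "S3 - (L Un \<omega>)" T by (rule T)
 obtain k where k: "path_functor BD X k" "!!p. path p ==> track p <= X ==> k p = qone | k p = - qone"
  "!!p. path p ==> track p <= X ==> finish p = start p ==> k p = scalar (total_sign p)"
  by (rule total_sign_functor[OF connected X]) blast
 interpret k: path_functor BD X k by (rule k(1))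
 have XY: "X <= S3 - (L Un \<omega>)" unfolding K_eq by blast
 interpret TX: path_functor BD X T by (rule T.restrict_domain[OF XY])
 define U where "U p = k p \<cdot> T p" for p
 have U: "path_functor BD X U"
 proof (intro path_functor.intro path_functor_axioms.intro group_BD)
  fix p assume p: "path p" "track p <= X"
  show "U p : carrier BD" unfolding U_def by (intro T.m_closed k.closed TX.closed p)
  fix q assume q: "path q" "track q <= X" "finish p = start q"
  have c: "k q \<cdot> T p = T p \<cdot> k q" using k(2)[OF q(1,2)] TX.closed[OF p] by (auto simp: BD_signs)
  show "U (p +++ q) = U p \<cdot> U q" unfolding U_def k.join[OF p(1) q(1) p(2) q(2,3)] TX.join[OF p(1) q(1) p(2) q(2,3)]
   using c k.closed[OF p] k.closed[OF q(1,2)] TX.closed[OF p] TX.closed[OF q(1,2)]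
   by (simp add: T.m_assoc) (simp flip: T.m_assoc)
 next
  fix p q assume "homotopic_paths X p q"
  then show "U p = U q" unfolding U_def using k.homotopic TX.homotopic by metis
 qed
 have "thin_transport BD X U (S3 - (L Un \<omega>'))"
 proof (rule thin[OF U])
  fix q A' B' g g' h e
  assume q: "q : \<omega> - (L Un \<omega>')" and t: "tube p0 A' B' \<omega> q g g' h" and r: "tube.region p0 A' B' q g h Int (L Un \<omega>') = {}"
   and e: "0 < e" "e < h"
  interpret t: tube p0 A' B' \<omega> q g g' h by (rule t)
  let ?c = "%u. t.flat e (turn u)"
  note c = t.flat_circle[OF e]
  have "t.region h - \<omega> <= X" using r t.region_S3 unfolding K_eq by blast
  then have cX: "track ?c <= X" using c(2) by blast
  have "t.region h Int L = {}" using r by blast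
  then have "T ?c = - qone" by (intro disc t.meridian_disc_flat[OF e order_refl])
  moreover have "k ?c = - qone" using k(3)[OF c(1) cX c(3)] total_sign_circle[OF q t r e] by (simp add: scalar_def qone_def)
  ultimately show "U ?c = one_BD" by (simp add: U_def BD_signs BD_one)
 qed
 then interpret thin_transport BD X U "S3 - (L Un \<omega>')" .
 obtain T' where T': "path_functor BD (S3 - (L Un \<omega>')) T'" "!!p. path p ==> track p <= X ==> T' p = U p"
  using extend_transport by blast
 show ?thesis by (rule that[OF T'(1)]) (simp add: T'(2) U_def k(3))
qed

end

lemma conjugate_surjective:
 assumes thin: "thin_complement P X Y" and k: "path k" "track k <= Y" "finish k : X" and p: "p : loops_at Y (start k)"
 shows "\<exists>l\<in>loops_at X (finish k). path_class Y (k +++ (l +++ reversepath k)) = path_class Y p"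
proof -
 let ?r = "reversepath k"
 have p': "path p" "track p <= Y" "start p = start k" "finish p = start k"
  using p by (auto simp: loops_at_def)
 define b where "b = ?r +++ (p +++ k)"
 have b: "path b" "track b <= Y" "start b = finish k" "finish b = finish k"
  using k p' by (auto simp: b_def path_image_join)
 obtain l where l: "path l" "track l <= X" "homotopic_paths Y b l"
  using thin_complement_push[OF thin b(1,2)] b(3,4) k(3) by auto
 have ll: "l : loops_at X (finish k)"
  using l b(3,4) homotopic_paths_imp_pathstart[OF l(3)] homotopic_paths_imp_pathfinish[OF l(3)] by (simp add: loops_at_def)
 have 1: "homotopic_paths Y (k +++ (l +++ ?r)) (k +++ (b +++ ?r))"
  using k b homotopic_paths_sym[OF l(3)] ll by (intro homotopic_paths_join) (auto simp: loops_at_def)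
 have "homotopic_paths Y ((p +++ k) +++ ?r) (p +++ (k +++ ?r))"
  using k p' by (intro homotopic_paths_sym[OF homotopic_paths_assoc]) auto
 moreover have "homotopic_paths Y (p +++ (k +++ ?r)) (p +++ linepath (finish p) (finish p))"
  using k p' homotopic_paths_rinv[of k Y] by (intro homotopic_paths_join) auto
 moreover have "homotopic_paths Y (p +++ linepath (finish p) (finish p)) p" by (rule homotopic_paths_rid[OF p'(1,2)])
 ultimately have a: "homotopic_paths Y ((p +++ k) +++ ?r) p" using homotopic_paths_trans by blast
 have "homotopic_paths Y (b +++ ?r) (?r +++ ((p +++ k) +++ ?r))" unfolding b_def
  using k p' by (intro homotopic_paths_sym[OF homotopic_paths_assoc]) (auto simp: path_image_join)
 moreover have "homotopic_paths Y (?r +++ ((p +++ k) +++ ?r)) (?r +++ p)" using a k p' by (intro homotopic_paths_join) auto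
 ultimately have h: "homotopic_paths Y (b +++ ?r) (?r +++ p)" using homotopic_paths_trans by blast
 have "homotopic_paths Y (k +++ (b +++ ?r)) (k +++ (?r +++ p))" by (rule homotopic_paths_join[OF _ h]) (use k b in auto)
 moreover have "homotopic_paths Y (k +++ (?r +++ p)) ((k +++ ?r) +++ p)" using k p' by (intro homotopic_paths_assoc) auto
 moreover have "homotopic_paths Y ((k +++ ?r) +++ p) (linepath (start p) (start p) +++ p)"
  using k p' homotopic_paths_rinv[of k Y] by (intro homotopic_paths_join) auto
 moreover have "homotopic_paths Y (linepath (start p) (start p) +++ p) p" by (rule homotopic_paths_lid[OF p'(1,2)])
 ultimately have "homotopic_paths Y (k +++ (l +++ ?r)) p" using 1 homotopic_paths_trans by metis
 from path_class_eqI[OF this] ll show ?thesis by (intro bexI[of _ l]) auto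
qed

context marking_pair begin

theorem transfer:
 assumes r: "r : reps L \<omega> x" and x: "x : S3 - (L Un \<omega>)" "x' : S3 - (L Un \<omega>')" and x0: "x0 : X"
  and k: "path k" "track k <= S3 - (L Un \<omega>)" "start k = x" "finish k = x0"
  and k': "path k'" "track k' <= S3 - (L Un \<omega>')" "start k' = x'" "finish k' = x0"
 shows "\<exists>e\<in>reps L \<omega>' x'. (\<forall>h\<in>loops_at X x0. e (path_class (S3 - (L Un \<omega>')) (k' +++ (h +++ reversepath k'))) =
   scalar (total_sign h) \<cdot> r (path_class (S3 - (L Un \<omega>)) (k +++ (h +++ reversepath k)))) &
  (r : reps_B L \<omega> x --> e : reps_B L \<omega>' x')"
proof -
 interpret swap: marking_pair p0 A B K cs L \<omega>' \<omega> V by (rule marking_pair_swap) unfold_locales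
 interpret group BD by (rule group_BD)
 let ?Y = "S3 - (L Un \<omega>)" and ?Y' = "S3 - (L Un \<omega>')"
 have Y: "?Y = S3 - (\<omega> Un L)" "?Y' = S3 - (\<omega>' Un L)" by auto
 have rh: "r : hom (fundamental_group ?Y x) BD" using r by (simp add: reps_def link_group_def)
 obtain T where T: "path_functor BD ?Y T" "!!p. p : loops_at ?Y x ==> T p = r (path_class ?Y p)"
  by (rule hom_path_functor[OF rh swap.complement_connected x(1)]) blast
 have disc: "T (rim d) = - qone" if "meridian_disc \<omega> L d" for d
  using meridians_iff_discs[OF T(1) swap.complement_connected x(1) Y(1) meridian_closed_minus_one T(2)[symmetric]] r that
  by (simp add: reps_def)
 obtain T' where T': "path_functor BD ?Y' T'"
  "!!p. path p ==> track p <= X ==> finish p = start p ==> T' p = scalar (total_sign p) \<cdot> T p"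
  using transport_across[OF T(1) _ disc] x0 by blast
 interpret T: path_functor BD ?Y T by (rule T(1))
 interpret T': path_functor BD ?Y' T' by (rule T'(1))
 \<comment> \<open>Conjugation by g makes the transports along the connecting paths k and k' cancel.\<close>
 define g where "g = T' k' \<cdot> inv_BD (T k)"
 have gc: "T k : carrier BD" "T' k' : carrier BD" "g : carrier BD"
  using T.closed[OF k(1,2)] T'.closed[OF k'(1,2)] by (auto simp: g_def)
 define U where "U p = inv_BD g \<cdot> T' p \<cdot> g" for p
 have U: "path_functor BD ?Y' U"
 proof (intro path_functor.intro path_functor_axioms.intro group_BD)
  fix p assume p: "path p" "track p <= ?Y'"
  then show "U p : carrier BD" unfolding U_def using gc T'.closed by auto
  fix q assume q: "path q" "track q <= ?Y'" "finish p = start q"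
  have "g \<cdot> (inv_BD g \<cdot> a) = a" if "a : carrier BD" for a using gc that by (simp flip: m_assoc)
  then show "U (p +++ q) = U p \<cdot> U q"
   unfolding U_def T'.join[OF p(1) q(1) p(2) q(2,3)] using gc T'.closed[OF p] T'.closed[OF q(1,2)] by (simp add: m_assoc)
 next
  fix p q assume "homotopic_paths ?Y' p q"
  then show "U p = U q" unfolding U_def using T'.homotopic by simp
 qed
 have US: "U p : S" if "T' p : S" "meridian_closed S" "path p" "track p <= ?Y'" for p S
 proof -
  have "inv_BD g \<cdot> T' p \<cdot> inv_BD (inv_BD g) : S"
   using that gc T'.closed unfolding meridian_closed_def by blast
  then show ?thesis using gc by (simp add: U_def)
 qed
 have bd: "path (rim d)" "track (rim d) <= S3 - (M Un N)"
  if "meridian_disc M N d" for M N d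
 proof -
  from meridian_disc_shrink[OF that, of 1] have "homotopic_loops (S3 - (M Un N)) (rim d) (rim d)" by simp
  then show "path (rim d)" "track (rim d) <= S3 - (M Un N)"
   using homotopic_loops_imp_path homotopic_loops_imp_subset by blast+
 qed
 obtain e where e: "e : hom (fundamental_group ?Y' x') BD Int extensional (carrier (fundamental_group ?Y' x'))"
  "\<forall>p\<in>loops_at ?Y' x'. e (path_class ?Y' p) = U p" using path_functor_hom[OF U x(2)] by blast
 have e': "e (path_class ?Y' p) = U p" if "p : loops_at ?Y' x'" for p using e(2) that by blast
 have "U (rim d) : {- qone}" if d: "meridian_disc \<omega>' L d" for d
 proof (rule US[OF _ meridian_closed_minus_one bd(1)[OF d]])
  have "T' (rim d) = - qone" by (rule discs_marking[OF T(1) T'(1) _ _ d]) (fact T'(2), fact disc)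
  then show "T' (rim d) : {- qone}" by simp
  show "track (rim d) <= ?Y'" using bd(2)[OF d] unfolding Y(2) .
 qed
 then have "\<forall>p. meridian \<omega>' L x' p --> e (path_class ?Y' p) : {- qone}"
  by (subst meridians_iff_discs[OF U complement_connected x(2) Y(2) meridian_closed_minus_one e']) simp_all
 then have er: "e : reps L \<omega>' x'" using e(1) by (simp add: reps_def link_group_def)
 moreover have "e (path_class ?Y' (k' +++ (h +++ reversepath k'))) =
   scalar (total_sign h) \<cdot> r (path_class ?Y (k +++ (h +++ reversepath k)))" if h: "h : loops_at X x0" for h
 proof -
  have a: "path h" "track h <= X" "finish h = start h" "start h = x0" using h by (auto simp: loops_at_def)
  have aY: "track h <= ?Y" "track h <= ?Y'" using a(2) unfolding K_eq by blast+
  have l: "k +++ (h +++ reversepath k) : loops_at ?Y x" "k' +++ (h +++ reversepath k') : loops_at ?Y' x'"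
   using a aY k k' by (auto simp: loops_at_def path_image_join)
  let ?s = "scalar (total_sign h)"
  have s: "?s = qone | ?s = - qone" using total_sign_values[OF a(1-3)] by (auto simp: scalar_def qone_def)
  have c: "T h : carrier BD" "?s : carrier BD" using T.closed[OF a(1) aY(1)] s BD_signs by auto
  have comm: "b \<cdot> ?s = ?s \<cdot> b" if "b : carrier BD" for b using s that by (auto simp: BD_signs)
  have "U (k' +++ (h +++ reversepath k')) = inv_BD g \<cdot> (T' k' \<cdot> (T' h \<cdot> inv_BD (T' k'))) \<cdot> g"
   using a aY k' by (simp add: U_def T'.join T'.rev path_image_join)
  also have "... = T k \<cdot> T' h \<cdot> inv_BD (T k)"
  proof -
   have "inv_BD g = T k \<cdot> inv_BD (T' k')" using gc by (simp add: g_def inv_mult_group)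
   moreover have "inv_BD (T' k') \<cdot> (T' k' \<cdot> b) = b" if "b : carrier BD" for b using gc that by (simp flip: m_assoc)
   ultimately show ?thesis using gc T'.closed[OF a(1) aY(2)] by (simp add: g_def m_assoc)
  qed
  also have "... = ?s \<cdot> (T k \<cdot> (T h \<cdot> inv_BD (T k)))"
   unfolding T'(2)[OF a(1-3)] using gc c comm[OF gc(1)] by (simp add: m_assoc) (simp flip: m_assoc)
  also have "T k \<cdot> (T h \<cdot> inv_BD (T k)) = T (k +++ (h +++ reversepath k))"
   using a aY k by (simp add: T.join T.rev path_image_join)
  finally show ?thesis using e'[OF l(2)] T(2)[OF l(1)] by simp
 qed
 moreover have "e : reps_B L \<omega>' x'" if rB: "r : reps_B L \<omega> x"
 proof -
  have "\<forall>p. meridian C ((L - C) Un \<omega>') x' p --> e (path_class ?Y' p) : S1B" if C: "C : components L" for C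
  proof -
   have CL: "?Y = S3 - (C Un ((L - C) Un \<omega>))" "?Y' = S3 - (C Un ((L - C) Un \<omega>'))"
    using in_components_subset[OF C] by auto
   have m: "\<forall>p. meridian C ((L - C) Un \<omega>) x p --> r (path_class ?Y p) : S1B" using rB C by (simp add: reps_B_def)
   have dB: "T (rim d) : S1B" if "meridian_disc C ((L - C) Un \<omega>) d" for d using m that
    by (subst (asm) meridians_iff_discs[OF T(1) swap.complement_connected x(1) CL(1) meridian_closed_S1B T(2)[symmetric]]) simp_all
   have "U (rim d) : S1B" if d: "meridian_disc C ((L - C) Un \<omega>') d" for d
   proof (rule US[OF _ meridian_closed_S1B bd(1)[OF d]])
    show "T' (rim d) : S1B" by (rule discs_link[OF T(1) T'(1) _ C _ d]) (fact T'(2), fact dB)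
    show "track (rim d) <= ?Y'" using bd(2)[OF d] unfolding CL(2)[symmetric] .
   qed
   then show ?thesis by (subst meridians_iff_discs[OF U complement_connected x(2) CL(2) meridian_closed_S1B e']) simp_all
  qed
  then show ?thesis using er by (simp add: reps_B_def)
 qed
 ultimately show ?thesis by blast
qed

end

section \<open>Homeomorphic representation spaces\<close>

lemma homeomorphic_quotients:
 assumes q: "quotient_map X Y q" "quotient_map X' Y' q'"
  and F: "continuous_map X X' F" "continuous_map X' X F'" "!!x. x : topspace X ==> F' (F x) = x" "!!x. x : topspace X' ==> F (F' x) = x"
  and eq: "!!x y. x : topspace X ==> y : topspace X ==> q x = q y ==> q' (F x) = q' (F y)"
   "!!x y. x : topspace X' ==> y : topspace X' ==> q' x = q' y ==> q (F' x) = q (F' y)"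
 shows "Y homeomorphic_space Y'"
proof -
 have c: "continuous_map X Y' (q' o F)" "continuous_map X' Y (q o F')"
  by (rule continuous_map_compose[OF F(1) quotient_imp_continuous_map[OF q(2)]],
    rule continuous_map_compose[OF F(2) quotient_imp_continuous_map[OF q(1)]])
 have e: "x : topspace X ==> y : topspace X ==> q x = q y ==> (q' o F) x = (q' o F) y"
  "x' : topspace X' ==> y' : topspace X' ==> q' x' = q' y' ==> (q o F') x' = (q o F') y'" for x y x' y'
  using eq(1)[of x y] eq(2)[of x' y'] by simp_all
 obtain h where h: "continuous_map Y Y' h" "!!x. x : topspace X ==> h (q x) = (q' o F) x"
  by (rule quotient_map_lift_exists[OF q(1) c(1)], erule (2) e(1)) blast
 obtain h' where h': "continuous_map Y' Y h'" "!!x. x : topspace X' ==> h' (q' x) = (q o F') x"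
  by (rule quotient_map_lift_exists[OF q(2) c(2)], erule (2) e(2)) blast
 have s: "q ` topspace X = topspace Y" "q' ` topspace X' = topspace Y'" using q by (auto simp: quotient_map_def)
 have FX: "F x : topspace X'" if "x : topspace X" for x using continuous_map_funspace[OF F(1)] that by blast
 have FX': "F' x : topspace X" if "x : topspace X'" for x using continuous_map_funspace[OF F(2)] that by blast
 have "homeomorphic_maps Y Y' h h'" unfolding homeomorphic_maps_def
 proof (intro conjI ballI h(1) h'(1))
  fix y assume "y : topspace Y"
  then obtain x where x: "x : topspace X" "y = q x" using s(1) by blast
  show "h' (h y) = y" using h(2)[OF x(1)] h'(2)[OF FX[OF x(1)]] F(3)[OF x(1)] by (simp add: x(2))
 next
  fix y assume "y : topspace Y'"
  then obtain x where x: "x : topspace X'" "y = q' x" using s(2) by blast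
  show "h (h' y) = y" using h'(2)[OF x(1)] h(2)[OF FX'[OF x(1)]] F(4)[OF x(1)] by (simp add: x(2))
 qed
 then show ?thesis by (auto simp: homeomorphic_space_def)
qed

lemma conj_orbit_eq_iff:
 assumes "r : carrier G \<rightarrow>\<^sub>E carrier BD" "r' : carrier G \<rightarrow>\<^sub>E carrier BD"
 shows "conj_orbit G r = conj_orbit G r' \<longleftrightarrow>
  (\<exists>g\<in>carrier BD. \<forall>a\<in>carrier G. r' a = g \<cdot> r a \<cdot> inv_BD g)"
proof
 interpret group BD by (rule group_BD)
 have car: "r a : carrier BD" "r' a : carrier BD" if "a : carrier G" for a using assms that by auto
 {
  assume "conj_orbit G r = conj_orbit G r'"
  moreover have "r' : conj_orbit G r'" unfolding conj_orbit_def
  proof (intro CollectI exI[of _ "one_BD"] conjI)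
   have "restrict (%a. one_BD \<cdot> r' a \<cdot> inv_BD one_BD) (carrier G) = restrict r' (carrier G)"
    using car by (intro restrict_ext) simp
   then show "r' = restrict (%a. one_BD \<cdot> r' a \<cdot> inv_BD one_BD) (carrier G)"
    using assms(2) by (simp add: PiE_def extensional_restrict)
  qed simp
  ultimately obtain g where "g : carrier BD" "r' = restrict (%a. g \<cdot> r a \<cdot> inv_BD g) (carrier G)"
   unfolding conj_orbit_def by blast
  then show "\<exists>g\<in>carrier BD. \<forall>a\<in>carrier G. r' a = g \<cdot> r a \<cdot> inv_BD g" by (intro bexI[of _ g]) auto
 next
  assume "\<exists>g\<in>carrier BD. \<forall>a\<in>carrier G. r' a = g \<cdot> r a \<cdot> inv_BD g"
  then obtain g where g: "g : carrier BD" "!!a. a : carrier G ==> r' a = g \<cdot> r a \<cdot> inv_BD g" by blast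
  have sub: "conj_orbit G u <= conj_orbit G u'"
   if t: "!!a. a : carrier G ==> u a : carrier BD" "g : carrier BD" "!!a. a : carrier G ==> u' a = g \<cdot> u a \<cdot> inv_BD g"
   for u u' g
  proof
   fix f assume "f : conj_orbit G u"
   then obtain k where k: "k : carrier BD" "f = restrict (%a. k \<cdot> u a \<cdot> inv_BD k) (carrier G)" unfolding conj_orbit_def by blast
   have c: "inv_BD g \<cdot> (g \<cdot> b) = b" if "b : carrier BD" for b using that t(2) by (simp flip: m_assoc)
   have "k \<cdot> u a \<cdot> inv_BD k = (k \<cdot> inv_BD g) \<cdot> u' a \<cdot> inv_BD (k \<cdot> inv_BD g)"
    if "a : carrier G" for a using t(1)[OF that] t(2) k(1) by (simp add: t(3)[OF that] inv_mult_group m_assoc c)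
   then have "f = restrict (%a. (k \<cdot> inv_BD g) \<cdot> u' a \<cdot> inv_BD (k \<cdot> inv_BD g)) (carrier G)"
    unfolding k(2) by (intro restrict_ext)
   moreover have "k \<cdot> inv_BD g : carrier BD" using k(1) t(2) by simp
   ultimately show "f : conj_orbit G u'" unfolding conj_orbit_def by blast
  qed
  have c: "inv_BD g \<cdot> (g \<cdot> b) = b" if "b : carrier BD" for b using that g(1) by (simp flip: m_assoc)
  have "r a = inv_BD g \<cdot> r' a \<cdot> inv_BD (inv_BD g)" if "a : carrier G" for a
   using car(1)[OF that] g(1) by (simp add: g(2)[OF that] m_assoc c)
  then show "conj_orbit G r = conj_orbit G r'"
   using sub[of r g r', OF car(1) g] sub[of r' "inv_BD g" r, OF car(2) inv_closed[OF g(1)]] by blast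
 }
qed

text \<open>
 Two sets of representations that correspond to each other by multiplication with central signs,
 along surjections from a common set of loops, have homeomorphic quotients.
\<close>

lemma rep_quotient_homeomorphic:
 fixes i i' :: "'i => (real => R4) set"
 assumes H: "H <= carrier G \<rightarrow>\<^sub>E carrier BD" "H' <= carrier G' \<rightarrow>\<^sub>E carrier BD"
  and i: "i ` I = carrier G" "i' ` I = carrier G'"
  and s: "!!h. h : I ==> s h = qone | s h = - qone"
  and F: "!!u. u : H ==> \<exists>e\<in>H'. \<forall>h\<in>I. e (i' h) = s h \<cdot> u (i h)"
   "!!e. e : H' ==> \<exists>u\<in>H. \<forall>h\<in>I. u (i h) = s h \<cdot> e (i' h)"
 shows "rep_quotient G H homeomorphic_space rep_quotient G' H'"
proof -
 interpret group BD by (rule group_BD)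
 have half: "\<exists>f. (\<forall>u\<in>H. f u : H' & (\<forall>h\<in>I. f u (i' h) = s h \<cdot> u (i h))) &
   continuous_map (subtopology (product_topology (%_. top_of_set (carrier BD)) (carrier G)) H)
    (subtopology (product_topology (%_. top_of_set (carrier BD)) (carrier G')) H') f &
   (\<forall>u\<in>H. \<forall>v\<in>H. conj_orbit G u = conj_orbit G v --> conj_orbit G' (f u) = conj_orbit G' (f v))"
  if H: "H <= carrier G \<rightarrow>\<^sub>E carrier BD" "H' <= carrier G' \<rightarrow>\<^sub>E carrier BD" and i: "i ` I = carrier G" "i' ` I = carrier G'"
   and F: "!!u. u : H ==> \<exists>e\<in>H'. \<forall>h\<in>I. e (i' h) = s h \<cdot> u (i h)"
  for G G' H H' and i i' :: "'i => (real => R4) set"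
 proof -
  obtain f where f: "!!u. u : H ==> f u : H'" "!!u h. u : H ==> h : I ==> f u (i' h) = s h \<cdot> u (i h)"
   using F by metis
  let ?P = "product_topology (%_. top_of_set (carrier BD)) (carrier G)"
  have "continuous_map (subtopology ?P H) (product_topology (%_. top_of_set (carrier BD)) (carrier G')) f"
   unfolding continuous_map_componentwise
  proof (intro conjI ballI)
   show "f ` topspace (subtopology ?P H) <= extensional (carrier G')" using f(1) H(2) by (auto simp: PiE_def)
   fix a assume "a : carrier G'"
   then obtain h where h: "h : I" "a = i' h" using i(2) by blast
   have ia: "i h : carrier G" using h(1) i(1) by blast
   have "continuous_map (subtopology ?P H) (top_of_set (carrier BD)) (%u. u (i h))"
    by (rule continuous_map_from_subtopology[OF continuous_map_product_projection[OF ia]])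
   moreover have "continuous_map (top_of_set (carrier BD)) (top_of_set (carrier BD)) (%b. s h \<cdot> b)"
   proof (rule continuous_map_into_subtopology)
    show "continuous_map (top_of_set (carrier BD)) euclidean (%b. s h \<cdot> b)"
     by (auto simp: BD_def qmult_def intro!: continuous_intros)
    show "(%b. s h \<cdot> b) : topspace (top_of_set (carrier BD)) \<rightarrow> carrier BD" using s[OF h(1)] BD_signs by auto
   qed
   ultimately have "continuous_map (subtopology ?P H) (top_of_set (carrier BD)) ((%b. s h \<cdot> b) o (%u. u (i h)))"
    by (rule continuous_map_compose)
   then show "continuous_map (subtopology ?P H) (top_of_set (carrier BD)) (%u. f u a)"
    by (rule continuous_map_eq) (use f(2) h in auto)
  qed
  then have c: "continuous_map (subtopology ?P H) (subtopology (product_topology (%_. top_of_set (carrier BD)) (carrier G')) H') f"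
   by (rule continuous_map_into_subtopology) (use f(1) in auto)
  have "conj_orbit G' (f u) = conj_orbit G' (f v)" if r: "u : H" "v : H" "conj_orbit G u = conj_orbit G v" for u v
  proof -
   have E: "u : carrier G \<rightarrow>\<^sub>E carrier BD" "v : carrier G \<rightarrow>\<^sub>E carrier BD" using r H(1) by auto
   have E': "f u : carrier G' \<rightarrow>\<^sub>E carrier BD" "f v : carrier G' \<rightarrow>\<^sub>E carrier BD" by (rule subsetD[OF H(2) f(1)]; fact)+
   obtain g where g: "g : carrier BD" "\<forall>a\<in>carrier G. v a = g \<cdot> u a \<cdot> inv_BD g" using conj_orbit_eq_iff[OF E] r(3) by blast
   have "f v a = g \<cdot> f u a \<cdot> inv_BD g" if a: "a : carrier G'" for a
   proof -
    obtain h where h: "h : I" "a = i' h" using i(2) a by blast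
    have ia: "i h : carrier G" using h(1) i(1) by blast
    then have rc: "u (i h) : carrier BD" using E by auto
    have sc: "s h : carrier BD" "g \<cdot> s h = s h \<cdot> g" using s[OF h(1)] g(1) by (auto simp: BD_signs)
    have "s h \<cdot> (g \<cdot> u (i h) \<cdot> inv_BD g) = (s h \<cdot> g) \<cdot> u (i h) \<cdot> inv_BD g"
     using g(1) rc sc(1) by (simp add: m_assoc)
    also have "... = g \<cdot> (s h \<cdot> u (i h)) \<cdot> inv_BD g"
     unfolding sc(2)[symmetric] using g(1) rc sc(1) by (simp add: m_assoc)
    finally show ?thesis using f(2)[OF r(1) h(1)] f(2)[OF r(2) h(1)] g(2) ia by (simp add: h(2))
   qed
   then show ?thesis using conj_orbit_eq_iff[OF E'] g(1) by blast
  qed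
  then show ?thesis using f c by blast
 qed
 obtain f where f: "\<forall>u\<in>H. f u : H' & (\<forall>h\<in>I. f u (i' h) = s h \<cdot> u (i h))"
  "continuous_map (subtopology (product_topology (%_. top_of_set (carrier BD)) (carrier G)) H)
    (subtopology (product_topology (%_. top_of_set (carrier BD)) (carrier G')) H') f"
  "\<forall>u\<in>H. \<forall>v\<in>H. conj_orbit G u = conj_orbit G v --> conj_orbit G' (f u) = conj_orbit G' (f v)"
  using half[OF H i F(1)] by blast
 obtain f' where f': "\<forall>e\<in>H'. f' e : H & (\<forall>h\<in>I. f' e (i h) = s h \<cdot> e (i' h))"
  "continuous_map (subtopology (product_topology (%_. top_of_set (carrier BD)) (carrier G')) H')
    (subtopology (product_topology (%_. top_of_set (carrier BD)) (carrier G)) H) f'"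
  "\<forall>u\<in>H'. \<forall>v\<in>H'. conj_orbit G' u = conj_orbit G' v --> conj_orbit G (f' u) = conj_orbit G (f' v)"
  using half[OF H(2,1) i(2,1) F(2)] by blast
 have ss: "s h \<cdot> (s h \<cdot> b) = b" if "h : I" "b : carrier BD" for h b
  using s[OF that(1)] that(2) by (auto simp: BD_signs)
 have top: "topspace (subtopology (product_topology (%_. top_of_set (carrier BD)) (carrier G)) H) = H"
  "topspace (subtopology (product_topology (%_. top_of_set (carrier BD)) (carrier G')) H') = H'" using H by auto
 have inv1: "f' (f u) = u" if r: "u : H" for u
 proof (rule PiE_ext[of _ "carrier G" "%_. carrier BD"])
  have fr: "f u : H'" "f' (f u) : H" using f(1) f'(1) r by auto
  then show "f' (f u) : carrier G \<rightarrow>\<^sub>E carrier BD" "u : carrier G \<rightarrow>\<^sub>E carrier BD" using H(1) r by auto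
  fix a assume "a : carrier G"
  then obtain h where h: "h : I" "a = i h" using i(1) by blast
  have "u (i h) : carrier BD" using H(1) r h(1) i(1) by blast
  then show "f' (f u) a = u a" using f(1) f'(1) r fr h ss by simp
 qed
 have inv2: "f (f' e) = e" if r: "e : H'" for e
 proof (rule PiE_ext[of _ "carrier G'" "%_. carrier BD"])
  have fr: "f' e : H" "f (f' e) : H'" using f(1) f'(1) r by auto
  then show "f (f' e) : carrier G' \<rightarrow>\<^sub>E carrier BD" "e : carrier G' \<rightarrow>\<^sub>E carrier BD" using H(2) r by auto
  fix a assume "a : carrier G'"
  then obtain h where h: "h : I" "a = i' h" using i(2) by blast
  have "e (i' h) : carrier BD" using H(2) r h(1) i(2) by blast
  then show "f (f' e) a = e a" using f(1) f'(1) r fr h ss by simp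
 qed
 show ?thesis unfolding rep_quotient_def
 proof (rule homeomorphic_quotients[OF quotient_map_quotient_topology quotient_map_quotient_topology f(2) f'(2)], unfold top)
  show "f' (f u) = u" if "u : H" for u by (rule inv1[OF that])
  show "f (f' e) = e" if "e : H'" for e by (rule inv2[OF that])
  show "conj_orbit G' (f x) = conj_orbit G' (f y)" if "x : H" "y : H" "conj_orbit G x = conj_orbit G y" for x y
   using f(3) that by blast
  show "conj_orbit G (f' x) = conj_orbit G (f' y)" if "x : H'" "y : H'" "conj_orbit G' x = conj_orbit G' y" for x y
   using f'(3) that by blast
 qed
qed

lemma curve_complement_connected:
 assumes "closed N" "closed M" "M <= S3" "p0 : S3" "p0 ~: N Un M" "!!q. q : M - N ==> manifold_interior_point M q"
 shows "path_connected (S3 - (N Un M Un {p0})) \<longleftrightarrow> path_connected (S3 - N)"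
proof (rule thin_complement_path_connected[OF thin_curve_complement])
 show "path_functor BD (S3 - (N Un M Un {p0})) (%_. one_BD)"
  by (intro path_functor.intro path_functor_axioms.intro group_BD) (auto simp: BD_one BD_signs)
 fix q A B g g' d assume "tube p0 A B M q g g' d"
 then have "d > 0" by (rule tube.\<delta>)
 then show "\<exists>e. 0 < e & e < d & one_BD = one_BD" by (intro exI[of _ "d / 2"]) simp
qed (fact assms)+

lemma reps_PiE: "reps L \<omega> x <= carrier (link_group L \<omega> x) \<rightarrow>\<^sub>E carrier BD" "reps_B L \<omega> x <= carrier (link_group L \<omega> x) \<rightarrow>\<^sub>E carrier BD"
 by (auto simp: reps_def reps_B_def PiE_def hom_def)

lemma (in marking_pair) R_spaces_homeomorphic:
 assumes x: "x : S3 - (L Un \<omega>)" "x' : S3 - (L Un \<omega>')"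
 shows "R_space L \<omega> x homeomorphic_space R_space L \<omega>' x'" "R_B_space L \<omega> x homeomorphic_space R_B_space L \<omega>' x'"
proof -
 interpret swap: marking_pair p0 A B K cs L \<omega>' \<omega> V by (rule marking_pair_swap) unfold_locales
 let ?Y = "S3 - (L Un \<omega>)" and ?Y' = "S3 - (L Un \<omega>')"
 obtain x0 where x0: "x0 : X" by (rule thin_complementE[OF thin_complement_marking openin_subtopology_self x(2)]) auto
 then have x0Y: "x0 : ?Y" "x0 : ?Y'" unfolding K_eq by blast+
 obtain k where k: "path k" "track k <= ?Y" "start k = x" "finish k = x0"
  using swap.complement_connected x(1) x0Y(1) unfolding path_connected_def by blast
 obtain k' where k': "path k'" "track k' <= ?Y'" "start k' = x'" "finish k' = x0"
  using complement_connected x(2) x0Y(2) unfolding path_connected_def by blast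
 define i where "i b = path_class ?Y (k +++ (b +++ reversepath k))" for b
 define i' where "i' b = path_class ?Y' (k' +++ (b +++ reversepath k'))" for b
 let ?I = "loops_at X x0"
 have onto: "(%b. path_class Y (k +++ (b +++ reversepath k))) ` ?I = carrier (fundamental_group Y x)"
  if thin: "thin_complement P X Y" and k: "path k" "track k <= Y" "start k = x" "finish k = x0" for P Y k x
 proof (intro subset_antisym subsetI)
  fix a assume "a : (%b. path_class Y (k +++ (b +++ reversepath k))) ` ?I"
  then obtain b where b: "b : ?I" "a = path_class Y (k +++ (b +++ reversepath k))" by blast
  have "b : loops_at Y (finish k)" using b(1) k(4) thin_complement_subset[OF thin] by (auto simp: loops_at_def)
  from loops_at_join_closed[OF k(1-3) this] show "a : carrier (fundamental_group Y x)"
   by (simp add: fundamental_group_def b(2))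
 next
  fix a assume "a : carrier (fundamental_group Y x)"
  then obtain p where p: "p : loops_at Y (start k)" "a = path_class Y p" by (auto simp: fundamental_group_def k(3))
  have "finish k : X" using k(4) x0 by simp
  from conjugate_surjective[OF thin k(1,2) this p(1)]
  show "a : (%b. path_class Y (k +++ (b +++ reversepath k))) ` ?I" unfolding p(2) k(4) by blast
 qed
 have ii: "i ` ?I = carrier (link_group L \<omega> x)" "i' ` ?I = carrier (link_group L \<omega>' x')"
  unfolding i_def i'_def link_group_def
  by (rule onto[OF swap.thin_complement_marking k], rule onto[OF thin_complement_marking k'])
 have s: "scalar (total_sign b) = qone | scalar (total_sign b) = - qone" if "b : ?I" for b
  using total_sign_values[of b] that by (auto simp: loops_at_def scalar_def qone_def)
 have F: "\<exists>e\<in>reps L \<omega>' x'. (\<forall>b\<in>?I. e (i' b) = scalar (total_sign b) \<cdot> r (i b)) & (r : reps_B L \<omega> x --> e : reps_B L \<omega>' x')"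
  if "r : reps L \<omega> x" for r unfolding i_def i'_def by (rule transfer[OF that x x0 k k'])
 have F': "\<exists>r\<in>reps L \<omega> x. (\<forall>b\<in>?I. r (i b) = scalar (total_sign b) \<cdot> e (i' b)) & (e : reps_B L \<omega>' x' --> r : reps_B L \<omega> x)"
  if "e : reps L \<omega>' x'" for e unfolding i_def i'_def by (rule swap.transfer[OF that x(2,1) x0 k' k])
 show "R_space L \<omega> x homeomorphic_space R_space L \<omega>' x'"
  unfolding R_space_def by (rule rep_quotient_homeomorphic[OF reps_PiE(1) reps_PiE(1) ii s]) (use F F' in blast)+
 have B: "reps_B L \<omega> x <= reps L \<omega> x" "reps_B L \<omega>' x' <= reps L \<omega>' x'" by (auto simp: reps_B_def)
 show "R_B_space L \<omega> x homeomorphic_space R_B_space L \<omega>' x'"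
  unfolding R_B_space_def by (rule rep_quotient_homeomorphic[OF reps_PiE(2) reps_PiE(2) ii s]) (use F F' B in blast)+
qed

theorem lemma1p7:
 fixes L \<omega> \<omega>' :: "(real ^ 4) set" and x x' :: "real ^ 4"
 assumes "link L"
  and "marking_data L \<omega>" and "marking_data L \<omega>'"
  and "\<And>C. C \<in> components L \<Longrightarrow>
      even (card (manifold_boundary \<omega> \<inter> C)) \<longleftrightarrow> even (card (manifold_boundary \<omega>' \<inter> C))"
  and "x \<in> S3 - (L \<union> \<omega>)" and "x' \<in> S3 - (L \<union> \<omega>')"
 shows "R_space L \<omega> x homeomorphic_space R_space L \<omega>' x' \<and>
     R_B_space L \<omega> x homeomorphic_space R_B_space L \<omega>' x'"
proof -
 define K where "K = L Un (\<omega> Un \<omega>')"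
 have cl: "closed L" "closed \<omega>" "closed \<omega>'" and S: "L <= S3" "\<omega> <= S3" "\<omega>' <= S3"
  using assms(1-3) by (auto simp: link_def marking_data_def submanifold1_def compact_imp_closed)
 have int: "q : L ==> manifold_interior_point L q" "q : \<omega> - L ==> manifold_interior_point \<omega> q"
  "q : \<omega>' - L ==> manifold_interior_point \<omega>' q" for q
  using link_interior[OF assms(1)] marking_interior[OF assms(2)] marking_interior[OF assms(3)] by blast+
 have op: "openin (top_of_set S3) (S3 - N)" if "closed N" for N
  using that by (auto simp: openin_open intro!: exI[of _ "- N"])
 have "S3 ~= {}" using assms(5) by blast
 then have "S3 - L ~= {}" by (rule open_curve_complement_nonempty[OF openin_subtopology_self _ S(1)]) (use int(1) in blast)
 then have "(S3 - L) - \<omega> ~= {}" by (rule open_curve_complement_nonempty[OF op[OF cl(1)] _ S(2)]) (use int(2) in blast)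
 then have "S3 - (L Un \<omega>) ~= {}" by blast
 then have "(S3 - (L Un \<omega>)) - \<omega>' ~= {}"
  by (rule open_curve_complement_nonempty[OF op[OF closed_Un[OF cl(1,2)]] _ S(3)]) (use int(3) in blast)
 then obtain p0 where p0: "p0 : S3" "p0 ~: K" unfolding K_def by blast
 obtain A B where st: "stereographic p0 A B" using stereographic_exists[OF p0(1)] by blast
 \<comment> \<open>The sets L, \<omega> and \<omega>' are removed one after the other; the pole is put back in between.\<close>
 have rm: "path_connected (S3 - N)" if "path_connected (S3 - (N Un {p0}))" "closed N" "p0 ~: N" for N
  using curve_complement_connected[of N "{}" p0] that p0(1) by simp
 have "path_connected S3" unfolding S3_def by (intro path_connected_sphere) simp
 then have "path_connected (S3 - ({} Un L Un {p0}))"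
  using curve_complement_connected[of "{}" L p0] cl(1) S(1) p0 int(1) by (auto simp: K_def)
 then have "path_connected (S3 - L)" using rm[of L] cl(1) p0(2) by (simp add: K_def)
 then have "path_connected (S3 - (L Un \<omega> Un {p0}))"
  using curve_complement_connected[of L \<omega> p0] cl(1,2) S(2) p0 int(2) by (auto simp: K_def)
 then have "path_connected (S3 - (L Un \<omega>))" using rm[of "L Un \<omega>"] cl(1,2) p0(2) by (auto simp: K_def)
 then have "path_connected (S3 - ((L Un \<omega>) Un \<omega>' Un {p0}))"
  using curve_complement_connected[of "L Un \<omega>" \<omega>' p0] cl S(3) p0 int(3) by (auto simp: K_def)
 moreover have "(L Un \<omega>) Un \<omega>' Un {p0} = K Un {p0}" by (auto simp: K_def)
 ultimately have pc: "path_connected (S3 - (K Un {p0}))" by simp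
 obtain V cs where V: "finite V" "(\<omega> Un \<omega>') Int L <= V"
  and cs: "\<forall>c\<in>set cs. path c & pathfinish c = pathstart c & path_image c <= L Un \<omega> Un \<omega>'"
  and vis: "\<forall>q. q ~: L Un V --> (\<forall>c\<in>set cs. passes_well q c) &
    (\<Sum>c\<leftarrow>cs. card (visits c q)) = of_bool (q : \<omega>) + of_bool (q : \<omega>')"
  by (rule marking_closed_paths[OF assms(1-4)]) blast
 have "linking_character p0 A B K cs"
  by (intro linking_character.intro linking_character_axioms.intro st) (use S p0(2) cs in \<open>auto simp: K_def Un_assoc\<close>)
 then have "marking_pair p0 A B K cs L \<omega> \<omega>' V"
  by (intro marking_pair.intro marking_pair_axioms.intro K_def p0(1) assms(1-3) V vis pc)
 from marking_pair.R_spaces_homeomorphic[OF this assms(5,6)] show ?thesis by blast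
qed

end
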